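(* Let $M$ be a real $d\times d$ dilation matrix, let $2\le p<\infty$, $1/p+1/q=1$, $N\in\mathbb{Z}_+$, $\varepsilon>0$, and $\gamma\in\left(N+\frac dp,\,N+\frac dp+\varepsilon\right)$. Suppose that (a) $\widetilde\varphi$ is a tempered distribution on $\mathbb{R}^d$ whose Fourier transform $\widehat{\widetilde\varphi}$ is a function on $\mathbb{R}^d$ such that $|\widehat{\widetilde\varphi}(\xi)|\le C_{\widetilde\varphi}|\xi|^N$ for almost all $\xi\notin\mathbb{T}^d$ and $|\widehat{\widetilde\varphi}(\xi)|\le C'_{\widetilde\varphi}$ for almost all $\xi\in\mathbb{T}^d$; (b) $\varphi\in\mathcal{B}$; (c) $\widetilde\varphi$ and $\varphi$ are strictly compatible, with parameter $\delta\in(0,1/2)$; (d) $f\in L_p$, $\widehat f\in L_q$, and $\widehat f(\xi)=O(|\xi|^{-N-d-\varepsilon})$ as $|\xi|\to\infty$. Then for all $j\in\mathbb{Z}_+$ $$\left\|f-Q_j(\varphi,\widetilde\varphi,f)\right\|_p^q\le C\,\|M^{*-j}\|^{\gamma q}\int_{|M^{*-j}\xi|\ge\delta}|\xi|^{q\gamma}|\widehat f(\xi)|^q\,d\xi,$$ where $C$ does not depend on $j$ and $f$.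
   Context: A dilation matrix is a real $d\times d$ matrix all of whose eigenvalues are bigger than $1$ in modulus; $m=|\det M|$, $M^*$ is the conjugate (transpose) matrix, $M^{*-j}=(M^* )^{-j}$, and $\|\cdot\|$ is the operator norm. $\mathbb{T}^d=[-\frac12,\frac12]^d$, $L_p=L_p(\mathbb{R}^d)$, $\langle f,g\rangle=\int_{\mathbb{R}^d}f\overline g$, and $\widehat f(\xi)=\int_{\mathbb{R}^d}f(x)e^{-2\pi i(x,\xi)}\,dx$ (extended to tempered distributions by $\langle\widehat f,\widehat\varphi\rangle=\langle f,\varphi\rangle$, $f$ in the Schwartz class). For a function $\varphi$, $\varphi_{jk}(x)=m^{j/2}\varphi(M^jx+k)$. For a tempered distribution $\widetilde\varphi$, $\widetilde\varphi_{jk}$ is defined by $\langle f,\widetilde\varphi_{jk}\rangle=\langle f_{-j,-M^{-j}k},\widetilde\varphi\rangle$ for Schwartz $f$; when $\widehat{\widetilde\varphi}$ is a function, $\widehat{\widetilde\varphi_{jk}}(\xi)=m^{-j/2}e^{2\pi i(M^{-j}k,\xi)}\widehat{\widetilde\varphi}(M^{*-j}\xi)$. The scaling operator is $$Q_j(\varphi,\widetilde\varphi,f)=\sum_{k\in\mathbb{Z}^d}\langle\widehat f,\widehat{\widetilde\varphi_{jk}}\rangle\varphi_{jk},\qquad j\in\mathbb{Z}_+,$$ the series being understood as unconditionally convergent in $L_p$. $\mathcal{B}=\mathcal{B}(\mathbb{R}^d)$ is the class of functions $\varphi(x)=\int_{\mathbb{R}^d}\theta(\xi)e^{2\pi i(x,\xi)}\,d\xi$,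 where $\theta$ is supported on a parallelepiped $S=[a_1,b_1]\times\dots\times[a_d,b_d]$ and $\theta|_S\in C^d(S)$ (so $\widehat\varphi=\theta$). A tempered distribution $\widetilde\varphi$ and a function $\varphi$ are strictly compatible (with parameter $\delta$) if there is $\delta\in(0,1/2)$ such that $\overline{\widehat\varphi(\xi)}\,\widehat{\widetilde\varphi}(\xi)=1$ for a.e. $\xi$ with $|\xi|<\delta$, and $\widehat\varphi(\xi)=0$ for a.e. $\xi$ with $|l-\xi|<\delta$, for all $l\in\mathbb{Z}^d\setminus\{0\}$. *)

theory Defs
  imports "HOL-Analysis.Analysis"
begin

section \<open>Dilation matrices and powers\<close>

definition dilation_matrix :: "real^'n^'n \<Rightarrow> bool" where
  "dilation_matrix M \<longleftrightarrow>
     (\<forall>(z::complex) v. v \<noteq> 0 \<and> map_matrix complex_of_real M *v v = z *s v \<longrightarrow> norm z > 1)"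

text \<open>Note that \<open>^\<close> and \<open>*\<close> are not the matrix operations on the type of matrices.\<close>

definition matpow :: "real^'n^'n \<Rightarrow> nat \<Rightarrow> real^'n^'n" where
  "matpow A j = ((\<lambda>B. A ** B) ^^ j) (mat 1)"

definition adj_inv_pow :: "real^'n^'n \<Rightarrow> nat \<Rightarrow> real^'n^'n" where
  "adj_inv_pow M j = matpow (matrix_inv (transpose M)) j"

definition lattice_point :: "int^'n \<Rightarrow> real^'n" where
  "lattice_point k = (\<chi> i. of_int (k $ i))"

definition torus :: "(real^'n) set" where
  "torus = cbox (\<chi> i. - 1/2) (\<chi> i. 1/2)"

section \<open>Lebesgue spaces and unconditional convergence\<close>

text \<open>Functions are taken everywhere defined and Lebesgue measurable; they are representatives
  of the elements of \<open>L\<^sub>p\<close>.\<close>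

definition Lp_space :: "real \<Rightarrow> (real^'n \<Rightarrow> complex) set" where
  "Lp_space p = {f. f \<in> borel_measurable lebesgue \<and> integrable lebesgue (\<lambda>x. norm (f x) powr p)}"

definition Lp_norm :: "real \<Rightarrow> (real^'n \<Rightarrow> complex) \<Rightarrow> real" where
  "Lp_norm p f = (LINT x|lebesgue. norm (f x) powr p) powr (1 / p)"

text \<open>Unconditional convergence is convergence of the net of all finite partial sums.\<close>

definition has_Lp_sum ::
    "real \<Rightarrow> ('k \<Rightarrow> real^'n \<Rightarrow> complex) \<Rightarrow> (real^'n \<Rightarrow> complex) \<Rightarrow> bool" where
  "has_Lp_sum p u S \<longleftrightarrow>
     (\<forall>k. u k \<in> Lp_space p) \<and> S \<in> Lp_space p \<and>
     ((\<lambda>A. Lp_norm p (\<lambda>x. S x - (\<Sum>k\<in>A. u k x))) \<longlongrightarrow> 0) (finite_subsets_at_top UNIV)"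

definition Lp_summable :: "real \<Rightarrow> ('k \<Rightarrow> real^'n \<Rightarrow> complex) \<Rightarrow> bool" where
  "Lp_summable p u \<longleftrightarrow> (\<exists>S. has_Lp_sum p u S)"

text \<open>A representative of the sum, which is determined up to a null set.\<close>

definition Lp_infsum :: "real \<Rightarrow> ('k \<Rightarrow> real^'n \<Rightarrow> complex) \<Rightarrow> real^'n \<Rightarrow> complex" where
  "Lp_infsum p u = (SOME S. has_Lp_sum p u S)"

section \<open>Tempered distributions and their Fourier transforms\<close>

fun iter_partial :: "'n list \<Rightarrow> (real^'n \<Rightarrow> complex) \<Rightarrow> real^'n \<Rightarrow> complex" where
  "iter_partial [] f = f"
| "iter_partial (i # is) f = (\<lambda>x. frechet_derivative (iter_partial is f) (at x) (axis i 1))"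

definition schwartz :: "(real^'n \<Rightarrow> complex) set" where
  "schwartz = {f. \<forall>is. (\<forall>x. iter_partial is f differentiable (at x)) \<and>
      (\<forall>n. bounded (range (\<lambda>x. (1 + norm x) ^ n *\<^sub>R iter_partial is f x)))}"

definition schwartz_seminorm :: "nat \<Rightarrow> (real^'n \<Rightarrow> complex) \<Rightarrow> real" where
  "schwartz_seminorm n f =
     (SUP (is, x) \<in> {is. length is \<le> n} \<times> UNIV. (1 + norm x) ^ n * norm (iter_partial is f x))"

text \<open>The functional \<open>T\<close> encoding a distribution \<open>u\<close> is \<open>T h = \<langle>h, u\<rangle>\<close> with the pairing
  \<open>\<langle>h, u\<rangle> = \<integral> h \<cdot> cnj u\<close>. It is therefore linear in \<open>h\<close>. The seminorms increase with \<open>n\<close>,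
  so the estimate below is continuity for the topology they generate.\<close>

definition tempered_distribution :: "((real^'n \<Rightarrow> complex) \<Rightarrow> complex) \<Rightarrow> bool" where
  "tempered_distribution T \<longleftrightarrow>
     (\<forall>f\<in>schwartz. \<forall>g\<in>schwartz. \<forall>a b. T (\<lambda>x. a * f x + b * g x) = a * T f + b * T g) \<and>
     (\<exists>C n. \<forall>f\<in>schwartz. norm (T f) \<le> C * schwartz_seminorm n f)"

definition distr_of :: "(real^'n \<Rightarrow> complex) \<Rightarrow> (real^'n \<Rightarrow> complex) \<Rightarrow> complex" where
  "distr_of f = (\<lambda>h. LINT x|lebesgue. h x * cnj (f x))"

definition fourier :: "(real^'n \<Rightarrow> complex) \<Rightarrow> real^'n \<Rightarrow> complex" where
  "fourier h \<xi> = (LINT x|lebesgue. h x * cis (- 2 * pi * (x \<bullet> \<xi>)))"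

text \<open>The Fourier transform of the tempered distribution \<open>T\<close> is the function \<open>F\<close>:
  \<open>\<langle>fourier h, F\<rangle> = \<langle>h, T\<rangle>\<close> for all Schwartz functions \<open>h\<close>.\<close>

definition has_fourier_function ::
    "((real^'n \<Rightarrow> complex) \<Rightarrow> complex) \<Rightarrow> (real^'n \<Rightarrow> complex) \<Rightarrow> bool" where
  "has_fourier_function T F \<longleftrightarrow>
     F \<in> borel_measurable lebesgue \<and>
     (\<forall>h\<in>schwartz. integrable lebesgue (\<lambda>\<xi>. fourier h \<xi> * cnj (F \<xi>)) \<and>
        T h = (LINT \<xi>|lebesgue. fourier h \<xi> * cnj (F \<xi>)))"

section \<open>The class \<open>\<B>\<close> and strict compatibility\<close>

text \<open>Used for boxes with non-empty interior only, where the derivatives within the closed box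
  are unique.\<close>

primrec Ck_on :: "nat \<Rightarrow> (real^'n) set \<Rightarrow> (real^'n \<Rightarrow> complex) \<Rightarrow> bool" where
  "Ck_on 0 S f \<longleftrightarrow> continuous_on S f"
| "Ck_on (Suc k) S f \<longleftrightarrow>
     (\<exists>D. (\<forall>x\<in>S. (f has_derivative (\<lambda>h. \<Sum>i\<in>UNIV. (h $ i) *\<^sub>R D i x)) (at x within S)) \<and>
          (\<forall>i. Ck_on k S (D i)))"

text \<open>\<open>\<phi>\<close> belongs to \<open>\<B>\<close> with spectrum \<open>\<theta>\<close>; here \<open>\<theta>\<close> is the Fourier transform of \<open>\<phi>\<close>.
  The function \<open>\<theta>\<close> may jump across the boundary of the box.\<close>

definition class_B :: "(real^'n \<Rightarrow> complex) \<Rightarrow> (real^'n \<Rightarrow> complex) \<Rightarrow> bool" where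
  "class_B \<phi> \<theta> \<longleftrightarrow>
     (\<exists>a b. (\<forall>i. a $ i < b $ i) \<and> (\<forall>\<xi>. \<xi> \<notin> cbox a b \<longrightarrow> \<theta> \<xi> = 0) \<and> Ck_on CARD('n) (cbox a b) \<theta>) \<and>
     (\<forall>x. \<phi> x = (LINT \<xi>|lebesgue. \<theta> \<xi> * cis (2 * pi * (x \<bullet> \<xi>))))"

text \<open>The arguments \<open>G\<close> and \<open>\<theta>\<close> are the Fourier transforms of the distribution and of the
  function.\<close>

definition strictly_compatible ::
    "real \<Rightarrow> (real^'n \<Rightarrow> complex) \<Rightarrow> (real^'n \<Rightarrow> complex) \<Rightarrow> bool" where
  "strictly_compatible \<delta> G \<theta> \<longleftrightarrow>
     0 < \<delta> \<and> \<delta> < 1/2 \<and>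
     (AE \<xi> in lebesgue. norm \<xi> < \<delta> \<longrightarrow> cnj (\<theta> \<xi>) * G \<xi> = 1) \<and>
     (\<forall>l. l \<noteq> 0 \<longrightarrow> (AE \<xi> in lebesgue. norm (lattice_point l - \<xi>) < \<delta> \<longrightarrow> \<theta> \<xi> = 0))"

section \<open>The scaling operator\<close>

definition dilate :: "real^'n^'n \<Rightarrow> (real^'n \<Rightarrow> complex) \<Rightarrow> nat \<Rightarrow> int^'n \<Rightarrow> real^'n \<Rightarrow> complex" where
  "dilate M \<phi> j k = (\<lambda>x. of_real (\<bar>det M\<bar> powr (real j / 2)) *
      \<phi> (matpow M j *v x + lattice_point k))"

text \<open>The Fourier transform of the distribution \<open>u\<^sub>j\<^sub>k\<close> given by
  \<open>\<langle>h, u\<^sub>j\<^sub>k\<rangle> = \<langle>x \<mapsto> m\<^bsup>-j/2\<^esup> h (M\<^bsup>-j\<^esup> (x - k)), u\<rangle>\<close>, \<open>m = \<bar>det M\<bar>\<close>, where the Fourier transform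
  of \<open>u\<close> is the function \<open>G\<close>.\<close>

definition dilate_hat ::
    "real^'n^'n \<Rightarrow> (real^'n \<Rightarrow> complex) \<Rightarrow> nat \<Rightarrow> int^'n \<Rightarrow> real^'n \<Rightarrow> complex" where
  "dilate_hat M G j k = (\<lambda>\<xi>. of_real (\<bar>det M\<bar> powr (- real j / 2)) *
      cis (2 * pi * ((matpow (matrix_inv M) j *v lattice_point k) \<bullet> \<xi>)) *
      G (adj_inv_pow M j *v \<xi>))"

text \<open>The terms of the series defining \<open>Q\<^sub>j\<close>; \<open>G\<close> and \<open>F\<close> are the Fourier transforms of the
  sampling distribution and of the function to be approximated.\<close>

definition scaling_term ::
    "real^'n^'n \<Rightarrow> (real^'n \<Rightarrow> complex) \<Rightarrow> (real^'n \<Rightarrow> complex) \<Rightarrow> (real^'n \<Rightarrow> complex) \<Rightarrow>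
     nat \<Rightarrow> int^'n \<Rightarrow> real^'n \<Rightarrow> complex" where
  "scaling_term M \<phi> G F j k =
     (\<lambda>x. (LINT \<xi>|lebesgue. F \<xi> * cnj (dilate_hat M G j k \<xi>)) * dilate M \<phi> j k x)"

definition scaling_op ::
    "real \<Rightarrow> real^'n^'n \<Rightarrow> (real^'n \<Rightarrow> complex) \<Rightarrow> (real^'n \<Rightarrow> complex) \<Rightarrow> (real^'n \<Rightarrow> complex) \<Rightarrow>
     nat \<Rightarrow> real^'n \<Rightarrow> complex" where
  "scaling_op p M \<phi> G F j = Lp_infsum p (scaling_term M \<phi> G F j)"

end

theory Submission
  imports Defs
begin

text \<open>Conjugating with \<open>A = M\<^sup>j\<close> replaces the spectrum \<open>F\<close> of \<open>f\<close> by \<open>|det A| F(A\<^sup>* \<eta>)\<close> and reduces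
  everything to the integer translates of \<open>\<phi>\<close>, with a constant that does not depend on \<open>A\<close>. There, Fejer
  summation identifies the sum of the series on the coset \<open>s + \<int>\<^sup>d\<close> as the sequence of Fourier
  coefficients of a periodization, so that \<open>f - Q f\<close> on that coset has coefficients given by
  \<open>v\<^sub>s(\<eta>) = F(\<eta>) (e(s \<eta>) - cnj (G(\<eta>)) \<Theta>\<^sub>s(\<eta>))\<close>, where \<open>\<Theta>\<^sub>s\<close> is the periodization of \<open>\<theta> e(s \<cdot>)\<close>.
  Strict compatibility makes \<open>v\<^sub>s\<close> vanish for \<open>|\<eta>| < \<delta>\<close>, and the Hausdorff-Young inequality together with
  Hoelder's inequality for the weights \<open>|\<eta>|\<^sup>\<gamma>\<close> bounds its coefficients in \<open>\<ell>\<^sub>p\<close>, uniformly in \<open>s\<close>.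
  Unconditional convergence is the \<open>\<ell>\<^sub>p\<close> boundedness of \<open>a \<mapsto> \<Sum>\<^sub>k a\<^sub>k \<phi>(\<cdot> + k)\<close>. Differentiating \<open>\<theta>\<close> once in
  each coordinate writes \<open>\<phi>\<close> as an average of transforms of boxes, for which the operator is a tensor
  product of modulated discrete Hilbert transforms.\<close>

text \<open>The obstacle is the slow decay of \<phi>. Its spectrum may jump on the faces of the box,
  so the values \<phi>(s + k) need not be absolutely summable in k, and the series cannot be
  estimated term by term. Fejer means take the place of partial sums because the periodized spectrum
  is only bounded and almost everywhere continuous; the l_p bound for the synthesis then upgrades
  them to unconditional convergence. The two bounds on \<gamma> do separate work. The lower one
  makes (1 + |\<eta>|)^(-(\<gamma>-N)p) summable over lattice cosets, which pays for the growth of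
  \<open>G\<close>. The upper one makes the weighted L_q norm of \<open>F\<close> finite under the
  assumed decay; only this finiteness is used, so its value never reaches the constant. The powers
  of |det A| coming from the spectrum and from the Jacobian cancel because q/p = q - 1. The Hilbert
  transform bound and the Hausdorff-Young inequality rest on the same device: truncation at each
  height t, an l_2 bound there, and summation over t by the layer-cake formula.\<close>

section \<open>Convexity inequalities and the Schur test\<close>

text \<open>The tangent line form of convexity. Summed or integrated with \<open>m\<close> the mean,
  its linear term vanishes and Jensen's inequality remains. The boundary values are treated apart
  because the derivative is taken on the open half-line.\<close>

lemma powr_above_tangent:
  fixes p x m :: real
  assumes "p \<ge> 1" "x \<ge> 0" "m \<ge> 0"
  shows "m powr p + p * m powr (p - 1) * (x - m) \<le> x powr p"
proof (cases "m = 0 \<or> x = 0")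
  case True
  then show ?thesis
  proof
    assume "x = 0"
    then show ?thesis
      using assms by (cases "m = 0") (auto simp: powr_diff mult_right_mono)
  qed (use assms in auto)
next
  case False
  then have pos: "x > 0" "m > 0" using assms by auto
  have "x powr p - m powr p \<ge> (p * m powr (p - 1)) * (x - m)"
    by (rule convex_on_imp_above_tangent[where A = "{0<..}"])
      (use pos assms in \<open>auto intro!: powr_convex derivative_eq_intros simp: interior_open connected_Ioi\<close>)
  then show ?thesis by simp
qed

text \<open>The weights are not normalised: the tangent inequality at the weighted mean is summed,
  and the factor \<open>W powr (p - 1)\<close> restores homogeneity in the total weight.\<close>

lemma sum_powr_Jensen:
  fixes w x :: "'a \<Rightarrow> real"
  assumes "finite A" "p \<ge> 1" and w: "\<And>i. i \<in> A \<Longrightarrow> w i \<ge> 0" and x: "\<And>i. i \<in> A \<Longrightarrow> x i \<ge> 0"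
  shows "(\<Sum>i\<in>A. w i * x i) powr p \<le> (\<Sum>i\<in>A. w i) powr (p - 1) * (\<Sum>i\<in>A. w i * x i powr p)"
proof -
  define W where "W = (\<Sum>i\<in>A. w i)"
  have W0: "W \<ge> 0" unfolding W_def by (intro sum_nonneg w)
  show ?thesis
  proof (cases "W = 0")
    case True
    then have "\<And>i. i \<in> A \<Longrightarrow> w i = 0"
      using w \<open>finite A\<close> unfolding W_def by (simp add: sum_nonneg_eq_0_iff)
    then show ?thesis by simp
  next
    case False
    define m where "m = (\<Sum>i\<in>A. w i * x i) / W"
    have m0: "m \<ge> 0" unfolding m_def using w x W0 by (intro divide_nonneg_nonneg sum_nonneg) auto
    have "(\<Sum>i\<in>A. w i * (m powr p + p * m powr (p - 1) * (x i - m))) \<le> (\<Sum>i\<in>A. w i * x i powr p)"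
      by (intro sum_mono mult_left_mono powr_above_tangent w x m0 assms)
    also have "(\<Sum>i\<in>A. w i * (m powr p + p * m powr (p - 1) * (x i - m)))
        = W * m powr p + p * m powr (p - 1) * ((\<Sum>i\<in>A. w i * x i) - W * m)"
      unfolding W_def by (simp add: algebra_simps sum.distrib sum_subtractf sum_distrib_left sum_distrib_right)
    also have "(\<Sum>i\<in>A. w i * x i) - W * m = 0" using False by (simp add: m_def)
    finally have 1: "W * m powr p \<le> (\<Sum>i\<in>A. w i * x i powr p)" by simp
    have "(\<Sum>i\<in>A. w i * x i) = W * m" using False by (simp add: m_def)
    then have "(\<Sum>i\<in>A. w i * x i) powr p = W powr p * m powr p"
      using W0 m0 by (simp add: powr_mult)
    also have "\<dots> = W powr (p - 1) * (W * m powr p)"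
      using W0 False by (simp add: powr_diff)
    also have "\<dots> \<le> W powr (p - 1) * (\<Sum>i\<in>A. w i * x i powr p)"
      by (intro mult_left_mono 1) auto
    finally show ?thesis by (simp add: W_def)
  qed
qed

lemma powr_add_le:
  fixes x y p :: real
  assumes "p \<ge> 1" "x \<ge> 0" "y \<ge> 0"
  shows "(x + y) powr p \<le> 2 powr p * (x powr p + y powr p)"
proof -
  have "(x + y) powr p \<le> (2 * max x y) powr p"
    using assms by (intro powr_mono2) auto
  also have "\<dots> = 2 powr p * max x y powr p"
    using assms by (simp add: powr_mult)
  also have "\<dots> \<le> 2 powr p * (x powr p + y powr p)"
    by (intro mult_left_mono) (auto simp: max_def)
  finally show ?thesis .
qed

lemma powr_add3_le:
  fixes x y z p :: real
  assumes "p \<ge> 1" "x \<ge> 0" "y \<ge> 0" "z \<ge> 0"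
  shows "(x + y + z) powr p \<le> 3 powr p * (x powr p + y powr p + z powr p)"
proof -
  have "(x + y + z) powr p \<le> (3 * max x (max y z)) powr p"
    using assms by (intro powr_mono2) auto
  also have "\<dots> = 3 powr p * max x (max y z) powr p"
    using assms by (simp add: powr_mult)
  also have "\<dots> \<le> 3 powr p * (x powr p + y powr p + z powr p)"
    by (intro mult_left_mono) (auto simp: max_def)
  finally show ?thesis .
qed

text \<open>Jensen with the row \<open>K n\<close> as weights costs \<rho>^(p-1), and summing over
  the columns costs one more \<rho>. It disposes of the absolutely summable error kernels that
  accompany the Hilbert transform.\<close>

lemma Schur_test:
  fixes K :: "'a \<Rightarrow> 'b \<Rightarrow> real"
  assumes "finite A" "finite B" "p \<ge> 1" "\<rho> \<ge> 0"
    and K: "\<And>n k. n \<in> B \<Longrightarrow> k \<in> A \<Longrightarrow> K n k \<ge> 0" and x: "\<And>k. k \<in> A \<Longrightarrow> x k \<ge> 0"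
    and row: "\<And>n. n \<in> B \<Longrightarrow> (\<Sum>k\<in>A. K n k) \<le> \<rho>" and col: "\<And>k. k \<in> A \<Longrightarrow> (\<Sum>n\<in>B. K n k) \<le> \<rho>"
  shows "(\<Sum>n\<in>B. (\<Sum>k\<in>A. K n k * x k) powr p) \<le> \<rho> powr p * (\<Sum>k\<in>A. x k powr p)"
proof -
  have "(\<Sum>n\<in>B. (\<Sum>k\<in>A. K n k * x k) powr p) \<le> (\<Sum>n\<in>B. \<rho> powr (p - 1) * (\<Sum>k\<in>A. K n k * x k powr p))"
  proof (rule sum_mono)
    fix n assume n: "n \<in> B"
    have "(\<Sum>k\<in>A. K n k * x k) powr p \<le> (\<Sum>k\<in>A. K n k) powr (p - 1) * (\<Sum>k\<in>A. K n k * x k powr p)"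
      by (rule sum_powr_Jensen) (use assms n in auto)
    also have "\<dots> \<le> \<rho> powr (p - 1) * (\<Sum>k\<in>A. K n k * x k powr p)"
      using assms n by (intro mult_right_mono powr_mono2 sum_nonneg) auto
    finally show "(\<Sum>k\<in>A. K n k * x k) powr p \<le> \<rho> powr (p - 1) * (\<Sum>k\<in>A. K n k * x k powr p)" .
  qed
  also have "\<dots> = \<rho> powr (p - 1) * (\<Sum>k\<in>A. (\<Sum>n\<in>B. K n k) * x k powr p)"
    unfolding sum_distrib_left[symmetric] by (subst sum.swap) (simp add: sum_distrib_right)
  also have "\<dots> \<le> \<rho> powr (p - 1) * (\<Sum>k\<in>A. \<rho> * x k powr p)"
    by (intro mult_left_mono sum_mono mult_right_mono col) auto
  also have "\<dots> = \<rho> powr p * (\<Sum>k\<in>A. x k powr p)"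
    using assms(4) by (cases "\<rho> = 0") (auto simp: sum_distrib_left[symmetric] powr_diff)
  finally show ?thesis .
qed

subsection \<open>The discrete Hilbert transform\<close>

text \<open>Input and output are restricted to one finite set, so no convergence question arises;
  the bounds below are uniform in \<open>I\<close>.\<close>

definition hilb :: "int set \<Rightarrow> (int \<Rightarrow> real) \<Rightarrow> int \<Rightarrow> real" where
  "hilb I a n = (\<Sum>k\<in>I - {n}. a k / real_of_int (n - k))"

definition inv_sq :: "int \<Rightarrow> real" where
  "inv_sq m = (if m = 0 then 0 else 1 / (real_of_int m)\<^sup>2)"

lemma inv_sq_nonneg: "inv_sq m \<ge> 0"
  by (simp add: inv_sq_def)

lemma inv_sq_minus: "inv_sq (- m) = inv_sq m"
  by (simp add: inv_sq_def)

text \<open>Comparison with the telescoping series of 1/L - 1/(L+1). At L = 0 the convention 1/0 = 0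
  makes the claim 0 \<le> 2.\<close>

lemma sum_inv_sq_nat: "(\<Sum>m=1..L::nat. 1 / (real m)\<^sup>2) \<le> 2 - 1 / real L"
proof (induction L)
  case (Suc L)
  show ?case
  proof (cases "L = 0")
    case False
    then have "1 / (real (Suc L))\<^sup>2 \<le> 1 / real L - 1 / real (Suc L)"
      by (simp add: divide_simps power2_eq_square)
    then show ?thesis using Suc by simp
  qed simp
qed simp

lemma sum_inv_sq_pos:
  assumes "finite J" "\<And>m. m \<in> J \<Longrightarrow> m > 0"
  shows "(\<Sum>m\<in>J. inv_sq m) \<le> 2"
proof -
  have inj: "inj_on nat J" using assms(2) by (force simp: inj_on_def)
  have "real (nat m) = of_int m" if "m \<in> J" for m
    using assms(2)[OF that] by simp
  then have "(\<Sum>m\<in>J. inv_sq m) = (\<Sum>m\<in>nat ` J. 1 / (real m)\<^sup>2)"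
    unfolding sum.reindex[OF inj] by (intro sum.cong) (auto simp: inv_sq_def)
  also have "\<dots> \<le> (\<Sum>m=1..Max (insert 0 (nat ` J)). 1 / (real m)\<^sup>2)"
    using assms by (intro sum_mono2) (auto intro!: Max_ge simp: Suc_le_eq)
  also have "\<dots> \<le> 2" using sum_inv_sq_nat by (rule order_trans) auto
  finally show ?thesis .
qed

lemma sum_inv_sq_le:
  assumes "finite J"
  shows "(\<Sum>m\<in>J. inv_sq m) \<le> 4"
proof -
  have J: "J = {m\<in>J. m > 0} \<union> ({m\<in>J. m < 0} \<union> {m\<in>J. m = 0})" by auto
  have "(\<Sum>m\<in>J. inv_sq m) = (\<Sum>m\<in>{m\<in>J. m > 0}. inv_sq m) + ((\<Sum>m\<in>{m\<in>J. m < 0}. inv_sq m) + (\<Sum>m\<in>{m\<in>J. m = 0}. inv_sq m))"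
    using assms by (subst J, subst sum.union_disjoint, auto, subst sum.union_disjoint, auto)
  moreover have "(\<Sum>m\<in>{m\<in>J. m = 0}. inv_sq m) = 0" by (simp add: inv_sq_def)
  moreover have "(\<Sum>m\<in>{m\<in>J. m < 0}. inv_sq m) = (\<Sum>m\<in>uminus ` {m\<in>J. m < 0}. inv_sq m)"
    by (subst sum.reindex) (auto simp: inv_sq_minus)
  moreover have "(\<Sum>m\<in>uminus ` {m\<in>J. m < 0}. inv_sq m) \<le> 2"
    using assms by (intro sum_inv_sq_pos) auto
  moreover have "(\<Sum>m\<in>{m\<in>J. m > 0}. inv_sq m) \<le> 2"
    using assms by (intro sum_inv_sq_pos) auto
  ultimately show ?thesis by linarith
qed

lemma sum_inv_sq_diff_le:
  assumes "finite I"
  shows "(\<Sum>k\<in>I. inv_sq (n - k)) \<le> 4" "(\<Sum>k\<in>I. inv_sq (k - n)) \<le> 4"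
proof -
  show "(\<Sum>k\<in>I. inv_sq (n - k)) \<le> 4"
    using sum_inv_sq_le[of "(\<lambda>k. n - k) ` I"] assms by (simp add: sum.reindex inj_on_def)
  then show "(\<Sum>k\<in>I. inv_sq (k - n)) \<le> 4"
    by (metis (no_types, lifting) inv_sq_minus minus_diff_eq sum.cong)
qed

definition invsq_conv :: "int set \<Rightarrow> (int \<Rightarrow> real) \<Rightarrow> int \<Rightarrow> real" where
  "invsq_conv I a n = (\<Sum>k\<in>I. inv_sq (n - k) * a k)"

lemma abs_invsq_conv_le: "\<bar>invsq_conv I a n\<bar> \<le> invsq_conv I (\<lambda>k. \<bar>a k\<bar>) n"
  unfolding invsq_conv_def
  by (rule order_trans[OF sum_abs]) (simp add: abs_mult inv_sq_nonneg)

lemma invsq_conv_bound: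
  assumes "finite I" "p \<ge> 1"
  shows "(\<Sum>n\<in>I. \<bar>invsq_conv I a n\<bar> powr p) \<le> 4 powr p * (\<Sum>k\<in>I. \<bar>a k\<bar> powr p)"
proof -
  have "(\<Sum>n\<in>I. \<bar>invsq_conv I a n\<bar> powr p) \<le> (\<Sum>n\<in>I. (\<Sum>k\<in>I. inv_sq (n - k) * \<bar>a k\<bar>) powr p)"
    using assms abs_invsq_conv_le[of I a] by (intro sum_mono powr_mono2) (auto simp: invsq_conv_def)
  also have "\<dots> \<le> 4 powr p * (\<Sum>k\<in>I. \<bar>a k\<bar> powr p)"
    using assms by (intro Schur_test sum_inv_sq_diff_le inv_sq_nonneg) auto
  finally show ?thesis .
qed

text \<open>The partial fraction identity \<open>1/((n-k)(n-l)) = (1/(n-k) - 1/(n-l))/(k-l)\<close> turns the square of the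
  transform into Cotlar's identity, with error terms coming from coinciding indices.\<close>

lemma hilb_Cotlar:
  assumes "finite I" "n \<in> I"
  shows "(hilb I a n)\<^sup>2 = 2 * hilb I (\<lambda>k. a k * hilb I a k) n + 2 * (a n * invsq_conv I a n)
    + invsq_conv I (\<lambda>k. (a k)\<^sup>2) n"
proof -
  let ?J = "I - {n}"
  define r where "r k l = (1 / real_of_int (k - l))" for k l :: int
  have r0: "r k k = 0" for k by (simp add: r_def)
  have rr: "r n k * r n k = inv_sq (n - k)" for k
    by (simp add: r_def inv_sq_def power2_eq_square)
  have pf: "r n k * r n l = (r n k - r n l) * r k l" if "k \<noteq> l" "k \<noteq> n" "l \<noteq> n" for k l
    using that by (simp add: r_def field_simps)
  have rs: "r l k = - r k l" for k l
    by (cases "k = l") (simp_all add: r_def field_simps)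
  have H: "hilb I a m = (\<Sum>k\<in>I. a k * r m k)" if "m \<in> I" for a m
    unfolding hilb_def using assms that
    by (subst sum.remove[of I m]) (auto simp: r_def)
  have off: "(\<Sum>k\<in>?J. \<Sum>l\<in>?J. if k = l then 0 else a k * a l * (r n k * r k l))
      = hilb I (\<lambda>k. a k * hilb I a k) n + a n * invsq_conv I a n"
  proof -
    have "(\<Sum>k\<in>?J. \<Sum>l\<in>?J. if k = l then 0 else a k * a l * (r n k * r k l))
        = (\<Sum>k\<in>?J. a k * r n k * (\<Sum>l\<in>?J. a l * r k l))"
      by (intro sum.cong refl) (simp add: sum_distrib_left, intro sum.cong refl, auto simp: r0)
    \<comment> \<open>The inner sum omits l = n. Restoring that term subtracts
      \<open>a n * r k n\<close>, and antisymmetry of \<open>r\<close> turns the correction into the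
      inverse square convolution.\<close>
    also have "\<dots> = (\<Sum>k\<in>?J. a k * r n k * (hilb I a k - a n * r k n))"
      using assms by (intro sum.cong refl) (simp add: H sum_diff1)
    also have "\<dots> = (\<Sum>k\<in>?J. (a k * hilb I a k) * r n k) + a n * (\<Sum>k\<in>?J. inv_sq (n - k) * a k)"
      by (simp add: rs[of _ n] algebra_simps sum.distrib sum_distrib_left flip: rr)
    also have "(\<Sum>k\<in>?J. inv_sq (n - k) * a k) = invsq_conv I a n"
      unfolding invsq_conv_def using assms by (intro sum.mono_neutral_left) (auto simp: inv_sq_def)
    finally show ?thesis by (simp add: hilb_def r_def)
  qed
  have "(hilb I a n)\<^sup>2 = (\<Sum>k\<in>?J. a k * r n k) * (\<Sum>l\<in>?J. a l * r n l)"
    by (simp add: hilb_def r_def power2_eq_square)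
  also have "\<dots> = (\<Sum>k\<in>?J. \<Sum>l\<in>?J. a k * a l * (r n k * r n l))"
    by (simp add: sum_product algebra_simps)
  \<comment> \<open>The diagonal k = l is split off because the partial fraction identity divides by
    k - l. The two off-diagonal sums are mirror images, which produces the factor 2.\<close>
  also have "\<dots> = (\<Sum>k\<in>?J. \<Sum>l\<in>?J. (if k = l then 0 else a k * a l * (r n k * r k l))
      + (if k = l then 0 else a k * a l * (r n l * r l k)) + (if k = l then (a k)\<^sup>2 * inv_sq (n - k) else 0))"
  proof (intro sum.cong refl)
    fix k l assume "k \<in> ?J" "l \<in> ?J"
    then show "a k * a l * (r n k * r n l) = (if k = l then 0 else a k * a l * (r n k * r k l))
      + (if k = l then 0 else a k * a l * (r n l * r l k)) + (if k = l then (a k)\<^sup>2 * inv_sq (n - k) else 0)"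
    proof (cases "k = l")
      case False
      then have "r n k * r n l = (r n k - r n l) * r k l"
        using \<open>k \<in> ?J\<close> \<open>l \<in> ?J\<close> by (intro pf) auto
      then have "a k * a l * (r n k * r n l) = a k * a l * ((r n k - r n l) * r k l)" by simp
      also have "\<dots> = a k * a l * (r n k * r k l) + a k * a l * (r n l * r l k)"
        by (simp add: rs[of l k] algebra_simps)
      finally show ?thesis using False by simp
    qed (simp add: rr power2_eq_square)
  qed
  also have "\<dots> = (\<Sum>k\<in>?J. \<Sum>l\<in>?J. if k = l then 0 else a k * a l * (r n k * r k l))
      + (\<Sum>k\<in>?J. \<Sum>l\<in>?J. if k = l then 0 else a k * a l * (r n l * r l k))
      + (\<Sum>k\<in>?J. (a k)\<^sup>2 * inv_sq (n - k))"
    using assms by (simp add: sum.distrib)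
  also have "(\<Sum>k\<in>?J. \<Sum>l\<in>?J. if k = l then 0 else a k * a l * (r n l * r l k))
      = (\<Sum>k\<in>?J. \<Sum>l\<in>?J. if k = l then 0 else a k * a l * (r n k * r k l))"
    by (subst sum.swap, intro sum.cong refl) auto
  also have "(\<Sum>k\<in>?J. (a k)\<^sup>2 * inv_sq (n - k)) = invsq_conv I (\<lambda>k. (a k)\<^sup>2) n"
    unfolding invsq_conv_def using assms by (intro sum.mono_neutral_cong_left) (auto simp: inv_sq_def)
  finally show ?thesis unfolding off by simp
qed

subsection \<open>Boundedness on \<open>\<ell>\<^sub>2\<close>\<close>

lemma has_vector_derivative_cis_mult:
  "((\<lambda>t. cis (c * t)) has_vector_derivative (\<i> * of_real c * cis (c * t))) (at t within S)"
proof -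
  have "((\<lambda>t. exp (\<i> * of_real c * of_real t)) has_vector_derivative
      (\<i> * of_real c * exp (\<i> * of_real c * of_real t))) (at t within S)"
    by (rule has_vector_derivative_real_field) (auto intro!: derivative_eq_intros)
  then show ?thesis by (simp add: cis_conv_exp mult.assoc)
qed

lemma has_integral_cis_int:
  "((\<lambda>t. cis (2 * pi * real_of_int m * t)) has_integral (if m = 0 then 1 else 0)) {0..1}"
proof (cases "m = 0")
  case True
  then show ?thesis using has_integral_const_real[of "1::complex" 0 1] by simp
next
  case False
  define c where "c = 2 * pi * real_of_int m"
  have c: "c \<noteq> 0" using False by (simp add: c_def)
  have "((\<lambda>t. cis (c * t)) has_integral (cis (c * 1) / (\<i> * c) - cis (c * 0) / (\<i> * c))) {0..1}"
  proof (rule fundamental_theorem_of_calculus)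
    show "((\<lambda>t. cis (c * t) / (\<i> * c)) has_vector_derivative cis (c * t)) (at t within {0..1})" for t
      using has_vector_derivative_mult_left[OF has_vector_derivative_cis_mult[of c t "{0..1}"], of "1 / (\<i> * c)"] c
      by simp
  qed simp
  then show ?thesis using False by (simp add: cis_multiple_2pi c_def)
qed

text \<open>Up to the factor 2 pi i, the kernel 1/m is the sequence of Fourier coefficients of a
  bounded function, the sawtooth. This is the source of the l_2 bound for the Hilbert
  transform.\<close>

lemma has_integral_sawtooth_cis_int:
  "((\<lambda>t. of_real (t - 1/2) * cis (2 * pi * real_of_int m * t)) has_integral
     (if m = 0 then 0 else 1 / (2 * pi * \<i> * m))) {0..1}"
proof (cases "m = 0")
  case True
  have "((\<lambda>t. complex_of_real (t - 1/2)) has_integral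
      (complex_of_real ((1 - 1/2)\<^sup>2 / 2) - complex_of_real ((0 - 1/2)\<^sup>2 / 2))) {0..1}"
    by (intro fundamental_theorem_of_calculus has_vector_derivative_of_real)
      (auto intro!: derivative_eq_intros simp flip: has_real_derivative_iff_has_vector_derivative)
  then show ?thesis using True by (simp add: power2_eq_square)
next
  case False
  define c where "c = 2 * pi * real_of_int m"
  have c: "c \<noteq> 0" using False by (simp add: c_def)
  define w where "w = \<i> * complex_of_real c"
  have w: "w \<noteq> 0" using c by (simp add: w_def)
  \<comment> \<open>An antiderivative found by parts. At the two ends it equals (1/2)/w - 1/w^2 and
    -(1/2)/w - 1/w^2, so the difference is 1/w.\<close>
  define F where "F t = (of_real (t - 1/2) / w - 1 / w\<^sup>2) * cis (c * t)" for t
  have "((\<lambda>t. of_real (t - 1/2) * cis (c * t)) has_integral (F 1 - F 0)) {0..1}"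
  proof (rule fundamental_theorem_of_calculus)
    fix t :: real
    have "((\<lambda>t. of_real (t - 1/2) / w - 1 / w\<^sup>2) has_vector_derivative (1 / w)) (at t within {0..1})"
      using has_vector_derivative_real_field[of "\<lambda>z. (z - 1/2) / w - 1 / w\<^sup>2" "1 / w" t "{0..1}"]
      by (auto intro!: derivative_eq_intros)
    from has_vector_derivative_mult[OF this has_vector_derivative_cis_mult[of c]]
    have "(F has_vector_derivative ((of_real (t - 1/2) / w - 1 / w\<^sup>2) * (w * cis (c * t)) + 1 / w * cis (c * t))) (at t within {0..1})"
      unfolding F_def w_def .
    also have "(of_real (t - 1/2) / w - 1 / w\<^sup>2) * (w * cis (c * t)) + 1 / w * cis (c * t) = of_real (t - 1/2) * cis (c * t)"
      using w by (simp add: divide_simps power2_eq_square) (simp add: algebra_simps)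
    finally show "(F has_vector_derivative of_real (t - 1/2) * cis (c * t)) (at t within {0..1})" .
  qed simp
  moreover have "F 1 - F 0 = 1 / w"
    using w by (simp add: F_def c_def cis_multiple_2pi diff_divide_distrib)
  ultimately show ?thesis using False by (simp add: w_def c_def mult_ac)
qed

lemma has_integral_trig_poly_sq:
  fixes a :: "int \<Rightarrow> real"
  assumes "finite I"
  shows "((\<lambda>t. (norm (\<Sum>k\<in>I. of_real (a k) * cis (2 * pi * real_of_int k * t)))\<^sup>2) has_integral (\<Sum>k\<in>I. (a k)\<^sup>2)) {0..1}"
proof -
  have "((\<lambda>t. Re (\<Sum>k\<in>I. \<Sum>l\<in>I. of_real (a k * a l) * cis (2 * pi * real_of_int (k - l) * t))) has_integral
      Re (\<Sum>k\<in>I. \<Sum>l\<in>I. of_real (a k * a l) * (if k - l = 0 then 1 else 0))) {0..1}"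
    by (intro has_integral_Re has_integral_sum has_integral_mult_right has_integral_cis_int assms)
  also have "(\<Sum>k\<in>I. \<Sum>l\<in>I. complex_of_real (a k * a l) * (if k - l = 0 then 1 else 0)) = of_real (\<Sum>k\<in>I. (a k)\<^sup>2)"
    using assms by (simp add: power2_eq_square if_distrib cong: if_cong)
  also have "(\<lambda>t. Re (\<Sum>k\<in>I. \<Sum>l\<in>I. of_real (a k * a l) * cis (2 * pi * real_of_int (k - l) * t)))
     = (\<lambda>t. (norm (\<Sum>k\<in>I. of_real (a k) * cis (2 * pi * real_of_int k * t)))\<^sup>2)"
  proof
    fix t
    let ?A = "\<Sum>k\<in>I. of_real (a k) * cis (2 * pi * real_of_int k * t)"
    have "(\<Sum>k\<in>I. \<Sum>l\<in>I. of_real (a k * a l) * cis (2 * pi * real_of_int (k - l) * t)) = ?A * cnj ?A"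
      by (simp add: sum_product cis_cnj mult_ac cis_mult algebra_simps)
    also have "Re \<dots> = (norm ?A)\<^sup>2" by (metis Re_complex_of_real complex_norm_square)
    finally show "Re (\<Sum>k\<in>I. \<Sum>l\<in>I. of_real (a k * a l) * cis (2 * pi * real_of_int (k - l) * t)) = (norm ?A)\<^sup>2" .
  qed
  finally show ?thesis by simp
qed

text \<open>The bilinear form is 2 pi i times the integral of the sawtooth against a product of two
  trigonometric polynomials. The sawtooth is at most 1/2 in modulus and the product is at most half
  the sum of the squares, so the constant is 2 pi / 4.\<close>

lemma hilb_bilinear_bound:
  assumes "finite I"
  shows "\<bar>\<Sum>n\<in>I. b n * hilb I a n\<bar> \<le> pi / 2 * ((\<Sum>k\<in>I. (a k)\<^sup>2) + (\<Sum>k\<in>I. (b k)\<^sup>2))"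
proof -
  let ?P = "\<lambda>a t. \<Sum>k\<in>I. complex_of_real (a k) * cis (2 * pi * real_of_int k * t)"
  have 1: "((\<lambda>t. \<Sum>n\<in>I. \<Sum>k\<in>I. complex_of_real (b n * a k) * (of_real (t - 1/2) * cis (2 * pi * real_of_int (n - k) * t)))
      has_integral (\<Sum>n\<in>I. \<Sum>k\<in>I. complex_of_real (b n * a k) * (if n - k = 0 then 0 else 1 / (2 * pi * \<i> * of_int (n - k))))) {0..1}"
    (is "(?f has_integral ?v) _")
    by (intro has_integral_sum has_integral_mult_right has_integral_sawtooth_cis_int assms)
  have f: "?f t = of_real (t - 1/2) * ?P b t * cnj (?P a t)" for t
  proof -
    have "?P b t * cnj (?P a t) = (\<Sum>n\<in>I. \<Sum>k\<in>I. complex_of_real (b n * a k) * cis (2 * pi * real_of_int (n - k) * t))"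
      by (simp add: sum_product cis_cnj mult_ac cis_mult algebra_simps)
    moreover have "?f t = of_real (t - 1/2) * (\<Sum>n\<in>I. \<Sum>k\<in>I. complex_of_real (b n * a k) * cis (2 * pi * real_of_int (n - k) * t))"
      unfolding sum_distrib_left by (intro sum.cong refl) (simp only: mult_ac)
    ultimately show ?thesis by (simp only: mult.assoc)
  qed
  have v: "?v = of_real (\<Sum>n\<in>I. b n * hilb I a n) / (2 * pi * \<i>)"
  proof -
    have "?v = (\<Sum>n\<in>I. \<Sum>k\<in>I - {n}. complex_of_real (b n * a k) / (2 * pi * \<i> * of_int (n - k)))"
      using assms by (intro sum.cong refl sum.mono_neutral_cong_right) auto
    then show ?thesis
      by (simp add: hilb_def sum_distrib_left sum_divide_distrib field_simps)
  qed
  have 2: "((\<lambda>t. 1/4 * ((norm (?P a t))\<^sup>2 + (norm (?P b t))\<^sup>2)) has_integral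
      1/4 * ((\<Sum>k\<in>I. (a k)\<^sup>2) + (\<Sum>k\<in>I. (b k)\<^sup>2))) {0..1}" (is "(?g has_integral ?w) _")
    by (intro has_integral_mult_right has_integral_add has_integral_trig_poly_sq assms)
  have "norm (integral {0..1} ?f) \<le> integral {0..1} ?g"
  proof (rule integral_norm_bound_integral)
    fix t :: real assume t: "t \<in> {0..1}"
    have "norm (?f t) = \<bar>t - 1/2\<bar> * (norm (?P a t) * norm (?P b t))"
      unfolding f norm_mult norm_of_real complex_mod_cnj by simp
    also have "\<dots> \<le> 1/2 * (1/2 * ((norm (?P a t))\<^sup>2 + (norm (?P b t))\<^sup>2))"
    proof (rule mult_mono)
      have "x * y \<le> 1/2 * (x\<^sup>2 + y\<^sup>2)" for x y :: real
        using sum_squares_bound[of x y] by simp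
      then show "norm (?P a t) * norm (?P b t) \<le> 1/2 * ((norm (?P a t))\<^sup>2 + (norm (?P b t))\<^sup>2)"
        by blast
    qed (use t in \<open>auto simp: abs_real_def\<close>)
    finally show "norm (?f t) \<le> ?g t" by simp
  qed (use 1 2 in \<open>auto intro: has_integral_integrable\<close>)
  then have "norm ?v \<le> ?w" by (simp only: integral_unique[OF 1] integral_unique[OF 2])
  then have "\<bar>\<Sum>n\<in>I. b n * hilb I a n\<bar> / (2 * pi) \<le> ?w"
    unfolding v norm_divide norm_mult norm_of_real by simp
  then show ?thesis by (simp add: pos_divide_le_eq mult_ac)
qed

lemma hilb_l2_bound:
  assumes "finite I"
  shows "(\<Sum>n\<in>I. (hilb I a n)\<^sup>2) \<le> pi\<^sup>2 * (\<Sum>k\<in>I. (a k)\<^sup>2)"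
proof -
  let ?X = "\<Sum>n\<in>I. (hilb I a n)\<^sup>2"
  \<comment> \<open>The choice b = Ha / pi balances the two squares: half of \<open>?X / pi\<close>
    then reappears on the right and can be absorbed.\<close>
  have "\<bar>\<Sum>n\<in>I. (hilb I a n / pi) * hilb I a n\<bar> \<le> pi / 2 * ((\<Sum>k\<in>I. (a k)\<^sup>2) + (\<Sum>k\<in>I. (hilb I a k / pi)\<^sup>2))"
    by (rule hilb_bilinear_bound[OF assms])
  moreover have "(\<Sum>n\<in>I. (hilb I a n / pi) * hilb I a n) = ?X / pi"
    by (simp add: sum_divide_distrib power2_eq_square)
  moreover have "(\<Sum>k\<in>I. (hilb I a k / pi)\<^sup>2) = ?X / pi\<^sup>2"
    by (simp add: sum_divide_distrib power_divide)
  moreover have "?X \<ge> 0" by (intro sum_nonneg) simp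
  ultimately have "?X / pi \<le> pi / 2 * ((\<Sum>k\<in>I. (a k)\<^sup>2) + ?X / pi\<^sup>2)" by (simp only: abs_of_nonneg divide_nonneg_pos pi_gt_zero)
  also have "\<dots> = (pi * (\<Sum>k\<in>I. (a k)\<^sup>2)) / 2 + ?X / pi / 2"
    by (simp add: distrib_left power2_eq_square)
  finally have *: "?X / pi \<le> (pi * (\<Sum>k\<in>I. (a k)\<^sup>2)) / 2 + ?X / pi / 2" .
  have "x \<le> y" if "x \<le> y / 2 + x / 2" for x y :: real using that by simp
  from this[OF *] have "?X / pi \<le> pi * (\<Sum>k\<in>I. (a k)\<^sup>2)" .
  then have "?X \<le> pi * (\<Sum>k\<in>I. (a k)\<^sup>2) * pi" by (simp add: pos_divide_le_eq)
  then show ?thesis by (simp add: power2_eq_square mult_ac)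
qed


subsection \<open>Boundedness on \<open>\<ell>\<^sub>p\<close>\<close>

definition hilb_bounded :: "real \<Rightarrow> bool" where
  "hilb_bounded p \<longleftrightarrow> (\<exists>C\<ge>0. \<forall>I a. finite I \<longrightarrow>
     (\<Sum>n\<in>I. \<bar>hilb I a n\<bar> powr p) \<le> C * (\<Sum>k\<in>I. \<bar>a k\<bar> powr p))"

lemma hilb_bounded_2: "hilb_bounded 2"
  unfolding hilb_bounded_def using hilb_l2_bound by (intro exI[of _ "pi\<^sup>2"]) auto

lemma powr_square: "(x powr p)\<^sup>2 = x powr (2 * p)" for x p :: real
  by (simp add: power2_eq_square flip: powr_add)

lemma square_powr: "(x\<^sup>2) powr p = \<bar>x\<bar> powr (2 * p)" for x p :: real
proof -
  have "(x\<^sup>2) powr p = (\<bar>x\<bar> powr 2) powr p" by simp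
  then show ?thesis by (simp only: powr_powr)
qed

text \<open>The 2p-th power of |Ha| is the p-th power of (Ha)^2, to which Cotlar's identity applies.
  Its main term is H(a Ha), controlled at exponent p; Young's inequality then splits the product a
  Ha so that half of the left-hand side, which is a finite sum, is absorbed.\<close>

lemma hilb_bounded_double:
  assumes "hilb_bounded p" "p \<ge> 1"
  shows "hilb_bounded (2 * p)"
proof -
  from assms obtain C where C: "C \<ge> 0"
    and H: "\<And>I a. finite I \<Longrightarrow> (\<Sum>n\<in>I. \<bar>hilb I a n\<bar> powr p) \<le> C * (\<Sum>k\<in>I. \<bar>a k\<bar> powr p)"
    unfolding hilb_bounded_def by blast
  define D where "D = 6 powr p * C"
  \<comment> \<open>Twice the total of the constants for the three terms of Cotlar's identity, since
    half of \<open>X\<close> is moved to the left.\<close>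
  define C' where "C' = D\<^sup>2 + 6 powr p * (1 + 4 powr (2 * p)) + 2 * (3 powr p * 4 powr p)"
  have "(\<Sum>n\<in>I. \<bar>hilb I a n\<bar> powr (2 * p)) \<le> C' * (\<Sum>k\<in>I. \<bar>a k\<bar> powr (2 * p))" if I: "finite I" for I a
  proof -
    define X where "X = (\<Sum>n\<in>I. \<bar>hilb I a n\<bar> powr (2 * p))"
    define A where "A = (\<Sum>n\<in>I. \<bar>a n\<bar> powr (2 * p))"
    define u v w where "u = hilb I (\<lambda>k. a k * hilb I a k)" and "v = (\<lambda>n. a n * invsq_conv I a n)"
      and "w = invsq_conv I (\<lambda>k. (a k)\<^sup>2)"
    have young: "x * y \<le> x\<^sup>2 / 2 + y\<^sup>2 / 2" for x y :: real
      using sum_squares_bound[of x y] by simp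
    have six: "3 powr p * 2 powr p = 6 powr p" by (simp flip: powr_mult)
    have "X \<le> (\<Sum>n\<in>I. 3 powr p * ((2 * \<bar>u n\<bar>) powr p + (2 * \<bar>v n\<bar>) powr p + \<bar>w n\<bar> powr p))"
      unfolding X_def
    proof (rule sum_mono)
      fix n assume n: "n \<in> I"
      have "\<bar>hilb I a n\<bar> powr (2 * p) = \<bar>(hilb I a n)\<^sup>2\<bar> powr p"
        by (simp add: square_powr)
      also have "\<dots> = \<bar>2 * u n + 2 * v n + w n\<bar> powr p"
        by (simp only: hilb_Cotlar[OF I n, of a] u_def v_def w_def)
      also have "\<dots> \<le> (2 * \<bar>u n\<bar> + 2 * \<bar>v n\<bar> + \<bar>w n\<bar>) powr p"
        using assms by (intro powr_mono2) auto
      also have "\<dots> \<le> 3 powr p * ((2 * \<bar>u n\<bar>) powr p + (2 * \<bar>v n\<bar>) powr p + \<bar>w n\<bar> powr p)"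
        using assms by (intro powr_add3_le) auto
      finally show "\<bar>hilb I a n\<bar> powr (2 * p) \<le> 3 powr p * ((2 * \<bar>u n\<bar>) powr p + (2 * \<bar>v n\<bar>) powr p + \<bar>w n\<bar> powr p)" .
    qed
    also have "\<dots> = 6 powr p * (\<Sum>n\<in>I. \<bar>u n\<bar> powr p) + 6 powr p * (\<Sum>n\<in>I. \<bar>v n\<bar> powr p) + 3 powr p * (\<Sum>n\<in>I. \<bar>w n\<bar> powr p)"
      by (simp add: six[symmetric] powr_mult sum.distrib distrib_left sum_distrib_left mult.assoc)
    finally have X: "X \<le> 6 powr p * (\<Sum>n\<in>I. \<bar>u n\<bar> powr p) + 6 powr p * (\<Sum>n\<in>I. \<bar>v n\<bar> powr p) + 3 powr p * (\<Sum>n\<in>I. \<bar>w n\<bar> powr p)" .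
    have "6 powr p * (\<Sum>n\<in>I. \<bar>u n\<bar> powr p) \<le> D * (\<Sum>k\<in>I. \<bar>a k * hilb I a k\<bar> powr p)"
      unfolding u_def D_def mult.assoc by (intro mult_left_mono H I) auto
    also have "\<dots> = (\<Sum>k\<in>I. (D * \<bar>a k\<bar> powr p) * \<bar>hilb I a k\<bar> powr p)"
      by (simp add: sum_distrib_left abs_mult powr_mult mult.assoc)
    also have "\<dots> \<le> (\<Sum>k\<in>I. (D * \<bar>a k\<bar> powr p)\<^sup>2 / 2 + (\<bar>hilb I a k\<bar> powr p)\<^sup>2 / 2)"
      by (intro sum_mono young)
    also have "\<dots> = D\<^sup>2 / 2 * A + X / 2"
      by (simp add: A_def X_def power_mult_distrib powr_square sum.distrib sum_divide_distrib sum_distrib_left)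
    finally have u: "6 powr p * (\<Sum>n\<in>I. \<bar>u n\<bar> powr p) \<le> D\<^sup>2 / 2 * A + X / 2" .
    have "(\<Sum>n\<in>I. \<bar>v n\<bar> powr p) = (\<Sum>n\<in>I. \<bar>a n\<bar> powr p * \<bar>invsq_conv I a n\<bar> powr p)"
      by (simp add: v_def abs_mult powr_mult)
    also have "\<dots> \<le> (\<Sum>n\<in>I. (\<bar>a n\<bar> powr p)\<^sup>2 / 2 + (\<bar>invsq_conv I a n\<bar> powr p)\<^sup>2 / 2)"
      by (intro sum_mono young)
    also have "\<dots> = A / 2 + (\<Sum>n\<in>I. \<bar>invsq_conv I a n\<bar> powr (2 * p)) / 2"
      by (simp add: A_def powr_square sum.distrib sum_divide_distrib)
    also have "\<dots> \<le> A / 2 + (4 powr (2 * p) * A) / 2"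
      unfolding A_def using assms by (intro add_left_mono divide_right_mono invsq_conv_bound I) auto
    finally have v: "6 powr p * (\<Sum>n\<in>I. \<bar>v n\<bar> powr p) \<le> 6 powr p * (A / 2 + (4 powr (2 * p) * A) / 2)"
      by (rule mult_left_mono) auto
    have "(\<Sum>n\<in>I. \<bar>w n\<bar> powr p) \<le> 4 powr p * (\<Sum>k\<in>I. \<bar>(a k)\<^sup>2\<bar> powr p)"
      unfolding w_def using assms by (intro invsq_conv_bound I) auto
    then have "(\<Sum>n\<in>I. \<bar>w n\<bar> powr p) \<le> 4 powr p * A"
      by (simp add: A_def square_powr)
    then have w: "3 powr p * (\<Sum>n\<in>I. \<bar>w n\<bar> powr p) \<le> 3 powr p * (4 powr p * A)"
      by (rule mult_left_mono) auto
    have "X \<le> (C' * A) / 2 + X / 2"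
    proof -
      have "(C' * A) / 2 = D\<^sup>2 / 2 * A + 6 powr p * (A / 2 + (4 powr (2 * p) * A) / 2) + 3 powr p * (4 powr p * A)"
        by (simp add: C'_def field_simps)
      then show ?thesis using X u v w by linarith
    qed
    then have "X \<le> C' * A" by simp
    then show ?thesis by (simp add: X_def A_def)
  qed
  moreover have "C' \<ge> 0" unfolding C'_def by auto
  ultimately show ?thesis unfolding hilb_bounded_def by blast
qed

lemma hilb_bounded_pow2: "hilb_bounded (2 ^ Suc m)"
proof (induction m)
  case (Suc m)
  have "1 \<le> (2::real) ^ Suc m" by (intro one_le_power) simp
  from hilb_bounded_double[OF Suc this] show ?case by simp
qed (simp add: hilb_bounded_2)

section \<open>Truncation at each height and the layer-cake formula\<close>

text \<open>Only the factor \<open>lam k powr s\<close> is written as the length of an interval; the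
  square stays inside the sum, so an l_2 bound on each superlevel set suffices. The variable u
  stands for t^s. The Hilbert transform and the Hausdorff-Young inequality both use this
  form.\<close>

lemma sum_powr_layer_cake:
  fixes lam :: "'a \<Rightarrow> real" and \<Phi> :: "real \<Rightarrow> ennreal"
  assumes "finite A" "s > 0" and lam: "\<And>k. k \<in> A \<Longrightarrow> lam k \<ge> 0"
    and \<Phi>: "\<And>t. t > 0 \<Longrightarrow> ennreal (\<Sum>k\<in>{k\<in>A. lam k > t}. (lam k)\<^sup>2) \<le> \<Phi> t"
  shows "ennreal (\<Sum>k\<in>A. lam k powr (2 + s)) \<le> (\<integral>\<^sup>+u. \<Phi> (u powr (1 / s)) * indicator {0<..} u \<partial>lborel)"
proof -
  have "ennreal (\<Sum>k\<in>A. lam k powr (2 + s)) = (\<Sum>k\<in>A. ennreal ((lam k)\<^sup>2) * ennreal (lam k powr s))"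
    by (subst sum_ennreal[symmetric]) (auto simp: powr_add lam ennreal_mult' intro!: sum.cong)
  also have "\<dots> = (\<Sum>k\<in>A. \<integral>\<^sup>+u. ennreal ((lam k)\<^sup>2) * indicator {0<..<lam k powr s} u \<partial>lborel)"
    by (intro sum.cong refl) (simp add: nn_integral_cmult_indicator)
  also have "\<dots> = (\<integral>\<^sup>+u. (\<Sum>k\<in>A. ennreal ((lam k)\<^sup>2) * indicator {0<..<lam k powr s} u) \<partial>lborel)"
    by (subst nn_integral_sum) auto
  also have "\<dots> \<le> (\<integral>\<^sup>+u. \<Phi> (u powr (1 / s)) * indicator {0<..} u \<partial>lborel)"
  proof (rule nn_integral_mono)
    fix u :: real
    show "(\<Sum>k\<in>A. ennreal ((lam k)\<^sup>2) * indicator {0<..<lam k powr s} u) \<le> \<Phi> (u powr (1 / s)) * indicator {0<..} u"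
    proof (cases "u > 0")
      case True
      have iff: "u < lam k powr s \<longleftrightarrow> lam k > u powr (1 / s)" if "k \<in> A" for k
      proof
        assume "u < lam k powr s"
        then have "u powr (1 / s) < (lam k powr s) powr (1 / s)"
          using True assms by (intro powr_less_mono2) auto
        then show "lam k > u powr (1 / s)" using lam[OF that] assms by (simp add: powr_powr)
      next
        assume "lam k > u powr (1 / s)"
        then have "(u powr (1 / s)) powr s < lam k powr s"
          using True assms by (intro powr_less_mono2) auto
        then show "u < lam k powr s" using True assms by (simp add: powr_powr)
      qed
      have "(\<Sum>k\<in>A. ennreal ((lam k)\<^sup>2) * indicator {0<..<lam k powr s} u) = (\<Sum>k\<in>{k\<in>A. lam k > u powr (1 / s)}. ennreal ((lam k)\<^sup>2))"
        using \<open>finite A\<close> True iff by (intro sum.mono_neutral_cong_right) (auto simp: indicator_def)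
      also have "\<dots> = ennreal (\<Sum>k\<in>{k\<in>A. lam k > u powr (1 / s)}. (lam k)\<^sup>2)"
        by (subst sum_ennreal) auto
      also have "\<dots> \<le> \<Phi> (u powr (1 / s))" using True by (intro \<Phi>) auto
      finally show ?thesis using True by simp
    qed simp
  qed
  finally show ?thesis .
qed

lemma nn_integral_powr_tail:
  assumes "c > 0" "\<beta> > 1"
  shows "(\<integral>\<^sup>+u. ennreal (u powr (- \<beta>)) * indicator {c..} u \<partial>lborel) = ennreal (c powr (1 - \<beta>) / (\<beta> - 1))"
proof -
  have "((\<lambda>u. u powr (- \<beta>)) has_integral (-(c powr (- \<beta> + 1)) / (- \<beta> + 1))) {c..}"
    using assms by (intro has_integral_powr_to_inf) auto
  then have "(\<integral>\<^sup>+u. ennreal (u powr (- \<beta>)) * indicator {c..} u \<partial>lborel) = ennreal (-(c powr (- \<beta> + 1)) / (- \<beta> + 1))"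
    by (intro nn_integral_has_integral_lebesgue') auto
  also have "-(c powr (- \<beta> + 1)) / (- \<beta> + 1) = c powr (1 - \<beta>) / (\<beta> - 1)"
    using assms by (simp add: field_simps)
  finally show ?thesis .
qed

text \<open>Marcinkiewicz' argument: at height t the sequence is cut at the same height, the large
  part is estimated in l_2 and the small part in l_r. Integrating over t reproduces the p-th powers
  of the entries in both cases.\<close>

lemma hilb_bounded_interpolate:
  assumes "hilb_bounded r" "2 < p" "p < r"
  shows "hilb_bounded p"
proof -
  from hilb_bounded_2 obtain C2 where C2: "C2 \<ge> 0"
    and H2: "\<And>I a. finite I \<Longrightarrow> (\<Sum>n\<in>I. \<bar>hilb I a n\<bar> powr 2) \<le> C2 * (\<Sum>k\<in>I. \<bar>a k\<bar> powr 2)"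
    unfolding hilb_bounded_def by blast
  from assms(1) obtain Cr where Cr: "Cr \<ge> 0"
    and Hr: "\<And>I a. finite I \<Longrightarrow> (\<Sum>n\<in>I. \<bar>hilb I a n\<bar> powr r) \<le> Cr * (\<Sum>k\<in>I. \<bar>a k\<bar> powr r)"
    unfolding hilb_bounded_def by blast
  define s where "s = p - 2"
  \<comment> \<open>In the variable u = t^s the factor t^(2-r) of the small part becomes
    u^(-\<beta>). Its tail is integrable because p < r makes \<beta> > 1.\<close>
  define \<beta> where "\<beta> = (r - 2) / s"
  have s: "s > 0" "p = 2 + s" and \<beta>: "\<beta> > 1" using assms by (auto simp: s_def \<beta>_def field_simps)
  define K where "K = 4 * 2 powr (r - 2) * Cr"
  have K: "K \<ge> 0" using Cr by (simp add: K_def)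
  define C where "C = 4 * C2 + K / (\<beta> - 1)"
  have "(\<Sum>n\<in>I. \<bar>hilb I a n\<bar> powr p) \<le> C * (\<Sum>k\<in>I. \<bar>a k\<bar> powr p)" if I: "finite I" for I a
  proof -
    \<comment> \<open>The first summand is the l_2 bound for the entries above t, the second the l_r
      bound for those at most t. The constant \<open>K\<close> collects the factors that come with
      (t/2)^(2-r).\<close>
    define \<Phi> where "\<Phi> t = (\<Sum>k\<in>I. ennreal (4 * C2 * (a k)\<^sup>2) * indicator {..<\<bar>a k\<bar>} t +
        ennreal (K * \<bar>a k\<bar> powr r) * (ennreal (t powr (2 - r)) * indicator {\<bar>a k\<bar>..} t))" for t :: real
    have "ennreal (\<Sum>n\<in>I. \<bar>hilb I a n\<bar> powr (2 + s)) \<le> (\<integral>\<^sup>+u. \<Phi> (u powr (1 / s)) * indicator {0<..} u \<partial>lborel)"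
    proof (rule sum_powr_layer_cake[OF I s(1)])
      fix t :: real assume t: "t > 0"
      define a1 a2 where "a1 k = (if \<bar>a k\<bar> > t then a k else 0)" and "a2 k = (if \<bar>a k\<bar> > t then 0 else a k)" for k
      have split: "hilb I a n = hilb I a1 n + hilb I a2 n" for n
        unfolding hilb_def sum.distrib[symmetric] by (intro sum.cong) (auto simp: a1_def a2_def)
      \<comment> \<open>One of the two parts carries at least half of the value. If it is the small
        one, y = |Ha|/2 exceeds t/2, and the negative exponent 2 - r converts this into y^2 \<le>
        (t/2)^(2-r) y^r.\<close>
      have pt: "\<bar>hilb I a n\<bar>\<^sup>2 \<le> 4 * \<bar>hilb I a1 n\<bar> powr 2 + 4 * (t / 2) powr (2 - r) * \<bar>hilb I a2 n\<bar> powr r"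
        if "\<bar>hilb I a n\<bar> > t" for n
      proof (cases "\<bar>hilb I a1 n\<bar> \<ge> \<bar>hilb I a n\<bar> / 2")
        case True
        then have "\<bar>hilb I a n\<bar>\<^sup>2 \<le> (2 * \<bar>hilb I a1 n\<bar>)\<^sup>2" by (intro power_mono) auto
        also have "\<dots> \<le> 4 * \<bar>hilb I a1 n\<bar> powr 2 + 4 * (t / 2) powr (2 - r) * \<bar>hilb I a2 n\<bar> powr r"
          by (simp add: power_mult_distrib)
        finally show ?thesis .
      next
        case False
        then have 1: "\<bar>hilb I a2 n\<bar> \<ge> \<bar>hilb I a n\<bar> / 2" using split[of n] by linarith
        define y where "y = \<bar>hilb I a n\<bar> / 2"
        have y: "y > t / 2" "y > 0" using that t by (auto simp: y_def)
        have "y\<^sup>2 = y powr r * y powr (2 - r)" using y by (simp flip: powr_add)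
        also have "\<dots> \<le> \<bar>hilb I a2 n\<bar> powr r * (t / 2) powr (2 - r)"
          using y 1 t assms by (intro mult_mono powr_mono2 powr_mono2') (auto simp: y_def)
        finally have "\<bar>hilb I a n\<bar>\<^sup>2 \<le> 4 * (t / 2) powr (2 - r) * \<bar>hilb I a2 n\<bar> powr r"
          by (simp add: y_def power_divide mult_ac)
        moreover have "4 * \<bar>hilb I a1 n\<bar> powr 2 \<ge> 0" by simp
        ultimately show ?thesis by linarith
      qed
      have "(\<Sum>n\<in>{n\<in>I. \<bar>hilb I a n\<bar> > t}. \<bar>hilb I a n\<bar>\<^sup>2)
          \<le> (\<Sum>n\<in>{n\<in>I. \<bar>hilb I a n\<bar> > t}. 4 * \<bar>hilb I a1 n\<bar> powr 2 + 4 * (t / 2) powr (2 - r) * \<bar>hilb I a2 n\<bar> powr r)"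
        by (intro sum_mono pt) auto
      also have "\<dots> \<le> (\<Sum>n\<in>I. 4 * \<bar>hilb I a1 n\<bar> powr 2 + 4 * (t / 2) powr (2 - r) * \<bar>hilb I a2 n\<bar> powr r)"
        using I by (intro sum_mono2) auto
      also have "\<dots> = 4 * (\<Sum>n\<in>I. \<bar>hilb I a1 n\<bar> powr 2) + 4 * (t / 2) powr (2 - r) * (\<Sum>n\<in>I. \<bar>hilb I a2 n\<bar> powr r)"
        by (simp only: sum.distrib sum_distrib_left)
      also have "\<dots> \<le> 4 * (C2 * (\<Sum>k\<in>I. \<bar>a1 k\<bar> powr 2)) + 4 * (t / 2) powr (2 - r) * (Cr * (\<Sum>k\<in>I. \<bar>a2 k\<bar> powr r))"
        by (intro add_mono mult_left_mono H2 Hr I) auto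
      also have "4 * (t / 2) powr (2 - r) * (Cr * (\<Sum>k\<in>I. \<bar>a2 k\<bar> powr r)) = K * t powr (2 - r) * (\<Sum>k\<in>I. \<bar>a2 k\<bar> powr r)"
        using t by (simp add: K_def powr_divide powr_diff)
      also have "4 * (C2 * (\<Sum>k\<in>I. \<bar>a1 k\<bar> powr 2)) + K * t powr (2 - r) * (\<Sum>k\<in>I. \<bar>a2 k\<bar> powr r)
         = (\<Sum>k\<in>I. 4 * C2 * (a1 k)\<^sup>2 + K * t powr (2 - r) * \<bar>a2 k\<bar> powr r)"
        by (simp add: sum.distrib sum_distrib_left mult.assoc)
      finally have "ennreal (\<Sum>n\<in>{n\<in>I. \<bar>hilb I a n\<bar> > t}. \<bar>hilb I a n\<bar>\<^sup>2)
          \<le> ennreal (\<Sum>k\<in>I. 4 * C2 * (a1 k)\<^sup>2 + K * t powr (2 - r) * \<bar>a2 k\<bar> powr r)"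
        by (rule ennreal_leI)
      also have "\<dots> = (\<Sum>k\<in>I. ennreal (4 * C2 * (a1 k)\<^sup>2 + K * t powr (2 - r) * \<bar>a2 k\<bar> powr r))"
        using C2 K by (intro sum_ennreal[symmetric]) auto
      also have "\<dots> = \<Phi> t"
        unfolding \<Phi>_def
      proof (intro sum.cong refl)
        fix k
        show "ennreal (4 * C2 * (a1 k)\<^sup>2 + K * t powr (2 - r) * \<bar>a2 k\<bar> powr r) =
          ennreal (4 * C2 * (a k)\<^sup>2) * indicator {..<\<bar>a k\<bar>} t +
          ennreal (K * \<bar>a k\<bar> powr r) * (ennreal (t powr (2 - r)) * indicator {\<bar>a k\<bar>..} t)"
          using K by (auto simp: a1_def a2_def mult_ac simp flip: ennreal_mult)
      qed
      finally show "ennreal (\<Sum>n\<in>{n\<in>I. \<bar>hilb I a n\<bar> > t}. \<bar>hilb I a n\<bar>\<^sup>2) \<le> \<Phi> t" .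
    qed simp
    also have "\<dots> \<le> (\<integral>\<^sup>+u. (\<Sum>k\<in>I. ennreal (4 * C2 * (a k)\<^sup>2) * indicator {0<..<\<bar>a k\<bar> powr s} u +
        ennreal (K * \<bar>a k\<bar> powr r) * (ennreal (u powr (- \<beta>)) * indicator {\<bar>a k\<bar> powr s..} u)) \<partial>lborel)"
    proof (rule nn_integral_mono)
      fix u :: real
      show "\<Phi> (u powr (1 / s)) * indicator {0<..} u \<le> (\<Sum>k\<in>I. ennreal (4 * C2 * (a k)\<^sup>2) * indicator {0<..<\<bar>a k\<bar> powr s} u +
        ennreal (K * \<bar>a k\<bar> powr r) * (ennreal (u powr (- \<beta>)) * indicator {\<bar>a k\<bar> powr s..} u))"
      proof (cases "u > 0")
        case True
        have e: "(u powr (1 / s)) powr (2 - r) = u powr (- \<beta>)"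
          by (simp add: powr_powr \<beta>_def) (simp add: diff_divide_distrib)
        have iff: "u powr (1 / s) < y \<longleftrightarrow> u < y powr s" if "y \<ge> 0" for y
        proof
          assume "u powr (1 / s) < y"
          then have "(u powr (1 / s)) powr s < y powr s" using s by (intro powr_less_mono2) auto
          then show "u < y powr s" using True s by (simp add: powr_powr)
        next
          assume "u < y powr s"
          then have "u powr (1 / s) < (y powr s) powr (1 / s)" using True s by (intro powr_less_mono2) auto
          then show "u powr (1 / s) < y" using that s by (simp add: powr_powr)
        qed
        show ?thesis unfolding \<Phi>_def e using True iff[of "\<bar>a k\<bar>" for k]
          by (auto intro!: sum_mono simp: indicator_def not_less[symmetric])
      qed simp
    qed
    also have "\<dots> = (\<Sum>k\<in>I. ennreal (4 * C2 * (a k)\<^sup>2) * ennreal (\<bar>a k\<bar> powr s) +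
        ennreal (K * \<bar>a k\<bar> powr r) * (\<integral>\<^sup>+u. ennreal (u powr (- \<beta>)) * indicator {\<bar>a k\<bar> powr s..} u \<partial>lborel))"
      by (subst nn_integral_sum, simp, intro sum.cong refl, subst nn_integral_add)
        (auto simp: nn_integral_cmult nn_integral_cmult_indicator)
    also have "\<dots> = (\<Sum>k\<in>I. ennreal (C * \<bar>a k\<bar> powr p))"
    proof (intro sum.cong refl)
      fix k
      show "ennreal (4 * C2 * (a k)\<^sup>2) * ennreal (\<bar>a k\<bar> powr s) +
        ennreal (K * \<bar>a k\<bar> powr r) * (\<integral>\<^sup>+u. ennreal (u powr (- \<beta>)) * indicator {\<bar>a k\<bar> powr s..} u \<partial>lborel) = ennreal (C * \<bar>a k\<bar> powr p)"
      proof (cases "a k = 0")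
        case False
        then have "(\<integral>\<^sup>+u. ennreal (u powr (- \<beta>)) * indicator {\<bar>a k\<bar> powr s..} u \<partial>lborel)
            = ennreal ((\<bar>a k\<bar> powr s) powr (1 - \<beta>) / (\<beta> - 1))"
          using \<beta> by (intro nn_integral_powr_tail) auto
        also have "(\<bar>a k\<bar> powr s) powr (1 - \<beta>) = \<bar>a k\<bar> powr (p - r)"
        proof -
          have "s * (1 - \<beta>) = p - r" using s by (simp add: \<beta>_def field_simps)
          then show ?thesis by (simp add: powr_powr)
        qed
        finally have 1: "(\<integral>\<^sup>+u. ennreal (u powr (- \<beta>)) * indicator {\<bar>a k\<bar> powr s..} u \<partial>lborel)
            = ennreal (\<bar>a k\<bar> powr (p - r) / (\<beta> - 1))" .
        have 2: "\<bar>a k\<bar> powr r * \<bar>a k\<bar> powr (p - r) = \<bar>a k\<bar> powr p"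
          by (simp flip: powr_add)
        have 3: "(a k)\<^sup>2 * \<bar>a k\<bar> powr s = \<bar>a k\<bar> powr p"
          using False by (simp add: s powr_add)
        have "ennreal (4 * C2 * (a k)\<^sup>2) * ennreal (\<bar>a k\<bar> powr s) + ennreal (K * \<bar>a k\<bar> powr r) * ennreal (\<bar>a k\<bar> powr (p - r) / (\<beta> - 1))
          = ennreal (4 * C2 * ((a k)\<^sup>2 * \<bar>a k\<bar> powr s) + K * (\<bar>a k\<bar> powr r * \<bar>a k\<bar> powr (p - r)) / (\<beta> - 1))"
          using C2 K \<beta> by (simp add: mult.assoc flip: ennreal_mult ennreal_plus)
        then show ?thesis unfolding 1 2 3 by (simp add: C_def algebra_simps)
      qed simp
    qed
    also have "\<dots> = ennreal (C * (\<Sum>k\<in>I. \<bar>a k\<bar> powr p))"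
      using C2 K \<beta> by (subst sum_ennreal) (auto simp: C_def sum_distrib_left)
    finally show ?thesis
      using C2 K \<beta> unfolding s(2)[symmetric] by (subst (asm) ennreal_le_iff) (auto simp: C_def intro!: sum_nonneg mult_nonneg_nonneg)
  qed
  moreover have "C \<ge> 0" using C2 K \<beta> by (simp add: C_def)
  ultimately show ?thesis unfolding hilb_bounded_def by blast
qed

text \<open>Doubling from 2 reaches all powers of two, and interpolation between 2 and a
  sufficiently large power reaches the rest.\<close>

theorem hilb_bounded:
  assumes "p \<ge> 2"
  shows "hilb_bounded p"
proof (cases "p = 2")
  case False
  obtain m where "p < 2 ^ m" using real_arch_pow[of 2 p] by auto
  moreover have "(2::real) ^ m > 0" by simp
  ultimately have "p < 2 ^ Suc m" unfolding power_Suc by linarith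
  then show ?thesis using hilb_bounded_interpolate[OF hilb_bounded_pow2[of m]] False assms by simp
qed (simp add: hilb_bounded_2)

subsection \<open>Kernels of intervals\<close>

text \<open>The inverse Fourier transform of the indicator of an interval, a modulated sinc.\<close>

definition interval_kernel :: "real \<Rightarrow> real \<Rightarrow> real \<Rightarrow> complex" where
  "interval_kernel c b x = (LINT \<xi>|lborel. indicator {c..b} \<xi> *\<^sub>R cis (2 * pi * x * \<xi>))"

lemma integrable_interval_cis: "integrable lborel (\<lambda>\<xi>. indicator {c..b} \<xi> *\<^sub>R cis (y * \<xi>))"
  by (intro borel_integrable_compact continuous_intros) auto

lemma norm_interval_kernel_le:
  assumes "c \<le> b"
  shows "norm (interval_kernel c b x) \<le> b - c"
proof -
  have "norm (interval_kernel c b x) \<le> (LINT \<xi>|lborel. norm (indicator {c..b} \<xi> *\<^sub>R cis (2 * pi * x * \<xi>)))"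
    unfolding interval_kernel_def by (rule integral_norm_bound)
  also have "\<dots> = (LINT \<xi>|lborel. indicator {c..b} \<xi>)"
    by (intro Bochner_Integration.integral_cong) auto
  also have "\<dots> = b - c" using assms by simp
  finally show ?thesis .
qed

lemma interval_kernel_eq:
  assumes "c \<le> b" "x \<noteq> 0"
  shows "interval_kernel c b x = (cis (2 * pi * x * b) - cis (2 * pi * x * c)) / (2 * pi * \<i> * x)"
proof -
  let ?w = "\<i> * complex_of_real (2 * pi * x)"
  have "((\<lambda>t. cis (2 * pi * x * t)) has_integral (cis (2 * pi * x * b) / ?w - cis (2 * pi * x * c) / ?w)) {c..b}"
  proof (rule fundamental_theorem_of_calculus[OF assms(1)])
    show "((\<lambda>t. cis (2 * pi * x * t) / ?w) has_vector_derivative cis (2 * pi * x * t)) (at t within {c..b})" for t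
      using has_vector_derivative_mult_left[OF has_vector_derivative_cis_mult[of "2 * pi * x" t "{c..b}"], of "1 / ?w"] assms
      by simp
  qed
  moreover have "(LINT \<xi>:{c..b}|lborel. cis (2 * pi * x * \<xi>)) = integral {c..b} (\<lambda>\<xi>. cis (2 * pi * x * \<xi>))"
    using integrable_interval_cis[of c b "2 * pi * x"]
    by (intro set_borel_integral_eq_integral) (simp add: set_integrable_def)
  ultimately show ?thesis
    by (simp add: interval_kernel_def set_lebesgue_integral_def integral_unique diff_divide_distrib mult_ac)
qed

definition chilb :: "int set \<Rightarrow> (int \<Rightarrow> complex) \<Rightarrow> int \<Rightarrow> complex" where
  "chilb I a n = (\<Sum>k\<in>I - {n}. a k / of_int (n - k))"

lemma norm_powr_le_Re_Im:
  assumes "p \<ge> 1"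
  shows "norm z powr p \<le> 2 powr p * (\<bar>Re z\<bar> powr p + \<bar>Im z\<bar> powr p)"
proof -
  have "norm z powr p \<le> (\<bar>Re z\<bar> + \<bar>Im z\<bar>) powr p"
    using assms by (intro powr_mono2 cmod_le) auto
  also have "\<dots> \<le> 2 powr p * (\<bar>Re z\<bar> powr p + \<bar>Im z\<bar> powr p)"
    by (intro powr_add_le assms) auto
  finally show ?thesis .
qed

text \<open>The kernel is real, so real and imaginary parts are transformed separately.\<close>

lemma chilb_bound:
  assumes "p \<ge> 2"
  obtains C where "C \<ge> 0"
    "\<And>I a. finite I \<Longrightarrow> (\<Sum>n\<in>I. norm (chilb I a n) powr p) \<le> C * (\<Sum>k\<in>I. norm (a k) powr p)"
proof -
  obtain C where C: "C \<ge> 0"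
    and H: "\<And>I a. finite I \<Longrightarrow> (\<Sum>n\<in>I. \<bar>hilb I a n\<bar> powr p) \<le> C * (\<Sum>k\<in>I. \<bar>a k\<bar> powr p)"
    using hilb_bounded[OF assms] unfolding hilb_bounded_def by blast
  have Re: "Re (chilb I a n) = hilb I (\<lambda>k. Re (a k)) n" and Im: "Im (chilb I a n) = hilb I (\<lambda>k. Im (a k)) n" for I a n
  proof -
    have "Re (z / of_int m) = Re z / of_int m" "Im (z / of_int m) = Im z / of_int m" for z m
      by (metis Re_divide_of_real of_real_of_int_eq) (metis Im_divide_of_real of_real_of_int_eq)
    then show "Re (chilb I a n) = hilb I (\<lambda>k. Re (a k)) n" "Im (chilb I a n) = hilb I (\<lambda>k. Im (a k)) n"
      unfolding chilb_def hilb_def by (simp_all only: Re_sum Im_sum)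
  qed
  have "(\<Sum>n\<in>I. norm (chilb I a n) powr p) \<le> (2 powr p * (2 * C)) * (\<Sum>k\<in>I. norm (a k) powr p)" if "finite I" for I a
  proof -
    have "(\<Sum>n\<in>I. norm (chilb I a n) powr p) \<le> (\<Sum>n\<in>I. 2 powr p * (\<bar>Re (chilb I a n)\<bar> powr p + \<bar>Im (chilb I a n)\<bar> powr p))"
      using assms by (intro sum_mono norm_powr_le_Re_Im) auto
    also have "\<dots> = 2 powr p * ((\<Sum>n\<in>I. \<bar>hilb I (\<lambda>k. Re (a k)) n\<bar> powr p) + (\<Sum>n\<in>I. \<bar>hilb I (\<lambda>k. Im (a k)) n\<bar> powr p))"
      by (simp add: Re Im sum_distrib_left sum.distrib distrib_left)
    also have "\<dots> \<le> 2 powr p * (C * (\<Sum>k\<in>I. \<bar>Re (a k)\<bar> powr p) + C * (\<Sum>k\<in>I. \<bar>Im (a k)\<bar> powr p))"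
      by (intro mult_left_mono add_mono H that) auto
    also have "\<dots> \<le> 2 powr p * (C * (\<Sum>k\<in>I. norm (a k) powr p) + C * (\<Sum>k\<in>I. norm (a k) powr p))"
      using assms C by (intro mult_left_mono add_mono sum_mono powr_mono2 abs_Re_le_cmod abs_Im_le_cmod) auto
    finally show ?thesis by (simp add: algebra_simps)
  qed
  then show thesis using C by (intro that[of "2 powr p * (2 * C)"]) auto
qed

text \<open>Away from the diagonal the sinc kernel is a difference of two modulated kernels
  1/(n-k+s). Replacing the denominator by n - k costs O((n-k)^(-2)), which the Schur test absorbs.
  The modulations have modulus one, so neither the position of the interval nor \<open>s\<close>
  enters the constant, only a bound on the length.\<close>

lemma interval_kernel_bound:
  assumes "p \<ge> 2" "L \<ge> 0"
  obtains C where "C \<ge> 0"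
    "\<And>c b s I a. c \<le> b \<Longrightarrow> b - c \<le> L \<Longrightarrow> \<bar>s\<bar> \<le> 1/2 \<Longrightarrow> finite I \<Longrightarrow>
      (\<Sum>n\<in>I. norm (\<Sum>k\<in>I. interval_kernel c b (real_of_int (n - k) + s) * a k) powr p)
        \<le> C * (\<Sum>k\<in>I. norm (a k) powr p)"
proof -
  obtain C where C: "C \<ge> 0"
    and H: "\<And>I a. finite I \<Longrightarrow> (\<Sum>n\<in>I. norm (chilb I a n) powr p) \<le> C * (\<Sum>k\<in>I. norm (a k) powr p)"
    by (rule chilb_bound[OF assms(1)]) (rule that)
  define C' where "C' = 3 powr p * (2 * C + (4 + L) powr p)"
  have "(\<Sum>n\<in>I. norm (\<Sum>k\<in>I. interval_kernel c b (real_of_int (n - k) + s) * a k) powr p)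
        \<le> C' * (\<Sum>k\<in>I. norm (a k) powr p)"
    if cb: "c \<le> b" "b - c \<le> L" and s: "\<bar>s\<bar> \<le> 1/2" and I: "finite I" for c b s I a
  proof -
    define A where "A = (\<Sum>k\<in>I. norm (a k) powr p)"
    define E where "E y n = cis (2 * pi * y * (real_of_int n + s)) / (2 * pi * \<i>)" for y n
    define u where "u y k = cis (- 2 * pi * y * real_of_int k) * a k" for y k
    \<comment> \<open>Majorant of the error kernel: the inverse square off the diagonal, and on it
      the trivial bound by the length of the interval. Its row and column sums are at most 4 +
      L.\<close>
    define w where "w n k = inv_sq (n - k) + L * of_bool (n = k)" for n k
    have E1: "norm (E y n) \<le> 1" for y n
      using pi_ge_two by (simp add: E_def norm_divide norm_mult divide_le_eq)
    have R: "norm (interval_kernel c b (real_of_int (n - k) + s) * a k -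
        (if k = n then 0 else E b n * (u b k / of_int (n - k)) - E c n * (u c k / of_int (n - k)))) \<le> w n k * norm (a k)" for n k
    proof (cases "k = n")
      case True
      have "norm (interval_kernel c b s) \<le> L" using norm_interval_kernel_le[OF cb(1)] cb(2) by (rule order_trans)
      then show ?thesis using True by (simp add: w_def inv_sq_def norm_mult mult_right_mono)
    next
      case False
      define m where "m = real_of_int (n - k)"
      have m: "\<bar>m\<bar> \<ge> 1" using False unfolding m_def by linarith
      define x where "x = m + s"
      \<comment> \<open>Here |s| \<le> 1/2 \<le> |m|/2 is essential: the shifted denominator stays
        comparable to the integer one.\<close>
      have x: "\<bar>x\<bar> \<ge> \<bar>m\<bar> / 2" using m s unfolding x_def by linarith
      then have x0: "x \<noteq> 0" and m0: "m \<noteq> 0" using m by auto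
      define z where "z = (cis (2 * pi * x * b) - cis (2 * pi * x * c)) / (2 * pi * \<i>)"
      \<comment> \<open>With x = n - k + s the modulation factors into a phase depending on n and a
        phase depending on k. The latter is moved into the input sequence
        \<open>u y\<close>.\<close>
      have Eu: "E y n * (u y k / of_int (n - k)) = cis (2 * pi * x * y) / (2 * pi * \<i>) * (a k / m)" for y
        unfolding E_def u_def x_def m_def by (simp add: cis_mult algebra_simps)
      have "interval_kernel c b (real_of_int (n - k) + s) * a k -
        (if k = n then 0 else E b n * (u b k / of_int (n - k)) - E c n * (u c k / of_int (n - k)))
        = z / x * a k - z * (a k / m)"
        unfolding Eu using False x0 cb(1) interval_kernel_eq[of c b x]
        by (simp add: x_def m_def z_def diff_divide_distrib left_diff_distrib)
      also have "\<dots> = z * a k * complex_of_real (1 / x - 1 / m)"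
        by (simp add: algebra_simps)
      finally have "norm (interval_kernel c b (real_of_int (n - k) + s) * a k -
        (if k = n then 0 else E b n * (u b k / of_int (n - k)) - E c n * (u c k / of_int (n - k))))
        = norm z * norm (a k) * \<bar>1 / x - 1 / m\<bar>"
        by (simp only: norm_mult norm_of_real)
      also have "\<dots> \<le> 1 * norm (a k) * inv_sq (n - k)"
      proof (intro mult_mono)
        have "norm (cis (2 * pi * x * b) - cis (2 * pi * x * c)) \<le> 2"
          by (rule order_trans[OF norm_triangle_ineq4]) simp
        then show "norm z \<le> 1" using pi_ge_two by (simp add: z_def norm_divide norm_mult divide_le_eq)
        have "\<bar>1 / x - 1 / m\<bar> = \<bar>s\<bar> / (\<bar>x\<bar> * \<bar>m\<bar>)"
        proof -
          have "1 / x - 1 / m = - s / (x * m)" using x0 m0 by (simp add: x_def divide_simps)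
          then show ?thesis by (simp add: abs_mult)
        qed
        also have "\<dots> \<le> (1/2) / ((\<bar>m\<bar> / 2) * \<bar>m\<bar>)"
          using s m x m0 by (intro frac_le mult_right_mono mult_pos_pos) auto
        also have "\<dots> = inv_sq (n - k)"
          using False by (simp add: inv_sq_def m_def power2_eq_square)
        finally show "\<bar>1 / x - 1 / m\<bar> \<le> inv_sq (n - k)" .
      qed auto
      finally show ?thesis using False by (simp add: w_def mult_ac)
    qed
    have "(\<Sum>n\<in>I. norm (\<Sum>k\<in>I. interval_kernel c b (real_of_int (n - k) + s) * a k) powr p)
      \<le> (\<Sum>n\<in>I. 3 powr p * (norm (chilb I (u b) n) powr p + norm (chilb I (u c) n) powr p + (\<Sum>k\<in>I. w n k * norm (a k)) powr p))"
    proof (rule sum_mono)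
      fix n assume n: "n \<in> I"
      have eq: "(\<Sum>k\<in>I. if k = n then 0 else E b n * (u b k / of_int (n - k)) - E c n * (u c k / of_int (n - k)))
          = E b n * chilb I (u b) n - E c n * chilb I (u c) n"
      proof -
        have "(\<Sum>k\<in>I. if k = n then 0 else E b n * (u b k / of_int (n - k)) - E c n * (u c k / of_int (n - k)))
          = (\<Sum>k\<in>I - {n}. E b n * (u b k / of_int (n - k)) - E c n * (u c k / of_int (n - k)))"
          using I by (intro sum.mono_neutral_cong_right) auto
        then show ?thesis by (simp add: chilb_def sum_subtractf sum_distrib_left)
      qed
      have "norm (\<Sum>k\<in>I. interval_kernel c b (real_of_int (n - k) + s) * a k)
        = norm ((E b n * chilb I (u b) n - E c n * chilb I (u c) n) + (\<Sum>k\<in>I. interval_kernel c b (real_of_int (n - k) + s) * a k -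
        (if k = n then 0 else E b n * (u b k / of_int (n - k)) - E c n * (u c k / of_int (n - k)))))"
        unfolding sum_subtractf eq by simp
      also have "\<dots> \<le> (norm (E b n * chilb I (u b) n) + norm (E c n * chilb I (u c) n)) + (\<Sum>k\<in>I. w n k * norm (a k))"
        by (intro norm_triangle_mono norm_triangle_ineq4 sum_norm_le R)
      also have "\<dots> \<le> norm (chilb I (u b) n) + norm (chilb I (u c) n) + (\<Sum>k\<in>I. w n k * norm (a k))"
        using E1 by (intro add_right_mono add_mono) (auto simp: norm_mult intro!: mult_left_le_one_le)
      finally have "norm (\<Sum>k\<in>I. interval_kernel c b (real_of_int (n - k) + s) * a k) powr p
        \<le> (norm (chilb I (u b) n) + norm (chilb I (u c) n) + (\<Sum>k\<in>I. w n k * norm (a k))) powr p"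
        using assms by (intro powr_mono2) auto
      also have "\<dots> \<le> 3 powr p * (norm (chilb I (u b) n) powr p + norm (chilb I (u c) n) powr p + (\<Sum>k\<in>I. w n k * norm (a k)) powr p)"
        using assms by (intro powr_add3_le sum_nonneg) (auto simp: w_def inv_sq_nonneg)
      finally show "norm (\<Sum>k\<in>I. interval_kernel c b (real_of_int (n - k) + s) * a k) powr p \<le> \<dots>" .
    qed
    also have "\<dots> = 3 powr p * ((\<Sum>n\<in>I. norm (chilb I (u b) n) powr p) + (\<Sum>n\<in>I. norm (chilb I (u c) n) powr p)
        + (\<Sum>n\<in>I. (\<Sum>k\<in>I. w n k * norm (a k)) powr p))"
      by (simp only: sum_distrib_left[symmetric] sum.distrib)
    also have "\<dots> \<le> 3 powr p * (C * (\<Sum>k\<in>I. norm (u b k) powr p) + C * (\<Sum>k\<in>I. norm (u c k) powr p) + (4 + L) powr p * A)"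
      unfolding A_def
    proof (intro mult_left_mono add_mono H I Schur_test)
      show "(\<Sum>k\<in>I. w n k) \<le> 4 + L" if "n \<in> I" for n
        using sum_inv_sq_diff_le(1)[OF I, of n] I that by (simp add: w_def sum.distrib flip: sum_distrib_left)
      show "(\<Sum>n\<in>I. w n k) \<le> 4 + L" if "k \<in> I" for k
        using sum_inv_sq_diff_le(2)[OF I, of k] I that by (simp add: w_def sum.distrib flip: sum_distrib_left)
    qed (use assms in \<open>auto simp: w_def inv_sq_nonneg\<close>)
    also have "\<dots> = C' * A"
      by (simp add: u_def norm_mult A_def C'_def algebra_simps)
    finally show ?thesis by (simp add: A_def)
  qed
  then show thesis using C by (intro that[of C']) (auto simp: C'_def)
qed

subsection \<open>Tensor products of matrices\<close>

definition grid :: "'a set \<Rightarrow> ('a^'n) set" where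
  "grid D = {v. \<forall>i. v $ i \<in> D}"

definition vupd :: "'a^'n \<Rightarrow> 'n \<Rightarrow> 'a \<Rightarrow> 'a^'n" where
  "vupd v i t = (\<chi> j. if j = i then t else v $ j)"

lemma vupd_nth [simp]: "vupd v i t $ j = (if j = i then t else v $ j)"
  by (simp add: vupd_def)

lemma vupd_vupd [simp]: "vupd (vupd v i t) i u = vupd v i u"
  by (simp add: vec_eq_iff)

lemma vupd_same [simp]: "vupd v i (v $ i) = v"
  by (simp add: vec_eq_iff)

lemma vupd_in_grid: "v \<in> grid D \<Longrightarrow> t \<in> D \<Longrightarrow> vupd v i t \<in> grid D"
  by (simp add: grid_def)

lemma finite_grid:
  assumes "finite D"
  shows "finite (grid D :: ('a^'n) set)"
proof (rule finite_subset)
  show "(grid D :: ('a^'n) set) \<subseteq> vec_lambda ` (UNIV \<rightarrow>\<^sub>E D)"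
  proof
    fix v :: "'a^'n" assume "v \<in> grid D"
    then have "vec_nth v \<in> UNIV \<rightarrow>\<^sub>E D" by (auto simp: grid_def)
    then show "v \<in> vec_lambda ` (UNIV \<rightarrow>\<^sub>E D)" by (intro image_eqI[of _ _ "vec_nth v"]) auto
  qed
  show "finite (vec_lambda ` ((UNIV::'n set) \<rightarrow>\<^sub>E D))"
    by (intro finite_imageI finite_PiE assms) auto
qed

text \<open>Averaging over one coordinate without splitting the grid as a product: each line in
  direction \<open>i\<close> is run through once for each of its points, hence \<open>card D\<close>
  times.\<close>

lemma sum_grid_vupd:
  fixes f :: "'a^'n \<Rightarrow> real"
  shows "(\<Sum>n\<in>grid D. \<Sum>t\<in>D. f (vupd n i t)) = real (card D) * (\<Sum>n\<in>grid D. f n)"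
proof -
  have "(\<Sum>n\<in>grid D. \<Sum>t\<in>D. f (vupd n i t)) = (\<Sum>(n, t)\<in>grid D \<times> D. f (vupd n i t))"
    by (simp add: sum.cartesian_product)
  also have "\<dots> = (\<Sum>(n, t)\<in>grid D \<times> D. f n)"
    by (rule sum.reindex_bij_witness[of _ "\<lambda>(n, t). (vupd n i t, n $ i)" "\<lambda>(n, t). (vupd n i t, n $ i)"])
      (auto simp: vupd_in_grid, auto simp: grid_def)
  also have "\<dots> = real (card D) * (\<Sum>n\<in>grid D. f n)"
    by (simp add: sum_distrib_left flip: sum.cartesian_product)
  finally show ?thesis .
qed

text \<open>The one-dimensional operators are switched on one coordinate at a time. Each step
  applies the hypothesis along the lines parallel to an axis and multiplies the constant by
  \<open>C\<close>.\<close>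

lemma tensor_bound:
  fixes K :: "'n::finite \<Rightarrow> 'a \<Rightarrow> 'a \<Rightarrow> complex"
  assumes D: "finite D" and C: "C \<ge> 0" and "p \<ge> 1"
    and K: "\<And>i a. (\<Sum>n\<in>D. norm (\<Sum>k\<in>D. K i n k * a k) powr p) \<le> C * (\<Sum>k\<in>D. norm (a k) powr p)"
  shows "(\<Sum>n\<in>grid D. norm (\<Sum>k\<in>grid D. (\<Prod>i\<in>UNIV. K i (n $ i) (k $ i)) * a k) powr p)
    \<le> C ^ CARD('n) * (\<Sum>k\<in>grid D. norm (a k) powr p)"
proof -
  \<comment> \<open>The partial tensor product: the kernels act in the coordinates of
    \<open>J\<close>, the identity in the others.\<close>
  define T where "T J n = (\<Sum>k\<in>grid D. (\<Prod>i\<in>J. K i (n $ i) (k $ i)) * (\<Prod>i\<in>-J. of_bool (n $ i = k $ i)) * a k)"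
    for J and n :: "'a^'n"
  have "(\<Sum>n\<in>grid D. norm (T J n) powr p) \<le> C ^ card J * (\<Sum>k\<in>grid D. norm (a k) powr p)" for J :: "'n set"
  proof (induction J rule: finite_induct[OF finite])
    case 1
    have "T {} n = a n" if "n \<in> grid D" for n
    proof -
      have "(\<Prod>i\<in>UNIV. of_bool (n $ i = k $ i)) = (of_bool (n = k) :: complex)" for k
        by (auto simp: vec_eq_iff)
      then show ?thesis using that D by (simp add: T_def finite_grid)
    qed
    then show ?case by simp
  next
    case (2 i J)
    show ?case
    proof (cases "D = {}")
      case True
      then show ?thesis by (simp add: grid_def)
    next
      case False
      then have cD: "real (card D) > 0" using D by (simp add: card_gt_0_iff)
      have T: "T (insert i J) (vupd n i u) = (\<Sum>t\<in>D. K i u t * T J (vupd n i t))" for n u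
      proof -
        have "(\<Sum>t\<in>D. K i u t * T J (vupd n i t))
          = (\<Sum>t\<in>D. \<Sum>k\<in>grid D. if t = k $ i then K i u t * (\<Prod>j\<in>J. K j (n $ j) (k $ j)) * (\<Prod>j\<in>-insert i J. of_bool (n $ j = k $ j)) * a k else 0)"
          unfolding T_def sum_distrib_left
        proof (intro sum.cong refl)
          fix t k
          have "(\<Prod>j\<in>-J. of_bool (vupd n i t $ j = k $ j)) = (of_bool (t = k $ i) :: complex) * (\<Prod>j\<in>-insert i J. of_bool (n $ j = k $ j))"
          proof -
            have "- J = insert i (- insert i J)" using 2 by auto
            then show ?thesis by (simp only: prod.insert[OF finite, of i "- insert i J"]) auto
          qed
          moreover have "(\<Prod>j\<in>J. K j (vupd n i t $ j) (k $ j)) = (\<Prod>j\<in>J. K j (n $ j) (k $ j))"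
            using 2 by (intro prod.cong) auto
          ultimately show "K i u t * ((\<Prod>j\<in>J. K j (vupd n i t $ j) (k $ j)) * (\<Prod>j\<in>-J. of_bool (vupd n i t $ j = k $ j)) * a k)
            = (if t = k $ i then K i u t * (\<Prod>j\<in>J. K j (n $ j) (k $ j)) * (\<Prod>j\<in>-insert i J. of_bool (n $ j = k $ j)) * a k else 0)"
            by simp
        qed
        also have "\<dots> = (\<Sum>k\<in>grid D. K i u (k $ i) * (\<Prod>j\<in>J. K j (n $ j) (k $ j)) * (\<Prod>j\<in>-insert i J. of_bool (n $ j = k $ j)) * a k)"
          by (subst sum.swap, intro sum.cong refl) (use D in \<open>auto simp: grid_def\<close>)
        also have "\<dots> = T (insert i J) (vupd n i u)"
          unfolding T_def
        proof (intro sum.cong refl)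
          fix k
          have "(\<Prod>j\<in>J. K j (vupd n i u $ j) (k $ j)) = (\<Prod>j\<in>J. K j (n $ j) (k $ j))"
            using 2 by (intro prod.cong) auto
          moreover have "(\<Prod>j\<in>-insert i J. of_bool (vupd n i u $ j = k $ j)) = (\<Prod>j\<in>-insert i J. of_bool (n $ j = k $ j) :: complex)"
            by (intro prod.cong) auto
          ultimately show "K i u (k $ i) * (\<Prod>j\<in>J. K j (n $ j) (k $ j)) * (\<Prod>j\<in>-insert i J. of_bool (n $ j = k $ j)) * a k
            = (\<Prod>j\<in>insert i J. K j (vupd n i u $ j) (k $ j)) * (\<Prod>j\<in>-insert i J. of_bool (vupd n i u $ j = k $ j)) * a k"
            using 2 by simp
        qed
        finally show ?thesis by simp
      qed
      have "real (card D) * (\<Sum>n\<in>grid D. norm (T (insert i J) n) powr p)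
        = (\<Sum>n\<in>grid D. \<Sum>u\<in>D. norm (\<Sum>t\<in>D. K i u t * T J (vupd n i t)) powr p)"
        by (simp only: sum_grid_vupd[where i = i, symmetric] T)
      also have "\<dots> \<le> (\<Sum>n\<in>grid D. C * (\<Sum>t\<in>D. norm (T J (vupd n i t)) powr p))"
        by (intro sum_mono K)
      also have "\<dots> = real (card D) * (C * (\<Sum>n\<in>grid D. norm (T J n) powr p))"
        by (simp only: sum_distrib_left[symmetric] sum_grid_vupd[where i = i and f = "\<lambda>n. norm (T J n) powr p"] mult_ac)
      also have "\<dots> \<le> real (card D) * (C * (C ^ card J * (\<Sum>k\<in>grid D. norm (a k) powr p)))"
        using C 2 by (intro mult_left_mono) auto
      finally show ?thesis using cD 2 by (simp add: mult_ac)
    qed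
  qed
  from this[of UNIV] show ?thesis by (simp add: T_def)
qed

subsection \<open>Kernels of boxes\<close>

definition wave :: "real^'n \<Rightarrow> real^'n \<Rightarrow> complex" where
  "wave x \<xi> = cis (2 * pi * (x \<bullet> \<xi>))"

lemma norm_wave [simp]: "norm (wave x \<xi>) = 1"
  by (simp add: wave_def)

lemma wave_add_left: "wave (x + y) \<xi> = wave x \<xi> * wave y \<xi>"
  by (simp add: wave_def inner_add_left cis_mult distrib_left)

lemma wave_add_right: "wave x (\<xi> + \<eta>) = wave x \<xi> * wave x \<eta>"
  by (simp add: wave_def inner_add_right cis_mult distrib_left)

lemma wave_minus_left: "wave (- x) \<xi> = cnj (wave x \<xi>)"
  by (simp add: wave_def cis_cnj)

lemma wave_minus_right: "wave x (- \<xi>) = cnj (wave x \<xi>)"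
  by (simp add: wave_def cis_cnj)

lemma wave_0 [simp]: "wave 0 \<xi> = 1" "wave x 0 = 1"
  by (simp_all add: wave_def)

lemma continuous_on_wave [continuous_intros]:
  assumes "continuous_on S f" "continuous_on S g"
  shows "continuous_on S (\<lambda>z. wave (f z) (g z))"
  unfolding wave_def using assms by (intro continuous_intros)

lemma wave_measurable [measurable (raw)]:
  assumes [measurable]: "f \<in> borel_measurable M" "g \<in> borel_measurable M"
  shows "(\<lambda>z. wave (f z) (g z)) \<in> borel_measurable M"
proof -
  have [measurable]: "cis \<in> borel_measurable borel"
    by (intro borel_measurable_continuous_onI continuous_on_cis continuous_on_id)
  show ?thesis unfolding wave_def by measurable
qed

lemma wave_eq_prod:
  fixes x \<xi> :: "real^'n"
  shows "wave x \<xi> = (\<Prod>i\<in>UNIV. cis (2 * pi * (x $ i) * (\<xi> $ i)))"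
proof -
  have "cis (\<Sum>i\<in>A. f i) = (\<Prod>i\<in>A. cis (f i))" if "finite A" for A :: "'n set" and f
    using that by induction (auto simp flip: cis_mult)
  then show ?thesis by (simp add: wave_def inner_vec_def sum_distrib_left mult.assoc)
qed

text \<open>Lebesgue measure on \<open>real^'n\<close> arises from a product over
  \<open>Basis\<close>; the inverse \<open>idx\<close> of the map to axis vectors relabels that
  product by coordinates.\<close>

lemma integral_prod_coordinates:
  fixes f :: "'n::finite \<Rightarrow> real \<Rightarrow> complex"
  assumes "\<And>i. integrable lborel (f i)"
  shows "(LINT x|lborel. (\<Prod>i\<in>UNIV. f i (x $ i))) = (\<Prod>i\<in>UNIV. LINT t|lborel. f i t)"
proof -
  interpret product_sigma_finite "\<lambda>b. lborel :: real measure" ..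
  have [measurable]: "f i \<in> borel_measurable borel" for i
    using assms[of i] by (simp add: borel_measurable_integrable[simplified])
  define idx where "idx = (the_inv (\<lambda>i::'n. axis i (1::real)))"
  have inj: "inj (\<lambda>i::'n. axis i (1::real))" by (simp add: inj_on_def axis_eq_axis)
  have idx: "idx (axis i 1) = i" for i unfolding idx_def by (rule the_inv_f_f[OF inj])
  have B: "(Basis :: (real^'n) set) = range (\<lambda>i. axis i 1)" by (auto simp: Basis_vec_def)
  have prodB: "(\<Prod>b\<in>(Basis::(real^'n) set). g b) = (\<Prod>i\<in>UNIV. g (axis i 1))" for g :: "real^'n \<Rightarrow> complex"
    unfolding B using inj by (subst prod.reindex) auto
  have "(LINT x|lborel. (\<Prod>i\<in>UNIV. f i (x $ i))) = (LINT g|(PiM (Basis::(real^'n) set) (\<lambda>_. lborel)).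
      (\<Prod>i\<in>UNIV. f i ((\<Sum>b\<in>Basis. g b *\<^sub>R b) $ i)))"
    by (subst lborel_eq[where 'a = "real^'n"], subst integral_distr) auto
  also have "\<dots> = (LINT g|(PiM (Basis::(real^'n) set) (\<lambda>_. lborel)). (\<Prod>b\<in>(Basis::(real^'n) set). f (idx b) (g b)))"
  proof (intro Bochner_Integration.integral_cong refl)
    fix g :: "real^'n \<Rightarrow> real"
    have "(\<Sum>b\<in>Basis. g b *\<^sub>R b) $ i = g (axis i 1)" for i :: 'n
    proof -
      have "(\<Sum>b\<in>Basis. g b *\<^sub>R b) $ i = (\<Sum>b\<in>Basis. g b *\<^sub>R b) \<bullet> axis i 1" by (simp add: cart_eq_inner_axis)
      also have "\<dots> = g (axis i 1)" by (rule inner_sum_left_Basis) (simp add: B)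
      finally show ?thesis .
    qed
    then show "(\<Prod>i\<in>UNIV. f i ((\<Sum>b\<in>Basis. g b *\<^sub>R b) $ i)) = (\<Prod>b\<in>(Basis::(real^'n) set). f (idx b) (g b))"
      by (simp add: prodB idx)
  qed
  also have "\<dots> = (\<Prod>b\<in>(Basis::(real^'n) set). LINT t|lborel. f (idx b) t)"
    using assms by (intro product_integral_prod) auto
  finally show ?thesis by (simp add: prodB idx)
qed

lemma integral_box_wave:
  "(LINT \<xi>|lborel. indicator (cbox c b) \<xi> *\<^sub>R wave x \<xi>) = (\<Prod>i\<in>UNIV. interval_kernel (c $ i) (b $ i) (x $ i))"
proof -
  have "indicator (cbox c b) \<xi> *\<^sub>R wave x \<xi> = (\<Prod>i\<in>UNIV. indicator {c $ i..b $ i} (\<xi> $ i) *\<^sub>R cis (2 * pi * x $ i * \<xi> $ i))" for \<xi>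
  proof (cases "\<xi> \<in> cbox c b")
    case False
    then obtain i where "\<xi> $ i \<notin> {c $ i..b $ i}" by (auto simp: mem_box_cart)
    then show ?thesis using False by (subst prod_zero[OF finite]) (auto intro!: exI[of _ i] simp: indicator_def)
  qed (auto simp: wave_eq_prod mem_box_cart intro!: prod.cong)
  then show ?thesis
    unfolding interval_kernel_def
    using integral_prod_coordinates[of "\<lambda>i t. indicator {c $ i..b $ i} t *\<^sub>R cis (2 * pi * x $ i * t)"]
    by (simp add: integrable_interval_cis)
qed

text \<open>Boundedness on l_p of convolution with the samples of \<kappa> on the cosets s + Z^d,
  uniformly in s. The constant refers to p-th powers of norms, and sums over finite cubes keep
  convergence out of the definition.\<close>

definition conv_bounded :: "real \<Rightarrow> real \<Rightarrow> (real^'n \<Rightarrow> complex) \<Rightarrow> bool" where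
  "conv_bounded p C \<kappa> \<longleftrightarrow> 0 \<le> C \<and> (\<forall>s D a. (\<forall>i. \<bar>s $ i\<bar> \<le> 1/2) \<longrightarrow> finite D \<longrightarrow>
     (\<Sum>n\<in>grid D. norm (\<Sum>k\<in>grid D. \<kappa> (lattice_point (n - k) + s) * a k) powr p) \<le> C * (\<Sum>k\<in>grid D. norm (a k) powr p))"

text \<open>One constant for all boxes of bounded side length, wherever they lie. The uniformity is
  needed because boxes of varying size appear under an integral later.\<close>

lemma box_kernel_bound:
  assumes "p \<ge> 2" "L \<ge> 0"
  shows "\<exists>C\<ge>0. \<forall>c b :: real^'n. (\<forall>i. b $ i - c $ i \<le> L) \<longrightarrow> conv_bounded p C (\<lambda>x. LINT \<xi>|lborel. indicator (cbox c b) \<xi> *\<^sub>R wave x \<xi>)"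
proof -
  obtain C where C: "C \<ge> 0" and H: "\<And>c b s I a. c \<le> b \<Longrightarrow> b - c \<le> L \<Longrightarrow> \<bar>s\<bar> \<le> 1/2 \<Longrightarrow> finite I \<Longrightarrow>
      (\<Sum>n\<in>I. norm (\<Sum>k\<in>I. interval_kernel c b (real_of_int (n - k) + s) * a k) powr p)
        \<le> C * (\<Sum>k\<in>I. norm (a k) powr p)"
    by (rule interval_kernel_bound[OF assms]) (rule that)
  have "conv_bounded p (C ^ CARD('n)) (\<lambda>x. LINT \<xi>|lborel. indicator (cbox c b) \<xi> *\<^sub>R wave x \<xi>)"
    if L: "\<And>i. b $ i - c $ i \<le> L" for c b :: "real^'n"
  proof (cases "\<forall>i. c $ i \<le> b $ i")
    case False
    then have "cbox c b = {}" by (auto simp: interval_eq_empty_cart not_le)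
    then show ?thesis using C by (auto simp: conv_bounded_def intro!: mult_nonneg_nonneg sum_nonneg)
  next
    case True
    show ?thesis
      unfolding conv_bounded_def integral_box_wave
    proof (intro conjI allI impI)
      fix s :: "real^'n" and D :: "int set" and a
      assume s: "\<forall>i. \<bar>s $ i\<bar> \<le> 1/2" and D: "finite D"
      have "(\<Sum>n\<in>grid D. norm (\<Sum>k\<in>grid D. (\<Prod>i\<in>UNIV. (\<lambda>i m j. interval_kernel (c $ i) (b $ i) (real_of_int (m - j) + s $ i)) i (n $ i) (k $ i)) * a k) powr p)
        \<le> C ^ CARD('n) * (\<Sum>k\<in>grid D. norm (a k) powr p)"
        using s True L assms by (intro tensor_bound D C H) auto
      then show "(\<Sum>n\<in>grid D. norm (\<Sum>k\<in>grid D. (\<Prod>i\<in>UNIV. interval_kernel (c $ i) (b $ i) ((lattice_point (n - k) + s) $ i)) * a k) powr p)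
        \<le> C ^ CARD('n) * (\<Sum>k\<in>grid D. norm (a k) powr p)"
        by (simp add: lattice_point_def)
    qed (use C in auto)
  qed
  then show ?thesis using C by (intro exI[of _ "C ^ CARD('n)"]) auto
qed

section \<open>Sums, multiples and averages of bounded kernels\<close>

lemma conv_bounded_add:
  assumes "conv_bounded p A \<kappa>" "conv_bounded p B \<kappa>'" "p \<ge> 1"
  shows "conv_bounded p (2 powr p * (A + B)) (\<lambda>x. \<kappa> x + \<kappa>' x)"
  unfolding conv_bounded_def
proof (intro conjI allI impI)
  fix s :: "real^'a" and D :: "int set" and a :: "int^'a \<Rightarrow> complex"
  assume s: "\<forall>i. \<bar>s $ i\<bar> \<le> 1/2" and D: "finite D"
  let ?S = "\<lambda>\<kappa> n. \<Sum>k\<in>grid D. \<kappa> (lattice_point (n - k) + s) * a k"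
  have "(\<Sum>n\<in>grid D. norm (?S (\<lambda>x. \<kappa> x + \<kappa>' x) n) powr p)
    \<le> (\<Sum>n\<in>grid D. 2 powr p * (norm (?S \<kappa> n) powr p + norm (?S \<kappa>' n) powr p))"
  proof (rule sum_mono)
    fix n
    have "norm (?S (\<lambda>x. \<kappa> x + \<kappa>' x) n) \<le> norm (?S \<kappa> n) + norm (?S \<kappa>' n)"
      by (simp add: distrib_right sum.distrib norm_triangle_ineq)
    then have "norm (?S (\<lambda>x. \<kappa> x + \<kappa>' x) n) powr p \<le> (norm (?S \<kappa> n) + norm (?S \<kappa>' n)) powr p"
      using assms by (intro powr_mono2) auto
    also have "\<dots> \<le> 2 powr p * (norm (?S \<kappa> n) powr p + norm (?S \<kappa>' n) powr p)"
      using assms by (intro powr_add_le) auto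
    finally show "norm (?S (\<lambda>x. \<kappa> x + \<kappa>' x) n) powr p \<le> \<dots>" .
  qed
  also have "\<dots> = 2 powr p * ((\<Sum>n\<in>grid D. norm (?S \<kappa> n) powr p) + (\<Sum>n\<in>grid D. norm (?S \<kappa>' n) powr p))"
    by (simp only: sum_distrib_left[symmetric] sum.distrib)
  also have "\<dots> \<le> 2 powr p * (A * (\<Sum>k\<in>grid D. norm (a k) powr p) + B * (\<Sum>k\<in>grid D. norm (a k) powr p))"
    using assms s D unfolding conv_bounded_def by (intro mult_left_mono add_mono) auto
  finally show "(\<Sum>n\<in>grid D. norm (?S (\<lambda>x. \<kappa> x + \<kappa>' x) n) powr p) \<le> 2 powr p * (A + B) * (\<Sum>k\<in>grid D. norm (a k) powr p)"
    by (simp add: algebra_simps)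
qed (use assms in \<open>auto simp: conv_bounded_def\<close>)

lemma conv_bounded_cmult:
  assumes "conv_bounded p A \<kappa>" "norm c \<le> B" "p \<ge> 1"
  shows "conv_bounded p (B powr p * A) (\<lambda>x. c * \<kappa> x)"
  unfolding conv_bounded_def
proof (intro conjI allI impI)
  fix s :: "real^'a" and D :: "int set" and a :: "int^'a \<Rightarrow> complex"
  assume s: "\<forall>i. \<bar>s $ i\<bar> \<le> 1/2" and D: "finite D"
  let ?S = "\<lambda>\<kappa> n. \<Sum>k\<in>grid D. \<kappa> (lattice_point (n - k) + s) * a k"
  have "(\<Sum>n\<in>grid D. norm (?S (\<lambda>x. c * \<kappa> x) n) powr p) = norm c powr p * (\<Sum>n\<in>grid D. norm (?S \<kappa> n) powr p)"
    by (simp add: mult.assoc norm_mult powr_mult flip: sum_distrib_left)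
  also have "\<dots> \<le> B powr p * (A * (\<Sum>k\<in>grid D. norm (a k) powr p))"
    using assms s D unfolding conv_bounded_def by (intro mult_mono powr_mono2 sum_nonneg) auto
  finally show "(\<Sum>n\<in>grid D. norm (?S (\<lambda>x. c * \<kappa> x) n) powr p) \<le> B powr p * A * (\<Sum>k\<in>grid D. norm (a k) powr p)"
    by (simp add: mult.assoc)
qed (use assms in \<open>auto simp: conv_bounded_def\<close>)

lemma integrable_indicator_mult: "integrable lborel (\<lambda>t. indicator {\<alpha>..\<beta>} t * (c::real))" for \<alpha> \<beta> :: real
  by (intro integrable_mult_left integrable_real_indicator) (auto simp: emeasure_lborel_Icc_eq)

text \<open>Integration of the tangent inequality at the mean \<open>m\<close> over the interval;
  the mean of \<open>norm (g t)\<close> cancels the linear term.\<close>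

lemma integral_interval_Jensen:
  fixes g :: "real \<Rightarrow> complex"
  assumes "\<alpha> < \<beta>" "p \<ge> 1" and [measurable]: "g \<in> borel_measurable borel" and B: "\<And>t. norm (g t) \<le> B"
  shows "norm (LINT t|lborel. indicator {\<alpha>..\<beta>} t *\<^sub>R g t) powr p
    \<le> (\<beta> - \<alpha>) powr (p - 1) * (LINT t|lborel. indicator {\<alpha>..\<beta>} t * norm (g t) powr p)"
proof -
  define L where "L = \<beta> - \<alpha>"
  have L: "L > 0" using assms by (simp add: L_def)
  have B0: "B \<ge> 0" using B[of 0] norm_ge_zero order_trans by blast
  note int0 = integrable_indicator_mult[of \<alpha> \<beta>]
  have int1: "integrable lborel (\<lambda>t. indicator {\<alpha>..\<beta>} t * norm (g t))"
    by (rule Bochner_Integration.integrable_bound[OF int0[of B]]) (use B B0 in \<open>auto simp: indicator_def\<close>)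
  have int2: "integrable lborel (\<lambda>t. indicator {\<alpha>..\<beta>} t * norm (g t) powr p)"
    by (rule Bochner_Integration.integrable_bound[OF int0[of "B powr p"]])
      (use B B0 assms in \<open>auto simp: indicator_def intro!: powr_mono2\<close>)
  define I where "I = (LINT t|lborel. indicator {\<alpha>..\<beta>} t * norm (g t))"
  define m where "m = I / L"
  have I0: "I \<ge> 0" unfolding I_def by (intro Bochner_Integration.integral_nonneg) auto
  then have m0: "m \<ge> 0" using L by (simp add: m_def)
  have IL: "I = L * m" using L by (simp add: m_def)
  have len: "(LINT t|lborel. indicator {\<alpha>..\<beta>} t) = L" using assms by (simp add: L_def)
  have "(LINT t|lborel. indicator {\<alpha>..\<beta>} t * (m powr p - p * m powr (p - 1) * m) + p * m powr (p - 1) * (indicator {\<alpha>..\<beta>} t * norm (g t)))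
     \<le> (LINT t|lborel. indicator {\<alpha>..\<beta>} t * norm (g t) powr p)"
  proof (rule integral_mono[OF _ int2])
    show "integrable lborel (\<lambda>t. indicator {\<alpha>..\<beta>} t * (m powr p - p * m powr (p - 1) * m) + p * m powr (p - 1) * (indicator {\<alpha>..\<beta>} t * norm (g t)))"
      by (intro Bochner_Integration.integrable_add int0 integrable_mult_right int1)
    fix t
    show "indicator {\<alpha>..\<beta>} t * (m powr p - p * m powr (p - 1) * m) + p * m powr (p - 1) * (indicator {\<alpha>..\<beta>} t * norm (g t))
      \<le> indicator {\<alpha>..\<beta>} t * norm (g t) powr p"
      using powr_above_tangent[OF assms(2), of "norm (g t)" m] m0 by (auto simp: indicator_def algebra_simps)
  qed
  also have "(LINT t|lborel. indicator {\<alpha>..\<beta>} t * (m powr p - p * m powr (p - 1) * m) + p * m powr (p - 1) * (indicator {\<alpha>..\<beta>} t * norm (g t)))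
    = L * (m powr p - p * m powr (p - 1) * m) + p * m powr (p - 1) * I"
    by (subst Bochner_Integration.integral_add[OF int0 integrable_mult_right[OF int1]]) (simp add: I_def L_def assms less_imp_le)
  also have "\<dots> = L * m powr p" by (simp add: IL algebra_simps)
  finally have J: "L * m powr p \<le> (LINT t|lborel. indicator {\<alpha>..\<beta>} t * norm (g t) powr p)" .
  have "norm (LINT t|lborel. indicator {\<alpha>..\<beta>} t *\<^sub>R g t) \<le> (LINT t|lborel. norm (indicator {\<alpha>..\<beta>} t *\<^sub>R g t))"
    by (rule integral_norm_bound)
  also have "\<dots> = I" by (simp add: I_def)
  finally have "norm (LINT t|lborel. indicator {\<alpha>..\<beta>} t *\<^sub>R g t) powr p \<le> I powr p"
    using assms by (intro powr_mono2) auto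
  also have "\<dots> = L powr (p - 1) * (L * m powr p)"
    using L m0 by (simp add: IL powr_mult powr_diff)
  also have "\<dots> \<le> L powr (p - 1) * (LINT t|lborel. indicator {\<alpha>..\<beta>} t * norm (g t) powr p)"
    by (intro mult_left_mono J) auto
  finally show ?thesis by (simp add: L_def)
qed

text \<open>Jensen in the parameter replaces Minkowski's integral inequality: it gives
  (\<beta>-\<alpha>)^(p-1), and integrating the uniform bound gives the remaining factor
  \<beta>-\<alpha>. The sup bound on \<kappa> serves integrability only.\<close>

lemma conv_bounded_integral:
  fixes \<kappa> :: "real \<Rightarrow> real^'n \<Rightarrow> complex"
  assumes "\<alpha> < \<beta>" "p \<ge> 1" and [measurable]: "\<And>x. (\<lambda>t. \<kappa> t x) \<in> borel_measurable borel"
    and B: "\<And>t x. norm (\<kappa> t x) \<le> B"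
    and C: "\<And>t. t \<in> {\<alpha>..\<beta>} \<Longrightarrow> conv_bounded p C (\<kappa> t)"
  shows "conv_bounded p ((\<beta> - \<alpha>) powr p * C) (\<lambda>x. LINT t|lborel. indicator {\<alpha>..\<beta>} t *\<^sub>R \<kappa> t x)"
  unfolding conv_bounded_def
proof (intro conjI allI impI)
  have "\<alpha> \<in> {\<alpha>..\<beta>}" using assms by auto
  then have C0: "C \<ge> 0" using C unfolding conv_bounded_def by blast
  then show "0 \<le> (\<beta> - \<alpha>) powr p * C" by simp
  fix s :: "real^'n" and D :: "int set" and a :: "int^'n \<Rightarrow> complex"
  assume s: "\<forall>i. \<bar>s $ i\<bar> \<le> 1/2" and D: "finite D"
  define A where "A = (\<Sum>k\<in>grid D. norm (a k) powr p)"
  define g where "g n t = (\<Sum>k\<in>grid D. \<kappa> t (lattice_point (n - k) + s) * a k)" for n t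
  have [measurable]: "g n \<in> borel_measurable borel" for n unfolding g_def by measurable
  define B' where "B' = (\<Sum>k\<in>grid D. B * norm (a k))"
  have gB: "norm (g n t) \<le> B'" for n t
    unfolding g_def B'_def by (intro sum_norm_le) (auto simp: norm_mult intro!: mult_right_mono B)
  have intk: "integrable lborel (\<lambda>t. indicator {\<alpha>..\<beta>} t *\<^sub>R \<kappa> t x)" for x
    by (rule Bochner_Integration.integrable_bound[OF integrable_indicator_mult[of \<alpha> \<beta> B]])
      (use B in \<open>auto simp: indicator_def intro: order_trans[OF B] abs_ge_self\<close>)
  have eq: "(\<Sum>k\<in>grid D. (LINT t|lborel. indicator {\<alpha>..\<beta>} t *\<^sub>R \<kappa> t (lattice_point (n - k) + s)) * a k)
    = (LINT t|lborel. indicator {\<alpha>..\<beta>} t *\<^sub>R g n t)" for n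
  proof -
    have "(LINT t|lborel. indicator {\<alpha>..\<beta>} t *\<^sub>R g n t) = (LINT t|lborel. (\<Sum>k\<in>grid D. (indicator {\<alpha>..\<beta>} t *\<^sub>R \<kappa> t (lattice_point (n - k) + s)) * a k))"
      by (simp add: g_def scaleR_sum_right)
    also have "\<dots> = (\<Sum>k\<in>grid D. LINT t|lborel. (indicator {\<alpha>..\<beta>} t *\<^sub>R \<kappa> t (lattice_point (n - k) + s)) * a k)"
      by (intro Bochner_Integration.integral_sum integrable_mult_left intk)
    finally show ?thesis by (simp only: integral_mult_left_zero)
  qed
  have intp: "integrable lborel (\<lambda>t. indicator {\<alpha>..\<beta>} t * norm (g n t) powr p)" for n
  proof (rule Bochner_Integration.integrable_bound[of lborel "\<lambda>t. indicator {\<alpha>..\<beta>} t * B' powr p"])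
    show "integrable lborel (\<lambda>t. indicator {\<alpha>..\<beta>} t * B' powr p)" by (rule integrable_indicator_mult)
    show "AE t in lborel. norm (indicator {\<alpha>..\<beta>} t * norm (g n t) powr p) \<le> norm (indicator {\<alpha>..\<beta>} t * B' powr p)"
      using gB assms by (auto simp: indicator_def intro!: powr_mono2)
  qed measurable
  have "(\<Sum>n\<in>grid D. norm (LINT t|lborel. indicator {\<alpha>..\<beta>} t *\<^sub>R g n t) powr p)
    \<le> (\<Sum>n\<in>grid D. (\<beta> - \<alpha>) powr (p - 1) * (LINT t|lborel. indicator {\<alpha>..\<beta>} t * norm (g n t) powr p))"
    using assms gB by (intro sum_mono integral_interval_Jensen) auto
  also have "\<dots> = (\<beta> - \<alpha>) powr (p - 1) * (LINT t|lborel. (\<Sum>n\<in>grid D. indicator {\<alpha>..\<beta>} t * norm (g n t) powr p))"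
    using intp by (simp add: Bochner_Integration.integral_sum sum_distrib_left)
  also have "\<dots> \<le> (\<beta> - \<alpha>) powr (p - 1) * (LINT t|lborel. indicator {\<alpha>..\<beta>} t * (C * A))"
  proof (intro mult_left_mono integral_mono)
    show "(\<Sum>n\<in>grid D. indicator {\<alpha>..\<beta>} t * norm (g n t) powr p) \<le> indicator {\<alpha>..\<beta>} t * (C * A)" for t
      using C[of t] s D unfolding conv_bounded_def g_def A_def by (auto simp: indicator_def)
  qed (use intp integrable_indicator_mult in \<open>auto intro!: Bochner_Integration.integrable_sum\<close>)
  also have "\<dots> = (\<beta> - \<alpha>) powr p * C * A"
    using assms by (simp add: powr_diff)
  finally show "(\<Sum>n\<in>grid D. norm (\<Sum>k\<in>grid D. (LINT t|lborel. indicator {\<alpha>..\<beta>} t *\<^sub>R \<kappa> t (lattice_point (n - k) + s)) * a k) powr p)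
    \<le> (\<beta> - \<alpha>) powr p * C * (\<Sum>k\<in>grid D. norm (a k) powr p)"
    unfolding eq A_def .
qed

section \<open>Kernels whose spectrum is smooth on a box\<close>

text \<open>Coordinates in \<open>I\<close> are live variables taken from \<open>\<xi>\<close>; the
  others are frozen at \<open>u\<close>. It is the bookkeeping for differentiating the spectrum in
  one coordinate after another.\<close>

definition merge_vec :: "'n set \<Rightarrow> 'a^'n \<Rightarrow> 'a^'n \<Rightarrow> 'a^'n" where
  "merge_vec I \<xi> u = (\<chi> i. if i \<in> I then \<xi> $ i else u $ i)"

lemma merge_vec_nth [simp]: "merge_vec I \<xi> u $ i = (if i \<in> I then \<xi> $ i else u $ i)"
  by (simp add: merge_vec_def)

lemma merge_vec_in_cbox:
  fixes \<xi> u a b :: "real^'n"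
  shows "\<xi> \<in> cbox a b \<Longrightarrow> u \<in> cbox a b \<Longrightarrow> merge_vec I \<xi> u \<in> cbox a b"
  by (simp add: mem_box_cart)

lemma continuous_on_merge_vec [continuous_intros]:
  fixes f g :: "'b::topological_space \<Rightarrow> real^'n"
  assumes "continuous_on S f" "continuous_on S g"
  shows "continuous_on S (\<lambda>z. merge_vec I (f z) (g z))"
  unfolding merge_vec_def
proof (intro continuous_on_vec_lambda)
  show "continuous_on S (\<lambda>z. if i \<in> I then f z $ i else g z $ i)" for i
    using assms by (cases "i \<in> I") (auto intro: continuous_on_component)
qed

lemma continuous_on_vupd [continuous_intros]:
  fixes f :: "'b::topological_space \<Rightarrow> real^'n"
  assumes "continuous_on S f" "continuous_on S g"
  shows "continuous_on S (\<lambda>z. vupd (f z) i (g z))"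
  unfolding vupd_def
proof (intro continuous_on_vec_lambda)
  show "continuous_on S (\<lambda>z. if j = i then g z else f z $ j)" for j
    using assms by (cases "j = i") (auto intro: continuous_on_component)
qed

lemma merge_vec_vupd_measurable [measurable (raw)]:
  fixes u :: "real^'n"
  assumes "f \<in> borel_measurable M" "g \<in> borel_measurable M"
  shows "(\<lambda>z. merge_vec I (f z) (vupd u i (g z))) \<in> borel_measurable M"
proof -
  have "(\<lambda>z. merge_vec I (fst z) (vupd u i (snd z))) \<in> borel_measurable (borel \<Otimes>\<^sub>M borel)"
    unfolding borel_prod by (intro borel_measurable_continuous_onI continuous_intros)
  from measurable_compose[OF measurable_Pair[OF assms] this] show ?thesis by simp
qed

lemma vec_nth_measurable [measurable (raw)]:
  fixes f :: "'z \<Rightarrow> real^'n"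
  assumes "f \<in> borel_measurable M"
  shows "(\<lambda>z. f z $ i) \<in> borel_measurable M"
proof -
  have "(\<lambda>v::real^'n. v $ i) \<in> borel_measurable borel"
    by (intro borel_measurable_continuous_onI continuous_on_component continuous_on_id)
  from measurable_compose[OF assms this] show ?thesis .
qed

lemma of_bool_measurable [measurable (raw)]:
  assumes [measurable]: "Measurable.pred M P"
  shows "(\<lambda>x. of_bool (P x) :: complex) \<in> borel_measurable M"
  unfolding of_bool_def by measurable

lemma Ck_on_imp_continuous_on: "Ck_on k S f \<Longrightarrow> continuous_on S f"
  by (cases k) (auto simp: continuous_on_eq_continuous_within intro: has_derivative_continuous)

text \<open>Making coordinate \<open>i\<close> live costs one derivative in that direction. The
  range of integration is kept fixed and the condition t \<le> \<xi>_i is written as a factor, so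
  that after Fubini it becomes a restriction on \<xi>, that is, a smaller box.\<close>

lemma partial_FTC:
  fixes \<theta> :: "real^'n \<Rightarrow> complex"
  assumes der: "\<And>x. x \<in> cbox a b \<Longrightarrow> (\<theta> has_derivative (\<lambda>h. \<Sum>i\<in>UNIV. (h $ i) *\<^sub>R D i x)) (at x within cbox a b)"
    and cont: "continuous_on (cbox a b) (D i)" and i: "i \<notin> I" and \<xi>: "\<xi> \<in> cbox a b" and u: "u \<in> cbox a b"
  shows "\<theta> (merge_vec (insert i I) \<xi> u) = \<theta> (merge_vec I \<xi> (vupd u i (a $ i))) +
    (LINT t|lborel. indicator {a $ i..b $ i} t *\<^sub>R (of_bool (t \<le> \<xi> $ i) * D i (merge_vec I \<xi> (vupd u i t))))"
proof -
  define \<gamma> where "\<gamma> t = merge_vec I \<xi> (vupd u i t)" for t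
  have \<gamma>: "\<gamma> t = \<gamma> 0 + t *\<^sub>R axis i 1" for t
    using i by (simp add: vec_eq_iff \<gamma>_def axis_def)
  have \<gamma>in: "\<gamma> t \<in> cbox a b" if "t \<in> {a $ i..b $ i}" for t
    unfolding \<gamma>_def using that \<xi> u by (intro merge_vec_in_cbox) (auto simp: mem_box_cart)
  have \<xi>i: "a $ i \<le> \<xi> $ i" "\<xi> $ i \<le> b $ i" using \<xi> by (auto simp: mem_box_cart)
  have "((\<lambda>t. D i (\<gamma> t)) has_integral (\<theta> (\<gamma> (\<xi> $ i)) - \<theta> (\<gamma> (a $ i)))) {a $ i..\<xi> $ i}"
  proof (rule fundamental_theorem_of_calculus[OF \<xi>i(1)])
    fix t assume t: "t \<in> {a $ i..\<xi> $ i}"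
    have d\<gamma>: "(\<gamma> has_derivative (\<lambda>h. h *\<^sub>R axis i 1)) (at t within {a $ i..\<xi> $ i})"
      by (subst \<gamma>[abs_def]) (auto intro!: derivative_eq_intros)
    have sub: "\<gamma> ` {a $ i..\<xi> $ i} \<subseteq> cbox a b" using \<gamma>in \<xi>i by auto
    have d\<theta>: "(\<theta> has_derivative (\<lambda>h. \<Sum>j\<in>UNIV. (h $ j) *\<^sub>R D j (\<gamma> t))) (at (\<gamma> t) within \<gamma> ` {a $ i..\<xi> $ i})"
      using t \<xi>i by (intro has_derivative_subset[OF der sub] \<gamma>in) auto
    have "((\<lambda>t. \<theta> (\<gamma> t)) has_derivative (\<lambda>h. \<Sum>j\<in>UNIV. ((h *\<^sub>R axis i 1) $ j) *\<^sub>R D j (\<gamma> t))) (at t within {a $ i..\<xi> $ i})"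
      by (rule has_derivative_in_compose[OF d\<gamma> d\<theta>])
    also have "(\<lambda>h. \<Sum>j\<in>UNIV. ((h *\<^sub>R axis i 1) $ j) *\<^sub>R D j (\<gamma> t)) = (\<lambda>h. h *\<^sub>R D i (\<gamma> t))"
      by (simp add: axis_def if_distrib if_distribR cong: if_cong)
    finally show "((\<lambda>t. \<theta> (\<gamma> t)) has_vector_derivative D i (\<gamma> t)) (at t within {a $ i..\<xi> $ i})"
      by (simp add: has_vector_derivative_def)
  qed
  moreover have contD: "continuous_on {a $ i..\<xi> $ i} (\<lambda>t. D i (\<gamma> t))"
  proof (rule continuous_on_compose2[OF cont])
    show "continuous_on {a $ i..\<xi> $ i} \<gamma>" unfolding \<gamma>_def by (intro continuous_intros)
  qed (use \<gamma>in \<xi>i in auto)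
  ultimately have "(LINT t:{a $ i..\<xi> $ i}|lborel. D i (\<gamma> t)) = \<theta> (\<gamma> (\<xi> $ i)) - \<theta> (\<gamma> (a $ i))"
    using borel_integrable_compact[OF _ contD]
    by (subst set_borel_integral_eq_integral) (auto simp: set_integrable_def integral_unique)
  moreover have "(LINT t:{a $ i..\<xi> $ i}|lborel. D i (\<gamma> t))
      = (LINT t|lborel. indicator {a $ i..b $ i} t *\<^sub>R (of_bool (t \<le> \<xi> $ i) * D i (\<gamma> t)))"
    unfolding set_lebesgue_integral_def using \<xi>i
    by (intro Bochner_Integration.integral_cong) (auto simp: indicator_def)
  moreover have "\<gamma> (\<xi> $ i) = merge_vec (insert i I) \<xi> u"
    using i by (simp add: vec_eq_iff \<gamma>_def)
  ultimately have "\<theta> (merge_vec (insert i I) \<xi> u) - \<theta> (\<gamma> (a $ i))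
      = (LINT t|lborel. indicator {a $ i..b $ i} t *\<^sub>R (of_bool (t \<le> \<xi> $ i) * D i (\<gamma> t)))" by simp
  then show ?thesis by (simp add: \<gamma>_def diff_eq_eq add.commute)
qed

text \<open>Induction on the live coordinates: with none, the spectrum is a constant times a box
  indicator; each further one is an average over t of kernels with one derivative spent. Subbox and
  frozen point are arbitrary since the cut at t shrinks the box and freezes coordinate
  \<open>i\<close> at t. After all coordinates only mixed derivatives have been used, at most one
  per direction.\<close>

lemma Ck_on_kernel_bound:
  fixes a b :: "real^'n"
  assumes p: "p \<ge> 2" and ab: "\<And>i. a $ i < b $ i"
  shows "Ck_on k (cbox a b) \<theta> \<Longrightarrow> card I \<le> k \<Longrightarrow>
    \<exists>C. \<forall>u\<in>cbox a b. \<forall>c d. cbox c d \<subseteq> cbox a b \<longrightarrow>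
      conv_bounded p C (\<lambda>x. LINT \<xi>|lborel. indicator (cbox c d) \<xi> *\<^sub>R (\<theta> (merge_vec I \<xi> u) * wave x \<xi>))"
  using finite[of I]
proof (induction I arbitrary: k \<theta> rule: finite_induct)
  case empty
  define L where "L = (\<Sum>i\<in>UNIV. b $ i - a $ i)"
  have L: "L \<ge> 0" "b $ i - a $ i \<le> L" for i
    using ab by (auto simp: L_def less_imp_le intro!: sum_nonneg member_le_sum)
  obtain C where C: "C \<ge> 0"
    "\<And>c b :: real^'n. (\<And>i. b $ i - c $ i \<le> L) \<Longrightarrow> conv_bounded p C (\<lambda>x. LINT \<xi>|lborel. indicator (cbox c b) \<xi> *\<^sub>R wave x \<xi>)"
    using box_kernel_bound[OF p L(1)] by blast
  have "bounded (\<theta> ` cbox a b)"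
    using Ck_on_imp_continuous_on[OF empty(1)] by (intro compact_imp_bounded compact_continuous_image) auto
  then obtain B where B: "\<And>x. x \<in> cbox a b \<Longrightarrow> norm (\<theta> x) \<le> B"
    unfolding bounded_iff by auto
  have "conv_bounded p (B powr p * C) (\<lambda>x. LINT \<xi>|lborel. indicator (cbox c d) \<xi> *\<^sub>R (\<theta> (merge_vec {} \<xi> u) * wave x \<xi>))"
    if u: "u \<in> cbox a b" and cd: "cbox c d \<subseteq> cbox a b" for u c d
  proof -
    \<comment> \<open>An empty box gives no control over its corners \<open>c\<close> and
      \<open>d\<close>, so the zero kernel is treated apart.\<close>
    have zero: "conv_bounded p C (\<lambda>x. LINT \<xi>|lborel. indicator {} \<xi> *\<^sub>R wave x \<xi>)"
      using C(1) by (auto simp: conv_bounded_def intro!: mult_nonneg_nonneg sum_nonneg)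
    have len: "d $ i - c $ i \<le> L" if "cbox c d \<noteq> {}" for i
    proof -
      from that have "c \<in> cbox c d" "d \<in> cbox c d" by (auto simp: interval_eq_empty_cart mem_box_cart not_less)
      then have "c \<in> cbox a b" "d \<in> cbox a b" using cd by auto
      then have "a $ i \<le> c $ i" "d $ i \<le> b $ i" by (auto simp: mem_box_cart)
      then show ?thesis using L(2)[of i] by linarith
    qed
    have "conv_bounded p C (\<lambda>x. LINT \<xi>|lborel. indicator (cbox c d) \<xi> *\<^sub>R wave x \<xi>)"
      using C(2)[OF len] zero by (cases "cbox c d = {}") auto
    from conv_bounded_cmult[OF this B[OF u]] p
    have "conv_bounded p (B powr p * C) (\<lambda>x. \<theta> u * (LINT \<xi>|lborel. indicator (cbox c d) \<xi> *\<^sub>R wave x \<xi>))" by simp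
    moreover have "merge_vec {} \<xi> u = u" for \<xi> by (simp add: vec_eq_iff)
    moreover have "indicator (cbox c d) \<xi> *\<^sub>R (\<theta> u * wave x \<xi>) = \<theta> u * (indicator (cbox c d) \<xi> *\<^sub>R wave x \<xi>)" for x \<xi>
      by simp
    ultimately show ?thesis by (simp only: integral_mult_right_zero)
  qed
  then show ?case by blast
next
  case (insert i I)
  then obtain k' where k: "k = Suc k'" by (cases k) auto
  from insert.prems(1) obtain D where
    der: "\<And>x. x \<in> cbox a b \<Longrightarrow> (\<theta> has_derivative (\<lambda>h. \<Sum>i\<in>UNIV. (h $ i) *\<^sub>R D i x)) (at x within cbox a b)"
    and Ck: "\<And>i. Ck_on k' (cbox a b) (D i)"
    unfolding k by auto
  have cont: "continuous_on (cbox a b) (D j)" for j by (rule Ck_on_imp_continuous_on[OF Ck])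
  have cI: "card I \<le> k" "card I \<le> k'" using insert by (auto simp: k)
  obtain C1 where C1: "\<And>u c d. u \<in> cbox a b \<Longrightarrow> cbox c d \<subseteq> cbox a b \<Longrightarrow>
      conv_bounded p C1 (\<lambda>x. LINT \<xi>|lborel. indicator (cbox c d) \<xi> *\<^sub>R (\<theta> (merge_vec I \<xi> u) * wave x \<xi>))"
    using insert.IH[OF insert.prems(1) cI(1)] by blast
  obtain C2 where C2: "\<And>u c d. u \<in> cbox a b \<Longrightarrow> cbox c d \<subseteq> cbox a b \<Longrightarrow>
      conv_bounded p C2 (\<lambda>x. LINT \<xi>|lborel. indicator (cbox c d) \<xi> *\<^sub>R (D i (merge_vec I \<xi> u) * wave x \<xi>))"
    using insert.IH[OF Ck cI(2)] by blast
  have "bounded (D i ` cbox a b)"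
    by (intro compact_imp_bounded compact_continuous_image cont) auto
  then obtain B where B: "\<And>x. x \<in> cbox a b \<Longrightarrow> norm (D i x) \<le> B"
    unfolding bounded_iff by auto
  have "a \<in> cbox a b" using ab by (simp add: mem_box_cart less_imp_le)
  then have B0: "B \<ge> 0" using B norm_ge_zero order_trans by blast
  \<comment> \<open>Extension by zero, Borel measurable and bounded on the whole space; it agrees
    with \<open>D i\<close> wherever the integrals look.\<close>
  define D' where "D' y = indicator (cbox a b) y *\<^sub>R D i y" for y
  have [measurable]: "D' \<in> borel_measurable borel"
    unfolding D'_def by (intro borel_measurable_continuous_on_indicator cont) auto
  have D'B: "norm (D' y) \<le> B" for y using B B0 by (auto simp: D'_def indicator_def)
  define \<kappa> where "\<kappa> u c d t x = (LINT \<xi>|lborel. indicator (cbox c d) \<xi> *\<^sub>R (of_bool (t \<le> \<xi> $ i) * D' (merge_vec I \<xi> (vupd u i t)) * wave x \<xi>))"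
    for u c d :: "real^'n" and t x
  have \<kappa>meas: "(\<lambda>t. \<kappa> u c d t x) \<in> borel_measurable borel" for u c d x
    unfolding \<kappa>_def by measurable
  have fin: "emeasure lborel (cbox c d) < \<infinity>" for c d :: "real^'n" by (rule emeasure_lborel_cbox_finite)
  have \<kappa>B: "norm (\<kappa> u c d t x) \<le> measure lborel (cbox c d) * B" for u c d t x
  proof -
    have "norm (\<kappa> u c d t x) \<le> (LINT \<xi>|lborel. indicator (cbox c d) \<xi> * B)"
      unfolding \<kappa>_def
    proof (rule order_trans[OF integral_norm_bound], rule integral_mono)
      show iB: "integrable lborel (\<lambda>\<xi>. indicator (cbox c d) \<xi> * B)" using fin[of c d] by (intro integrable_mult_left) auto
      have bd: "norm (indicator (cbox c d) \<xi> *\<^sub>R (of_bool (t \<le> \<xi> $ i) * D' (merge_vec I \<xi> (vupd u i t)) * wave x \<xi>)) \<le> indicator (cbox c d) \<xi> * B" for \<xi>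
        using D'B B0 by (auto simp: indicator_def norm_mult)
      then show "norm (indicator (cbox c d) \<xi> *\<^sub>R (of_bool (t \<le> \<xi> $ i) * D' (merge_vec I \<xi> (vupd u i t)) * wave x \<xi>)) \<le> indicator (cbox c d) \<xi> * B" for \<xi> .
      show "integrable lborel (\<lambda>\<xi>. norm (indicator (cbox c d) \<xi> *\<^sub>R (of_bool (t \<le> \<xi> $ i) * D' (merge_vec I \<xi> (vupd u i t)) * wave x \<xi>)))"
        using bd B0 by (intro Bochner_Integration.integrable_bound[OF iB]) auto
    qed
    then show ?thesis by simp
  qed
  define C where "C = 2 powr p * (C1 + (b $ i - a $ i) powr p * C2)"
  have "conv_bounded p C (\<lambda>x. LINT \<xi>|lborel. indicator (cbox c d) \<xi> *\<^sub>R (\<theta> (merge_vec (insert i I) \<xi> u) * wave x \<xi>))"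
    if u: "u \<in> cbox a b" and cd: "cbox c d \<subseteq> cbox a b" for u c d
  proof -
    have ua: "vupd u i t \<in> cbox a b" if "t \<in> {a $ i..b $ i}" for t
      using u that by (auto simp: mem_box_cart)
    have k2: "conv_bounded p ((b $ i - a $ i) powr p * C2) (\<lambda>x. LINT t|lborel. indicator {a $ i..b $ i} t *\<^sub>R \<kappa> u c d t x)"
    proof (rule conv_bounded_integral[OF ab _ \<kappa>meas \<kappa>B])
      fix t assume t: "t \<in> {a $ i..b $ i}"
      \<comment> \<open>The condition t \<le> \<xi>_i just raises the lower corner of the box in
        direction \<open>i\<close> to max(c_i, t). The result is again a box inside the old one, as
        the induction hypothesis demands.\<close>
      have sub: "cbox (vupd c i (max (c $ i) t)) d \<subseteq> cbox c d"
        by (auto simp: mem_box_cart) (metis max.boundedE)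
      have "\<kappa> u c d t = (\<lambda>x. LINT \<xi>|lborel. indicator (cbox (vupd c i (max (c $ i) t)) d) \<xi> *\<^sub>R (D i (merge_vec I \<xi> (vupd u i t)) * wave x \<xi>))"
      proof
        fix x
        show "\<kappa> u c d t x = (LINT \<xi>|lborel. indicator (cbox (vupd c i (max (c $ i) t)) d) \<xi> *\<^sub>R (D i (merge_vec I \<xi> (vupd u i t)) * wave x \<xi>))"
          unfolding \<kappa>_def
        proof (intro Bochner_Integration.integral_cong refl)
          fix \<xi>
          have "\<xi> \<in> cbox (vupd c i (max (c $ i) t)) d \<longleftrightarrow> \<xi> \<in> cbox c d \<and> t \<le> \<xi> $ i"
            by (auto simp: mem_box_cart split: if_splits)
          moreover have "D' (merge_vec I \<xi> (vupd u i t)) = D i (merge_vec I \<xi> (vupd u i t))" if "\<xi> \<in> cbox c d"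
            using merge_vec_in_cbox[OF _ ua[OF t], of \<xi> I] that cd by (auto simp: D'_def)
          ultimately show "indicator (cbox c d) \<xi> *\<^sub>R (of_bool (t \<le> \<xi> $ i) * D' (merge_vec I \<xi> (vupd u i t)) * wave x \<xi>)
            = indicator (cbox (vupd c i (max (c $ i) t)) d) \<xi> *\<^sub>R (D i (merge_vec I \<xi> (vupd u i t)) * wave x \<xi>)"
            by (auto simp: indicator_def)
        qed
      qed
      then show "conv_bounded p C2 (\<kappa> u c d t)"
        using C2[OF ua[OF t]] sub cd by auto
    qed (use p in auto)
    have k1: "conv_bounded p C1 (\<lambda>x. LINT \<xi>|lborel. indicator (cbox c d) \<xi> *\<^sub>R (\<theta> (merge_vec I \<xi> (vupd u i (a $ i))) * wave x \<xi>))"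
      using C1[OF ua cd] ab[of i] by auto
    have "(LINT \<xi>|lborel. indicator (cbox c d) \<xi> *\<^sub>R (\<theta> (merge_vec (insert i I) \<xi> u) * wave x \<xi>))
      = (LINT \<xi>|lborel. indicator (cbox c d) \<xi> *\<^sub>R (\<theta> (merge_vec I \<xi> (vupd u i (a $ i))) * wave x \<xi>)) +
        (LINT t|lborel. indicator {a $ i..b $ i} t *\<^sub>R \<kappa> u c d t x)" for x
    proof -
      \<comment> \<open>The double integrand for Fubini: integrating in t first gives the remainder
        term of the fundamental theorem, integrating in \<xi> first gives the kernel at parameter
        t.\<close>
      define h where "h \<xi> t = indicator {a $ i..b $ i} t *\<^sub>R (indicator (cbox c d) \<xi> *\<^sub>R (of_bool (t \<le> \<xi> $ i) * D' (merge_vec I \<xi> (vupd u i t)) * wave x \<xi>))" for \<xi> t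
      have hm [measurable]: "(\<lambda>(\<xi>, t). h \<xi> t) \<in> borel_measurable (lborel \<Otimes>\<^sub>M lborel)"
        unfolding h_def by measurable
      have hint: "integrable (lborel \<Otimes>\<^sub>M lborel) (\<lambda>(\<xi>, t). h \<xi> t)"
      proof (rule Bochner_Integration.integrable_bound)
        show "integrable (lborel \<Otimes>\<^sub>M lborel) (\<lambda>z. indicator (cbox (c, a $ i) (d, b $ i)) z * B)"
          unfolding lborel_prod using emeasure_lborel_cbox_finite[of "(c, a $ i)" "(d, b $ i)"]
          by (intro integrable_mult_left) auto
        show "AE z in lborel \<Otimes>\<^sub>M lborel. norm (case z of (\<xi>, t) \<Rightarrow> h \<xi> t) \<le> norm (indicator (cbox (c, a $ i) (d, b $ i)) z * B)"
          using D'B B0 by (intro AE_I2) (auto simp: h_def indicator_def norm_mult cbox_Pair_eq)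
      qed (rule hm)
      have 1: "indicator (cbox c d) \<xi> *\<^sub>R (\<theta> (merge_vec (insert i I) \<xi> u) * wave x \<xi>)
        = indicator (cbox c d) \<xi> *\<^sub>R (\<theta> (merge_vec I \<xi> (vupd u i (a $ i))) * wave x \<xi>) + (LINT t|lborel. h \<xi> t)" for \<xi>
      proof (cases "\<xi> \<in> cbox c d")
        case True
        then have \<xi>: "\<xi> \<in> cbox a b" using cd by auto
        have "(LINT t|lborel. h \<xi> t) = (LINT t|lborel. (indicator {a $ i..b $ i} t *\<^sub>R (of_bool (t \<le> \<xi> $ i) * D i (merge_vec I \<xi> (vupd u i t)))) * wave x \<xi>)"
          using True merge_vec_in_cbox[OF \<xi> ua]
          by (intro Bochner_Integration.integral_cong) (auto simp: h_def D'_def indicator_def)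
        also have "\<dots> = (LINT t|lborel. indicator {a $ i..b $ i} t *\<^sub>R (of_bool (t \<le> \<xi> $ i) * D i (merge_vec I \<xi> (vupd u i t)))) * wave x \<xi>"
          by (rule integral_mult_left_zero)
        finally show ?thesis using True partial_FTC[OF der cont insert.hyps(2) \<xi> u]
          by (simp add: distrib_right)
      qed (simp add: h_def)
      have ih: "integrable lborel (\<lambda>\<xi>. LINT t|lborel. h \<xi> t)"
        using lborel_pair.integrable_fst'[OF hint] by simp
      have cont0: "continuous_on (cbox c d) (\<lambda>\<xi>. \<theta> (merge_vec I \<xi> (vupd u i (a $ i))) * wave x \<xi>)"
      proof (intro continuous_intros continuous_on_compose2[OF Ck_on_imp_continuous_on[OF insert.prems(1)]])
        show "(\<lambda>\<xi>. merge_vec I \<xi> (vupd u i (a $ i))) ` cbox c d \<subseteq> cbox a b"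
          using cd ab[of i] by (auto intro!: merge_vec_in_cbox ua)
      qed
      have i0: "integrable lborel (\<lambda>\<xi>. indicator (cbox c d) \<xi> *\<^sub>R (\<theta> (merge_vec I \<xi> (vupd u i (a $ i))) * wave x \<xi>))"
        by (rule borel_integrable_compact[OF _ cont0]) auto
      have "(LINT \<xi>|lborel. LINT t|lborel. h \<xi> t) = (LINT t|lborel. LINT \<xi>|lborel. h \<xi> t)"
        using lborel_pair.Fubini_integral[OF hint] by simp
      also have "\<dots> = (LINT t|lborel. indicator {a $ i..b $ i} t *\<^sub>R \<kappa> u c d t x)"
        unfolding h_def \<kappa>_def by (simp only: integral_scaleR_right)
      finally show ?thesis unfolding 1 using Bochner_Integration.integral_add[OF i0 ih] by simp
    qed
    then show ?thesis unfolding C_def using conv_bounded_add[OF k1 k2] p by simp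
  qed
  then show ?case by blast
qed

text \<open>The box may have jumps of the spectrum on its faces, which is why the Hilbert transform is unavoidable here.\<close>

lemma class_B_kernel_bound:
  fixes \<theta> :: "real^'n \<Rightarrow> complex"
  assumes p: "p \<ge> 2" and ab: "\<And>i. a $ i < b $ i" and Ck: "Ck_on CARD('n) (cbox a b) \<theta>"
    and \<theta>0: "\<And>\<xi>. \<xi> \<notin> cbox a b \<Longrightarrow> \<theta> \<xi> = 0"
  obtains C where "conv_bounded p C (\<lambda>x. LINT \<xi>|lborel. \<theta> \<xi> * wave x \<xi>)"
proof -
  obtain C where C: "\<And>u c d. u \<in> cbox a b \<Longrightarrow> cbox c d \<subseteq> cbox a b \<Longrightarrow>
      conv_bounded p C (\<lambda>x. LINT \<xi>|lborel. indicator (cbox c d) \<xi> *\<^sub>R (\<theta> (merge_vec UNIV \<xi> u) * wave x \<xi>))"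
    using Ck_on_kernel_bound[OF p ab Ck, where I = UNIV] by blast
  have "a \<in> cbox a b" using ab by (simp add: mem_box_cart less_imp_le)
  then have "conv_bounded p C (\<lambda>x. LINT \<xi>|lborel. indicator (cbox a b) \<xi> *\<^sub>R (\<theta> (merge_vec UNIV \<xi> a) * wave x \<xi>))"
    by (intro C) auto
  moreover have "indicator (cbox a b) \<xi> *\<^sub>R (\<theta> (merge_vec UNIV \<xi> a) * wave x \<xi>) = \<theta> \<xi> * wave x \<xi>" for x \<xi>
  proof -
    have "merge_vec UNIV \<xi> a = \<xi>" by (simp add: vec_eq_iff)
    then show ?thesis using \<theta>0[of \<xi>] by (auto simp: indicator_def)
  qed
  ultimately show thesis using that by simp
qed

subsection \<open>Periodization over the integer lattice\<close>

text \<open>Half open, so that its integer translates tile the space without overlap.\<close>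

definition unit_cube :: "(real^'n) set" where
  "unit_cube = {x. \<forall>i. - 1/2 \<le> x $ i \<and> x $ i < 1/2}"

lemma unit_cube_sets [measurable]: "(unit_cube :: (real^'n) set) \<in> sets borel"
proof -
  have "unit_cube = (\<Inter>i. {x::real^'n. - 1/2 \<le> x $ i \<and> x $ i < 1/2})"
    by (auto simp: unit_cube_def)
  also have "\<dots> \<in> sets borel" by measurable
  finally show ?thesis .
qed

lemma lattice_point_nth [simp]: "lattice_point k $ i = of_int (k $ i)"
  by (simp add: lattice_point_def)

lemma lattice_point_0 [simp]: "lattice_point 0 = 0"
  by (simp add: vec_eq_iff)

lemma lattice_point_add: "lattice_point (k + l) = lattice_point k + lattice_point l"
  by (simp add: vec_eq_iff)

lemma lattice_point_minus: "lattice_point (- k) = - lattice_point k"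
  by (simp add: vec_eq_iff)

lemma lattice_point_diff: "lattice_point (k - l) = lattice_point k - lattice_point l"
  by (simp add: vec_eq_iff)

lemma wave_lattice_lattice [simp]: "wave (lattice_point k) (lattice_point l) = 1"
proof -
  have "lattice_point k \<bullet> lattice_point l = of_int (\<Sum>i\<in>UNIV. k $ i * l $ i)"
    by (simp add: inner_vec_def)
  then show ?thesis by (simp only: wave_def cis_multiple_2pi Ints_of_int)
qed

lemma wave_lattice_periodic: "wave (lattice_point k) (\<xi> + lattice_point l) = wave (lattice_point k) \<xi>"
  by (simp add: wave_add_right)

lemma nn_integral_lborel_translate:
  fixes f :: "'a::euclidean_space \<Rightarrow> ennreal"
  assumes [measurable]: "f \<in> borel_measurable borel"
  shows "(\<integral>\<^sup>+x. f (c + x) \<partial>lborel) = (\<integral>\<^sup>+x. f x \<partial>lborel)"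
  by (subst (2) lborel_distr_plus[of c, symmetric]) (simp add: nn_integral_distr)

lemma ex1_lattice_unit_cube: "\<exists>!k. y - lattice_point k \<in> unit_cube"
proof (rule ex1I)
  let ?k = "\<chi> i. \<lfloor>y $ i + 1/2\<rfloor>"
  show "y - lattice_point ?k \<in> unit_cube"
    unfolding unit_cube_def by (auto, linarith+)
  fix k assume k: "y - lattice_point k \<in> unit_cube"
  have "k $ i = \<lfloor>y $ i + 1/2\<rfloor>" for i
  proof -
    have "- 1/2 \<le> y $ i - of_int (k $ i) \<and> y $ i - of_int (k $ i) < 1/2"
      using k by (simp add: unit_cube_def)
    then show ?thesis by (intro floor_unique[symmetric]) linarith+
  qed
  then show "k = ?k" by (simp add: vec_eq_iff)
qed

lemma nn_integral_count_indicator_unit_cube: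
  "(\<integral>\<^sup>+k. indicator unit_cube (y - lattice_point k) \<partial>count_space UNIV) = 1"
proof -
  obtain k0 where k0: "\<And>k. y - lattice_point k \<in> unit_cube \<longleftrightarrow> k = k0"
    using ex1_lattice_unit_cube[of y] by blast
  have "(\<lambda>k. indicator unit_cube (y - lattice_point k)) = (indicator {k0} :: _ \<Rightarrow> ennreal)"
    by (auto simp: indicator_def k0)
  then show ?thesis by simp
qed

lemma measurable_lattice_sum [measurable]:
  fixes f :: "'z \<Rightarrow> int^'n \<Rightarrow> ennreal"
  assumes "\<And>k. (\<lambda>x. f x k) \<in> borel_measurable M"
  shows "(\<lambda>x. \<integral>\<^sup>+k. f x k \<partial>count_space UNIV) \<in> borel_measurable M"
proof -
  interpret sigma_finite_measure "count_space (UNIV :: (int^'n) set)"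
    by (rule sigma_finite_measure_count_space)
  show ?thesis
  proof (rule borel_measurable_nn_integral)
    show "(\<lambda>(x, k). f x k) \<in> borel_measurable (M \<Otimes>\<^sub>M count_space UNIV)"
      using measurable_pair_swap[OF measurable_pair_measure_countable1[of UNIV "\<lambda>z. f (snd z) (fst z)" M borel]] assms
      by (simp add: case_prod_unfold)
  qed
qed

text \<open>The translated cube indicators sum to one at every point; inserting this partition and
  applying Tonelli and translation invariance folds the integral onto the cube.\<close>

lemma nn_integral_tiling:
  fixes f :: "real^'n \<Rightarrow> ennreal"
  assumes [measurable]: "f \<in> borel_measurable borel"
  shows "(\<integral>\<^sup>+x. f x \<partial>lborel) = (\<integral>\<^sup>+x. (\<integral>\<^sup>+k. f (x + lattice_point k) \<partial>count_space UNIV) * indicator unit_cube x \<partial>lborel)"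
proof -
  have "(\<integral>\<^sup>+x. (\<integral>\<^sup>+k. f (x + lattice_point k) \<partial>count_space UNIV) * indicator unit_cube x \<partial>lborel)
    = (\<integral>\<^sup>+x. (\<integral>\<^sup>+k. f (x + lattice_point k) * indicator unit_cube x \<partial>count_space UNIV) \<partial>lborel)"
    by (simp add: nn_integral_multc)
  also have "\<dots> = (\<integral>\<^sup>+k. (\<integral>\<^sup>+x. f (x + lattice_point k) * indicator unit_cube x \<partial>lborel) \<partial>count_space UNIV)"
    by (rule nn_integral_count_space_nn_integral) auto
  also have "\<dots> = (\<integral>\<^sup>+k. (\<integral>\<^sup>+x. f x * indicator unit_cube (x - lattice_point k) \<partial>lborel) \<partial>count_space UNIV)"
  proof (rule nn_integral_cong)
    fix k
    show "(\<integral>\<^sup>+x. f (x + lattice_point k) * indicator unit_cube x \<partial>lborel) = (\<integral>\<^sup>+x. f x * indicator unit_cube (x - lattice_point k) \<partial>lborel)"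
      by (subst nn_integral_lborel_translate[of "\<lambda>x. f x * indicator unit_cube (x - lattice_point k)" "lattice_point k", symmetric])
        (auto simp: add.commute)
  qed
  also have "\<dots> = (\<integral>\<^sup>+x. (\<integral>\<^sup>+k. f x * indicator unit_cube (x - lattice_point k) \<partial>count_space UNIV) \<partial>lborel)"
    by (rule nn_integral_count_space_nn_integral[symmetric]) auto
  also have "\<dots> = (\<integral>\<^sup>+x. f x \<partial>lborel)"
    by (simp add: nn_integral_cmult nn_integral_count_indicator_unit_cube)
  finally show ?thesis by simp
qed

lemma integral_unit_interval_cis:
  "integrable lborel (\<lambda>t. indicator {-1/2..<1/2} t *\<^sub>R cis (2 * pi * of_int m * t))" (is ?int)
  "(LINT t|lborel. indicator {-1/2..<1/2} t *\<^sub>R cis (2 * pi * of_int m * t)) = of_bool (m = 0)" (is ?eq)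
proof -
  have ae: "AE t in lborel. indicator {-1/2..<1/2} t *\<^sub>R cis (2 * pi * of_int m * t) = indicator {-1/2..1/2} t *\<^sub>R cis (2 * pi * of_int m * t)"
    using AE_lborel_singleton[of "1/2::real"] by eventually_elim (auto simp: indicator_def)
  have [measurable]: "cis \<in> borel_measurable borel"
    by (intro borel_measurable_continuous_onI continuous_on_cis continuous_on_id)
  have int: "integrable lborel (\<lambda>t. indicator {-1/2..1/2} t *\<^sub>R cis (2 * pi * of_int m * t))"
    by (rule integrable_interval_cis)
  show ?int using int by (subst integrable_cong_AE[OF _ _ ae]) auto
  have "(LINT t|lborel. indicator {-1/2..<1/2} t *\<^sub>R cis (2 * pi * of_int m * t)) = interval_kernel (-1/2) (1/2) (of_int m)"
    unfolding interval_kernel_def by (rule integral_cong_AE[OF _ _ ae]) measurable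
  also have "\<dots> = of_bool (m = 0)"
  proof (cases "m = 0")
    case True
    then show ?thesis by (simp add: interval_kernel_def scaleR_conv_of_real)
  next
    case False
    have "cis (pi * of_int m) = cis (- (pi * of_int m))"
      by (simp add: complex_eq_iff mult.commute)
    then show ?thesis using False by (simp add: interval_kernel_eq)
  qed
  finally show ?eq .
qed

lemma integral_unit_cube_wave:
  "(LINT \<xi>|lborel. indicator unit_cube \<xi> *\<^sub>R wave (lattice_point k) \<xi>) = of_bool (k = 0)"
proof -
  have "indicator unit_cube \<xi> *\<^sub>R wave (lattice_point k) \<xi> = (\<Prod>i\<in>UNIV. indicator {-1/2..<1/2} (\<xi> $ i) *\<^sub>R cis (2 * pi * of_int (k $ i) * \<xi> $ i))" for \<xi>
  proof (cases "\<xi> \<in> unit_cube")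
    case False
    then obtain i where "\<xi> $ i \<notin> {-1/2..<1/2}" by (auto simp: unit_cube_def)
    then show ?thesis using False by (subst prod_zero[OF finite]) (auto intro!: exI[of _ i] simp: indicator_def)
  qed (auto simp: wave_eq_prod unit_cube_def intro!: prod.cong)
  then have "(LINT \<xi>|lborel. indicator unit_cube \<xi> *\<^sub>R wave (lattice_point k) \<xi>)
    = (LINT \<xi>|lborel. (\<Prod>i\<in>UNIV. indicator {-1/2..<1/2} (\<xi> $ i) *\<^sub>R cis (2 * pi * of_int (k $ i) * \<xi> $ i)))"
    by (simp only:)
  also have "\<dots> = (\<Prod>i\<in>UNIV. LINT t|lborel. indicator {-1/2..<1/2} t *\<^sub>R cis (2 * pi * of_int (k $ i) * t))"
    by (rule integral_prod_coordinates) (rule integral_unit_interval_cis)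
  also have "\<dots> = (\<Prod>i\<in>UNIV. of_bool (k $ i = 0))"
    by (simp only: integral_unit_interval_cis)
  also have "\<dots> = of_bool (k = 0)" by (auto simp: vec_eq_iff)
  finally show ?thesis .
qed

lemma unit_cube_subset_cbox: "unit_cube \<subseteq> cbox (\<chi> i. - 1/2) (\<chi> i. 1/2)"
  by (auto simp: unit_cube_def mem_box_cart less_imp_le)

lemma emeasure_unit_cube_finite: "emeasure lborel (unit_cube :: (real^'n) set) < \<infinity>"
  by (rule le_less_trans[OF emeasure_mono[OF unit_cube_subset_cbox] emeasure_lborel_cbox_finite]) auto

text \<open>The volume is read off from the case k = 0 of the orthogonality relation.\<close>

lemma emeasure_unit_cube: "emeasure lborel (unit_cube :: (real^'n) set) = 1"
proof -
  have "complex_of_real (measure lborel (unit_cube :: (real^'n) set)) = 1"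
    using integral_unit_cube_wave[of "0 :: int^'n"] emeasure_unit_cube_finite[where 'n = 'n]
    by (simp add: scaleR_conv_of_real)
  then show ?thesis
    using emeasure_unit_cube_finite[where 'n = 'n] by (subst emeasure_eq_ennreal_measure) (auto simp: less_top)
qed

lemma integrable_unit_cube_bounded:
  fixes f :: "real^'n \<Rightarrow> 'b::{banach, second_countable_topology}"
  assumes "f \<in> borel_measurable borel" "\<And>x. norm (f x) \<le> B"
  shows "integrable lborel (\<lambda>x. indicator unit_cube x *\<^sub>R f x)"
proof (rule Bochner_Integration.integrable_bound)
  show "integrable lborel (\<lambda>x. indicator (unit_cube :: (real^'n) set) x * B)"
    using emeasure_unit_cube_finite by (intro integrable_mult_left) auto
  show "AE x in lborel. norm (indicator unit_cube x *\<^sub>R f x) \<le> norm (indicator unit_cube x * B)"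
    using assms(2) by (intro AE_I2) (auto simp: indicator_def intro: order_trans[OF _ abs_ge_self])
qed (use assms in measurable)

subsection \<open>Weights\<close>

text \<open>Domination by dyadic balls: on the ball of radius 2^m the weight contributes a multiple
  of 2^(-\<beta> m), the volume one of 2^(d m), and the geometric series converges since \<beta> >
  d.\<close>

lemma nn_integral_polynomial_weight_finite:
  assumes "\<beta> > real CARD('n)"
  shows "(\<integral>\<^sup>+x. ennreal ((1 + norm x) powr (- \<beta>)) \<partial>(lborel :: (real^'n) measure)) < \<infinity>"
proof -
  let ?d = "real CARD('n)"
  define r where "r = 2 powr (?d - \<beta>)"
  have r: "0 < r" "r < 1" using assms by (auto simp: r_def powr_less_one)
  let ?f = "\<lambda>m x. ennreal (2 powr \<beta> * (2 ^ m) powr (- \<beta>)) * indicator (ball 0 (2 ^ m)) (x::real^'n)"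
  have "(\<integral>\<^sup>+x. ennreal ((1 + norm x) powr (- \<beta>)) \<partial>(lborel :: (real^'n) measure)) \<le> (\<integral>\<^sup>+x. (\<Sum>m. ?f m x) \<partial>lborel)"
  proof (rule nn_integral_mono)
    fix x :: "real^'n"
    \<comment> \<open>The least exponent puts 1 + |x| between 2^m / 2 and 2^m; the lower bound
      explains the factor 2^\<beta> in \<open>?f\<close>.\<close>
    define m where "m = (LEAST m. 1 + norm x \<le> 2 ^ m)"
    have "\<exists>m. 1 + norm x \<le> 2 ^ m" using real_arch_pow[of 2 "1 + norm x"] by (auto intro: less_imp_le)
    then have m1: "1 + norm x \<le> 2 ^ m" unfolding m_def by (rule LeastI_ex)
    have m2: "2 ^ m \<le> 2 * (1 + norm x)"
    proof (cases m)
      case (Suc m')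
      then have "\<not> 1 + norm x \<le> 2 ^ m'" using not_less_Least[of m' "\<lambda>m. 1 + norm x \<le> 2 ^ m"] by (simp add: m_def)
      then show ?thesis using Suc by simp
    qed simp
    have "(1 + norm x) powr (- \<beta>) \<le> (2 ^ m / 2) powr (- \<beta>)"
      using m2 assms by (intro powr_mono2') (auto simp: add_nonneg_pos)
    also have "\<dots> = 2 powr \<beta> * (2 ^ m) powr (- \<beta>)"
      by (simp add: powr_divide powr_minus field_simps)
    finally have "ennreal ((1 + norm x) powr (- \<beta>)) \<le> ?f m x"
      using m1 by (auto simp: indicator_def intro!: ennreal_leI)
    also have "\<dots> = (\<Sum>k\<in>{m}. ?f k x)" by (simp only: sum.insert finite.emptyI sum.empty empty_iff not_False_eq_True add_0_right)
    also have "\<dots> \<le> (\<Sum>m. ?f m x)" by (rule sum_le_suminf) auto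
    finally show "ennreal ((1 + norm x) powr (- \<beta>)) \<le> (\<Sum>m. ?f m x)" .
  qed
  also have "\<dots> = (\<Sum>m. \<integral>\<^sup>+x. ?f m x \<partial>lborel)" 
    by (rule nn_integral_suminf, rule borel_measurable_times_ennreal, rule borel_measurable_const, rule borel_measurable_indicator) simp
  also have "\<dots> = (\<Sum>m. ennreal (2 powr \<beta> * unit_ball_vol ?d * r ^ m))"
  proof (intro suminf_cong)
    fix m
    have two: "(2::real) ^ m = 2 powr real m" by (rule powr_realpow[symmetric]) simp
    have "((2::real) ^ m) powr (- \<beta>) * (2 ^ m) ^ CARD('n) = (2 ^ m) powr (- \<beta>) * (2 ^ m) powr ?d"
      by (subst powr_realpow[of "2 ^ m" "CARD('n)"]) auto
    also have "\<dots> = (2 ^ m) powr (?d - \<beta>)"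
      by (simp flip: powr_add)
    also have "\<dots> = r powr real m"
      unfolding two r_def by (simp only: powr_powr mult.commute)
    also have "\<dots> = r ^ m" using r by (intro powr_realpow)
    finally have "((2::real) ^ m) powr (- \<beta>) * (2 ^ m) ^ CARD('n) = r ^ m" .
    then show "(\<integral>\<^sup>+x. ?f m x \<partial>lborel) = ennreal (2 powr \<beta> * unit_ball_vol ?d * r ^ m)"
    proof -
      assume *: "((2::real) ^ m) powr (- \<beta>) * (2 ^ m) ^ CARD('n) = r ^ m"
      have "(\<integral>\<^sup>+x. ?f m x \<partial>lborel) = ennreal (2 powr \<beta> * (2 ^ m) powr (- \<beta>)) * emeasure lborel (ball (0::real^'n) (2 ^ m))"
        by (rule nn_integral_cmult_indicator) simp
      also have "\<dots> = ennreal (2 powr \<beta> * (2 ^ m) powr (- \<beta>) * (unit_ball_vol ?d * (2 ^ m) ^ CARD('n)))"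
        by (subst emeasure_ball) (simp_all flip: ennreal_mult)
      also have "2 powr \<beta> * (2 ^ m) powr (- \<beta>) * (unit_ball_vol ?d * (2 ^ m) ^ CARD('n)) = 2 powr \<beta> * unit_ball_vol ?d * r ^ m"
        unfolding *[symmetric] by (simp only: mult_ac)
      finally show ?thesis .
    qed
  qed
  also have "\<dots> < \<infinity>"
  proof -
    have "summable (\<lambda>m. 2 powr \<beta> * unit_ball_vol ?d * r ^ m)"
      using r by (intro summable_mult summable_geometric) auto
    then show ?thesis using r by (subst suminf_ennreal2) auto
  qed
  finally show ?thesis .
qed

lemma norm_unit_cube_le: "x \<in> unit_cube \<Longrightarrow> norm x \<le> real CARD('n)" for x :: "real^'n"
proof -
  assume x: "x \<in> unit_cube"
  have "norm x \<le> (\<Sum>i\<in>UNIV. \<bar>x $ i\<bar>)" by (rule norm_le_l1_cart)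
  also have "\<dots> \<le> (\<Sum>i\<in>(UNIV::'n set). 1)"
  proof (rule sum_mono)
    fix i
    have "- 1/2 \<le> x $ i \<and> x $ i < 1/2" using x by (simp add: unit_cube_def)
    then show "\<bar>x $ i\<bar> \<le> 1" by linarith
  qed
  finally show ?thesis by simp
qed

text \<open>The sum is compared with the integral: moving the argument by a point of the unit cube,
  whose norm is at most d, changes the weight by a factor of at most (1+d)^\<beta>. Averaging over
  the cube and unfolding leaves the integral over the space, which no longer depends on
  \<open>x\<close>.\<close>

lemma lattice_weight_sum_bound:
  assumes "\<beta> > real CARD('n)"
  obtains W where "W > 0"
    "\<And>x::real^'n. (\<integral>\<^sup>+l. ennreal ((1 + norm (x + lattice_point l)) powr (- \<beta>)) \<partial>count_space UNIV) \<le> ennreal W"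
proof -
  let ?d = "real CARD('n)"
  let ?w = "\<lambda>x::real^'n. (1 + norm x) powr (- \<beta>)"
  define V where "V = (1 + ?d) powr \<beta> * enn2real (\<integral>\<^sup>+x. ennreal (?w x) \<partial>lborel)"
  have V: "ennreal ((1 + ?d) powr \<beta>) * (\<integral>\<^sup>+x. ennreal (?w x) \<partial>lborel) = ennreal V"
    using nn_integral_polynomial_weight_finite[OF assms] by (simp add: V_def ennreal_mult less_top)
  have "(\<integral>\<^sup>+l. ennreal (?w (x + lattice_point l)) \<partial>count_space UNIV) \<le> ennreal V" for x
  proof -
    have pt: "?w y \<le> (1 + ?d) powr \<beta> * ?w (y + z)" if "z \<in> unit_cube" for y z
    proof -
      have "1 + norm (y + z) \<le> (1 + norm y) + ?d"
        using norm_triangle_ineq[of y z] norm_unit_cube_le[OF that] by linarith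
      also have "\<dots> \<le> (1 + ?d) * (1 + norm y)" by (simp add: algebra_simps)
      finally have "((1 + ?d) * (1 + norm y)) powr (- \<beta>) \<le> ?w (y + z)"
        using assms by (intro powr_mono2') (auto simp: add_pos_nonneg)
      then have "(1 + ?d) powr \<beta> * ((1 + ?d) * (1 + norm y)) powr (- \<beta>) \<le> (1 + ?d) powr \<beta> * ?w (y + z)"
        by (intro mult_left_mono) auto
      also have "(1 + ?d) powr \<beta> * ((1 + ?d) * (1 + norm y)) powr (- \<beta>) = ?w y"
        by (simp add: powr_mult powr_minus)
      finally show ?thesis .
    qed
    have "(\<integral>\<^sup>+l. ennreal (?w (x + lattice_point l)) \<partial>count_space UNIV)
        = (\<integral>\<^sup>+z. (\<integral>\<^sup>+l. ennreal (?w (x + lattice_point l)) \<partial>count_space UNIV) * indicator (unit_cube :: (real^'n) set) z \<partial>lborel)"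
      by (subst nn_integral_cmult_indicator) (auto simp: emeasure_unit_cube)
    also have "\<dots> \<le> (\<integral>\<^sup>+z. (\<integral>\<^sup>+l. ennreal ((1 + ?d) powr \<beta> * ?w (x + (z + lattice_point l))) \<partial>count_space UNIV) * indicator unit_cube z \<partial>lborel)"
    proof (rule nn_integral_mono)
      fix z :: "real^'n"
      show "(\<integral>\<^sup>+l. ennreal (?w (x + lattice_point l)) \<partial>count_space UNIV) * indicator unit_cube z
        \<le> (\<integral>\<^sup>+l. ennreal ((1 + ?d) powr \<beta> * ?w (x + (z + lattice_point l))) \<partial>count_space UNIV) * indicator unit_cube z"
      proof (cases "z \<in> unit_cube")
        case True
        then show ?thesis using pt[OF True, of "x + lattice_point l" for l]
          by (auto intro!: nn_integral_mono ennreal_leI simp: add_ac)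
      qed simp
    qed
    also have "\<dots> = (\<integral>\<^sup>+z. ennreal ((1 + ?d) powr \<beta> * ?w (x + z)) \<partial>lborel)"
      by (rule nn_integral_tiling[symmetric]) measurable
    also have "\<dots> = (\<integral>\<^sup>+z. ennreal ((1 + ?d) powr \<beta> * ?w z) \<partial>lborel)"
      by (rule nn_integral_lborel_translate) measurable
    also have "\<dots> = ennreal V"
      by (simp add: ennreal_mult nn_integral_cmult V)
    finally show ?thesis .
  qed
  \<comment> \<open>Adding one secures strict positivity, which Hoelder's inequality below asks of
    its second bound.\<close>
  moreover have "ennreal V \<le> ennreal (\<bar>V\<bar> + 1)" by (intro ennreal_leI) auto
  ultimately show thesis by (intro that[of "\<bar>V\<bar> + 1"]) (auto intro: order_trans)
qed

subsection \<open>Hausdorff-Young inequality for periodized functions\<close>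

text \<open>Young's inequality, integrated after normalising both functions. It is stated with upper
  bounds \<open>a\<close> and \<open>b\<close> in place of the integrals; a = 0 forces f = 0 almost
  everywhere and is separate because it cannot be normalised.\<close>

lemma nn_integral_Hoelder:
  fixes f g :: "'a \<Rightarrow> real"
  assumes pq: "p > 1" "q > 1" "1 / p + 1 / q = 1"
    and [measurable]: "f \<in> borel_measurable M" "g \<in> borel_measurable M"
    and nonneg: "\<And>x. f x \<ge> 0" "\<And>x. g x \<ge> 0"
    and a: "a \<ge> 0" "(\<integral>\<^sup>+x. ennreal (f x powr q) \<partial>M) \<le> ennreal a"
    and b: "b > 0" "(\<integral>\<^sup>+x. ennreal (g x powr p) \<partial>M) \<le> ennreal b"
  shows "(\<integral>\<^sup>+x. ennreal (f x * g x) \<partial>M) \<le> ennreal (a powr (1 / q) * b powr (1 / p))"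
proof (cases "a = 0")
  case True
  then have "(\<integral>\<^sup>+x. ennreal (f x powr q) \<partial>M) = 0" using a by simp
  then have "AE x in M. ennreal (f x powr q) = 0" by (subst (asm) nn_integral_0_iff_AE) auto
  then have "AE x in M. ennreal (f x * g x) = 0" using nonneg by (auto elim!: eventually_mono)
  then have "(\<integral>\<^sup>+x. ennreal (f x * g x) \<partial>M) = 0" by (subst nn_integral_0_iff_AE) auto
  then show ?thesis by simp
next
  case False
  then have a0: "a > 0" using a by simp
  define \<alpha> \<beta> where "\<alpha> = a powr (1 / q)" and "\<beta> = b powr (1 / p)"
  have pos: "\<alpha> > 0" "\<beta> > 0" using a0 b by (auto simp: \<alpha>_def \<beta>_def)
  have \<alpha>q: "\<alpha> powr q = a" and \<beta>p: "\<beta> powr p = b" using a0 b pq by (auto simp: \<alpha>_def \<beta>_def powr_powr)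
  have "(\<integral>\<^sup>+x. ennreal (f x * g x) \<partial>M) \<le> (\<integral>\<^sup>+x. ennreal (\<alpha> * \<beta> / q / a) * ennreal (f x powr q) + ennreal (\<alpha> * \<beta> / p / b) * ennreal (g x powr p) \<partial>M)"
  proof (rule nn_integral_mono)
    fix x
    have "(g x / \<beta>) * (f x / \<alpha>) \<le> (g x / \<beta>) powr p / p + (f x / \<alpha>) powr q / q"
      using pq nonneg[of x] pos by (intro Youngs_inequality) auto
    also have "\<dots> = g x powr p / b / p + f x powr q / a / q"
      using nonneg[of x] pos by (simp add: powr_divide \<alpha>q \<beta>p)
    finally have "\<alpha> * \<beta> * ((g x / \<beta>) * (f x / \<alpha>)) \<le> \<alpha> * \<beta> * (g x powr p / b / p + f x powr q / a / q)"
      using pos by (intro mult_left_mono) auto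
    then have "f x * g x \<le> (\<alpha> * \<beta> / q / a) * f x powr q + (\<alpha> * \<beta> / p / b) * g x powr p"
      using pos by (simp add: field_simps)
    then have "ennreal (f x * g x) \<le> ennreal ((\<alpha> * \<beta> / q / a) * f x powr q + (\<alpha> * \<beta> / p / b) * g x powr p)"
      by (rule ennreal_leI)
    also have "\<dots> = ennreal (\<alpha> * \<beta> / q / a) * ennreal (f x powr q) + ennreal (\<alpha> * \<beta> / p / b) * ennreal (g x powr p)"
      using pos a0 b pq by (subst ennreal_plus) (auto simp flip: ennreal_mult)
    finally show "ennreal (f x * g x) \<le> \<dots>" .
  qed
  also have "\<dots> = ennreal (\<alpha> * \<beta> / q / a) * (\<integral>\<^sup>+x. ennreal (f x powr q) \<partial>M) + ennreal (\<alpha> * \<beta> / p / b) * (\<integral>\<^sup>+x. ennreal (g x powr p) \<partial>M)"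
    by (subst nn_integral_add) (auto simp: nn_integral_cmult)
  also have "\<dots> \<le> ennreal (\<alpha> * \<beta> / q / a) * ennreal a + ennreal (\<alpha> * \<beta> / p / b) * ennreal b"
    by (intro add_mono mult_left_mono a b) auto
  also have "\<dots> = ennreal (\<alpha> * \<beta> / q + \<alpha> * \<beta> / p)"
    using pos a0 b pq by (simp flip: ennreal_mult ennreal_plus)
  also have "\<alpha> * \<beta> / q + \<alpha> * \<beta> / p = \<alpha> * \<beta> * (1 / p + 1 / q)" by (simp add: field_simps)
  finally show ?thesis using pq by (simp add: \<alpha>_def \<beta>_def)
qed

text \<open>No integrability is assumed, since the integral of a non-integrable function is 0 by
  convention.\<close>

lemma ennreal_norm_integral_le:
  fixes f :: "'a \<Rightarrow> 'b::{banach, second_countable_topology}"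
  shows "ennreal (norm (integral\<^sup>L M f)) \<le> (\<integral>\<^sup>+x. ennreal (norm (f x)) \<partial>M)"
proof (cases "integrable M f")
  case True
  then show ?thesis by (rule integral_norm_bound_ennreal)
qed (simp add: not_integrable_integral_eq)

text \<open>Unfolding against a periodic factor. The periodization of \<open>v\<close> itself is
  never formed; only a majorant \<open>R\<close> of the fibre sums of |v| is used.\<close>

lemma nn_integral_le_periodized:
  fixes v :: "real^'n \<Rightarrow> complex" and R T :: "real^'n \<Rightarrow> real"
  assumes [measurable]: "v \<in> borel_measurable borel" "T \<in> borel_measurable borel"
    and per: "\<And>x l. T (x + lattice_point l) = T x" and T0: "\<And>x. T x \<ge> 0"
    and R: "AE x in lborel. x \<in> unit_cube \<longrightarrow> (\<integral>\<^sup>+l. ennreal (norm (v (x + lattice_point l))) \<partial>count_space UNIV) \<le> ennreal (R x)"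
  shows "(\<integral>\<^sup>+x. ennreal (norm (v x) * T x) \<partial>lborel) \<le> (\<integral>\<^sup>+x. ennreal (R x) * ennreal (T x) * indicator unit_cube x \<partial>lborel)"
proof -
  have "(\<integral>\<^sup>+x. ennreal (norm (v x) * T x) \<partial>lborel)
    = (\<integral>\<^sup>+x. (\<integral>\<^sup>+l. ennreal (norm (v (x + lattice_point l))) * ennreal (T x) \<partial>count_space UNIV) * indicator unit_cube x \<partial>lborel)"
    by (subst nn_integral_tiling) (auto simp: per ennreal_mult T0)
  also have "\<dots> \<le> (\<integral>\<^sup>+x. ennreal (R x) * ennreal (T x) * indicator unit_cube x \<partial>lborel)"
  proof (rule nn_integral_mono_AE)
    show "AE x in lborel. (\<integral>\<^sup>+l. ennreal (norm (v (x + lattice_point l))) * ennreal (T x) \<partial>count_space UNIV) * indicator unit_cube x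
        \<le> ennreal (R x) * ennreal (T x) * indicator unit_cube x"
      using R by eventually_elim (auto simp: nn_integral_multc indicator_def intro!: mult_right_mono)
  qed
  finally show ?thesis .
qed

text \<open>The integrals are the Fourier coefficients of the periodization of \<open>v\<close>.
  Pairing \<open>v\<close> with the polynomial \<open>T\<close> whose coefficients are the
  conjugates of the \<open>c k\<close> gives X = \<integral> v T, at most \<integral> R |T| over the
  cube. Half of \<integral> |T|^2 = X is then absorbed.\<close>

lemma Bessel_periodized:
  fixes v :: "real^'n \<Rightarrow> complex" and R :: "real^'n \<Rightarrow> real"
  assumes v: "integrable lborel v" and [measurable]: "R \<in> borel_measurable borel" and R0: "\<And>x. R x \<ge> 0"
    and R: "AE x in lborel. x \<in> unit_cube \<longrightarrow> (\<integral>\<^sup>+l. ennreal (norm (v (x + lattice_point l))) \<partial>count_space UNIV) \<le> ennreal (R x)"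
    and A: "finite A"
  shows "ennreal (\<Sum>k\<in>A. (norm (LINT \<xi>|lborel. v \<xi> * wave (lattice_point k) \<xi>))\<^sup>2) \<le> (\<integral>\<^sup>+x. ennreal ((R x)\<^sup>2) * indicator unit_cube x \<partial>lborel)"
proof -
  have [measurable]: "v \<in> borel_measurable borel" using v by (simp add: borel_measurable_integrable[simplified])
  define c where "c k = (LINT \<xi>|lborel. v \<xi> * wave (lattice_point k) \<xi>)" for k
  define T where "T \<xi> = (\<Sum>k\<in>A. cnj (c k) * wave (lattice_point k) \<xi>)" for \<xi>
  define X where "X = (\<Sum>k\<in>A. (norm (c k))\<^sup>2)"
  have X0: "X \<ge> 0" unfolding X_def by (intro sum_nonneg) auto
  have [measurable]: "T \<in> borel_measurable borel" unfolding T_def by measurable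
  have Tper: "T (x + lattice_point l) = T x" for x l by (simp add: T_def wave_lattice_periodic)
  have vw: "integrable lborel (\<lambda>\<xi>. v \<xi> * wave (lattice_point k) \<xi>)" for k
    by (rule Bochner_Integration.integrable_bound[OF v]) (auto simp: norm_mult)
  have "complex_of_real X = (\<Sum>k\<in>A. cnj (c k) * c k)"
    unfolding X_def of_real_sum by (intro sum.cong refl) (simp only: complex_norm_square mult.commute)
  also have "\<dots> = (\<Sum>k\<in>A. LINT \<xi>|lborel. cnj (c k) * (v \<xi> * wave (lattice_point k) \<xi>))"
    unfolding c_def by simp
  also have "\<dots> = (LINT \<xi>|lborel. (\<Sum>k\<in>A. cnj (c k) * (v \<xi> * wave (lattice_point k) \<xi>)))"
    by (rule Bochner_Integration.integral_sum[symmetric]) (intro integrable_mult_right vw)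
  also have "\<dots> = (LINT \<xi>|lborel. v \<xi> * T \<xi>)"
    by (intro Bochner_Integration.integral_cong refl) (simp add: T_def sum_distrib_left mult_ac)
  finally have "ennreal X = ennreal (norm (LINT \<xi>|lborel. v \<xi> * T \<xi>))"
    using X0 by (metis abs_of_nonneg norm_of_real)
  also have "\<dots> \<le> (\<integral>\<^sup>+x. ennreal (norm (v x) * norm (T x)) \<partial>lborel)"
    using ennreal_norm_integral_le[of lborel "\<lambda>\<xi>. v \<xi> * T \<xi>"] by (simp add: norm_mult)
  also have "\<dots> \<le> (\<integral>\<^sup>+x. ennreal (R x) * ennreal (norm (T x)) * indicator unit_cube x \<partial>lborel)"
    using R by (intro nn_integral_le_periodized) (auto simp: Tper)
  also have "\<dots> \<le> (\<integral>\<^sup>+x. ennreal (1/2) * (ennreal ((R x)\<^sup>2) * indicator unit_cube x) + ennreal (1/2) * (ennreal ((norm (T x))\<^sup>2) * indicator unit_cube x) \<partial>lborel)"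
  proof (rule nn_integral_mono)
    fix x
    have "R x * norm (T x) \<le> 1/2 * (R x)\<^sup>2 + 1/2 * (norm (T x))\<^sup>2"
      using sum_squares_bound[of "R x" "norm (T x)"] by simp
    then have "ennreal (R x * norm (T x)) \<le> ennreal (1/2 * (R x)\<^sup>2 + 1/2 * (norm (T x))\<^sup>2)"
      by (rule ennreal_leI)
    also have "\<dots> = ennreal (1/2) * ennreal ((R x)\<^sup>2) + ennreal (1/2) * ennreal ((norm (T x))\<^sup>2)"
      by (subst ennreal_plus) (auto simp only: ennreal_mult' zero_le_power2 intro!: mult_nonneg_nonneg)
    finally show "ennreal (R x) * ennreal (norm (T x)) * indicator unit_cube x \<le>
       ennreal (1/2) * (ennreal ((R x)\<^sup>2) * indicator unit_cube x) + ennreal (1/2) * (ennreal ((norm (T x))\<^sup>2) * indicator unit_cube x)"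
      by (auto simp: indicator_def ennreal_mult R0)
  qed
  also have "\<dots> = ennreal (1/2) * (\<integral>\<^sup>+x. ennreal ((R x)\<^sup>2) * indicator unit_cube x \<partial>lborel) + ennreal (1/2) * (\<integral>\<^sup>+x. ennreal ((norm (T x))\<^sup>2) * indicator unit_cube x \<partial>lborel)"
    by (subst nn_integral_add) (auto simp: nn_integral_cmult)
  also have "(\<integral>\<^sup>+x. ennreal ((norm (T x))\<^sup>2) * indicator unit_cube x \<partial>lborel) = ennreal X"
  proof -
    let ?S = "\<lambda>x. \<Sum>k\<in>A. \<Sum>l\<in>A. (cnj (c k) * c l) * (indicator unit_cube x *\<^sub>R wave (lattice_point (k - l)) x)"
    have iw: "integrable lborel (\<lambda>x. indicator unit_cube x *\<^sub>R wave (lattice_point k) x)" for k :: "int^'n"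
      by (rule integrable_unit_cube_bounded[of _ 1]) auto
    have S: "?S x = complex_of_real (indicator unit_cube x * (norm (T x))\<^sup>2)" for x
    proof -
      have "complex_of_real ((norm (T x))\<^sup>2) = T x * cnj (T x)" by (rule complex_norm_square)
      also have "\<dots> = (\<Sum>k\<in>A. \<Sum>l\<in>A. (cnj (c k) * c l) * wave (lattice_point (k - l)) x)"
        unfolding T_def cnj_sum sum_product
        by (intro sum.cong refl) (simp add: lattice_point_diff wave_add_left[of _ "- lattice_point _", simplified] wave_minus_left mult_ac)
      finally show ?thesis by (auto simp: indicator_def)
    qed
    have iS: "integrable lborel ?S" by (intro Bochner_Integration.integrable_sum integrable_mult_right iw)
    have "(LINT x|lborel. ?S x) = (\<Sum>k\<in>A. LINT x|lborel. (\<Sum>l\<in>A. (cnj (c k) * c l) * (indicator unit_cube x *\<^sub>R wave (lattice_point (k - l)) x)))"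
      by (rule Bochner_Integration.integral_sum) (intro Bochner_Integration.integrable_sum integrable_mult_right iw)
    also have "\<dots> = (\<Sum>k\<in>A. \<Sum>l\<in>A. LINT x|lborel. (cnj (c k) * c l) * (indicator unit_cube x *\<^sub>R wave (lattice_point (k - l)) x))"
      by (intro sum.cong refl Bochner_Integration.integral_sum integrable_mult_right iw)
    also have "\<dots> = (\<Sum>k\<in>A. \<Sum>l\<in>A. (cnj (c k) * c l) * of_bool (k - l = 0))"
      by (simp only: integral_mult_right_zero integral_unit_cube_wave)
    also have "\<dots> = (\<Sum>k\<in>A. cnj (c k) * c k)" using A by simp
    also have "\<dots> = complex_of_real X"
      unfolding X_def of_real_sum by (intro sum.cong refl) (simp only: complex_norm_square mult.commute)
    finally have eq: "(LINT x|lborel. complex_of_real (indicator unit_cube x * (norm (T x))\<^sup>2)) = complex_of_real X"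
      unfolding S .
    have "integrable lborel (\<lambda>x. complex_of_real (indicator unit_cube x * (norm (T x))\<^sup>2))"
      using iS unfolding S .
    then have i: "integrable lborel (\<lambda>x. indicator unit_cube x * (norm (T x))\<^sup>2)"
      by (simp only: complex_of_real_integrable_eq)
    have "(LINT x|lborel. indicator unit_cube x * (norm (T x))\<^sup>2) = X"
      using eq by (simp only: integral_complex_of_real of_real_eq_iff)
    moreover have "(\<integral>\<^sup>+x. ennreal ((norm (T x))\<^sup>2) * indicator unit_cube x \<partial>lborel) = (\<integral>\<^sup>+x. ennreal (indicator unit_cube x * (norm (T x))\<^sup>2) \<partial>lborel)"
      by (intro nn_integral_cong) (auto simp: indicator_def)
    ultimately show ?thesis using nn_integral_eq_integral[OF i] by simp
  qed
  finally have main: "ennreal X \<le> ennreal (1/2) * (\<integral>\<^sup>+x. ennreal ((R x)\<^sup>2) * indicator unit_cube x \<partial>lborel) + ennreal (1/2) * ennreal X" .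
  show ?thesis
  \<comment> \<open>If the integral of R^2 is infinite nothing is claimed; otherwise all terms are
    real and \<open>X\<close> can be subtracted.\<close>
  proof (cases "(\<integral>\<^sup>+x. ennreal ((R x)\<^sup>2) * indicator unit_cube x \<partial>lborel)")
    case (real y)
    have half: "ennreal (1/2) * ennreal z = ennreal (1/2 * z)" if "z \<ge> 0" for z
      using that by (intro ennreal_mult[symmetric]) auto
    have "ennreal X \<le> ennreal (1/2 * y) + ennreal (1/2 * X)"
      using main unfolding real half[OF real(1)] half[OF X0] .
    also have "\<dots> = ennreal (1/2 * y + 1/2 * X)"
      using X0 real(1) by (intro ennreal_plus[symmetric]) auto
    finally have "X \<le> 1/2 * y + 1/2 * X" using X0 real(1) by (subst (asm) ennreal_le_iff) auto
    then show ?thesis using real by (simp add: X_def c_def ennreal_leI)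
  qed simp
qed

text \<open>At height t the function is cut where the periodic majorant \<open>P\<close> is large,
  so the cut commutes with periodization. The large part contributes at most t/2 to every
  coefficient, hence coefficients above t live on the small part, where Bessel applies. The cases B
  = 0 and p = 2 are separate because the argument divides by B and by p - 2.\<close>

lemma Hausdorff_Young_periodized:
  fixes v :: "real^'n \<Rightarrow> complex" and P :: "real^'n \<Rightarrow> real"
  assumes pq: "p \<ge> 2" "1 / p + 1 / q = 1"
    and v: "integrable lborel v" and [measurable]: "P \<in> borel_measurable borel" and P0: "\<And>x. P x \<ge> 0"
    and per: "\<And>x l. P (x + lattice_point l) = P x"
    and dom: "AE x in lborel. x \<in> unit_cube \<longrightarrow> (\<integral>\<^sup>+l. ennreal (norm (v (x + lattice_point l))) \<partial>count_space UNIV) \<le> ennreal (P x)"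
    and B: "B \<ge> 0" "(\<integral>\<^sup>+x. ennreal (P x powr q) * indicator unit_cube x \<partial>lborel) \<le> ennreal B"
    and A: "finite A"
  shows "(\<Sum>k\<in>A. norm (LINT \<xi>|lborel. v \<xi> * wave (lattice_point k) \<xi>) powr p) \<le> 2 powr p * B powr (p - 1)"
proof -
  have [measurable]: "v \<in> borel_measurable borel" using v by (simp add: borel_measurable_integrable[simplified])
  define c where "c k = norm (LINT \<xi>|lborel. v \<xi> * wave (lattice_point k) \<xi>)" for k
  have q: "q > 1" "q = p / (p - 1)"
  proof -
    have "q \<noteq> 0" using pq by (cases "q = 0") auto
    then show eq: "q = p / (p - 1)" using pq by (simp add: field_simps)
    show "q > 1" unfolding eq using pq by (simp add: less_divide_eq)
  qed
  have Bes: "ennreal (\<Sum>k\<in>A. (c k)\<^sup>2) \<le> (\<integral>\<^sup>+x. ennreal ((P x)\<^sup>2) * indicator unit_cube x \<partial>lborel)"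
    unfolding c_def by (rule Bessel_periodized[OF v _ P0 dom A]) measurable
  consider "B = 0" | "B > 0" "p = 2" | "B > 0" "p > 2" using B pq by fastforce
  then show ?thesis
  proof cases
    case 1
    then have "(\<integral>\<^sup>+x. ennreal (P x powr q) * indicator unit_cube x \<partial>lborel) = 0" using B by simp
    then have "AE x in lborel. ennreal (P x powr q) * indicator unit_cube x = 0"
      by (subst (asm) nn_integral_0_iff_AE) auto
    then have "AE x in lborel. ennreal ((P x)\<^sup>2) * indicator unit_cube x = 0"
      by eventually_elim (auto simp: indicator_def)
    then have "(\<integral>\<^sup>+x. ennreal ((P x)\<^sup>2) * indicator unit_cube x \<partial>lborel) = 0"
      by (subst nn_integral_0_iff_AE) auto
    with Bes have "(\<Sum>k\<in>A. (c k)\<^sup>2) \<le> 0" by (simp add: ennreal_eq_0_iff)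
    then have "\<forall>k\<in>A. c k = 0"
      using A by (metis (no_types, lifting) order_antisym sum_nonneg sum_nonneg_eq_0_iff zero_le_power2 zero_eq_power2)
    then have "(\<Sum>k\<in>A. c k powr p) = 0" by simp
    then show ?thesis unfolding c_def[symmetric] by simp
  next
    case 2
    then have "q = 2" using q by simp
    then have "(\<integral>\<^sup>+x. ennreal ((P x)\<^sup>2) * indicator unit_cube x \<partial>lborel) \<le> ennreal B"
      using B P0 by simp
    with Bes have "ennreal (\<Sum>k\<in>A. (c k)\<^sup>2) \<le> ennreal B" by (rule order_trans)
    then have "(\<Sum>k\<in>A. (c k)\<^sup>2) \<le> B" using B by (simp add: ennreal_le_iff)
    also have "\<dots> \<le> 2 powr p * B powr (p - 1)" using 2 by simp
    finally show ?thesis unfolding c_def[symmetric] using 2 by (simp add: c_def)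
  next
    case 3
    define s where "s = p - 2"
    have s: "s > 0" "p = 2 + s" using 3 by (auto simp: s_def)
    \<comment> \<open>Four times the Bessel bound for the part of \<open>v\<close> on which
      \<open>P\<close> stays below the threshold for height t.\<close>
    define \<Phi> where "\<Phi> t = (\<integral>\<^sup>+x. ennreal (4 * (P x)\<^sup>2) * indicator {x. t * P x powr (q - 1) \<le> 2 * B} x * indicator unit_cube x \<partial>lborel)" for t
    have "ennreal (\<Sum>k\<in>A. c k powr (2 + s)) \<le> (\<integral>\<^sup>+u. \<Phi> (u powr (1 / s)) * indicator {0<..} u \<partial>lborel)"
    proof (rule sum_powr_layer_cake[OF A s(1)])
      fix t :: real assume t: "t > 0"
      define S where "S = {x. t * P x powr (q - 1) \<le> 2 * B}"
      have [measurable]: "S \<in> sets borel" unfolding S_def by measurable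
      have Sper: "x + lattice_point l \<in> S \<longleftrightarrow> x \<in> S" for x l by (simp add: S_def per)
      define v1 v2 where "v1 x = indicator (- S) x *\<^sub>R v x" and "v2 x = indicator S x *\<^sub>R v x" for x
      have v1: "integrable lborel v1" and v2: "integrable lborel v2"
        unfolding v1_def v2_def by (intro integrable_mult_indicator v; simp)+
      define c2 where "c2 k = norm (LINT \<xi>|lborel. v2 \<xi> * wave (lattice_point k) \<xi>)" for k
      have c1: "norm (LINT \<xi>|lborel. v1 \<xi> * wave (lattice_point k) \<xi>) \<le> t / 2" for k
      proof -
        have "ennreal (norm (LINT \<xi>|lborel. v1 \<xi> * wave (lattice_point k) \<xi>)) \<le> (\<integral>\<^sup>+x. ennreal (norm (v x) * indicator (- S) x) \<partial>lborel)"
          using ennreal_norm_integral_le[of lborel "\<lambda>\<xi>. v1 \<xi> * wave (lattice_point k) \<xi>"]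
          by (simp add: norm_mult v1_def mult.commute)
        also have "\<dots> \<le> (\<integral>\<^sup>+x. ennreal (P x) * ennreal (indicator (- S) x) * indicator unit_cube x \<partial>lborel)"
          using dom by (intro nn_integral_le_periodized) (auto simp: indicator_def Sper)
        also have "\<dots> \<le> (\<integral>\<^sup>+x. ennreal (t / (2 * B)) * (ennreal (P x powr q) * indicator unit_cube x) \<partial>lborel)"
        proof (rule nn_integral_mono)
          fix x
          \<comment> \<open>Off \<open>S\<close> the factor P^(q-1) exceeds 2B/t, so P is at most
            t/(2B) times P^q, whose integral is at most B.\<close>
          have "P x \<le> t / (2 * B) * P x powr q" if "x \<notin> S"
          proof -
            from that have big: "2 * B < t * P x powr (q - 1)" by (simp add: S_def)
            have "P x * (2 * B) \<le> P x * (t * P x powr (q - 1))"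
              using big P0[of x] by (intro mult_left_mono) auto
            also have "\<dots> = t * P x powr q"
              using P0[of x] by (cases "P x = 0") (auto simp: powr_diff)
            finally show ?thesis using 3 by (simp add: field_simps)
          qed
          then show "ennreal (P x) * ennreal (indicator (- S) x) * indicator unit_cube x \<le> ennreal (t / (2 * B)) * (ennreal (P x powr q) * indicator unit_cube x)"
            using t 3 by (auto simp: indicator_def simp flip: ennreal_mult intro!: ennreal_leI)
        qed
        also have "\<dots> = ennreal (t / (2 * B)) * (\<integral>\<^sup>+x. ennreal (P x powr q) * indicator unit_cube x \<partial>lborel)"
          by (rule nn_integral_cmult) measurable
        also have "\<dots> \<le> ennreal (t / (2 * B)) * ennreal B"
          by (intro mult_left_mono B) auto
        also have "\<dots> = ennreal (t / 2)" using t 3 by (simp flip: ennreal_mult)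
        finally show ?thesis using t by (simp add: ennreal_le_iff)
      qed
      have split: "c k \<le> t / 2 + c2 k" for k
      proof -
        have i: "integrable lborel (\<lambda>\<xi>. v' \<xi> * wave (lattice_point k) \<xi>)" if "integrable lborel v'" for v' :: "real^'n \<Rightarrow> complex"
        proof (rule Bochner_Integration.integrable_bound[OF that])
          have [measurable]: "v' \<in> borel_measurable borel" using that by (simp add: borel_measurable_integrable[simplified])
          show "(\<lambda>\<xi>. v' \<xi> * wave (lattice_point k) \<xi>) \<in> borel_measurable lborel" by measurable
        qed (auto simp: norm_mult)
        have "(LINT \<xi>|lborel. v \<xi> * wave (lattice_point k) \<xi>) = (LINT \<xi>|lborel. v1 \<xi> * wave (lattice_point k) \<xi> + v2 \<xi> * wave (lattice_point k) \<xi>)"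
          by (intro Bochner_Integration.integral_cong) (auto simp: v1_def v2_def indicator_def)
        also have "\<dots> = (LINT \<xi>|lborel. v1 \<xi> * wave (lattice_point k) \<xi>) + (LINT \<xi>|lborel. v2 \<xi> * wave (lattice_point k) \<xi>)"
          by (intro Bochner_Integration.integral_add i v1 v2)
        finally have "c k \<le> norm (LINT \<xi>|lborel. v1 \<xi> * wave (lattice_point k) \<xi>) + c2 k"
          unfolding c_def c2_def by (simp add: norm_triangle_ineq)
        then show ?thesis using c1[of k] by linarith
      qed
      have "(\<Sum>k\<in>{k\<in>A. c k > t}. (c k)\<^sup>2) \<le> (\<Sum>k\<in>{k\<in>A. c k > t}. 4 * (c2 k)\<^sup>2)"
      proof (rule sum_mono)
        fix k assume "k \<in> {k\<in>A. c k > t}"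
        then have "c k \<le> 2 * c2 k" using split[of k] by auto
        then have "(c k)\<^sup>2 \<le> (2 * c2 k)\<^sup>2" by (intro power_mono) (auto simp: c_def)
        then show "(c k)\<^sup>2 \<le> 4 * (c2 k)\<^sup>2" by (simp add: power_mult_distrib)
      qed
      also have "\<dots> = 4 * (\<Sum>k\<in>{k\<in>A. c k > t}. (c2 k)\<^sup>2)" by (simp add: sum_distrib_left)
      finally have "ennreal (\<Sum>k\<in>{k\<in>A. c k > t}. (c k)\<^sup>2) \<le> ennreal (4 * (\<Sum>k\<in>{k\<in>A. c k > t}. (c2 k)\<^sup>2))"
        by (rule ennreal_leI)
      also have "\<dots> = 4 * ennreal (\<Sum>k\<in>{k\<in>A. c k > t}. (c2 k)\<^sup>2)"
        by (subst ennreal_mult') auto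
      also have "\<dots> \<le> 4 * (\<integral>\<^sup>+x. ennreal ((P x * indicator S x)\<^sup>2) * indicator unit_cube x \<partial>lborel)"
        unfolding c2_def
      proof (intro mult_left_mono Bessel_periodized v2)
        show "AE x in lborel. x \<in> unit_cube \<longrightarrow> (\<integral>\<^sup>+l. ennreal (norm (v2 (x + lattice_point l))) \<partial>count_space UNIV) \<le> ennreal (P x * indicator S x)"
          using dom by eventually_elim (auto simp: v2_def indicator_def Sper)
      qed (use P0 A in auto)
      also have "\<dots> = \<Phi> t"
        unfolding \<Phi>_def S_def[symmetric]
        by (subst nn_integral_cmult[symmetric]) (auto simp: indicator_def ennreal_mult' intro!: nn_integral_cong)
      finally show "ennreal (\<Sum>k\<in>{k\<in>A. c k > t}. (c k)\<^sup>2) \<le> \<Phi> t" .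
    qed (simp add: c_def)
    also have "\<dots> = (\<integral>\<^sup>+u. (\<integral>\<^sup>+x. (ennreal (4 * (P x)\<^sup>2) * indicator unit_cube x) * indicator {z. u powr (1 / s) * P z powr (q - 1) \<le> 2 * B} x * indicator {0<..} u \<partial>lborel) \<partial>lborel)"
      unfolding \<Phi>_def
      by (intro nn_integral_cong) (auto simp: indicator_def intro!: nn_integral_cong)
    also have "\<dots> = (\<integral>\<^sup>+x. (\<integral>\<^sup>+u. (ennreal (4 * (P x)\<^sup>2) * indicator unit_cube x) * indicator {z. u powr (1 / s) * P z powr (q - 1) \<le> 2 * B} x * indicator {0<..} u \<partial>lborel) \<partial>lborel)"
    proof (rule lborel_pair.Fubini')
      have "(\<lambda>z. ennreal (4 * (P (fst z))\<^sup>2) * indicator unit_cube (fst z) *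
          indicator {z. snd z powr (1 / s) * P (fst z) powr (q - 1) \<le> 2 * B} z * indicator {0<..} (snd z)) \<in> borel_measurable (borel \<Otimes>\<^sub>M borel)"
        by measurable
      then show "(\<lambda>(x, u). (ennreal (4 * (P x)\<^sup>2) * indicator unit_cube x) * indicator {z. u powr (1 / s) * P z powr (q - 1) \<le> 2 * B} x * indicator {0<..} u) \<in> borel_measurable (lborel \<Otimes>\<^sub>M lborel)"
        by (simp add: indicator_def case_prod_unfold)
    qed
    also have "\<dots> \<le> (\<integral>\<^sup>+x. ennreal (4 * (2 * B) powr s) * (ennreal (P x powr q) * indicator unit_cube x) \<partial>lborel)"
    proof (rule nn_integral_mono)
      fix x
      show "(\<integral>\<^sup>+u. (ennreal (4 * (P x)\<^sup>2) * indicator unit_cube x) * indicator {z. u powr (1 / s) * P z powr (q - 1) \<le> 2 * B} x * indicator {0<..} u \<partial>lborel)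
        \<le> ennreal (4 * (2 * B) powr s) * (ennreal (P x powr q) * indicator unit_cube x)"
      proof (cases "P x = 0 \<or> x \<notin> unit_cube")
        case False
        define M where "M = (2 * B / P x powr (q - 1)) powr s"
        have Px: "P x > 0" using False P0[of x] by linarith
        have "(\<integral>\<^sup>+u. (ennreal (4 * (P x)\<^sup>2) * indicator unit_cube x) * indicator {z. u powr (1 / s) * P z powr (q - 1) \<le> 2 * B} x * indicator {0<..} u \<partial>lborel)
          \<le> (\<integral>\<^sup>+u. ennreal (4 * (P x)\<^sup>2) * indicator {0..M} u \<partial>lborel)"
        proof (rule nn_integral_mono)
          fix u :: real
          have "u \<le> M" if "u > 0" "u powr (1 / s) * P x powr (q - 1) \<le> 2 * B"
          proof -
            have "u powr (1 / s) \<le> 2 * B / P x powr (q - 1)" using that Px by (simp add: field_simps)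
            then have "(u powr (1 / s)) powr s \<le> M" unfolding M_def using s by (intro powr_mono2) auto
            then show ?thesis using that s by (simp add: powr_powr)
          qed
          then show "(ennreal (4 * (P x)\<^sup>2) * indicator unit_cube x) * indicator {z. u powr (1 / s) * P z powr (q - 1) \<le> 2 * B} x * indicator {0<..} u
            \<le> ennreal (4 * (P x)\<^sup>2) * indicator {0..M} u"
            by (auto simp: indicator_def)
        qed
        also have "\<dots> = ennreal (4 * (P x)\<^sup>2 * M)"
          by (subst nn_integral_cmult_indicator) (auto simp: M_def emeasure_lborel_Icc_eq simp flip: ennreal_mult)
        also have "4 * (P x)\<^sup>2 * M = 4 * (2 * B) powr s * P x powr q"
        proof -
          \<comment> \<open>The exponents close up exactly: q - 1 = 1/(p-1) and s = p - 2 give 2 -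
            (p-2)/(p-1) = p/(p-1) = q.\<close>
          have e: "2 - (q - 1) * s = q" using pq by (simp add: q(2) s_def field_simps)
          have "(P x)\<^sup>2 * (P x powr (- ((q - 1) * s))) = P x powr q"
            using Px e by (simp flip: powr_add powr_numeral)
          moreover have "M = (2 * B) powr s * P x powr (- ((q - 1) * s))"
            using Px 3 by (simp add: M_def powr_divide powr_powr powr_minus_divide)
          ultimately show ?thesis by simp
        qed
        finally show ?thesis using False 3 by (simp add: ennreal_mult)
      qed auto
    qed
    also have "\<dots> = ennreal (4 * (2 * B) powr s) * (\<integral>\<^sup>+x. ennreal (P x powr q) * indicator unit_cube x \<partial>lborel)"
      by (rule nn_integral_cmult) measurable
    also have "\<dots> \<le> ennreal (4 * (2 * B) powr s) * ennreal B"
      by (intro mult_left_mono B) auto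
    also have "\<dots> = ennreal (2 powr p * B powr (p - 1))"
    proof -
      have "4 * (2 * B) powr s * B = 2 powr p * B powr (p - 1)"
        using 3 by (simp add: s_def powr_mult powr_diff field_simps power2_eq_square)
      then show ?thesis using 3 by (simp flip: ennreal_mult)
    qed
    finally have "ennreal (\<Sum>k\<in>A. c k powr p) \<le> ennreal (2 powr p * B powr (p - 1))" by (simp add: s(2))
    then show ?thesis unfolding c_def by (subst (asm) ennreal_le_iff) auto
  qed
qed

lemma lattice_sum_periodic:
  fixes f :: "real^'n \<Rightarrow> ennreal"
  shows "(\<integral>\<^sup>+l. f (x + lattice_point k + lattice_point l) \<partial>count_space UNIV) = (\<integral>\<^sup>+l. f (x + lattice_point l) \<partial>count_space UNIV)"
proof -
  have "bij ((+) k)" by (rule bij_betw_byWitness[where f' = "\<lambda>x. x - k"]) auto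
  then have "(\<integral>\<^sup>+l. f (x + lattice_point (k + l)) \<partial>count_space UNIV) = (\<integral>\<^sup>+l. f (x + lattice_point l) \<partial>count_space UNIV)"
    by (rule nn_integral_bij_count_space)
  then show ?thesis by (simp add: lattice_point_add add.assoc)
qed

text \<open>Hoelder is used twice with the weight (1+|x|)^(N-\<gamma>), whose p-th power has
  exponent below -d: on the whole space for the integrability of \<open>v\<close>, and on each
  lattice coset for the majorant \<open>P\<close> of its periodization. Since P^q is W^(q/p) times a
  fibre sum, its integral unfolds to the weighted L_q integral of the envelope
  \<open>E\<close>.\<close>

lemma Hausdorff_Young_weighted:
  fixes p q N \<gamma> :: real
  assumes pq: "p \<ge> 2" "1 / p + 1 / q = 1" and \<gamma>: "(\<gamma> - N) * p > real CARD('n)"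
  shows "\<exists>C\<ge>0. \<forall>(v :: real^'n \<Rightarrow> complex) E I. v \<in> borel_measurable borel \<longrightarrow> E \<in> borel_measurable borel \<longrightarrow> (\<forall>x. E x \<ge> 0) \<longrightarrow>
      (\<forall>x. norm (v x) \<le> (1 + norm x) powr N * E x) \<longrightarrow> I \<ge> 0 \<longrightarrow>
      (\<integral>\<^sup>+x. ennreal (((1 + norm x) powr \<gamma> * E x) powr q) \<partial>lborel) \<le> ennreal I \<longrightarrow>
      integrable lborel v \<and> (\<forall>A. finite A \<longrightarrow>
        (\<Sum>k\<in>A. norm (LINT \<xi>|lborel. v \<xi> * wave (lattice_point k) \<xi>) powr p) \<le> C * I powr (p - 1))"
proof -
  define \<beta> where "\<beta> = (\<gamma> - N) * p"
  have q: "q > 1"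
  proof -
    have "q \<noteq> 0" using pq by (cases "q = 0") auto
    then have eq: "q = p / (p - 1)" using pq by (simp add: field_simps)
    show ?thesis unfolding eq using pq by (simp add: less_divide_eq)
  qed
  obtain W where W: "W > 0"
    "\<And>x::real^'n. (\<integral>\<^sup>+l. ennreal ((1 + norm (x + lattice_point l)) powr (- \<beta>)) \<partial>count_space UNIV) \<le> ennreal W"
    using lattice_weight_sum_bound[OF \<gamma>] unfolding \<beta>_def by blast
  define V where "V = enn2real (\<integral>\<^sup>+x. ennreal ((1 + norm x) powr (- \<beta>)) \<partial>(lborel :: (real^'n) measure)) + 1"
  have V: "V > 0" "(\<integral>\<^sup>+x. ennreal ((1 + norm x) powr (- \<beta>)) \<partial>(lborel :: (real^'n) measure)) \<le> ennreal V"
  proof -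
    show "V > 0" by (simp add: V_def add_nonneg_pos)
    have "(\<integral>\<^sup>+x. ennreal ((1 + norm x) powr (- \<beta>)) \<partial>(lborel :: (real^'n) measure)) = ennreal (V - 1)"
      using nn_integral_polynomial_weight_finite[OF \<gamma>] unfolding V_def \<beta>_def by (simp add: less_top)
    also have "\<dots> \<le> ennreal V" by (intro ennreal_leI) simp
    finally show "(\<integral>\<^sup>+x. ennreal ((1 + norm x) powr (- \<beta>)) \<partial>(lborel :: (real^'n) measure)) \<le> ennreal V" .
  qed
  define C where "C = 2 powr p * (W powr (q / p)) powr (p - 1)"
  have "integrable lborel v \<and> (\<forall>A. finite A \<longrightarrow>
        (\<Sum>k\<in>A. norm (LINT \<xi>|lborel. v \<xi> * wave (lattice_point k) \<xi>) powr p) \<le> C * I powr (p - 1))"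
    if [measurable]: "v \<in> borel_measurable borel" "E \<in> borel_measurable borel" and E0: "\<And>x. E x \<ge> 0"
      and vE: "\<And>x. norm (v x) \<le> (1 + norm x) powr N * E x" and I: "I \<ge> 0"
        "(\<integral>\<^sup>+x. ennreal (((1 + norm x) powr \<gamma> * E x) powr q) \<partial>lborel) \<le> ennreal I"
    for v :: "real^'n \<Rightarrow> complex" and E I
  proof -
    define z w where "z x = (1 + norm x) powr \<gamma> * E x" and "w x = (1 + norm x) powr (N - \<gamma>)" for x :: "real^'n"
    have [measurable]: "z \<in> borel_measurable borel" "w \<in> borel_measurable borel"
      unfolding z_def w_def by measurable
    have z0: "z x \<ge> 0" and w0: "w x \<ge> 0" for x using E0 by (auto simp: z_def w_def)
    have pos: "1 + norm x > 0" for x :: "real^'n" by (simp add: add_pos_nonneg)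
    have vzw: "norm (v x) \<le> z x * w x" for x
    proof -
      have "z x * w x = (1 + norm x) powr N * E x"
        using pos[of x] by (simp add: z_def w_def mult.assoc mult.left_commute[of _ "E x"] flip: powr_add)
      then show ?thesis using vE by simp
    qed
    have wp: "w x powr p = (1 + norm x) powr (- \<beta>)" for x
      by (simp add: w_def powr_powr \<beta>_def algebra_simps)
    have pq': "p > 1" "q > 1" "1 / p + 1 / q = 1" using pq q by auto
    have "(\<integral>\<^sup>+x. ennreal (norm (v x)) \<partial>lborel) \<le> (\<integral>\<^sup>+x. ennreal (z x * w x) \<partial>lborel)"
      by (intro nn_integral_mono ennreal_leI vzw)
    also have "\<dots> \<le> ennreal (I powr (1 / q) * V powr (1 / p))"
      using I V by (intro nn_integral_Hoelder pq' z0 w0) (auto simp: wp z_def)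
    finally have v: "integrable lborel v"
      by (intro integrableI_bounded) (auto intro: le_less_trans)
    define Z where "Z x = (\<integral>\<^sup>+l. ennreal (z (x + lattice_point l) powr q) \<partial>count_space UNIV)" for x
    have [measurable]: "Z \<in> borel_measurable borel" unfolding Z_def by measurable
    have Zper: "Z (x + lattice_point l) = Z x" for x l
      unfolding Z_def by (rule lattice_sum_periodic)
    have ZI: "(\<integral>\<^sup>+x. Z x * indicator unit_cube x \<partial>lborel) \<le> ennreal I"
      using I(2) nn_integral_tiling[of "\<lambda>x. ennreal (z x powr q)"] unfolding Z_def z_def by simp
    then have "(\<integral>\<^sup>+x. Z x * indicator unit_cube x \<partial>lborel) \<noteq> \<infinity>" by (auto simp: top_unique)
    then have ZAE: "AE x in lborel. Z x * indicator unit_cube x \<noteq> \<infinity>" by (intro nn_integral_PInf_AE) auto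
    \<comment> \<open>\<open>Z\<close> can be infinite on the cube only on a null set, where the
      default value of \<open>enn2real\<close> does no harm: domination is required almost
      everywhere, and the default only decreases \<open>P\<close>.\<close>
    define P where "P x = enn2real (Z x) powr (1 / q) * W powr (1 / p)" for x
    have [measurable]: "P \<in> borel_measurable borel" unfolding P_def by measurable
    have "(\<Sum>k\<in>A. norm (LINT \<xi>|lborel. v \<xi> * wave (lattice_point k) \<xi>) powr p) \<le> 2 powr p * (W powr (q / p) * I) powr (p - 1)"
      if A: "finite A" for A
    proof (rule Hausdorff_Young_periodized[OF pq v _ _ _ _ _ _ A])
      show "AE x in lborel. x \<in> unit_cube \<longrightarrow> (\<integral>\<^sup>+l. ennreal (norm (v (x + lattice_point l))) \<partial>count_space UNIV) \<le> ennreal (P x)"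
        using ZAE
      proof eventually_elim
        case (elim x)
        show ?case
        proof
          assume "x \<in> unit_cube"
          then have Zx: "Z x < \<infinity>" using elim by (simp add: less_top)
          have "(\<integral>\<^sup>+l. ennreal (norm (v (x + lattice_point l))) \<partial>count_space UNIV)
              \<le> (\<integral>\<^sup>+l. ennreal (z (x + lattice_point l) * w (x + lattice_point l)) \<partial>count_space UNIV)"
            by (intro nn_integral_mono ennreal_leI vzw)
          also have "\<dots> \<le> ennreal (P x)"
            unfolding P_def using Zx W by (intro nn_integral_Hoelder pq' z0 w0) (auto simp: wp Z_def less_top)
          finally show "(\<integral>\<^sup>+l. ennreal (norm (v (x + lattice_point l))) \<partial>count_space UNIV) \<le> ennreal (P x)" .
        qed
      qed
      have "(\<integral>\<^sup>+x. ennreal (P x powr q) * indicator unit_cube x \<partial>lborel) \<le> (\<integral>\<^sup>+x. ennreal (W powr (q / p)) * (Z x * indicator unit_cube x) \<partial>lborel)"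
      proof (rule nn_integral_mono)
        fix x
        have "P x powr q = enn2real (Z x) * W powr (q / p)"
          using q by (simp add: P_def powr_mult powr_powr)
        then have "ennreal (P x powr q) = ennreal (W powr (q / p)) * ennreal (enn2real (Z x))"
          by (simp add: ennreal_mult mult.commute)
        also have "\<dots> \<le> ennreal (W powr (q / p)) * Z x"
          by (intro mult_left_mono) (cases "Z x"; simp)+
        finally have "ennreal (P x powr q) \<le> ennreal (W powr (q / p)) * Z x" .
        then show "ennreal (P x powr q) * indicator unit_cube x \<le> ennreal (W powr (q / p)) * (Z x * indicator unit_cube x)"
          by (auto simp: indicator_def)
      qed
      also have "\<dots> = ennreal (W powr (q / p)) * (\<integral>\<^sup>+x. Z x * indicator unit_cube x \<partial>lborel)"
        by (rule nn_integral_cmult) measurable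
      also have "\<dots> \<le> ennreal (W powr (q / p)) * ennreal I"
        by (intro mult_left_mono ZI) auto
      also have "\<dots> = ennreal (W powr (q / p) * I)" using I by (simp add: ennreal_mult)
      finally show "(\<integral>\<^sup>+x. ennreal (P x powr q) * indicator unit_cube x \<partial>lborel) \<le> ennreal (W powr (q / p) * I)" .
    qed (use I in \<open>auto simp: P_def Zper\<close>)
    then show ?thesis using v I by (simp add: C_def powr_mult mult.assoc)
  qed
  moreover have "C \<ge> 0" by (simp add: C_def)
  ultimately show ?thesis by (intro exI[of _ C] conjI allI impI) blast+
qed

subsection \<open>Fejer summation\<close>

lemma card_grid:
  assumes "finite D"
  shows "card (grid D :: ('a^'n) set) = card D ^ CARD('n)"
proof -
  have "bij_betw vec_lambda ((UNIV::'n set) \<rightarrow>\<^sub>E D) (grid D)"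
    by (rule bij_betw_byWitness[where f' = vec_nth]) (auto simp: grid_def)
  then have "card (grid D :: ('a^'n) set) = card ((UNIV::'n set) \<rightarrow>\<^sub>E D)"
    by (simp add: bij_betw_same_card)
  then show ?thesis by (simp add: card_PiE)
qed

text \<open>For positive \<open>n\<close> this is the product of the triangle weights max(0, 1 -
  |k_i|/n). The form as a count of pairs with difference \<open>k\<close> is what squaring an
  exponential sum produces.\<close>

definition fejer_weight :: "nat \<Rightarrow> int^'n \<Rightarrow> real" where
  "fejer_weight n k = real (card {j\<in>grid {0..<int n}. j + k \<in> grid {0..<int n}}) / real n ^ CARD('n)"

lemma fejer_weight_nonneg: "fejer_weight n k \<ge> 0"
  by (simp add: fejer_weight_def)

lemma finite_grid_int: "finite (grid {a..<b::int})" "finite (grid {- b<..<b::int})"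
  by (simp_all add: finite_grid)

lemma fejer_weight_le_1: "fejer_weight n k \<le> 1"
proof -
  have "card {j\<in>grid {0..<int n}. j + k \<in> grid {0..<int n}} \<le> card (grid {0..<int n} :: (int^'a) set)"
    by (intro card_mono finite_grid_int) auto
  also have "\<dots> = n ^ CARD('a)" by (simp add: card_grid)
  finally have "real (card {j\<in>grid {0..<int n}. j + k \<in> grid {0..<int n}}) \<le> real (n ^ CARD('a))"
    by (simp only: of_nat_le_iff)
  then show ?thesis by (cases "n = 0") (auto simp: fejer_weight_def divide_le_eq_1)
qed

lemma fejer_weight_tendsto: "(\<lambda>n. fejer_weight n k) \<longlonglongrightarrow> 1" for k :: "int^'n"
proof (rule tendsto_sandwich)
  define L where "L = nat (\<Sum>i\<in>UNIV. \<bar>k $ i\<bar>)"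
  have L: "\<bar>k $ i\<bar> \<le> int L" for i
  proof -
    have "\<bar>k $ i\<bar> \<le> (\<Sum>i\<in>UNIV. \<bar>k $ i\<bar>)" by (rule member_le_sum) auto
    then show ?thesis by (simp add: L_def)
  qed
  \<comment> \<open>The cube shrunk by L on every side remains inside the original cube after
    translation by \<open>k\<close>.\<close>
  show "eventually (\<lambda>n. (1 - 2 * real L / real n) ^ CARD('n) \<le> fejer_weight n k) sequentially"
    using eventually_ge_at_top[of "2 * L + 1"]
  proof eventually_elim
    case (elim n)
    have "grid {int L..<int n - int L} \<subseteq> {j\<in>grid {0..<int n}. j + k \<in> grid {0..<int n}}"
    proof
      fix j :: "int^'n" assume j: "j \<in> grid {int L..<int n - int L}"
      have "0 \<le> j $ i \<and> j $ i < int n \<and> 0 \<le> j $ i + k $ i \<and> j $ i + k $ i < int n" for i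
        using j L[of i] unfolding grid_def by (auto dest!: spec[of _ i])
      then show "j \<in> {j\<in>grid {0..<int n}. j + k \<in> grid {0..<int n}}" by (auto simp: grid_def)
    qed
    then have "card (grid {int L..<int n - int L} :: (int^'n) set) \<le> card {j\<in>grid {0..<int n}. j + k \<in> grid {0..<int n}}"
      by (intro card_mono) (auto intro: finite_subset[OF _ finite_grid_int(1)[of 0 "int n"]])
    moreover have "card (grid {int L..<int n - int L} :: (int^'n) set) = (n - 2 * L) ^ CARD('n)"
      using elim by (simp add: card_grid nat_diff_distrib' nat_mult_distrib)
    ultimately have "real ((n - 2 * L) ^ CARD('n)) \<le> real (card {j\<in>grid {0..<int n}. j + k \<in> grid {0..<int n}})"
      by simp
    moreover have "1 - 2 * real L / real n = real (n - 2 * L) / real n"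
      using elim by (simp add: field_simps)
    ultimately show ?case
      by (simp add: fejer_weight_def power_divide divide_right_mono)
  qed
  have "(\<lambda>n. (1 - 2 * real L / real n) ^ CARD('n)) \<longlonglongrightarrow> (1 - 0) ^ CARD('n)"
    by (intro tendsto_intros tendsto_divide_0[OF tendsto_const] filterlim_compose[OF tendsto_inverse_0] filterlim_real_at_infinity_sequentially) 
  then show "(\<lambda>n. (1 - 2 * real L / real n) ^ CARD('n)) \<longlonglongrightarrow> 1" by simp
qed (auto intro!: always_eventually fejer_weight_le_1)

lemma fejer_double_sum:
  fixes u :: "int^'n \<Rightarrow> complex"
  assumes "n > 0"
  shows "(\<Sum>j\<in>grid {0..<int n}. \<Sum>j'\<in>grid {0..<int n}. u (j - j')) / of_nat n ^ CARD('n)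
    = (\<Sum>k\<in>grid {- int n<..<int n}. of_real (fejer_weight n k) * u k)"
proof -
  let ?G = "grid {0..<int n} :: (int^'n) set" and ?D = "grid {- int n<..<int n} :: (int^'n) set"
  have "(\<Sum>j\<in>?G. \<Sum>j'\<in>?G. u (j - j')) = (\<Sum>j'\<in>?G. \<Sum>j\<in>?G. u (j - j'))" by (rule sum.swap)
  also have "\<dots> = (\<Sum>j'\<in>?G. \<Sum>k\<in>?D. of_bool (j' + k \<in> ?G) * u k)"
  proof (rule sum.cong[OF refl])
    fix j' assume j': "j' \<in> ?G"
    have sub: "j - j' \<in> ?D" if "j \<in> ?G" for j
    proof -
      have "- int n < j $ i - j' $ i \<and> j $ i - j' $ i < int n" for i
        using that j' unfolding grid_def by (auto dest!: spec[of _ i])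
      then show ?thesis by (auto simp: grid_def)
    qed
    have "(\<Sum>j\<in>?G. u (j - j')) = (\<Sum>k\<in>{k\<in>?D. j' + k \<in> ?G}. u k)"
      by (rule sum.reindex_bij_witness[of _ "\<lambda>k. j' + k" "\<lambda>j. j - j'"]) (auto simp: sub)
    also have "\<dots> = (\<Sum>k\<in>?D. of_bool (j' + k \<in> ?G) * u k)"
      by (intro sum.mono_neutral_cong_left finite_grid_int) auto
    finally show "(\<Sum>j\<in>?G. u (j - j')) = (\<Sum>k\<in>?D. of_bool (j' + k \<in> ?G) * u k)" .
  qed
  also have "\<dots> = (\<Sum>k\<in>?D. (\<Sum>j'\<in>?G. of_bool (j' + k \<in> ?G)) * u k)"
    by (subst sum.swap) (simp add: sum_distrib_right)
  also have "\<dots> = (\<Sum>k\<in>?D. of_nat (card {j'\<in>?G. j' + k \<in> ?G}) * u k)"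
    by (intro sum.cong refl) (simp add: finite_grid_int Int_def)
  finally show ?thesis
    by (simp add: fejer_weight_def sum_divide_distrib)
qed

text \<open>Written as a square so that positivity is immediate; the expansion with the Fejer
  weights is derived afterwards.\<close>

definition fejer_kernel :: "nat \<Rightarrow> real^'n \<Rightarrow> real" where
  "fejer_kernel n x = (norm (\<Sum>j\<in>grid {0..<int n}. wave (lattice_point j) x))\<^sup>2 / real n ^ CARD('n)"

lemma fejer_kernel_nonneg: "fejer_kernel n x \<ge> 0"
  by (simp add: fejer_kernel_def)

lemma fejer_kernel_measurable [measurable]: "fejer_kernel n \<in> borel_measurable borel"
  unfolding fejer_kernel_def by measurable

lemma wave_lattice_diff: "wave (lattice_point (k - l)) x = wave (lattice_point k) x * cnj (wave (lattice_point l) x)"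
  using wave_add_left[of "lattice_point k" "- lattice_point l" x] by (simp add: lattice_point_diff wave_minus_left)

lemma fejer_kernel_eq:
  assumes "n > 0"
  shows "complex_of_real (fejer_kernel n x) = (\<Sum>k\<in>grid {- int n<..<int n}. of_real (fejer_weight n k) * wave (lattice_point k) x)"
proof -
  let ?T = "\<Sum>j\<in>grid {0..<int n}. wave (lattice_point j) x"
  have "complex_of_real (fejer_kernel n x) = ?T * cnj ?T / of_nat n ^ CARD('a)"
    by (simp only: fejer_kernel_def of_real_divide of_real_power[of "real n"] of_real_of_nat_eq complex_norm_square)
  also have "?T * cnj ?T = (\<Sum>j\<in>grid {0..<int n}. \<Sum>j'\<in>grid {0..<int n}. wave (lattice_point (j - j')) x)"
    by (simp add: sum_product wave_lattice_diff)
  finally show ?thesis using fejer_double_sum[OF assms, of "\<lambda>k. wave (lattice_point k) x"] by simp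
qed

lemma fejer_kernel_periodic: "fejer_kernel n (x + lattice_point l) = fejer_kernel n x"
  by (simp add: fejer_kernel_def wave_lattice_periodic)

lemma nn_integral_unit_cube_shift:
  fixes u :: "real^'n \<Rightarrow> ennreal"
  assumes [measurable]: "u \<in> borel_measurable borel" and per: "\<And>x l. u (x + lattice_point l) = u x"
  shows "(\<integral>\<^sup>+x. u (y + x) * indicator unit_cube x \<partial>lborel) = (\<integral>\<^sup>+x. u x * indicator unit_cube x \<partial>lborel)"
proof -
  have "(\<integral>\<^sup>+x. u (y + x) * indicator unit_cube x \<partial>lborel) = (\<integral>\<^sup>+x. u x * indicator unit_cube (x - y) \<partial>lborel)"
    by (subst nn_integral_lborel_translate[of "\<lambda>x. u x * indicator unit_cube (x - y)" y, symmetric]) auto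
  also have "\<dots> = (\<integral>\<^sup>+x. (\<integral>\<^sup>+l. u x * indicator unit_cube (x - y + lattice_point l) \<partial>count_space UNIV) * indicator unit_cube x \<partial>lborel)"
    by (subst nn_integral_tiling) (auto simp: per algebra_simps)
  also have "\<dots> = (\<integral>\<^sup>+x. u x * indicator unit_cube x \<partial>lborel)"
  proof (intro nn_integral_cong)
    fix x
    have "bij (uminus :: int^'n \<Rightarrow> _)" by (rule bij_betw_byWitness[where f' = uminus]) auto
    then have "(\<integral>\<^sup>+l. indicator unit_cube (x - y - lattice_point (- l)) \<partial>count_space UNIV) = (\<integral>\<^sup>+l. indicator unit_cube (x - y - lattice_point l) \<partial>count_space UNIV)"
      by (rule nn_integral_bij_count_space)
    then have "(\<integral>\<^sup>+l. indicator unit_cube (x - y + lattice_point l) \<partial>count_space UNIV) = 1"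
      by (simp add: lattice_point_minus nn_integral_count_indicator_unit_cube)
    then show "(\<integral>\<^sup>+l. u x * indicator unit_cube (x - y + lattice_point l) \<partial>count_space UNIV) * indicator unit_cube x = u x * indicator unit_cube x"
      by (simp add: nn_integral_cmult)
  qed
  finally show ?thesis .
qed

lemma integral_fejer_wave:
  assumes "n > 0"
  shows "(LINT x|lborel. indicator unit_cube x *\<^sub>R (complex_of_real (fejer_kernel n x) * wave (lattice_point l) x)) = of_real (fejer_weight n (- l))"
proof -
  let ?D = "grid {- int n<..<int n} :: (int^'a) set"
  have iw: "integrable lborel (\<lambda>x. indicator unit_cube x *\<^sub>R wave (lattice_point k) x)" for k :: "int^'a"
    by (rule integrable_unit_cube_bounded[of _ 1]) auto
  have "(LINT x|lborel. indicator unit_cube x *\<^sub>R (complex_of_real (fejer_kernel n x) * wave (lattice_point l) x))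
    = (LINT x|lborel. (\<Sum>k\<in>?D. of_real (fejer_weight n k) * (indicator unit_cube x *\<^sub>R wave (lattice_point (k + l)) x)))"
    by (intro Bochner_Integration.integral_cong refl)
      (simp add: fejer_kernel_eq[OF assms] sum_distrib_right scaleR_sum_right lattice_point_add wave_add_left mult.assoc)
  also have "\<dots> = (\<Sum>k\<in>?D. LINT x|lborel. of_real (fejer_weight n k) * (indicator unit_cube x *\<^sub>R wave (lattice_point (k + l)) x))"
    by (intro Bochner_Integration.integral_sum integrable_mult_right iw)
  also have "\<dots> = (\<Sum>k\<in>?D. of_real (fejer_weight n k) * of_bool (k + l = 0))"
    by (simp only: integral_mult_right_zero integral_unit_cube_wave)
  also have "\<dots> = (\<Sum>k\<in>?D. if k = - l then of_real (fejer_weight n (- l)) else 0)"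
    by (intro sum.cong refl) (auto simp flip: eq_neg_iff_add_eq_0)
  also have "\<dots> = of_real (fejer_weight n (- l))"
  proof (cases "- l \<in> ?D")
    case False
    have "{j\<in>grid {0..<int n}. j - l \<in> grid {0..<int n}} = {}"
    proof (rule ccontr)
      assume "{j\<in>grid {0..<int n}. j - l \<in> grid {0..<int n}} \<noteq> {}"
      then obtain j where j: "j \<in> grid {0..<int n}" "j - l \<in> grid {0..<int n}" by auto
      have "- int n < - l $ i \<and> - l $ i < int n" for i
        using j unfolding grid_def by (auto dest!: spec[of _ i])
      then have "- l \<in> ?D" by (auto simp: grid_def)
      with False show False by simp
    qed
    then have "fejer_weight n (- l) = 0" by (simp only: fejer_weight_def add_uminus_conv_diff card.empty)
    then show ?thesis by (subst sum.neutral) auto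
  qed (simp add: finite_grid_int)
  finally show ?thesis .
qed

lemma fejer_weight_0: "n > 0 \<Longrightarrow> fejer_weight n (0 :: int^'n) = 1"
  by (simp add: fejer_weight_def card_grid)

text \<open>The moment of \<open>1 - cos(2 \<pi> x\<^sub>i)\<close> replaces an estimate of the kernel away from the origin.\<close>

lemma nn_integral_fejer:
  assumes "n > 0"
  shows "(\<integral>\<^sup>+x. ennreal (fejer_kernel n x) * indicator (unit_cube :: (real^'n) set) x \<partial>lborel) = 1" (is ?th1)
    "(\<integral>\<^sup>+x. ennreal (fejer_kernel n x * (1 - cos (2 * pi * x $ i))) * indicator (unit_cube :: (real^'n) set) x \<partial>lborel)
      = ennreal (1 - fejer_weight n (- axis i 1))" (is ?th2)
proof -
  obtain B where B: "\<And>x::real^'n. fejer_kernel n x \<le> B"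
  proof -
    have "fejer_kernel n x \<le> (real (card (grid {0..<int n} :: (int^'n) set)))\<^sup>2 / real n ^ CARD('n)" for x :: "real^'n"
      unfolding fejer_kernel_def
    proof (intro divide_right_mono power_mono)
      show "norm (\<Sum>j\<in>grid {0..<int n}. wave (lattice_point j) x) \<le> real (card (grid {0..<int n} :: (int^'n) set))"
        by (rule order_trans[OF norm_sum]) simp
    qed auto
    then show ?thesis using that by blast
  qed
  have i: "integrable lborel (\<lambda>x::real^'n. indicator unit_cube x *\<^sub>R (complex_of_real (fejer_kernel n x) * wave (lattice_point l) x))" for l
    using B by (intro integrable_unit_cube_bounded[of _ B]) (auto simp: norm_mult fejer_kernel_nonneg)
  define g where "g l x = indicator unit_cube x * (fejer_kernel n x * Re (wave (lattice_point l) x))" for l and x :: "real^'n"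
  have g: "g l x = Re (indicator unit_cube x *\<^sub>R (complex_of_real (fejer_kernel n x) * wave (lattice_point l) x))" for l x
    by (simp add: g_def)
  have gi: "integrable lborel (g l)" for l unfolding g[abs_def] by (intro integrable_Re i)
  have gI: "(LINT x|lborel. g l x) = fejer_weight n (- l)" for l
    unfolding g by (subst integral_Re[OF i]) (simp add: integral_fejer_wave[OF assms])
  have axis: "wave (lattice_point (axis i 1)) x = cis (2 * pi * x $ i)" for x :: "real^'n"
  proof -
    have "lattice_point (axis i 1 :: int^'n) = axis i 1" by (simp add: vec_eq_iff axis_def)
    then show ?thesis by (simp add: wave_def inner_axis')
  qed
  have "(\<integral>\<^sup>+x. ennreal (fejer_kernel n x) * indicator (unit_cube :: (real^'n) set) x \<partial>lborel) = (\<integral>\<^sup>+x. ennreal (g 0 x) \<partial>lborel)"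
    by (intro nn_integral_cong) (auto simp: g_def indicator_def)
  also have "\<dots> = ennreal (LINT x|lborel. g 0 x)"
    by (intro nn_integral_eq_integral gi AE_I2) (auto simp: g_def fejer_kernel_nonneg)
  finally show ?th1 by (simp add: gI fejer_weight_0[OF assms])
  have "(\<integral>\<^sup>+x. ennreal (fejer_kernel n x * (1 - cos (2 * pi * x $ i))) * indicator (unit_cube :: (real^'n) set) x \<partial>lborel)
     = (\<integral>\<^sup>+x. ennreal (g 0 x - g (axis i 1) x) \<partial>lborel)"
    by (intro nn_integral_cong) (auto simp: g_def indicator_def axis algebra_simps)
  also have "\<dots> = ennreal (LINT x|lborel. g 0 x - g (axis i 1) x)"
  proof (intro nn_integral_eq_integral Bochner_Integration.integrable_diff gi AE_I2)
    fix x :: "real^'n"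
    have "g 0 x - g (axis i 1) x = indicator unit_cube x * (fejer_kernel n x * (1 - cos (2 * pi * x $ i)))"
      by (simp add: g_def axis algebra_simps)
    then show "0 \<le> g 0 x - g (axis i 1) x" by (simp add: fejer_kernel_nonneg)
  qed
  also have "(LINT x|lborel. g 0 x - g (axis i 1) x) = 1 - fejer_weight n (- axis i 1)"
    by (simp add: Bochner_Integration.integral_diff[OF gi gi] gI fejer_weight_0[OF assms])
  finally show ?th2 .
qed

lemma fejer_sum_eq:
  fixes u :: "real^'n \<Rightarrow> complex"
  assumes n: "n > 0" and [measurable]: "u \<in> borel_measurable borel" and B: "\<And>x. norm (u x) \<le> B"
  shows "(\<Sum>k\<in>grid {- int n<..<int n}. of_real (fejer_weight n k) * (LINT \<zeta>|lborel. indicator unit_cube \<zeta> *\<^sub>R (u \<zeta> * wave (lattice_point k) \<zeta>)) * cnj (wave (lattice_point k) x))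
    = (LINT \<zeta>|lborel. indicator unit_cube \<zeta> *\<^sub>R (u \<zeta> * of_real (fejer_kernel n (\<zeta> - x))))"
proof -
  let ?D = "grid {- int n<..<int n} :: (int^'n) set"
  let ?u = "\<lambda>k \<zeta>. indicator unit_cube \<zeta> *\<^sub>R (u \<zeta> * wave (lattice_point k) \<zeta>)"
  have i: "integrable lborel (?u k)" for k
    using B by (intro integrable_unit_cube_bounded[of _ B]) (auto simp: norm_mult)
  have "(LINT \<zeta>|lborel. indicator unit_cube \<zeta> *\<^sub>R (u \<zeta> * of_real (fejer_kernel n (\<zeta> - x))))
    = (LINT \<zeta>|lborel. (\<Sum>k\<in>?D. (of_real (fejer_weight n k) * cnj (wave (lattice_point k) x)) * ?u k \<zeta>))"
  proof (intro Bochner_Integration.integral_cong refl)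
    fix \<zeta>
    have "wave (lattice_point k) (\<zeta> - x) = wave (lattice_point k) \<zeta> * cnj (wave (lattice_point k) x)" for k
      using wave_add_right[of "lattice_point k" \<zeta> "- x"] by (simp add: wave_minus_right)
    then show "indicator unit_cube \<zeta> *\<^sub>R (u \<zeta> * of_real (fejer_kernel n (\<zeta> - x)))
      = (\<Sum>k\<in>?D. (of_real (fejer_weight n k) * cnj (wave (lattice_point k) x)) * ?u k \<zeta>)"
      by (simp add: fejer_kernel_eq[OF n] sum_distrib_left scaleR_sum_right mult_ac)
  qed
  also have "\<dots> = (\<Sum>k\<in>?D. LINT \<zeta>|lborel. (of_real (fejer_weight n k) * cnj (wave (lattice_point k) x)) * ?u k \<zeta>)"
    by (intro Bochner_Integration.integral_sum integrable_mult_right i)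
  also have "\<dots> = (\<Sum>k\<in>?D. (of_real (fejer_weight n k) * cnj (wave (lattice_point k) x)) * (LINT \<zeta>|lborel. ?u k \<zeta>))"
    by (simp only: integral_mult_right_zero)
  finally show ?thesis by (simp add: mult_ac)
qed

text \<open>Coefficients are taken against the unconjugated wave and resummed with the conjugate.
  With this sign the coefficients of the periodized spectrum become samples of \<phi> at s +
  k.\<close>

definition fejer_sum :: "(real^'n \<Rightarrow> complex) \<Rightarrow> nat \<Rightarrow> real^'n \<Rightarrow> complex" where
  "fejer_sum \<Theta> n x = (\<Sum>k\<in>grid {- int n<..<int n}. of_real (fejer_weight n k) *
     (LINT \<zeta>|lborel. indicator unit_cube \<zeta> *\<^sub>R (\<Theta> \<zeta> * wave (lattice_point k) \<zeta>)) * cnj (wave (lattice_point k) x))"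

lemma nn_integral_fejer_shift:
  assumes "n > 0"
  shows "(\<integral>\<^sup>+\<zeta>. ennreal (fejer_kernel n (\<zeta> - x)) * indicator unit_cube \<zeta> \<partial>lborel) = 1"
  using nn_integral_unit_cube_shift[of "\<lambda>\<zeta>. ennreal (fejer_kernel n \<zeta>)" "- x"] nn_integral_fejer(1)[OF assms]
  by (simp add: fejer_kernel_periodic)

lemma norm_fejer_sum_le:
  assumes n: "n > 0" and [measurable]: "\<Theta> \<in> borel_measurable borel" and B: "\<And>x. norm (\<Theta> x) \<le> B"
  shows "norm (fejer_sum \<Theta> n x) \<le> B"
proof -
  have B0: "B \<ge> 0" using B[of 0] norm_ge_zero order_trans by blast
  have "ennreal (norm (fejer_sum \<Theta> n x)) \<le> (\<integral>\<^sup>+\<zeta>. ennreal (norm (indicator unit_cube \<zeta> *\<^sub>R (\<Theta> \<zeta> * of_real (fejer_kernel n (\<zeta> - x))))) \<partial>lborel)"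
    unfolding fejer_sum_def fejer_sum_eq[OF assms] by (rule ennreal_norm_integral_le)
  also have "\<dots> \<le> (\<integral>\<^sup>+\<zeta>. ennreal B * (ennreal (fejer_kernel n (\<zeta> - x)) * indicator unit_cube \<zeta>) \<partial>lborel)"
    using B B0 by (intro nn_integral_mono)
      (auto simp: indicator_def norm_mult fejer_kernel_nonneg intro!: ennreal_leI mult_right_mono simp flip: ennreal_mult)
  also have "\<dots> = ennreal B"
    by (subst nn_integral_cmult) (simp_all add: nn_integral_fejer_shift[OF n])
  finally show ?thesis using B0 by (simp add: ennreal_le_iff)
qed

text \<open>A Korovkin argument: the oscillation of \<Theta> about \<open>x\<close> is at most r/2
  plus a multiple of the sum of 1 - cos(2 pi \<zeta>_i), and the kernel integrates this second term
  to 1 minus Fejer weights, which tends to 0.\<close>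

lemma fejer_sum_tendsto:
  fixes \<Theta> :: "real^'n \<Rightarrow> complex"
  assumes [measurable]: "\<Theta> \<in> borel_measurable borel" and B: "\<And>x. norm (\<Theta> x) \<le> B"
    and per: "\<And>x l. \<Theta> (x + lattice_point l) = \<Theta> x" and cont: "isCont \<Theta> x"
  shows "(\<lambda>n. fejer_sum \<Theta> n x) \<longlonglongrightarrow> \<Theta> x"
proof -
  have B0: "B \<ge> 0" using B[of 0] norm_ge_zero order_trans by blast
  have bound: "ennreal (norm (fejer_sum \<Theta> n x - \<Theta> x)) \<le> (\<integral>\<^sup>+\<zeta>. ennreal (norm (\<Theta> (x + \<zeta>) - \<Theta> x) * fejer_kernel n \<zeta>) * indicator unit_cube \<zeta> \<partial>lborel)"
    if n: "n > 0" for n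
  proof -
    let ?D = "grid {- int n<..<int n} :: (int^'n) set"
    have i1: "integrable lborel (\<lambda>\<zeta>. indicator unit_cube \<zeta> *\<^sub>R (\<Theta> \<zeta> * wave (lattice_point k) \<zeta>))" for k
      using B by (intro integrable_unit_cube_bounded[of _ B]) (auto simp: norm_mult)
    have i2: "integrable lborel (\<lambda>\<zeta>. indicator unit_cube \<zeta> *\<^sub>R wave (lattice_point k) \<zeta>)" for k :: "int^'n"
      by (rule integrable_unit_cube_bounded[of _ 1]) auto
    \<comment> \<open>Subtracting the constant \<open>\<Theta> x\<close> changes only the
      coefficient at k = 0, where the Fejer weight is 1; so the error is the Fejer sum of the
      difference.\<close>
    have c: "(LINT \<zeta>|lborel. indicator unit_cube \<zeta> *\<^sub>R ((\<Theta> \<zeta> - \<Theta> x) * wave (lattice_point k) \<zeta>))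
      = (LINT \<zeta>|lborel. indicator unit_cube \<zeta> *\<^sub>R (\<Theta> \<zeta> * wave (lattice_point k) \<zeta>)) - \<Theta> x * of_bool (k = 0)" for k
    proof -
      have "(LINT \<zeta>|lborel. indicator unit_cube \<zeta> *\<^sub>R ((\<Theta> \<zeta> - \<Theta> x) * wave (lattice_point k) \<zeta>))
        = (LINT \<zeta>|lborel. indicator unit_cube \<zeta> *\<^sub>R (\<Theta> \<zeta> * wave (lattice_point k) \<zeta>) - \<Theta> x * (indicator unit_cube \<zeta> *\<^sub>R wave (lattice_point k) \<zeta>))"
        by (intro Bochner_Integration.integral_cong refl) (simp add: algebra_simps indicator_def)
      also have "\<dots> = (LINT \<zeta>|lborel. indicator unit_cube \<zeta> *\<^sub>R (\<Theta> \<zeta> * wave (lattice_point k) \<zeta>)) - (LINT \<zeta>|lborel. \<Theta> x * (indicator unit_cube \<zeta> *\<^sub>R wave (lattice_point k) \<zeta>))"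
        by (intro Bochner_Integration.integral_diff i1 integrable_mult_right i2)
      finally show ?thesis by (simp only: integral_mult_right_zero integral_unit_cube_wave)
    qed
    have "fejer_sum (\<lambda>\<zeta>. \<Theta> \<zeta> - \<Theta> x) n x = fejer_sum \<Theta> n x - (\<Sum>k\<in>?D. of_real (fejer_weight n k) * (\<Theta> x * of_bool (k = 0)) * cnj (wave (lattice_point k) x))"
      unfolding fejer_sum_def c by (simp only: right_diff_distrib left_diff_distrib sum_subtractf)
    also have "(\<Sum>k\<in>?D. of_real (fejer_weight n k) * (\<Theta> x * of_bool (k = 0)) * cnj (wave (lattice_point k) x))
      = (\<Sum>k\<in>?D. if k = 0 then \<Theta> x else 0)"
      using n by (intro sum.cong refl) (auto simp: fejer_weight_0)
    also have "\<dots> = \<Theta> x" using n by (simp add: finite_grid_int) (simp add: grid_def)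
    finally have e: "fejer_sum (\<lambda>\<zeta>. \<Theta> \<zeta> - \<Theta> x) n x = fejer_sum \<Theta> n x - \<Theta> x" .
    have "norm (\<Theta> \<zeta> - \<Theta> x) \<le> B + B" for \<zeta>
      by (rule order_trans[OF norm_triangle_ineq4]) (intro add_mono B)
    then have "fejer_sum \<Theta> n x - \<Theta> x = (LINT \<zeta>|lborel. indicator unit_cube \<zeta> *\<^sub>R ((\<Theta> \<zeta> - \<Theta> x) * of_real (fejer_kernel n (\<zeta> - x))))"
      unfolding e[symmetric] unfolding fejer_sum_def by (intro fejer_sum_eq[OF n]) auto
    then have "ennreal (norm (fejer_sum \<Theta> n x - \<Theta> x)) = ennreal (norm (LINT \<zeta>|lborel. indicator unit_cube \<zeta> *\<^sub>R ((\<Theta> \<zeta> - \<Theta> x) * of_real (fejer_kernel n (\<zeta> - x)))))"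
      by (simp only:)
    also have "\<dots> \<le> (\<integral>\<^sup>+\<zeta>. ennreal (norm (indicator unit_cube \<zeta> *\<^sub>R ((\<Theta> \<zeta> - \<Theta> x) * of_real (fejer_kernel n (\<zeta> - x))))) \<partial>lborel)"
      by (rule ennreal_norm_integral_le)
    also have "\<dots> = (\<integral>\<^sup>+\<zeta>. ennreal (norm (\<Theta> (x + (- x + \<zeta>)) - \<Theta> x) * fejer_kernel n (- x + \<zeta>)) * indicator unit_cube \<zeta> \<partial>lborel)"
      by (intro nn_integral_cong) (auto simp: indicator_def norm_mult fejer_kernel_nonneg)
    also have "\<dots> = (\<integral>\<^sup>+\<zeta>. ennreal (norm (\<Theta> (x + \<zeta>) - \<Theta> x) * fejer_kernel n \<zeta>) * indicator unit_cube \<zeta> \<partial>lborel)"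
      by (rule nn_integral_unit_cube_shift) (auto simp: fejer_kernel_periodic per simp flip: add.assoc)
    finally show ?thesis .
  qed
  show ?thesis
  proof (rule LIMSEQ_I)
    fix r :: real assume r: "r > 0"
    obtain d where d: "d > 0" "\<And>z. norm z < d \<Longrightarrow> norm (\<Theta> (x + z) - \<Theta> x) < r / 2"
    proof -
      from cont r obtain d where "d > 0" "\<And>y. dist y x < d \<Longrightarrow> dist (\<Theta> y) (\<Theta> x) < r / 2"
        unfolding continuous_at_eps_delta by (meson half_gt_zero)
      then show ?thesis using that by (auto simp: dist_norm)
    qed
    \<comment> \<open>A vector of norm at least d has a coordinate of size at least d divided by the
      dimension. The cap 1/2 keeps 2 pi \<delta> in [0, pi], where the cosine decreases.\<close>
    define \<delta> where "\<delta> = min (1/2) (d / real CARD('n))"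
    have \<delta>: "0 < \<delta>" "\<delta> \<le> 1/2" "\<delta> * real CARD('n) \<le> d"
      using d by (auto simp: \<delta>_def min_def field_simps)
    define \<kappa> where "\<kappa> = 1 - cos (2 * pi * \<delta>)"
    have \<kappa>: "\<kappa> > 0"
    proof -
      have "cos (2 * pi * \<delta>) < cos 0" using \<delta> by (intro cos_monotone_0_pi) auto
      then show ?thesis by (simp add: \<kappa>_def)
    qed
    \<comment> \<open>The kernel moments of 1 - cos(2 pi \<zeta>_i); each tends to 0 because the
      Fejer weight at a fixed lattice point tends to 1.\<close>
    define m where "m n = (\<Sum>i\<in>UNIV. 1 - fejer_weight n (- axis i 1 :: int^'n))" for n
    have m0: "m n \<ge> 0" for n unfolding m_def by (intro sum_nonneg) (simp add: fejer_weight_le_1)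
    have "m \<longlonglongrightarrow> (\<Sum>i\<in>(UNIV::'n set). 1 - 1)"
      unfolding m_def by (intro tendsto_intros fejer_weight_tendsto)
    then have "m \<longlonglongrightarrow> 0" by simp
    then have "(\<lambda>n. 2 * B / \<kappa> * m n) \<longlonglongrightarrow> 0" by (rule tendsto_mult_right_zero)
    then have "eventually (\<lambda>n. 2 * B / \<kappa> * m n < r / 2) sequentially"
      using r by (auto dest!: order_tendstoD(2)[of _ _ _ "r / 2"])
    then obtain n0 where n0: "\<And>n. n \<ge> n0 \<Longrightarrow> 2 * B / \<kappa> * m n < r / 2"
      unfolding eventually_sequentially by blast
    have "norm (fejer_sum \<Theta> n x - \<Theta> x) < r" if "n \<ge> max n0 1" for n
    proof -
      have n: "n > 0" "n \<ge> n0" using that by auto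
      have pt: "norm (\<Theta> (x + \<zeta>) - \<Theta> x) \<le> r / 2 + 2 * B / \<kappa> * (\<Sum>i\<in>UNIV. 1 - cos (2 * pi * \<zeta> $ i))" if \<zeta>: "\<zeta> \<in> unit_cube" for \<zeta>
      proof (cases "norm \<zeta> < d")
        case True
        have "0 \<le> 2 * B / \<kappa> * (\<Sum>i\<in>UNIV. 1 - cos (2 * pi * \<zeta> $ i))"
          using B0 \<kappa> by (intro mult_nonneg_nonneg sum_nonneg) auto
        then show ?thesis using d(2)[OF True] by linarith
      next
        case False
        have "\<exists>i. \<bar>\<zeta> $ i\<bar> \<ge> \<delta>"
        proof (rule ccontr)
          assume "\<nexists>i. \<bar>\<zeta> $ i\<bar> \<ge> \<delta>"
          then have "(\<Sum>i\<in>UNIV. \<bar>\<zeta> $ i\<bar>) < (\<Sum>i\<in>(UNIV::'n set). \<delta>)"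
            by (intro sum_strict_mono) (auto simp: not_le)
          then have "norm \<zeta> < \<delta> * real CARD('n)"
            using norm_le_l1_cart[of \<zeta>] by (simp add: mult.commute)
          then show False using False \<delta> by linarith
        qed
        then obtain i where i: "\<bar>\<zeta> $ i\<bar> \<ge> \<delta>" by blast
        have "- 1/2 \<le> \<zeta> $ i \<and> \<zeta> $ i < 1/2" using \<zeta> by (simp add: unit_cube_def)
        then have i2: "\<bar>\<zeta> $ i\<bar> \<le> 1/2" by linarith
        have "cos (2 * pi * \<bar>\<zeta> $ i\<bar>) \<le> cos (2 * pi * \<delta>)"
          using i i2 \<delta> by (intro cos_monotone_0_pi_le) auto
        then have "\<kappa> \<le> 1 - cos (2 * pi * \<zeta> $ i)"
          unfolding \<kappa>_def using cos_abs_real[of "2 * pi * \<zeta> $ i"] by (simp add: abs_mult)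
        also have "\<dots> \<le> (\<Sum>i\<in>UNIV. 1 - cos (2 * pi * \<zeta> $ i))"
          by (rule member_le_sum) auto
        finally have "2 * B / \<kappa> * \<kappa> \<le> 2 * B / \<kappa> * (\<Sum>i\<in>UNIV. 1 - cos (2 * pi * \<zeta> $ i))"
          using B0 \<kappa> by (intro mult_left_mono) auto
        then have "2 * B \<le> 2 * B / \<kappa> * (\<Sum>i\<in>UNIV. 1 - cos (2 * pi * \<zeta> $ i))"
          using \<kappa> by simp
        moreover have "norm (\<Theta> (x + \<zeta>) - \<Theta> x) \<le> B + B"
          by (rule order_trans[OF norm_triangle_ineq4]) (intro add_mono B)
        ultimately show ?thesis using r by linarith
      qed
      have "ennreal (norm (fejer_sum \<Theta> n x - \<Theta> x)) \<le> (\<integral>\<^sup>+\<zeta>. ennreal (norm (\<Theta> (x + \<zeta>) - \<Theta> x) * fejer_kernel n \<zeta>) * indicator unit_cube \<zeta> \<partial>lborel)"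
        by (rule bound[OF n(1)])
      also have "\<dots> \<le> (\<integral>\<^sup>+\<zeta>. ennreal (r / 2) * (ennreal (fejer_kernel n \<zeta>) * indicator unit_cube \<zeta>) + ennreal (2 * B / \<kappa>) *
          (\<Sum>i\<in>UNIV. ennreal (fejer_kernel n \<zeta> * (1 - cos (2 * pi * \<zeta> $ i))) * indicator unit_cube \<zeta>) \<partial>(lborel :: (real^'n) measure))"
      proof (rule nn_integral_mono)
        fix \<zeta> :: "real^'n"
        show "ennreal (norm (\<Theta> (x + \<zeta>) - \<Theta> x) * fejer_kernel n \<zeta>) * indicator unit_cube \<zeta>
          \<le> ennreal (r / 2) * (ennreal (fejer_kernel n \<zeta>) * indicator unit_cube \<zeta>) + ennreal (2 * B / \<kappa>) *
          (\<Sum>i\<in>UNIV. ennreal (fejer_kernel n \<zeta> * (1 - cos (2 * pi * \<zeta> $ i))) * indicator unit_cube \<zeta>)"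
        proof (cases "\<zeta> \<in> unit_cube")
          case True
          let ?k = "fejer_kernel n \<zeta>"
          have s0: "(\<Sum>i\<in>UNIV. ?k * (1 - cos (2 * pi * \<zeta> $ i))) \<ge> 0"
            by (intro sum_nonneg mult_nonneg_nonneg) (auto simp: fejer_kernel_nonneg)
          have "norm (\<Theta> (x + \<zeta>) - \<Theta> x) * ?k \<le> (r / 2 + 2 * B / \<kappa> * (\<Sum>i\<in>UNIV. 1 - cos (2 * pi * \<zeta> $ i))) * ?k"
            by (intro mult_right_mono pt True fejer_kernel_nonneg)
          also have "\<dots> = r / 2 * ?k + 2 * B / \<kappa> * (\<Sum>i\<in>UNIV. ?k * (1 - cos (2 * pi * \<zeta> $ i)))"
          proof -
            have "(a + b * s) * k = a * k + b * (k * s)" for a b s k :: real by (simp add: algebra_simps)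
            then show ?thesis by (simp only: sum_distrib_left[symmetric])
          qed
          finally have "ennreal (norm (\<Theta> (x + \<zeta>) - \<Theta> x) * ?k) \<le> ennreal (r / 2 * ?k + 2 * B / \<kappa> * (\<Sum>i\<in>UNIV. ?k * (1 - cos (2 * pi * \<zeta> $ i))))"
            by (rule ennreal_leI)
          also have "\<dots> = ennreal (r / 2 * ?k) + ennreal (2 * B / \<kappa> * (\<Sum>i\<in>UNIV. ?k * (1 - cos (2 * pi * \<zeta> $ i))))"
            using r B0 \<kappa> s0 by (intro ennreal_plus mult_nonneg_nonneg) (auto simp: fejer_kernel_nonneg)
          also have "ennreal (r / 2 * ?k) = ennreal (r / 2) * ennreal ?k"
            using r by (intro ennreal_mult) (auto simp: fejer_kernel_nonneg)
          also have "ennreal (2 * B / \<kappa> * (\<Sum>i\<in>UNIV. ?k * (1 - cos (2 * pi * \<zeta> $ i)))) = ennreal (2 * B / \<kappa>) * ennreal (\<Sum>i\<in>UNIV. ?k * (1 - cos (2 * pi * \<zeta> $ i)))"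
            using B0 \<kappa> s0 by (intro ennreal_mult) auto
          also have "ennreal (\<Sum>i\<in>UNIV. ?k * (1 - cos (2 * pi * \<zeta> $ i))) = (\<Sum>i\<in>UNIV. ennreal (?k * (1 - cos (2 * pi * \<zeta> $ i))))"
            by (intro sum_ennreal[symmetric] mult_nonneg_nonneg) (auto simp: fejer_kernel_nonneg)
          finally show ?thesis using True by simp
        qed simp
      qed
      also have "\<dots> = ennreal (r / 2) * (\<integral>\<^sup>+\<zeta>. ennreal (fejer_kernel n \<zeta>) * indicator (unit_cube :: (real^'n) set) \<zeta> \<partial>lborel) + ennreal (2 * B / \<kappa>) *
          (\<Sum>i\<in>UNIV. \<integral>\<^sup>+\<zeta>. ennreal (fejer_kernel n \<zeta> * (1 - cos (2 * pi * \<zeta> $ i))) * indicator (unit_cube :: (real^'n) set) \<zeta> \<partial>lborel)"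
      proof -
        define G where "G \<zeta> = ennreal (fejer_kernel n \<zeta>) * indicator unit_cube \<zeta>" for \<zeta> :: "real^'n"
        define H where "H i \<zeta> = ennreal (fejer_kernel n \<zeta> * (1 - cos (2 * pi * \<zeta> $ i))) * indicator unit_cube \<zeta>" for i and \<zeta> :: "real^'n"
        have [measurable]: "G \<in> borel_measurable borel" "H i \<in> borel_measurable borel" for i
          unfolding G_def H_def by measurable
        have "(\<integral>\<^sup>+\<zeta>. ennreal (r / 2) * G \<zeta> + ennreal (2 * B / \<kappa>) * (\<Sum>i\<in>UNIV. H i \<zeta>) \<partial>lborel)
          = (\<integral>\<^sup>+\<zeta>. ennreal (r / 2) * G \<zeta> \<partial>lborel) + (\<integral>\<^sup>+\<zeta>. ennreal (2 * B / \<kappa>) * (\<Sum>i\<in>UNIV. H i \<zeta>) \<partial>lborel)"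
          by (rule nn_integral_add) measurable
        also have "(\<integral>\<^sup>+\<zeta>. ennreal (r / 2) * G \<zeta> \<partial>lborel) = ennreal (r / 2) * (\<integral>\<^sup>+\<zeta>. G \<zeta> \<partial>lborel)"
          by (rule nn_integral_cmult) measurable
        also have "(\<integral>\<^sup>+\<zeta>. ennreal (2 * B / \<kappa>) * (\<Sum>i\<in>UNIV. H i \<zeta>) \<partial>lborel) = ennreal (2 * B / \<kappa>) * (\<integral>\<^sup>+\<zeta>. (\<Sum>i\<in>UNIV. H i \<zeta>) \<partial>lborel)"
          by (rule nn_integral_cmult) measurable
        also have "(\<integral>\<^sup>+\<zeta>. (\<Sum>i\<in>UNIV. H i \<zeta>) \<partial>lborel) = (\<Sum>i\<in>UNIV. \<integral>\<^sup>+\<zeta>. H i \<zeta> \<partial>lborel)"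
          by (rule nn_integral_sum) measurable
        finally show ?thesis unfolding G_def H_def .
      qed
      also have "\<dots> = ennreal (r / 2) + ennreal (2 * B / \<kappa>) * ennreal (m n)"
        by (simp add: nn_integral_fejer[OF n(1)] sum_ennreal fejer_weight_le_1 m_def)
      also have "\<dots> = ennreal (r / 2 + 2 * B / \<kappa> * m n)"
      proof -
        have "ennreal (2 * B / \<kappa>) * ennreal (m n) = ennreal (2 * B / \<kappa> * m n)"
          using B0 \<kappa> m0[of n] by (intro ennreal_mult[symmetric]) auto
        moreover have "0 \<le> 2 * B / \<kappa> * m n"
          using B0 \<kappa> m0[of n] by (intro mult_nonneg_nonneg) auto
        ultimately show ?thesis using r by (simp only: ennreal_plus less_imp_le half_gt_zero)
      qed
      also have "\<dots> < ennreal r"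
        using n0[OF n(2)] r B0 \<kappa> m0[of n] by (intro ennreal_lessI) auto
      finally show ?thesis using r by (simp add: ennreal_less_iff)
    qed
    then show "\<exists>n0. \<forall>n\<ge>n0. norm (fejer_sum \<Theta> n x - \<Theta> x) < r" by blast
  qed
qed

lemma cnj_measurable [measurable]: "cnj \<in> borel_measurable borel"
  by (intro borel_measurable_continuous_onI continuous_intros)

text \<open>Parseval's formula in Cesaro form. The kernel is positive with mass one, so the Fejer
  sums inherit the bound \<open>B\<close> and dominated convergence applies; no summability of
  either coefficient sequence is assumed.\<close>

lemma fejer_integral_tendsto:
  fixes \<Theta> h :: "real^'n \<Rightarrow> complex"
  assumes [measurable]: "\<Theta> \<in> borel_measurable borel" and B: "\<And>x. norm (\<Theta> x) \<le> B"
    and per: "\<And>x l. \<Theta> (x + lattice_point l) = \<Theta> x" and cont: "AE x in lborel. isCont \<Theta> x"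
    and h: "integrable lborel h"
  shows "(\<lambda>n. \<Sum>k\<in>grid {- int n<..<int n}. of_real (fejer_weight n k) *
     (LINT \<zeta>|lborel. indicator unit_cube \<zeta> *\<^sub>R (\<Theta> \<zeta> * wave (lattice_point k) \<zeta>)) * (LINT x|lborel. h x * wave (lattice_point (- k)) x))
     \<longlonglongrightarrow> (LINT x|lborel. h x * \<Theta> x)"
proof -
  have [measurable]: "h \<in> borel_measurable borel" using h by (simp add: borel_measurable_integrable[simplified])
  have B0: "B \<ge> 0" using B[of 0] norm_ge_zero order_trans by blast
  let ?c = "\<lambda>k. LINT \<zeta>|lborel. indicator unit_cube \<zeta> *\<^sub>R (\<Theta> \<zeta> * wave (lattice_point k) \<zeta>)"
  have hw: "integrable lborel (\<lambda>x. h x * wave (lattice_point k) x)" for k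
    by (rule Bochner_Integration.integrable_bound[OF h]) (auto simp: norm_mult)
  have [measurable]: "fejer_sum \<Theta> n \<in> borel_measurable borel" for n
    unfolding fejer_sum_def by measurable
  have eq: "(LINT x|lborel. h x * fejer_sum \<Theta> n x) = (\<Sum>k\<in>grid {- int n<..<int n}. of_real (fejer_weight n k) * ?c k * (LINT x|lborel. h x * wave (lattice_point (- k)) x))" for n
  proof -
    have "(LINT x|lborel. h x * fejer_sum \<Theta> n x) = (LINT x|lborel. (\<Sum>k\<in>grid {- int n<..<int n}. (of_real (fejer_weight n k) * ?c k) * (h x * wave (lattice_point (- k)) x)))"
      by (intro Bochner_Integration.integral_cong refl)
        (simp add: fejer_sum_def sum_distrib_left lattice_point_minus wave_minus_left mult_ac)
    also have "\<dots> = (\<Sum>k\<in>grid {- int n<..<int n}. LINT x|lborel. (of_real (fejer_weight n k) * ?c k) * (h x * wave (lattice_point (- k)) x))"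
      by (intro Bochner_Integration.integral_sum integrable_mult_right hw)
    finally show ?thesis by (simp only: integral_mult_right_zero)
  qed
  have "(\<lambda>n. LINT x|lborel. h x * fejer_sum \<Theta> n x) \<longlonglongrightarrow> (LINT x|lborel. h x * \<Theta> x)"
  proof (rule integral_dominated_convergence[where w = "\<lambda>x. norm (h x) * B"])
    show "integrable lborel (\<lambda>x. norm (h x) * B)" using h by (intro integrable_mult_left integrable_norm)
    show "AE x in lborel. (\<lambda>n. h x * fejer_sum \<Theta> n x) \<longlonglongrightarrow> h x * \<Theta> x"
      using cont
    proof eventually_elim
      case (elim x)
      show ?case by (intro tendsto_mult_left fejer_sum_tendsto[OF _ B per elim]) auto
    qed
    show "AE x in lborel. norm (h x * fejer_sum \<Theta> n x) \<le> norm (h x) * B" for n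
    proof (cases "n = 0")
      case True
      then show ?thesis using B0 by (simp add: fejer_sum_def grid_def)
    next
      case False
      then have "norm (fejer_sum \<Theta> n x) \<le> B" for x using B by (intro norm_fejer_sum_le) auto
      then show ?thesis by (intro AE_I2) (auto simp: norm_mult intro!: mult_left_mono)
    qed
  qed measurable
  then show ?thesis unfolding eq .
qed

subsection \<open>Sums over the lattice\<close>

lemma nn_integral_count_space_le:
  fixes f :: "int^'n \<Rightarrow> ennreal"
  assumes "\<And>X. finite X \<Longrightarrow> (\<Sum>k\<in>X. f k) \<le> c"
  shows "(\<integral>\<^sup>+k. f k \<partial>count_space UNIV) \<le> c"
proof -
  let ?G = "\<lambda>n. grid {- int n..int n} :: (int^'n) set"
  have mono: "incseq ?G" by (auto simp: incseq_def grid_def) (smt (verit) of_nat_le_iff)+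
  have "f k = (SUP n. f k * indicator (?G n) k)" for k
  proof (rule antisym)
    define n where "n = nat (\<Sum>i\<in>UNIV. \<bar>k $ i\<bar>)"
    have "\<bar>k $ i\<bar> \<le> int n" for i
    proof -
      have "\<bar>k $ i\<bar> \<le> (\<Sum>i\<in>UNIV. \<bar>k $ i\<bar>)" by (rule member_le_sum) auto
      then show ?thesis by (simp add: n_def)
    qed
    then have "k \<in> ?G n" by (auto simp: grid_def abs_le_iff minus_le_iff)
    then show "f k \<le> (SUP n. f k * indicator (?G n) k)" by (intro SUP_upper2[of n]) auto
    show "(SUP n. f k * indicator (?G n) k) \<le> f k" by (intro SUP_least) (auto simp: indicator_def)
  qed
  then have "(\<integral>\<^sup>+k. f k \<partial>count_space UNIV) = (\<integral>\<^sup>+k. (SUP n. f k * indicator (?G n) k) \<partial>count_space UNIV)"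
    by (simp only:)
  also have "\<dots> = (SUP n. \<integral>\<^sup>+k. f k * indicator (?G n) k \<partial>count_space UNIV)"
    using mono by (intro nn_integral_monotone_convergence_SUP) (auto simp: incseq_def le_fun_def indicator_def)
  also have "\<dots> \<le> c"
  proof (rule SUP_least)
    fix n
    have "(\<integral>\<^sup>+k. f k * indicator (?G n) k \<partial>count_space UNIV) = (\<Sum>k\<in>?G n. f k)"
      by (simp add: nn_integral_count_space_indicator[symmetric] nn_integral_count_space_finite finite_grid)
    also have "\<dots> \<le> c" by (intro assms finite_grid) simp
    finally show "(\<integral>\<^sup>+k. f k * indicator (?G n) k \<partial>count_space UNIV) \<le> c" .
  qed
  finally show ?thesis .
qed

lemma finite_subset_symmetric_grid:
  assumes "finite (X :: (int^'n) set)"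
  obtains M where "X \<subseteq> grid {- int M..int M}"
proof -
  define M where "M = nat (\<Sum>k\<in>X. \<Sum>i\<in>UNIV. \<bar>k $ i\<bar>)"
  have "\<bar>k $ i\<bar> \<le> int M" if "k \<in> X" for k i
  proof -
    have "\<bar>k $ i\<bar> \<le> (\<Sum>i\<in>UNIV. \<bar>k $ i\<bar>)" by (rule member_le_sum) auto
    also have "\<dots> \<le> (\<Sum>k\<in>X. \<Sum>i\<in>UNIV. \<bar>k $ i\<bar>)" using assms that by (intro member_le_sum sum_nonneg) auto
    finally have "\<bar>k $ i\<bar> \<le> (\<Sum>k\<in>X. \<Sum>i\<in>UNIV. \<bar>k $ i\<bar>)" .
    then show ?thesis unfolding M_def using abs_ge_zero[of "k $ i"] by linarith
  qed
  then have "X \<subseteq> grid {- int M..int M}" by (auto simp: grid_def abs_le_iff minus_le_iff)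
  then show thesis by (rule that)
qed

text \<open>The passage from l_p to L_p: the unit cube has measure one, so a bound valid for the
  finite sums on every coset passes to the integral without loss.\<close>

lemma nn_integral_lattice_fibers_le:
  fixes f :: "real^'n \<Rightarrow> ennreal"
  assumes [measurable]: "f \<in> borel_measurable borel"
    and "\<And>s X. s \<in> unit_cube \<Longrightarrow> finite X \<Longrightarrow> (\<Sum>n\<in>X. f (s + lattice_point n)) \<le> c"
  shows "(\<integral>\<^sup>+x. f x \<partial>lborel) \<le> c"
proof -
  have "(\<integral>\<^sup>+x. f x \<partial>lborel) = (\<integral>\<^sup>+s. (\<integral>\<^sup>+n. f (s + lattice_point n) \<partial>count_space UNIV) * indicator unit_cube s \<partial>lborel)"
    by (rule nn_integral_tiling) measurable
  also have "\<dots> \<le> (\<integral>\<^sup>+s. c * indicator (unit_cube :: (real^'n) set) s \<partial>lborel)"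
    using assms(2) by (intro nn_integral_mono) (auto simp: indicator_def intro!: nn_integral_count_space_le)
  also have "\<dots> = c" by (simp add: nn_integral_cmult emeasure_unit_cube)
  finally show ?thesis .
qed

lemma conv_bounded_Lp:
  fixes \<phi> :: "real^'n \<Rightarrow> complex"
  assumes \<phi>: "conv_bounded p C \<phi>" and [measurable]: "\<phi> \<in> borel_measurable borel" and p: "p \<ge> 1" and A: "finite A"
  shows "(\<integral>\<^sup>+x. ennreal (norm (\<Sum>k\<in>A. u k * \<phi> (x + lattice_point k)) powr p) \<partial>lborel) \<le> ennreal (C * (\<Sum>k\<in>A. norm (u k) powr p))"
proof (rule nn_integral_lattice_fibers_le)
  fix s :: "real^'n" and X :: "(int^'n) set" assume s: "s \<in> unit_cube" and X: "finite X"
  obtain M where M: "X \<union> uminus ` A \<subseteq> grid {- int M..int M}"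
    using finite_subset_symmetric_grid[of "X \<union> uminus ` A"] X A by blast
  let ?G = "grid {- int M..int M} :: (int^'n) set"
  have finG: "finite ?G" by (intro finite_grid) simp
  \<comment> \<open>The series uses \<phi>(x + k), the kernel bound a convolution; reflecting the
    coefficients reconciles the two.\<close>
  define a where "a k = (if - k \<in> A then u (- k) else 0)" for k
  have a0: "a k = 0" if "k \<notin> uminus ` A" for k
  proof -
    have "- k \<notin> A" using that by (metis image_eqI minus_minus)
    then show ?thesis by (simp add: a_def)
  qed
  have s': "\<forall>i. \<bar>s $ i\<bar> \<le> 1/2"
  proof
    fix i
    have "- 1/2 \<le> s $ i \<and> s $ i < 1/2" using s by (simp add: unit_cube_def)
    then show "\<bar>s $ i\<bar> \<le> 1/2" by linarith
  qed
  have sumA: "(\<Sum>k\<in>?G. g k * a k) = (\<Sum>k\<in>A. g (- k) * u k)" for g :: "int^'n \<Rightarrow> complex"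
  proof -
    have "(\<Sum>k\<in>?G. g k * a k) = (\<Sum>k\<in>uminus ` A. g k * a k)"
      using M finG by (intro sum.mono_neutral_right) (auto simp: a0)
    also have "\<dots> = (\<Sum>k\<in>A. g (- k) * u k)"
      by (subst sum.reindex) (auto simp: a_def inj_on_def)
    finally show ?thesis .
  qed
  have "(\<Sum>n\<in>X. norm (\<Sum>k\<in>A. u k * \<phi> (s + lattice_point n + lattice_point k)) powr p)
    \<le> (\<Sum>n\<in>?G. norm (\<Sum>k\<in>A. u k * \<phi> (s + lattice_point n + lattice_point k)) powr p)"
    using M finG by (intro sum_mono2) auto
  also have "\<dots> = (\<Sum>n\<in>?G. norm (\<Sum>k\<in>?G. \<phi> (lattice_point (n - k) + s) * a k) powr p)"
    unfolding sumA by (simp add: lattice_point_add mult.commute add_ac)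
  also have "\<dots> \<le> C * (\<Sum>k\<in>?G. norm (a k) powr p)"
    using \<phi> s' unfolding conv_bounded_def by auto
  also have "(\<Sum>k\<in>?G. norm (a k) powr p) = (\<Sum>k\<in>uminus ` A. norm (a k) powr p)"
    using M finG by (intro sum.mono_neutral_right) (auto simp: a0)
  also have "\<dots> = (\<Sum>k\<in>A. norm (u k) powr p)"
    by (subst sum.reindex) (auto simp: a_def inj_on_def)
  finally have "(\<Sum>n\<in>X. norm (\<Sum>k\<in>A. u k * \<phi> (s + lattice_point n + lattice_point k)) powr p) \<le> C * (\<Sum>k\<in>A. norm (u k) powr p)" .
  then show "(\<Sum>n\<in>X. ennreal (norm (\<Sum>k\<in>A. u k * \<phi> (s + lattice_point n + lattice_point k)) powr p)) \<le> ennreal (C * (\<Sum>k\<in>A. norm (u k) powr p))"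
    by (subst sum_ennreal) (auto intro: ennreal_leI)
qed measurable

subsection \<open>Periodization of compactly supported functions\<close>

text \<open>The finitely many translations that bring \<open>x\<close> into the box. Summing over
  them gives the full periodization whenever the summand vanishes off the box, and keeps every sum
  finite.\<close>

definition lat_set :: "real^'n \<Rightarrow> real^'n \<Rightarrow> real^'n \<Rightarrow> (int^'n) set" where
  "lat_set a b x = {l. x - lattice_point l \<in> cbox a b}"

definition lat_sum :: "real^'n \<Rightarrow> real^'n \<Rightarrow> (real^'n \<Rightarrow> complex) \<Rightarrow> real^'n \<Rightarrow> complex" where
  "lat_sum a b g x = (\<Sum>l\<in>lat_set a b x. g (x - lattice_point l))"

lemma lat_set_subset_grid:
  assumes "norm x \<le> R"
  shows "lat_set a b x \<subseteq> grid {- \<lceil>R + norm a + norm b\<rceil>..\<lceil>R + norm a + norm b\<rceil>}"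
proof
  fix l assume l: "l \<in> lat_set a b x"
  have "\<bar>real_of_int (l $ i)\<bar> \<le> R + norm a + norm b" for i
  proof -
    have "a $ i \<le> x $ i - l $ i" "x $ i - l $ i \<le> b $ i"
      using l by (auto simp: lat_set_def mem_box_cart)
    moreover have "\<bar>a $ i\<bar> \<le> norm a" "\<bar>b $ i\<bar> \<le> norm b" "\<bar>x $ i\<bar> \<le> norm x"
      by (rule component_le_norm_cart)+
    ultimately show ?thesis using assms by linarith
  qed
  then have "real_of_int (l $ i) \<le> \<lceil>R + norm a + norm b\<rceil>" "- real_of_int (l $ i) \<le> \<lceil>R + norm a + norm b\<rceil>" for i
    by (meson abs_le_D1 abs_le_D2 order_trans le_of_int_ceiling)+
  then show "l \<in> grid {- \<lceil>R + norm a + norm b\<rceil>..\<lceil>R + norm a + norm b\<rceil>}"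
    by (auto simp: grid_def) (smt (verit) of_int_le_iff of_int_minus)+
qed

lemma finite_lat_set: "finite (lat_set a b x)"
  by (rule finite_subset[OF lat_set_subset_grid[OF order_refl]]) (simp add: finite_grid)

lemma lat_sum_eq:
  assumes "finite T" "lat_set a b x \<subseteq> T" "\<And>y. y \<notin> cbox a b \<Longrightarrow> g y = 0"
  shows "lat_sum a b g x = (\<Sum>l\<in>T. g (x - lattice_point l))"
  unfolding lat_sum_def using assms by (intro sum.mono_neutral_left) (auto simp: lat_set_def)

lemma lat_sum_periodic: "lat_sum a b g (x + lattice_point k) = lat_sum a b g x"
  unfolding lat_sum_def
  by (rule sum.reindex_bij_witness[of _ "\<lambda>l. l + k" "\<lambda>l. l - k"])
    (auto simp: lat_set_def lattice_point_add lattice_point_diff algebra_simps)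

text \<open>The index set varies with \<open>x\<close>, so the sum is exhibited as a limit of sums
  over fixed grids that are eventually constant at each point.\<close>

lemma lat_sum_measurable:
  assumes [measurable]: "g \<in> borel_measurable borel" and g0: "\<And>y. y \<notin> cbox a b \<Longrightarrow> g y = 0"
  shows "lat_sum a b g \<in> borel_measurable borel"
proof (rule borel_measurable_LIMSEQ_metric)
  let ?T = "\<lambda>n. grid {- \<lceil>real n + norm a + norm b\<rceil>..\<lceil>real n + norm a + norm b\<rceil>} :: (int^'a) set"
  show "(\<lambda>x. \<Sum>l\<in>?T n. g (x - lattice_point l)) \<in> borel_measurable borel" for n by measurable
  fix x :: "real^'a"
  have "eventually (\<lambda>n. (\<Sum>l\<in>?T n. g (x - lattice_point l)) = lat_sum a b g x) sequentially"
    using eventually_ge_at_top[of "nat \<lceil>norm x\<rceil>"]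
  proof eventually_elim
    case (elim n)
    then have "norm x \<le> real n" by linarith
    then show ?case by (intro lat_sum_eq[symmetric] lat_set_subset_grid g0) (simp_all add: finite_grid)
  qed
  then show "(\<lambda>n. \<Sum>l\<in>?T n. g (x - lattice_point l)) \<longlonglongrightarrow> lat_sum a b g x"
    by (rule tendsto_eventually)
qed

lemma lat_sum_bounded:
  fixes a b :: "real^'n"
  assumes B: "\<And>y. norm (g y) \<le> B" and g0: "\<And>y. y \<notin> cbox a b \<Longrightarrow> g y = 0"
  shows "norm (lat_sum a b g x) \<le> real (card (grid {- \<lceil>real CARD('n) + norm a + norm b\<rceil>..\<lceil>real CARD('n) + norm a + norm b\<rceil>} :: (int^'n) set)) * B"
proof -
  obtain k where k: "x - lattice_point k \<in> unit_cube" using ex1_lattice_unit_cube[of x] by blast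
  let ?y = "x - lattice_point k"
  let ?T = "grid {- \<lceil>real CARD('n) + norm a + norm b\<rceil>..\<lceil>real CARD('n) + norm a + norm b\<rceil>} :: (int^'n) set"
  have "lat_sum a b g x = lat_sum a b g ?y" using lat_sum_periodic[of a b g ?y k] by simp
  also have "\<dots> = (\<Sum>l\<in>?T. g (?y - lattice_point l))"
    by (rule lat_sum_eq[OF _ lat_set_subset_grid[OF norm_unit_cube_le[OF k]] g0]) (simp_all add: finite_grid)
  also have "norm \<dots> \<le> (\<Sum>l\<in>?T. B)" by (intro sum_norm_le B)
  finally show ?thesis by simp
qed

text \<open>Discontinuities can occur only on the integer translates of the boundary of the box, a
  countable union of null sets. Near any other point the periodization is a fixed finite sum of
  continuous functions.\<close>

lemma lat_sum_isCont_AE: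
  assumes cont: "continuous_on (cbox a b) g" and g0: "\<And>y. y \<notin> cbox a b \<Longrightarrow> g y = 0"
  shows "AE x in lborel. isCont (lat_sum a b g) x"
proof -
  have contg: "isCont g y" if y: "y \<notin> cbox a b - box a b" for y
  proof (cases "y \<in> box a b")
    case True
    have "continuous_on (box a b) g" by (rule continuous_on_subset[OF cont box_subset_cbox])
    then show ?thesis using True by (simp add: continuous_on_eq_continuous_at[OF open_box])
  next
    case False
    then have "y \<in> - cbox a b" using y by auto
    moreover have "continuous_on (- cbox a b) g"
      using g0 by (intro continuous_on_eq[OF continuous_on_const[of _ 0]]) auto
    moreover have "open (- cbox a b)" by (intro open_Compl closed_cbox)
    ultimately show ?thesis by (auto simp: continuous_on_eq_continuous_at)
  qed
  have null: "cbox a b - box a b \<in> null_sets lborel"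
  proof -
    have "negligible (cbox a b - box a b)" by (rule negligible_frontier_interval)
    then have "cbox a b - box a b \<in> null_sets lebesgue" by (simp add: negligible_iff_null_sets)
    then show ?thesis by (subst (asm) null_sets_completion_iff) auto
  qed
  have AEl: "AE x in lborel. x - lattice_point l \<notin> cbox a b - box a b" for l
  proof -
    have "AE x in distr lborel borel ((+) (- lattice_point l)). x \<notin> cbox a b - box a b"
      unfolding lborel_distr_plus using null by (rule AE_not_in)
    then show ?thesis by (subst (asm) AE_distr_iff) auto
  qed
  then have "AE x in lborel. \<forall>l. x - lattice_point l \<notin> cbox a b - box a b"
    by (subst AE_all_countable) auto
  then show ?thesis
  proof eventually_elim
    case (elim x)
    let ?R = "norm x + 1"
    let ?T = "grid {- \<lceil>?R + norm a + norm b\<rceil>..\<lceil>?R + norm a + norm b\<rceil>} :: (int^'a) set"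
    have "isCont (\<lambda>y. \<Sum>l\<in>?T. g (y - lattice_point l)) x"
    proof (intro continuous_sum)
      fix l
      have "isCont (g \<circ> (\<lambda>y. y - lattice_point l)) x"
        using elim by (intro continuous_at_compose contg continuous_intros) auto
      then show "isCont (\<lambda>y. g (y - lattice_point l)) x" by (simp add: o_def)
    qed
    moreover have "eventually (\<lambda>y. lat_sum a b g y = (\<Sum>l\<in>?T. g (y - lattice_point l))) (nhds x)"
    proof -
      have "eventually (\<lambda>y. y \<in> ball x 1) (nhds x)" by (intro eventually_nhds_in_open) auto
      then show ?thesis
      proof eventually_elim
        case (elim y)
        then have "norm y \<le> ?R" using norm_triangle_ineq2[of y x] by (simp add: dist_norm norm_minus_commute)
        then show ?case by (intro lat_sum_eq[OF _ lat_set_subset_grid g0]) (auto simp: finite_grid)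
      qed
    qed
    ultimately show ?case by (simp add: isCont_cong)
  qed
qed

lemma integral_lborel_translate:
  fixes f :: "'a::euclidean_space \<Rightarrow> complex"
  assumes [measurable]: "f \<in> borel_measurable borel"
  shows "(LINT x|lborel. f (c + x)) = (LINT x|lborel. f x)"
  by (subst (2) lborel_distr_plus[of c, symmetric]) (simp add: integral_distr)

lemma integrable_lborel_translate:
  fixes f :: "'a::euclidean_space \<Rightarrow> complex"
  assumes "integrable lborel f"
  shows "integrable lborel (\<lambda>x. f (c + x))"
proof -
  have "integrable (distr lborel borel ((+) c)) f" using assms by (simp only: lborel_distr_plus)
  then show ?thesis by (subst (asm) integrable_distr_eq) (use assms in auto)
qed

lemma integral_unit_cube_lat_sum:
  fixes a b :: "real^'n"
  assumes g: "integrable lborel g" and g0: "\<And>y. y \<notin> cbox a b \<Longrightarrow> g y = 0"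
  shows "(LINT x|lborel. indicator unit_cube x *\<^sub>R lat_sum a b g x) = (LINT x|lborel. g x)"
proof -
  have [measurable]: "g \<in> borel_measurable borel" using g by (simp add: borel_measurable_integrable[simplified])
  let ?T = "grid {- \<lceil>real CARD('n) + norm a + norm b\<rceil>..\<lceil>real CARD('n) + norm a + norm b\<rceil>} :: (int^'n) set"
  have T: "lat_set a b x \<subseteq> ?T" if "x \<in> unit_cube" for x
    by (rule lat_set_subset_grid[OF norm_unit_cube_le[OF that]])
  have gi: "integrable lborel (\<lambda>x. indicator unit_cube x *\<^sub>R g (x - lattice_point l))" for l
    using integrable_lborel_translate[OF g, of "- lattice_point l"]
    by (intro integrable_mult_indicator) auto
  have gi2: "integrable lborel (\<lambda>y. indicator unit_cube (y + lattice_point l) *\<^sub>R g y)" for l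
    using integrable_lborel_translate[OF gi[of l], of "lattice_point l"] by (simp add: add.commute)
  have "(LINT x|lborel. indicator unit_cube x *\<^sub>R lat_sum a b g x) = (LINT x|lborel. (\<Sum>l\<in>?T. indicator unit_cube x *\<^sub>R g (x - lattice_point l)))"
    using lat_sum_eq[OF _ T g0] by (intro Bochner_Integration.integral_cong refl) (auto simp: indicator_def finite_grid)
  also have "\<dots> = (\<Sum>l\<in>?T. LINT x|lborel. indicator unit_cube x *\<^sub>R g (x - lattice_point l))"
    by (intro Bochner_Integration.integral_sum gi)
  also have "\<dots> = (\<Sum>l\<in>?T. LINT y|lborel. indicator unit_cube (y + lattice_point l) *\<^sub>R g y)"
  proof (rule sum.cong[OF refl])
    fix l
    show "(LINT x|lborel. indicator unit_cube x *\<^sub>R g (x - lattice_point l)) = (LINT y|lborel. indicator unit_cube (y + lattice_point l) *\<^sub>R g y)"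
      by (subst integral_lborel_translate[of "\<lambda>x. indicator unit_cube x *\<^sub>R g (x - lattice_point l)" "lattice_point l", symmetric])
        (auto simp: add.commute)
  qed
  also have "\<dots> = (LINT y|lborel. (\<Sum>l\<in>?T. indicator unit_cube (y + lattice_point l) *\<^sub>R g y))"
    by (intro Bochner_Integration.integral_sum[symmetric] gi2)
  also have "\<dots> = (LINT y|lborel. g y)"
  proof (intro Bochner_Integration.integral_cong refl)
    fix y
    show "(\<Sum>l\<in>?T. indicator unit_cube (y + lattice_point l) *\<^sub>R g y) = g y"
    proof (cases "y \<in> cbox a b")
      case True
      \<comment> \<open>For each y exactly one translate lies in the cube, so the sum of indicators
        collapses to a single term.\<close>
      obtain k where k: "\<And>l. y - lattice_point l \<in> unit_cube \<longleftrightarrow> l = k" using ex1_lattice_unit_cube[of y] by blast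
      have iff: "y + lattice_point l \<in> unit_cube \<longleftrightarrow> l = - k" for l
        using k[of "- l"] by (auto simp: lattice_point_minus)
      have "- k \<in> lat_set a b (y + lattice_point (- k))" using True by (simp add: lat_set_def)
      then have "- k \<in> ?T" using T[of "y + lattice_point (- k)"] iff by auto
      have "(\<Sum>l\<in>?T. indicator unit_cube (y + lattice_point l) *\<^sub>R g y) = (\<Sum>l\<in>?T. if l = - k then g y else 0)"
        by (intro sum.cong refl) (simp add: indicator_def iff)
      then show ?thesis using \<open>- k \<in> ?T\<close> by (simp add: finite_grid)
    qed (simp add: g0)
  qed
  finally show ?thesis .
qed

subsection \<open>The estimate for the identity dilation\<close>

lemma AE_lborel_null_set:
  assumes "AE x in lborel. P x"
  shows "\<exists>N\<in>null_sets lborel. \<forall>x. x \<notin> N \<longrightarrow> P x"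
proof -
  from assms obtain N where "{x \<in> space lborel. \<not> P x} \<subseteq> N" "emeasure lborel N = 0" "N \<in> sets lborel"
    by (rule AE_E)
  then show ?thesis by (intro bexI[of _ N]) (auto simp: null_sets_def)
qed

lemma AE_lborel_translate:
  fixes c :: "'a::euclidean_space"
  assumes "AE x in lborel. P x"
  shows "AE x in lborel. P (c + x)"
proof -
  from AE_lborel_null_set[OF assms] obtain N where N: "\<And>x. x \<notin> N \<Longrightarrow> P x" "N \<in> null_sets lborel"
    by blast
  have [measurable]: "N \<in> sets borel" using N(2) by auto
  have "AE x in distr lborel borel ((+) c). x \<notin> N"
    unfolding lborel_distr_plus using N(2) by (rule AE_not_in)
  then have "AE x in lborel. c + x \<notin> N" by (subst (asm) AE_distr_iff) auto
  then show ?thesis by eventually_elim (use N(1) in auto)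
qed

lemma spectrum_measurable:
  fixes \<theta> :: "real^'n \<Rightarrow> complex"
  assumes "continuous_on (cbox a b) \<theta>" and \<theta>0: "\<And>\<xi>. \<xi> \<notin> cbox a b \<Longrightarrow> \<theta> \<xi> = 0"
  shows "\<theta> \<in> borel_measurable borel"
proof -
  have "(\<lambda>\<xi>. indicator (cbox a b) \<xi> *\<^sub>R \<theta> \<xi>) \<in> borel_measurable borel"
    using assms(1) by (intro borel_measurable_continuous_on_indicator) auto
  also have "(\<lambda>\<xi>. indicator (cbox a b) \<xi> *\<^sub>R \<theta> \<xi>) = \<theta>"
    using \<theta>0 by (auto simp: indicator_def)
  finally show ?thesis .
qed

lemma inverse_fourier_measurable:
  fixes F :: "real^'n \<Rightarrow> complex"
  assumes [measurable]: "F \<in> borel_measurable borel"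
  shows "(\<lambda>x. LINT \<xi>|lborel. F \<xi> * wave x \<xi>) \<in> borel_measurable borel"
  by measurable

text \<open>The constant is chosen before \<open>F\<close>, so that it serves for every rescaled
  spectrum at once. The bound \<open>I0\<close> on the full weighted norm only secures convergence,
  whereas \<open>J\<close> bounds the part of it outside the ball of radius \<delta>, and the error
  is estimated by \<open>J\<close> alone.\<close>

lemma core_approximation:
  fixes a b :: "real^'n" and \<theta> G \<phi> :: "real^'n \<Rightarrow> complex" and N :: nat and p q \<gamma> \<delta> K :: real
  assumes pq: "p \<ge> 2" "1 / p + 1 / q = 1" and \<gamma>: "(\<gamma> - real N) * p > real CARD('n)"
    and ab: "\<And>i. a $ i < b $ i" and Ck: "Ck_on CARD('n) (cbox a b) \<theta>" and \<theta>0: "\<And>\<xi>. \<xi> \<notin> cbox a b \<Longrightarrow> \<theta> \<xi> = 0"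
    and \<phi>: "\<And>x. \<phi> x = (LINT \<xi>|lborel. \<theta> \<xi> * wave x \<xi>)"
    and Gm [measurable]: "G \<in> borel_measurable borel" and K: "K \<ge> 0" "AE \<xi> in lborel. norm (G \<xi>) \<le> K * (1 + norm \<xi>) powr real N"
    and \<delta>: "\<delta> > 0" and compat1: "AE \<xi> in lborel. norm \<xi> < \<delta> \<longrightarrow> cnj (\<theta> \<xi>) * G \<xi> = 1"
    and compat2: "\<And>l. l \<noteq> 0 \<Longrightarrow> AE \<xi> in lborel. norm (lattice_point l - \<xi>) < \<delta> \<longrightarrow> \<theta> \<xi> = 0"
  shows "\<exists>C\<ge>0. \<forall>F I0. F \<in> borel_measurable borel \<longrightarrow> I0 \<ge> 0 \<longrightarrow>
      (\<integral>\<^sup>+\<xi>. ennreal (((1 + norm \<xi>) powr \<gamma> * norm (F \<xi>)) powr q) \<partial>lborel) \<le> ennreal I0 \<longrightarrow>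
      integrable lborel F \<and> (\<exists>S\<in>borel_measurable borel.
        ((\<lambda>A. \<integral>\<^sup>+x. ennreal (norm (S x - (\<Sum>k\<in>A. (LINT \<xi>|lborel. F \<xi> * cnj (wave (lattice_point k) \<xi> * G \<xi>)) * \<phi> (x + lattice_point k))) powr p) \<partial>lborel)
          \<longlongrightarrow> 0) (finite_subsets_at_top UNIV) \<and>
        (\<forall>J\<ge>0. (\<integral>\<^sup>+\<xi>. ennreal ((norm \<xi> powr \<gamma> * norm (F \<xi>)) powr q) * indicator {\<xi>. \<delta> \<le> norm \<xi>} \<xi> \<partial>lborel) \<le> ennreal J \<longrightarrow>
          (\<integral>\<^sup>+x. ennreal (norm ((LINT \<xi>|lborel. F \<xi> * wave x \<xi>) - S x) powr p) \<partial>lborel) \<le> ennreal (C * J powr (p - 1))))"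
proof -
  have p1: "p \<ge> 1" "p > 0" using pq by auto
  have q: "q > 1" "q = p / (p - 1)"
  proof -
    have "q \<noteq> 0" using pq by (cases "q = 0") auto
    then show eq: "q = p / (p - 1)" using pq by (simp add: field_simps)
    show "q > 1" unfolding eq using pq by (simp add: less_divide_eq)
  qed
  have \<gamma>0: "\<gamma> \<ge> 0"
  proof (rule ccontr)
    assume "\<not> \<gamma> \<ge> 0"
    then have "(\<gamma> - real N) * p \<le> 0" using p1 by (intro mult_nonpos_nonneg) auto
    then show False using \<gamma> by simp
  qed
  have contB: "continuous_on (cbox a b) \<theta>" by (rule Ck_on_imp_continuous_on[OF Ck])
  have [measurable]: "\<theta> \<in> borel_measurable borel" by (rule spectrum_measurable[OF contB \<theta>0])
  have "bounded (\<theta> ` cbox a b)" by (intro compact_imp_bounded compact_continuous_image contB) auto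
  then obtain B where B': "\<And>x. x \<in> cbox a b \<Longrightarrow> norm (\<theta> x) \<le> B" unfolding bounded_iff by auto
  have "a \<in> cbox a b" using ab by (simp add: mem_box_cart less_imp_le)
  then have B0: "B \<ge> 0" using B' norm_ge_zero order_trans by blast
  have B: "norm (\<theta> x) \<le> B" for x using B'[of x] \<theta>0[of x] B0 by (cases "x \<in> cbox a b") auto
  have [measurable]: "\<phi> \<in> borel_measurable borel"
    using inverse_fourier_measurable[of \<theta>] by (simp add: \<phi>[abs_def])
  obtain Ck where Ck: "conv_bounded p Ck \<phi>"
    using class_B_kernel_bound[OF pq(1) ab Ck \<theta>0] unfolding \<phi>[abs_def] by blast
  have Ck0: "Ck \<ge> 0" using Ck by (simp add: conv_bounded_def)
  \<comment> \<open>Its Fourier coefficients are the samples \<phi>(s + k), as shown in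
    \<open>coefs\<close>; it is bounded, periodic and almost everywhere continuous, which is what
    Fejer summation asks for.\<close>
  define \<Theta> where "\<Theta> s = lat_sum a b (\<lambda>\<xi>. \<theta> \<xi> * wave s \<xi>)" for s
  define BT where "BT = real (card (grid {- \<lceil>real CARD('n) + norm a + norm b\<rceil>..\<lceil>real CARD('n) + norm a + norm b\<rceil>} :: (int^'n) set)) * B"
  have BT: "norm (\<Theta> s x) \<le> BT" for s x
    unfolding \<Theta>_def BT_def by (intro lat_sum_bounded) (auto simp: norm_mult B \<theta>0)
  have BT0: "BT \<ge> 0" using B0 by (simp add: BT_def)
  have [measurable]: "\<Theta> s \<in> borel_measurable borel" for s
    unfolding \<Theta>_def by (rule lat_sum_measurable) (auto simp: \<theta>0)
  have \<Theta>per: "\<Theta> s (x + lattice_point l) = \<Theta> s x" for s x l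
    unfolding \<Theta>_def by (rule lat_sum_periodic)
  have \<Theta>cont: "AE x in lborel. isCont (\<Theta> s) x" for s
    unfolding \<Theta>_def by (rule lat_sum_isCont_AE) (auto simp: \<theta>0 intro!: continuous_intros contB)
  have \<Theta>shift: "\<Theta> (s + lattice_point n) \<eta> = wave (lattice_point n) \<eta> * \<Theta> s \<eta>" for s n \<eta>
  proof -
    have "wave (s + lattice_point n) (\<eta> - lattice_point l) = wave (lattice_point n) \<eta> * wave s (\<eta> - lattice_point l)" for l
    proof -
      have "wave (lattice_point n) (\<eta> - lattice_point l) = wave (lattice_point n) \<eta>"
        using wave_lattice_periodic[of n "\<eta> - lattice_point l" l] by simp
      then show ?thesis by (simp add: wave_add_left)
    qed
    then show ?thesis by (simp add: \<Theta>_def lat_sum_def sum_distrib_left mult_ac)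
  qed
  have \<theta>int: "integrable lborel \<theta>"
  proof -
    have "integrable lborel (\<lambda>\<xi>. indicator (cbox a b) \<xi> *\<^sub>R \<theta> \<xi>)"
      by (rule borel_integrable_compact[OF _ contB]) auto
    also have "(\<lambda>\<xi>. indicator (cbox a b) \<xi> *\<^sub>R \<theta> \<xi>) = \<theta>" using \<theta>0 by (auto simp: indicator_def)
    finally show ?thesis .
  qed
  have coefs: "(LINT \<zeta>|lborel. indicator unit_cube \<zeta> *\<^sub>R (\<Theta> x \<zeta> * wave (lattice_point k) \<zeta>)) = \<phi> (x + lattice_point k)" for x k
  proof -
    have "\<Theta> x \<zeta> * wave (lattice_point k) \<zeta> = lat_sum a b (\<lambda>\<xi>. \<theta> \<xi> * wave (x + lattice_point k) \<xi>) \<zeta>" for \<zeta>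
      using \<Theta>shift[of x k \<zeta>] by (simp add: \<Theta>_def mult.commute)
    then have "(LINT \<zeta>|lborel. indicator unit_cube \<zeta> *\<^sub>R (\<Theta> x \<zeta> * wave (lattice_point k) \<zeta>))
      = (LINT \<zeta>|lborel. \<theta> \<zeta> * wave (x + lattice_point k) \<zeta>)"
      by (simp only:) (intro integral_unit_cube_lat_sum, auto simp: \<theta>0 norm_mult intro: Bochner_Integration.integrable_bound[OF \<theta>int])
    then show ?thesis by (simp add: \<phi>)
  qed
  \<comment> \<open>There is one exceptional null set for each nonzero lattice point; translating
    them to a common \<xi> and using countability merges them into one.\<close>
  have "AE \<xi> in lborel. \<forall>l. l \<noteq> 0 \<longrightarrow> norm \<xi> < \<delta> \<longrightarrow> \<theta> (\<xi> - lattice_point l) = 0"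
  proof (subst AE_all_countable, intro allI)
    fix l :: "int^'n"
    show "AE \<xi> in lborel. l \<noteq> 0 \<longrightarrow> norm \<xi> < \<delta> \<longrightarrow> \<theta> (\<xi> - lattice_point l) = 0"
    proof (cases "l = 0")
      case False
      then have "AE \<xi> in lborel. norm (lattice_point (- l) - \<xi>) < \<delta> \<longrightarrow> \<theta> \<xi> = 0" by (intro compat2) simp
      from AE_lborel_translate[OF this, of "- lattice_point l"] show ?thesis
        by eventually_elim (auto simp: lattice_point_minus)
    qed simp
  qed
  with K(2) compat1 have "AE \<xi> in lborel. norm (G \<xi>) \<le> K * (1 + norm \<xi>) powr real N \<and>
      (norm \<xi> < \<delta> \<longrightarrow> cnj (\<theta> \<xi>) * G \<xi> = 1 \<and> (\<forall>l. l \<noteq> 0 \<longrightarrow> \<theta> (\<xi> - lattice_point l) = 0))"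
    by eventually_elim auto
  from AE_lborel_null_set[OF this] obtain N0 where N0: "N0 \<in> null_sets lborel" and
    good: "\<And>\<xi>. \<xi> \<notin> N0 \<Longrightarrow> norm (G \<xi>) \<le> K * (1 + norm \<xi>) powr real N \<and>
      (norm \<xi> < \<delta> \<longrightarrow> cnj (\<theta> \<xi>) * G \<xi> = 1 \<and> (\<forall>l. l \<noteq> 0 \<longrightarrow> \<theta> (\<xi> - lattice_point l) = 0))"
    by blast
  have N0s [measurable]: "N0 \<in> sets borel" using N0 by auto
  obtain CH where CH: "CH \<ge> 0"
    "\<And>(v :: real^'n \<Rightarrow> complex) E I. v \<in> borel_measurable borel \<Longrightarrow> E \<in> borel_measurable borel \<Longrightarrow> (\<And>x. E x \<ge> 0) \<Longrightarrow>
      (\<And>x. norm (v x) \<le> (1 + norm x) powr real N * E x) \<Longrightarrow> I \<ge> 0 \<Longrightarrow>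
      (\<integral>\<^sup>+x. ennreal (((1 + norm x) powr \<gamma> * E x) powr q) \<partial>lborel) \<le> ennreal I \<Longrightarrow>
      integrable lborel v \<and> (\<forall>A. finite A \<longrightarrow>
        (\<Sum>k\<in>A. norm (LINT \<xi>|lborel. v \<xi> * wave (lattice_point k) \<xi>) powr p) \<le> CH * I powr (p - 1))"
    using Hausdorff_Young_weighted[OF pq \<gamma>] by blast
  \<comment> \<open>\<open>M1\<close> bounds the multiplier of \<open>F\<close> in the error
    spectrum relative to (1+|\<eta>|)^N. \<open>M2\<close> also absorbs the inequality 1 + |\<eta>|
    \<le> (1 + 1/\<delta>) |\<eta>|, valid for |\<eta>| \<ge> \<delta>.\<close>
  define M1 where "M1 = 1 + K * BT"
  define M2 where "M2 = (M1 * (1 + 1 / \<delta>) powr \<gamma>) powr q"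
  have M1: "M1 \<ge> 0" using K BT0 by (simp add: M1_def)
  define C where "C = CH * M2 powr (p - 1)"
  have weight1: "(1 + norm x) powr real N \<ge> 1" for x :: "real^'n"
    by (rule ge_one_powr_ge_zero) auto
  \<comment> \<open>For \<open>F\<close> vanishing on the exceptional null set, the almost
    everywhere hypotheses become pointwise ones wherever \<open>F\<close> is nonzero, as the
    weighted inequality requires.\<close>
  have main: "integrable lborel F \<and> (\<exists>S\<in>borel_measurable borel.
        ((\<lambda>A. \<integral>\<^sup>+x. ennreal (norm (S x - (\<Sum>k\<in>A. (LINT \<xi>|lborel. F \<xi> * cnj (wave (lattice_point k) \<xi> * G \<xi>)) * \<phi> (x + lattice_point k))) powr p) \<partial>lborel)
          \<longlongrightarrow> 0) (finite_subsets_at_top UNIV) \<and>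
        (\<forall>J\<ge>0. (\<integral>\<^sup>+\<xi>. ennreal ((norm \<xi> powr \<gamma> * norm (F \<xi>)) powr q) * indicator {\<xi>. \<delta> \<le> norm \<xi>} \<xi> \<partial>lborel) \<le> ennreal J \<longrightarrow>
          (\<integral>\<^sup>+x. ennreal (norm ((LINT \<xi>|lborel. F \<xi> * wave x \<xi>) - S x) powr p) \<partial>lborel) \<le> ennreal (C * J powr (p - 1))))"
    if [measurable]: "F \<in> borel_measurable borel" and I0: "I0 \<ge> 0" "(\<integral>\<^sup>+\<xi>. ennreal (((1 + norm \<xi>) powr \<gamma> * norm (F \<xi>)) powr q) \<partial>lborel) \<le> ennreal I0"
      and FN0: "\<And>\<xi>. \<xi> \<in> N0 \<Longrightarrow> F \<xi> = 0" for F I0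
  proof -
    have F: "integrable lborel F"
    proof -
      have "norm (F x) \<le> (1 + norm x) powr real N * norm (F x)" for x
        using mult_right_mono[OF weight1[of x], of "norm (F x)"] by simp
      from CH(2)[OF _ _ _ this I0] show ?thesis by auto
    qed
    define h where "h \<xi> = F \<xi> * cnj (G \<xi>)" for \<xi>
    have [measurable]: "h \<in> borel_measurable borel" unfolding h_def by measurable
    define A where "A k = (LINT \<xi>|lborel. h \<xi> * wave (lattice_point (- k)) \<xi>)" for k
    have A_eq: "(LINT \<xi>|lborel. F \<xi> * cnj (wave (lattice_point k) \<xi> * G \<xi>)) = A k" for k
      unfolding A_def h_def by (intro Bochner_Integration.integral_cong refl) (simp add: lattice_point_minus wave_minus_left mult_ac)
    have hb: "norm (h x) \<le> (1 + norm x) powr real N * (K * norm (F x))" for x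
    proof (cases "x \<in> N0")
      case False
      then have "norm (F x) * norm (G x) \<le> norm (F x) * (K * (1 + norm x) powr real N)"
        using good by (intro mult_left_mono) auto
      then show ?thesis by (simp add: h_def norm_mult mult_ac)
    qed (simp add: h_def FN0)
    have hI: "(\<integral>\<^sup>+x. ennreal (((1 + norm x) powr \<gamma> * (K * norm (F x))) powr q) \<partial>lborel) \<le> ennreal (K powr q * I0)"
    proof -
      have "(\<integral>\<^sup>+x. ennreal (((1 + norm x) powr \<gamma> * (K * norm (F x))) powr q) \<partial>lborel)
        = (\<integral>\<^sup>+x. ennreal (K powr q) * ennreal (((1 + norm x) powr \<gamma> * norm (F x)) powr q) \<partial>lborel)"
        using K by (intro nn_integral_cong) (simp add: powr_mult mult_ac flip: ennreal_mult)
      also have "\<dots> = ennreal (K powr q) * (\<integral>\<^sup>+x. ennreal (((1 + norm x) powr \<gamma> * norm (F x)) powr q) \<partial>lborel)"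
        by (rule nn_integral_cmult) measurable
      also have "\<dots> \<le> ennreal (K powr q) * ennreal I0" by (intro mult_left_mono I0) auto
      finally show ?thesis using I0 by (simp add: ennreal_mult)
    qed
    have h: "integrable lborel h" and hA: "\<And>X. finite X \<Longrightarrow> (\<Sum>k\<in>X. norm (LINT \<xi>|lborel. h \<xi> * wave (lattice_point k) \<xi>) powr p) \<le> CH * (K powr q * I0) powr (p - 1)"
      using CH(2)[OF _ _ _ hb _ hI] K I0 by auto
    have Asum: "(\<Sum>k\<in>X. norm (A k) powr p) \<le> CH * (K powr q * I0) powr (p - 1)" if "finite X" for X
      using hA[of "uminus ` X"] that by (simp add: sum.reindex inj_on_def A_def)
    have Asummable: "(\<lambda>k. norm (A k) powr p) summable_on UNIV"
      using Asum by (intro nonneg_bdd_above_summable_on bdd_aboveI2) auto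
    \<comment> \<open>The sum of the series in closed form, at every point. The Fejer means of the
      series converge to it pointwise, and this also yields its measurability.\<close>
    define S where "S x = (LINT \<xi>|lborel. h \<xi> * \<Theta> x \<xi>)" for x
    define D where "D n = (grid {- int n<..<int n} :: (int^'n) set)" for n
    have finD: "finite (D n)" for n unfolding D_def by (rule finite_grid_int)
    have Slim: "(\<lambda>n. \<Sum>k\<in>D n. of_real (fejer_weight n k) * \<phi> (x + lattice_point k) * A k) \<longlonglongrightarrow> S x" for x
      using fejer_integral_tendsto[OF _ BT \<Theta>per \<Theta>cont h, of x] unfolding coefs S_def A_def D_def by simp
    have Sm [measurable]: "S \<in> borel_measurable borel"
      by (rule borel_measurable_LIMSEQ_metric[OF _ Slim]) measurable
    have sums: "((\<lambda>X. \<integral>\<^sup>+x. ennreal (norm (S x - (\<Sum>k\<in>X. A k * \<phi> (x + lattice_point k))) powr p) \<partial>lborel) \<longlongrightarrow> 0) (finite_subsets_at_top UNIV)"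
    proof -
      \<comment> \<open>\<open>T - \<Sum>\<close> over \<open>X\<close> is the l_p mass of the
        coefficients outside \<open>X\<close>; it tends to 0 along finite sets, and up to
        \<open>Ck\<close> it will bound the p-th power of the L_p error.\<close>
      define T where "T = (\<Sum>\<^sub>\<infinity>k. norm (A k) powr p)"
      define r where "r X = T - (\<Sum>k\<in>X. norm (A k) powr p)" for X
      have le: "(\<integral>\<^sup>+x. ennreal (norm (S x - (\<Sum>k\<in>X. A k * \<phi> (x + lattice_point k))) powr p) \<partial>lborel) \<le> ennreal (Ck * r X)"
        if X: "finite X" for X
      proof -
        \<comment> \<open>The coefficients of a Fejer mean minus the partial sum over
          \<open>X\<close>. Outside \<open>X\<close> they are at most 1 in modulus, and at each
          point of \<open>X\<close> they tend to 0.\<close>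
        define e where "e n k = (of_bool (k \<in> D n) * fejer_weight n k - of_bool (k \<in> X))" for n k
        define f where "f n x = (\<Sum>k\<in>D n \<union> X. (of_real (e n k) * A k) * \<phi> (x + lattice_point k))" for n x
        have f_eq: "f n x = (\<Sum>k\<in>D n. of_real (fejer_weight n k) * \<phi> (x + lattice_point k) * A k) - (\<Sum>k\<in>X. A k * \<phi> (x + lattice_point k))" for n x
        proof -
          have "f n x = (\<Sum>k\<in>D n \<union> X. of_bool (k \<in> D n) * (of_real (fejer_weight n k) * \<phi> (x + lattice_point k) * A k)
              - of_bool (k \<in> X) * (A k * \<phi> (x + lattice_point k)))"
            unfolding f_def e_def by (intro sum.cong refl) (simp add: algebra_simps)
          also have "\<dots> = (\<Sum>k\<in>D n. of_real (fejer_weight n k) * \<phi> (x + lattice_point k) * A k) - (\<Sum>k\<in>X. A k * \<phi> (x + lattice_point k))"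
            unfolding sum_subtractf using finD X
            by (intro arg_cong2[where f = minus] sum.mono_neutral_cong_right) auto
          finally show ?thesis .
        qed
        have [measurable]: "f n \<in> borel_measurable borel" for n unfolding f_def by measurable
        have flim: "(\<lambda>n. f n x) \<longlonglongrightarrow> S x - (\<Sum>k\<in>X. A k * \<phi> (x + lattice_point k))" for x
          unfolding f_eq by (intro tendsto_intros Slim)
        define t where "t n = (\<Sum>k\<in>X. \<bar>e n k\<bar> powr p * norm (A k) powr p)" for n
        have fn: "(\<integral>\<^sup>+x. ennreal (norm (f n x) powr p) \<partial>lborel) \<le> ennreal (Ck * (r X + t n))" for n
        proof -
          have "(\<integral>\<^sup>+x. ennreal (norm (f n x) powr p) \<partial>lborel) \<le> ennreal (Ck * (\<Sum>k\<in>D n \<union> X. norm (of_real (e n k) * A k) powr p))"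
            unfolding f_def using finD X p1 by (intro conv_bounded_Lp Ck) auto
          also have "\<dots> \<le> ennreal (Ck * (r X + t n))"
          proof (intro ennreal_leI mult_left_mono Ck0)
            have "(\<Sum>k\<in>D n \<union> X. norm (of_real (e n k) * A k) powr p) = (\<Sum>k\<in>D n - X. norm (of_real (e n k) * A k) powr p) + (\<Sum>k\<in>X. norm (of_real (e n k) * A k) powr p)"
              using finD X by (subst sum.union_disjoint[symmetric]) auto
            also have "(\<Sum>k\<in>X. norm (of_real (e n k) * A k) powr p) = t n"
              by (simp add: t_def norm_mult powr_mult)
            also have "(\<Sum>k\<in>D n - X. norm (of_real (e n k) * A k) powr p) \<le> (\<Sum>k\<in>D n - X. norm (A k) powr p)"
            proof (rule sum_mono)
              fix k assume "k \<in> D n - X"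
              then have "\<bar>e n k\<bar> \<le> 1" using fejer_weight_nonneg[of n k] fejer_weight_le_1[of n k] by (simp add: e_def)
              then have "norm (of_real (e n k) * A k) \<le> norm (A k)" by (simp add: norm_mult mult_left_le_one_le)
              then show "norm (of_real (e n k) * A k) powr p \<le> norm (A k) powr p" using p1 by (intro powr_mono2) auto
            qed
            also have "\<dots> \<le> r X"
            proof -
              have "(\<Sum>k\<in>D n - X. norm (A k) powr p) + (\<Sum>k\<in>X. norm (A k) powr p) = (\<Sum>k\<in>D n \<union> X. norm (A k) powr p)"
                using finD X by (subst sum.union_disjoint[symmetric]) auto
              also have "\<dots> \<le> T" unfolding T_def
                using finD X by (intro finite_sum_le_infsum Asummable) auto
              finally show ?thesis by (simp add: r_def)
            qed
            finally show "(\<Sum>k\<in>D n \<union> X. norm (of_real (e n k) * A k) powr p) \<le> r X + t n" by simp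
          qed
          finally show ?thesis .
        qed
        have tlim: "t \<longlonglongrightarrow> 0"
        proof -
          have elim: "(\<lambda>n. e n k) \<longlonglongrightarrow> 0" if k: "k \<in> X" for k
          proof -
            obtain m where m: "{k} \<subseteq> grid {- int m..int m}" using finite_subset_symmetric_grid[of "{k}"] by auto
            have "eventually (\<lambda>n. e n k = fejer_weight n k - 1) sequentially"
              using eventually_gt_at_top[of m]
            proof eventually_elim
              case (elim n)
              have "k \<in> D n" unfolding D_def grid_def
              proof (intro CollectI allI)
                fix i
                have "k $ i \<in> {- int m..int m}" using m by (auto simp: grid_def)
                then show "k $ i \<in> {- int n<..<int n}" using elim by auto
              qed
              then show ?case using k by (simp add: e_def)
            qed
            moreover have "(\<lambda>n. fejer_weight n k - 1) \<longlonglongrightarrow> 1 - 1" by (intro tendsto_intros fejer_weight_tendsto)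
            ultimately show ?thesis by (simp add: tendsto_cong)
          qed
          have "(\<lambda>n. \<bar>e n k\<bar> powr p) \<longlonglongrightarrow> 0" if "k \<in> X" for k
            using tendsto_powr'[OF tendsto_rabs[OF elim[OF that]] tendsto_const[of p]] p1 by auto
          then have "t \<longlonglongrightarrow> (\<Sum>k\<in>X. 0 * norm (A k) powr p)"
            unfolding t_def by (intro tendsto_intros)
          then show ?thesis by simp
        qed
        \<comment> \<open>Fatou's lemma carries the bound for finite combinations over to the
          pointwise limit, so no L_p convergence of the Fejer means is presupposed.\<close>
        have "(\<integral>\<^sup>+x. ennreal (norm (S x - (\<Sum>k\<in>X. A k * \<phi> (x + lattice_point k))) powr p) \<partial>lborel)
          = (\<integral>\<^sup>+x. liminf (\<lambda>n. ennreal (norm (f n x) powr p)) \<partial>lborel)"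
        proof (rule nn_integral_cong)
          fix x
          have "(\<lambda>n. norm (f n x) powr p) \<longlonglongrightarrow> norm (S x - (\<Sum>k\<in>X. A k * \<phi> (x + lattice_point k))) powr p"
            using p1 by (intro tendsto_powr' tendsto_norm flim tendsto_const) auto
          then have "(\<lambda>n. ennreal (norm (f n x) powr p)) \<longlonglongrightarrow> ennreal (norm (S x - (\<Sum>k\<in>X. A k * \<phi> (x + lattice_point k))) powr p)"
            by (rule tendsto_ennrealI)
          then show "ennreal (norm (S x - (\<Sum>k\<in>X. A k * \<phi> (x + lattice_point k))) powr p) = liminf (\<lambda>n. ennreal (norm (f n x) powr p))"
            by (intro lim_imp_Liminf[symmetric]) auto
        qed
        also have "\<dots> \<le> liminf (\<lambda>n. \<integral>\<^sup>+x. ennreal (norm (f n x) powr p) \<partial>lborel)"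
          by (rule nn_integral_liminf) measurable
        also have "\<dots> \<le> liminf (\<lambda>n. ennreal (Ck * (r X + t n)))"
          by (intro Liminf_mono always_eventually allI fn)
        also have "\<dots> = ennreal (Ck * (r X + 0))"
          by (intro lim_imp_Liminf tendsto_ennrealI tendsto_intros tlim) simp
        finally show ?thesis by simp
      qed
      have "((\<lambda>X. sum (\<lambda>k. norm (A k) powr p) X) \<longlongrightarrow> T) (finite_subsets_at_top UNIV)"
        using has_sum_infsum[OF Asummable] unfolding T_def has_sum_def .
      then have "((\<lambda>X. Ck * r X) \<longlongrightarrow> Ck * (T - T)) (finite_subsets_at_top UNIV)"
        unfolding r_def by (intro tendsto_intros)
      then have "((\<lambda>X. ennreal (Ck * r X)) \<longlongrightarrow> ennreal 0) (finite_subsets_at_top UNIV)"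
        by (intro tendsto_ennrealI) simp
      then have lim0: "((\<lambda>X. ennreal (Ck * r X)) \<longlongrightarrow> 0) (finite_subsets_at_top UNIV)" by simp
      show ?thesis
      proof (rule tendsto_sandwich[OF _ _ tendsto_const lim0])
        show "\<forall>\<^sub>F X in finite_subsets_at_top UNIV. (\<integral>\<^sup>+x. ennreal (norm (S x - (\<Sum>k\<in>X. A k * \<phi> (x + lattice_point k))) powr p) \<partial>lborel) \<le> ennreal (Ck * r X)"
          by (rule eventually_finite_subsets_at_top_weakI) (rule le)
      qed simp
    qed
    have est: "(\<integral>\<^sup>+x. ennreal (norm ((LINT \<xi>|lborel. F \<xi> * wave x \<xi>) - S x) powr p) \<partial>lborel) \<le> ennreal (C * J powr (p - 1))"
      if J: "J \<ge> 0" "(\<integral>\<^sup>+\<xi>. ennreal ((norm \<xi> powr \<gamma> * norm (F \<xi>)) powr q) * indicator {\<xi>. \<delta> \<le> norm \<xi>} \<xi> \<partial>lborel) \<le> ennreal J" for J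
    proof (rule nn_integral_lattice_fibers_le)
      have [measurable]: "(\<lambda>x. LINT \<xi>|lborel. F \<xi> * wave x \<xi>) \<in> borel_measurable borel" by (rule inverse_fourier_measurable) measurable
      show "(\<lambda>x. ennreal (norm ((LINT \<xi>|lborel. F \<xi> * wave x \<xi>) - S x) powr p)) \<in> borel_measurable borel" by measurable
      fix s :: "real^'n" and X :: "(int^'n) set" assume X: "finite X"
      define v where "v \<eta> = F \<eta> * (wave s \<eta> - cnj (G \<eta>) * \<Theta> s \<eta>)" for \<eta>
      have [measurable]: "v \<in> borel_measurable borel" unfolding v_def by measurable
      have eq: "(LINT \<xi>|lborel. F \<xi> * wave (s + lattice_point n) \<xi>) - S (s + lattice_point n) = (LINT \<xi>|lborel. v \<xi> * wave (lattice_point n) \<xi>)" for n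
      proof -
        have i1: "integrable lborel (\<lambda>\<xi>. F \<xi> * wave (s + lattice_point n) \<xi>)"
          by (rule Bochner_Integration.integrable_bound[OF F]) (auto simp: norm_mult)
        have i2: "integrable lborel (\<lambda>\<xi>. h \<xi> * \<Theta> (s + lattice_point n) \<xi>)"
        proof (rule Bochner_Integration.integrable_bound)
          show "integrable lborel (\<lambda>\<xi>. norm (h \<xi>) * BT)" using h by (intro integrable_mult_left integrable_norm)
          show "AE \<xi> in lborel. norm (h \<xi> * \<Theta> (s + lattice_point n) \<xi>) \<le> norm (norm (h \<xi>) * BT)"
            using BT BT0 by (intro AE_I2) (auto simp: norm_mult intro!: mult_left_mono)
        qed measurable
        show ?thesis unfolding S_def
          by (subst Bochner_Integration.integral_diff[OF i1 i2, symmetric], intro Bochner_Integration.integral_cong refl)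
            (simp add: v_def h_def \<Theta>shift wave_add_left algebra_simps)
      qed
      \<comment> \<open>For |\<eta>| < \<delta> only the translate l = 0 survives in \<Theta>_s,
        leaving \<theta> e(s \<eta>); compatibility then makes the two terms of the error
        cancel.\<close>
      have v0: "v \<eta> = 0" if \<eta>: "norm \<eta> < \<delta>" for \<eta>
      proof (cases "\<eta> \<in> N0")
        case False
        have "\<Theta> s \<eta> = (\<Sum>l\<in>lat_set a b \<eta>. if l = 0 then \<theta> \<eta> * wave s \<eta> else 0)"
          unfolding \<Theta>_def lat_sum_def using good[OF False] \<eta> by (intro sum.cong refl) auto
        also have "\<dots> = (if 0 \<in> lat_set a b \<eta> then \<theta> \<eta> * wave s \<eta> else 0)" by (simp add: finite_lat_set)
        also have "\<dots> = \<theta> \<eta> * wave s \<eta>" using \<theta>0[of \<eta>] by (auto simp: lat_set_def)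
        finally have "cnj (G \<eta>) * \<Theta> s \<eta> = cnj (cnj (\<theta> \<eta>) * G \<eta>) * wave s \<eta>" by (simp add: mult_ac)
        also have "\<dots> = wave s \<eta>" using good[OF False] \<eta> by simp
        finally show ?thesis by (simp add: v_def)
      qed (simp add: v_def FN0)
      \<comment> \<open>The envelope carries the cut at |\<eta>| \<ge> \<delta>; through it the
        weighted inequality sees only the tail of \<open>F\<close>.\<close>
      define E where "E \<eta> = indicator {\<eta>. \<delta> \<le> norm \<eta>} \<eta> * (M1 * norm (F \<eta>))" for \<eta>
      have [measurable]: "E \<in> borel_measurable borel" unfolding E_def by measurable
      have vb: "norm (v \<eta>) \<le> (1 + norm \<eta>) powr real N * E \<eta>" for \<eta>
      proof (cases "norm \<eta> < \<delta> \<or> \<eta> \<in> N0")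
        case True
        then show ?thesis using v0[of \<eta>] M1 by (auto simp: v_def FN0 E_def)
      next
        case False
        let ?w = "(1 + norm \<eta>) powr real N"
        have "norm (wave s \<eta> - cnj (G \<eta>) * \<Theta> s \<eta>) \<le> 1 + norm (G \<eta>) * norm (\<Theta> s \<eta>)"
          by (rule order_trans[OF norm_triangle_ineq4]) (simp add: norm_mult)
        also have "\<dots> \<le> ?w + (K * ?w) * BT"
          using good[of \<eta>] False BT K weight1[of \<eta>] by (intro add_mono mult_mono) auto
        also have "\<dots> = ?w * M1" by (simp add: M1_def algebra_simps)
        finally have "norm (F \<eta>) * norm (wave s \<eta> - cnj (G \<eta>) * \<Theta> s \<eta>) \<le> norm (F \<eta>) * (?w * M1)"
          by (rule mult_left_mono) simp
        then show ?thesis using False by (simp add: v_def norm_mult E_def mult_ac)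
      qed
      have EI: "(\<integral>\<^sup>+x. ennreal (((1 + norm x) powr \<gamma> * E x) powr q) \<partial>lborel) \<le> ennreal (M2 * J)"
      proof -
        have "(\<integral>\<^sup>+x. ennreal (((1 + norm x) powr \<gamma> * E x) powr q) \<partial>lborel)
          \<le> (\<integral>\<^sup>+x. ennreal M2 * (ennreal ((norm x powr \<gamma> * norm (F x)) powr q) * indicator {x. \<delta> \<le> norm x} x) \<partial>lborel)"
        proof (rule nn_integral_mono)
          fix x :: "real^'n"
          show "ennreal (((1 + norm x) powr \<gamma> * E x) powr q) \<le> ennreal M2 * (ennreal ((norm x powr \<gamma> * norm (F x)) powr q) * indicator {x. \<delta> \<le> norm x} x)"
          proof (cases "\<delta> \<le> norm x")
            case True
            have "1 + norm x \<le> (1 + 1 / \<delta>) * norm x" using True \<delta> by (simp add: field_simps)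
            then have "(1 + norm x) powr \<gamma> \<le> ((1 + 1 / \<delta>) * norm x) powr \<gamma>" using \<gamma>0 by (intro powr_mono2) auto
            also have "\<dots> = (1 + 1 / \<delta>) powr \<gamma> * norm x powr \<gamma>" using \<delta> by (simp add: powr_mult)
            finally have "(1 + norm x) powr \<gamma> * E x \<le> ((1 + 1 / \<delta>) powr \<gamma> * norm x powr \<gamma>) * (M1 * norm (F x))"
              using True M1 by (auto simp: E_def intro!: mult_right_mono)
            then have "((1 + norm x) powr \<gamma> * E x) powr q \<le> (((1 + 1 / \<delta>) powr \<gamma> * norm x powr \<gamma>) * (M1 * norm (F x))) powr q"
              using M1 q by (intro powr_mono2) (auto simp: E_def)
            also have "\<dots> = M2 * (norm x powr \<gamma> * norm (F x)) powr q"
              using M1 by (simp add: M2_def powr_mult mult_ac)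
            finally have "ennreal (((1 + norm x) powr \<gamma> * E x) powr q) \<le> ennreal (M2 * (norm x powr \<gamma> * norm (F x)) powr q)"
              by (rule ennreal_leI)
            then show ?thesis using True by (simp add: ennreal_mult M2_def)
          qed (simp add: E_def)
        qed
        also have "\<dots> = ennreal M2 * (\<integral>\<^sup>+x. ennreal ((norm x powr \<gamma> * norm (F x)) powr q) * indicator {x. \<delta> \<le> norm x} x \<partial>lborel)"
          by (rule nn_integral_cmult) measurable
        also have "\<dots> \<le> ennreal M2 * ennreal J" by (intro mult_left_mono J) auto
        finally show ?thesis using J by (simp add: ennreal_mult M2_def)
      qed
      have M2: "M2 \<ge> 0" by (simp add: M2_def)
      have "(\<Sum>n\<in>X. norm (LINT \<xi>|lborel. v \<xi> * wave (lattice_point n) \<xi>) powr p) \<le> CH * (M2 * J) powr (p - 1)"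
        using CH(2)[OF _ _ _ vb _ EI] M1 M2 J X by (auto simp: E_def)
      also have "\<dots> = C * J powr (p - 1)" using M2 J by (simp add: C_def powr_mult)
      finally have "(\<Sum>n\<in>X. norm ((LINT \<xi>|lborel. F \<xi> * wave (s + lattice_point n) \<xi>) - S (s + lattice_point n)) powr p) \<le> C * J powr (p - 1)"
        by (simp only: eq)
      then show "(\<Sum>n\<in>X. ennreal (norm ((LINT \<xi>|lborel. F \<xi> * wave (s + lattice_point n) \<xi>) - S (s + lattice_point n)) powr p)) \<le> ennreal (C * J powr (p - 1))"
        by (subst sum_ennreal) (auto intro: ennreal_leI)
    qed
    show ?thesis using F Sm sums est unfolding A_eq by blast
  qed
  \<comment> \<open>The general case: erasing \<open>F\<close> on the exceptional null set changes
    none of the integrals.\<close>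
  have "integrable lborel F \<and> (\<exists>S\<in>borel_measurable borel.
        ((\<lambda>A. \<integral>\<^sup>+x. ennreal (norm (S x - (\<Sum>k\<in>A. (LINT \<xi>|lborel. F \<xi> * cnj (wave (lattice_point k) \<xi> * G \<xi>)) * \<phi> (x + lattice_point k))) powr p) \<partial>lborel)
          \<longlongrightarrow> 0) (finite_subsets_at_top UNIV) \<and>
        (\<forall>J\<ge>0. (\<integral>\<^sup>+\<xi>. ennreal ((norm \<xi> powr \<gamma> * norm (F \<xi>)) powr q) * indicator {\<xi>. \<delta> \<le> norm \<xi>} \<xi> \<partial>lborel) \<le> ennreal J \<longrightarrow>
          (\<integral>\<^sup>+x. ennreal (norm ((LINT \<xi>|lborel. F \<xi> * wave x \<xi>) - S x) powr p) \<partial>lborel) \<le> ennreal (C * J powr (p - 1))))"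
    if [measurable]: "F \<in> borel_measurable borel" and I0: "I0 \<ge> 0" "(\<integral>\<^sup>+\<xi>. ennreal (((1 + norm \<xi>) powr \<gamma> * norm (F \<xi>)) powr q) \<partial>lborel) \<le> ennreal I0" for F I0
  proof -
    define F' where "F' \<xi> = indicator (- N0) \<xi> *\<^sub>R F \<xi>" for \<xi>
    have F'm [measurable]: "F' \<in> borel_measurable borel" unfolding F'_def by measurable
    have F'0: "F' \<xi> = 0" if "\<xi> \<in> N0" for \<xi> using that by (simp add: F'_def)
    have ae: "AE \<xi> in lborel. F' \<xi> = F \<xi>"
      using AE_not_in[OF N0] by eventually_elim (simp add: F'_def)
    have nn: "(\<integral>\<^sup>+\<xi>. g \<xi> (F' \<xi>) \<partial>lborel) = (\<integral>\<^sup>+\<xi>. g \<xi> (F \<xi>) \<partial>lborel)" for g :: "real^'n \<Rightarrow> complex \<Rightarrow> ennreal"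
      using ae by (intro nn_integral_cong_AE) (auto elim!: eventually_mono)
    have int: "(LINT \<xi>|lborel. F' \<xi> * g \<xi>) = (LINT \<xi>|lborel. F \<xi> * g \<xi>)" if [measurable]: "g \<in> borel_measurable borel" for g
      using ae by (intro integral_cong_AE) (auto elim!: eventually_mono)
    have i: "integrable lborel F' = integrable lborel F"
      using ae by (intro integrable_cong_AE) auto
    have "(\<integral>\<^sup>+\<xi>. ennreal (((1 + norm \<xi>) powr \<gamma> * norm (F' \<xi>)) powr q) \<partial>lborel) \<le> ennreal I0"
      using I0(2) nn[of "\<lambda>\<xi> y. ennreal (((1 + norm \<xi>) powr \<gamma> * norm y) powr q)"] by simp
    from main[OF F'm I0(1) this F'0] have "integrable lborel F' \<and> (\<exists>S\<in>borel_measurable borel.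
        ((\<lambda>A. \<integral>\<^sup>+x. ennreal (norm (S x - (\<Sum>k\<in>A. (LINT \<xi>|lborel. F' \<xi> * cnj (wave (lattice_point k) \<xi> * G \<xi>)) * \<phi> (x + lattice_point k))) powr p) \<partial>lborel)
          \<longlongrightarrow> 0) (finite_subsets_at_top UNIV) \<and>
        (\<forall>J\<ge>0. (\<integral>\<^sup>+\<xi>. ennreal ((norm \<xi> powr \<gamma> * norm (F' \<xi>)) powr q) * indicator {\<xi>. \<delta> \<le> norm \<xi>} \<xi> \<partial>lborel) \<le> ennreal J \<longrightarrow>
          (\<integral>\<^sup>+x. ennreal (norm ((LINT \<xi>|lborel. F' \<xi> * wave x \<xi>) - S x) powr p) \<partial>lborel) \<le> ennreal (C * J powr (p - 1))))"
      .
    moreover have "(LINT \<xi>|lborel. F' \<xi> * cnj (wave (lattice_point k) \<xi> * G \<xi>)) = (LINT \<xi>|lborel. F \<xi> * cnj (wave (lattice_point k) \<xi> * G \<xi>))" for k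
      by (rule int) measurable
    moreover have "(LINT \<xi>|lborel. F' \<xi> * wave x \<xi>) = (LINT \<xi>|lborel. F \<xi> * wave x \<xi>)" for x
      by (rule int) measurable
    moreover have "(\<integral>\<^sup>+\<xi>. ennreal ((norm \<xi> powr \<gamma> * norm (F' \<xi>)) powr q) * indicator {\<xi>. \<delta> \<le> norm \<xi>} \<xi> \<partial>lborel)
       = (\<integral>\<^sup>+\<xi>. ennreal ((norm \<xi> powr \<gamma> * norm (F \<xi>)) powr q) * indicator {\<xi>. \<delta> \<le> norm \<xi>} \<xi> \<partial>lborel)"
      by (rule nn[of "\<lambda>\<xi> y. ennreal ((norm \<xi> powr \<gamma> * norm y) powr q) * indicator {\<xi>. \<delta> \<le> norm \<xi>} \<xi>"])
    ultimately show ?thesis unfolding i by (simp only:)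
  qed
  moreover have "C \<ge> 0" using CH(1) by (simp add: C_def)
  ultimately show ?thesis by blast
qed

subsection \<open>Uniqueness of the Fourier transform\<close>

lemma integral_lborel_scale:
  fixes f :: "'a::euclidean_space \<Rightarrow> complex"
  assumes [measurable]: "f \<in> borel_measurable borel" and c: "c > 0"
  shows "(LINT x|lborel. f x) = (c ^ DIM('a)) *\<^sub>R (LINT x|lborel. f (c *\<^sub>R x))"
  using c by (subst lborel_affine[of c 0]) (simp_all add: integral_density integral_distr)

lemma integrable_lborel_scale:
  fixes f :: "'a::euclidean_space \<Rightarrow> complex"
  assumes f: "integrable lborel f" and c: "c > 0"
  shows "integrable lborel (\<lambda>x. f (c *\<^sub>R x))"
proof -
  have [measurable]: "f \<in> borel_measurable borel" using f by (simp add: borel_measurable_integrable[simplified])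
  have "(\<integral>\<^sup>+x. ennreal (norm (f x)) \<partial>lborel) < \<infinity>" using f by (simp add: integrable_iff_bounded)
  then have "ennreal (c ^ DIM('a)) * (\<integral>\<^sup>+x. ennreal (norm (f (c *\<^sub>R x))) \<partial>lborel) < \<infinity>"
    using c by (subst (asm) lborel_affine[of c 0]) (simp_all add: nn_integral_density nn_integral_distr nn_integral_cmult)
  then have "(\<integral>\<^sup>+x. ennreal (norm (f (c *\<^sub>R x))) \<partial>lborel) < \<infinity>"
    using c by (auto simp: ennreal_mult_less_top)
  then show ?thesis by (auto simp: integrable_iff_bounded)
qed

text \<open>Since \<open>ennreal\<close> clips negative values to 0, the two densities are the
  positive and the negative part of \<open>u\<close>. The resulting finite measures agree on boxes,
  which form an intersection-stable generator, so they are equal.\<close>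

lemma AE_zero_if_box_integrals_zero:
  fixes u :: "real^'n \<Rightarrow> real"
  assumes u: "integrable lborel u" and box: "\<And>a b. (LINT x|lborel. indicator (box a b) x * u x) = 0"
  shows "AE x in lborel. u x = 0"
proof -
  have [measurable]: "u \<in> borel_measurable borel" using u by (simp add: borel_measurable_integrable[simplified])
  have fin: "(\<integral>\<^sup>+x. ennreal (u x) \<partial>lborel) < \<infinity>" "(\<integral>\<^sup>+x. ennreal (- u x) \<partial>lborel) < \<infinity>"
    using u by (auto simp: real_integrable_def less_top)
  let ?M = "density lborel (\<lambda>x. ennreal (u x))" and ?N = "density lborel (\<lambda>x. ennreal (- u x))"
  have eq: "emeasure ?M (box a b) = emeasure ?N (box a b)" for a b
  proof -
    let ?u = "\<lambda>x. indicator (box a b) x * u x"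
    have i: "integrable lborel ?u" using integrable_mult_indicator[OF _ u, of "box a b"] by simp
    have "(\<integral>\<^sup>+x. ennreal (?u x) \<partial>lborel) = (\<integral>\<^sup>+x. ennreal (- ?u x) \<partial>lborel)"
    proof -
      have fin: "(\<integral>\<^sup>+x. ennreal (?u x) \<partial>lborel) < top" "(\<integral>\<^sup>+x. ennreal (- ?u x) \<partial>lborel) < top"
        using i by (auto simp: real_integrable_def less_top)
      have "(\<integral>\<^sup>+x. ennreal (?u x) \<partial>lborel) = ennreal (enn2real (\<integral>\<^sup>+x. ennreal (?u x) \<partial>lborel))"
        by (rule ennreal_enn2real[OF fin(1), symmetric])
      also have "enn2real (\<integral>\<^sup>+x. ennreal (?u x) \<partial>lborel) = enn2real (\<integral>\<^sup>+x. ennreal (- ?u x) \<partial>lborel)"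
        using box[of a b] real_lebesgue_integral_def[OF i] by simp
      also have "ennreal \<dots> = (\<integral>\<^sup>+x. ennreal (- ?u x) \<partial>lborel)"
        by (rule ennreal_enn2real[OF fin(2)])
      finally show ?thesis .
    qed
    moreover have "(\<integral>\<^sup>+x. ennreal (?u x) \<partial>lborel) = emeasure ?M (box a b)"
      by (subst emeasure_density) (auto simp: indicator_def intro!: nn_integral_cong)
    moreover have "(\<integral>\<^sup>+x. ennreal (- ?u x) \<partial>lborel) = emeasure ?N (box a b)"
      by (subst emeasure_density) (auto simp: indicator_def intro!: nn_integral_cong)
    ultimately show ?thesis by simp
  qed
  have "?M = ?N"
  proof (rule measure_eqI_generator_eq)
    let ?E = "range (\<lambda>(a, b). box a b :: (real^'n) set)"
    show "Int_stable ?E" by (auto simp: Int_stable_def box_Int_box)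
    show "?E \<subseteq> Pow UNIV" "sets ?M = sigma_sets UNIV ?E" "sets ?N = sigma_sets UNIV ?E"
      by (simp_all add: borel_eq_box)
    let ?A = "\<lambda>n::nat. box (- (real n *\<^sub>R One)) (real n *\<^sub>R One) :: (real^'n) set"
    show "range ?A \<subseteq> ?E" "(\<Union>i. ?A i) = UNIV" unfolding UN_box_eq_UNIV by auto
    show "emeasure ?M (?A i) \<noteq> \<infinity>" for i
    proof -
      have "emeasure ?M (?A i) \<le> (\<integral>\<^sup>+x. ennreal (u x) \<partial>lborel)"
        by (subst emeasure_density) (auto simp: indicator_def intro!: nn_integral_mono)
      then show ?thesis using fin by (auto simp: top_unique)
    qed
    show "emeasure ?M X = emeasure ?N X" if "X \<in> ?E" for X using that eq by auto
  qed
  then have "AE x in lborel. ennreal (u x) = ennreal (- u x)"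
    using fin by (subst (asm) finite_density_unique) auto
  then show ?thesis
  proof eventually_elim
    case (elim x)
    then show ?case by (cases "u x \<ge> 0") (simp_all add: ennreal_neg ennreal_eq_0_iff)
  qed
qed

text \<open>Periodic functions are reached through Fejer summation: all coefficients of
  \<open>v\<close> vanish, hence so does its integral against the periodized indicator of a box.
  Letting the period grow leaves a single copy of the box, and boxes determine
  \<open>v\<close>.\<close>

lemma fourier_uniqueness:
  fixes v :: "real^'n \<Rightarrow> complex"
  assumes v: "integrable lborel v" and zero: "\<And>y. (LINT x|lborel. v x * wave y x) = 0"
  shows "AE x in lborel. v x = 0"
proof -
  have [measurable]: "v \<in> borel_measurable borel" using v by (simp add: borel_measurable_integrable[simplified])
  have cbox: "(LINT x|lborel. v x * indicator (cbox a b) x) = 0" for a b :: "real^'n"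
  proof -
    \<comment> \<open>The box is shrunk by the factor m + 1 and periodized with period 1; evaluated
      at x/(m+1) this is the indicator of the original box repeated with period m + 1.\<close>
    define H where "H m = lat_sum ((1 / real (Suc m)) *\<^sub>R a) ((1 / real (Suc m)) *\<^sub>R b) (indicator (cbox ((1 / real (Suc m)) *\<^sub>R a) ((1 / real (Suc m)) *\<^sub>R b)))" for m
    have [measurable]: "H m \<in> borel_measurable borel" for m
      unfolding H_def by (rule lat_sum_measurable) auto
    let ?g = "\<lambda>L. grid {- \<lceil>real CARD('n) + L\<rceil>..\<lceil>real CARD('n) + L\<rceil>} :: (int^'n) set"
    define B where "B = real (card (?g (norm a + norm b)))"
    have HB: "norm (H m x) \<le> B" for m x
    proof -
      let ?a = "(1 / real (Suc m)) *\<^sub>R a" and ?b = "(1 / real (Suc m)) *\<^sub>R b"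
      have "norm (H m x) \<le> real (card (?g (norm ?a + norm ?b))) * 1"
        unfolding H_def add.assoc[symmetric] by (rule lat_sum_bounded) (auto simp: indicator_def)
      also have "\<dots> \<le> B"
      proof -
        have "norm ?a + norm ?b \<le> norm a + norm b"
          by (intro add_mono) (auto simp: divide_le_eq mult_le_cancel_left1 intro: mult_left_le)
        then have "\<lceil>real CARD('n) + (norm ?a + norm ?b)\<rceil> \<le> \<lceil>real CARD('n) + (norm a + norm b)\<rceil>"
          by (intro ceiling_mono) simp
        moreover have "grid {- c..c} \<subseteq> (grid {- d..d} :: (int^'n) set)" if "c \<le> d" for c d :: int
        proof
          fix k :: "int^'n" assume k: "k \<in> grid {- c..c}"
          have "- d \<le> k $ i \<and> k $ i \<le> d" for i
            using k that unfolding grid_def by (auto dest!: spec[of _ i])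
          then show "k \<in> grid {- d..d}" by (simp add: grid_def)
        qed
        ultimately have "?g (norm ?a + norm ?b) \<subseteq> ?g (norm a + norm b)" by blast
        then show ?thesis unfolding B_def by (simp add: card_mono finite_grid)
      qed
      finally show ?thesis .
    qed
    have "(LINT x|lborel. v x * H m ((1 / real (Suc m)) *\<^sub>R x)) = 0" for m
    proof -
      let ?R = "real (Suc m)"
      have vR: "integrable lborel (\<lambda>x. v (?R *\<^sub>R x))" by (intro integrable_lborel_scale v) simp
      have coef: "(LINT x|lborel. v (?R *\<^sub>R x) * wave k x) = 0" for k :: "real^'n"
      proof -
        have w: "wave ((1 / ?R) *\<^sub>R k) (?R *\<^sub>R x) = wave k x" for x by (simp add: wave_def)
        have "0 = (?R ^ DIM(real^'n)) *\<^sub>R (LINT x|lborel. v (?R *\<^sub>R x) * wave k x)"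
          using integral_lborel_scale[of "\<lambda>x. v x * wave ((1 / ?R) *\<^sub>R k) x" ?R] unfolding w zero by simp
        then show ?thesis by simp
      qed
      have "(\<lambda>n. \<Sum>k\<in>grid {- int n<..<int n}. of_real (fejer_weight n k) *
         (LINT \<zeta>|lborel. indicator unit_cube \<zeta> *\<^sub>R (H m \<zeta> * wave (lattice_point k) \<zeta>)) * (LINT x|lborel. v (?R *\<^sub>R x) * wave (lattice_point (- k)) x))
         \<longlonglongrightarrow> (LINT x|lborel. v (?R *\<^sub>R x) * H m x)"
      proof (rule fejer_integral_tendsto[OF _ HB _ _ vR])
        show "H m (x + lattice_point l) = H m x" for x l unfolding H_def by (rule lat_sum_periodic)
        have "continuous_on (cbox ((1 / ?R) *\<^sub>R a) ((1 / ?R) *\<^sub>R b)) (indicator (cbox ((1 / ?R) *\<^sub>R a) ((1 / ?R) *\<^sub>R b)) :: _ \<Rightarrow> complex)"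
          by (rule continuous_on_eq[OF continuous_on_const[of _ 1]]) auto
        then show "AE x in lborel. isCont (H m) x"
          unfolding H_def by (rule lat_sum_isCont_AE) auto
      qed measurable
      then have "(LINT x|lborel. v (?R *\<^sub>R x) * H m x) = 0"
        unfolding coef by (simp add: LIMSEQ_const_iff)
      moreover have "(LINT x|lborel. v x * H m ((1 / ?R) *\<^sub>R x)) = (?R ^ DIM(real^'n)) *\<^sub>R (LINT x|lborel. v (?R *\<^sub>R x) * H m ((1 / ?R) *\<^sub>R (?R *\<^sub>R x)))"
        by (rule integral_lborel_scale) measurable
      ultimately show ?thesis by simp
    qed
    moreover have "(\<lambda>m. LINT x|lborel. v x * H m ((1 / real (Suc m)) *\<^sub>R x)) \<longlonglongrightarrow> (LINT x|lborel. v x * indicator (cbox a b) x)"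
    proof (rule integral_dominated_convergence[where w = "\<lambda>x. norm (v x) * B"])
      show "integrable lborel (\<lambda>x. norm (v x) * B)" using v by (intro integrable_mult_left integrable_norm)
      show "AE x in lborel. norm (v x * H m ((1 / real (Suc m)) *\<^sub>R x)) \<le> norm (v x) * B" for m
        using HB by (intro AE_I2) (auto simp: norm_mult intro!: mult_left_mono)
      show "AE x in lborel. (\<lambda>m. v x * H m ((1 / real (Suc m)) *\<^sub>R x)) \<longlonglongrightarrow> v x * indicator (cbox a b) x"
      proof (intro AE_I2 tendsto_mult_left)
        fix x :: "real^'n"
        obtain m0 where m0: "norm x + norm a + norm b < real m0" using reals_Archimedean2 by blast
        have "eventually (\<lambda>m. H m ((1 / real (Suc m)) *\<^sub>R x) = indicator (cbox a b) x) sequentially"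
          using eventually_ge_at_top[of m0]
        proof eventually_elim
          case (elim m)
          let ?R = "real (Suc m)"
          have R: "norm x + norm a + norm b < ?R" using m0 elim by simp
          have scale: "(1 / ?R) *\<^sub>R x - lattice_point l \<in> cbox ((1 / ?R) *\<^sub>R a) ((1 / ?R) *\<^sub>R b) \<longleftrightarrow> x - ?R *\<^sub>R lattice_point l \<in> cbox a b" for l
          proof -
            have "(1 / r) * s \<le> (1 / r) * t - u \<longleftrightarrow> s \<le> t - r * u" "(1 / r) * t - u \<le> (1 / r) * s \<longleftrightarrow> t - r * u \<le> s"
              if "r > 0" for r s t u :: real
              using that mult_le_cancel_left_pos[of r "(1 / r) * s" "(1 / r) * t - u"]
                mult_le_cancel_left_pos[of r "(1 / r) * t - u" "(1 / r) * s"] by (simp_all add: right_diff_distrib)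
            from this[of ?R] show ?thesis by (simp add: mem_box_cart del: of_nat_Suc)
          qed
          \<comment> \<open>Once the period exceeds |x| + |a| + |b|, a nonzero translation would
            move \<open>x\<close> too far to land in the box.\<close>
          have l0: "l = 0" if "x - ?R *\<^sub>R lattice_point l \<in> cbox a b" for l
          proof (rule ccontr)
            assume "l \<noteq> 0"
            then obtain i where i: "l $ i \<noteq> 0" by (auto simp: vec_eq_iff)
            have "\<bar>a $ i\<bar> \<le> norm a" "\<bar>b $ i\<bar> \<le> norm b" "\<bar>x $ i\<bar> \<le> norm x" by (rule component_le_norm_cart)+
            moreover have "a $ i \<le> x $ i - ?R * of_int (l $ i)" "x $ i - ?R * of_int (l $ i) \<le> b $ i"
              using that by (auto simp: mem_box_cart)
            ultimately have "\<bar>?R * of_int (l $ i)\<bar> \<le> norm x + norm a + norm b" by linarith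
            then have le: "?R * \<bar>of_int (l $ i)\<bar> \<le> norm x + norm a + norm b" by (simp only: abs_mult abs_of_nat)
            have "1 \<le> \<bar>real_of_int (l $ i)\<bar>" using i by linarith
            then have "?R * 1 \<le> ?R * \<bar>of_int (l $ i)\<bar>" by (rule mult_left_mono) (rule of_nat_0_le_iff)
            from order_trans[OF this le] show False using R by simp
          qed
          have "lat_set ((1 / ?R) *\<^sub>R a) ((1 / ?R) *\<^sub>R b) ((1 / ?R) *\<^sub>R x) = (if x \<in> cbox a b then {0} else {})"
          proof -
            have "x - ?R *\<^sub>R lattice_point l \<in> cbox a b \<longleftrightarrow> l = 0 \<and> x \<in> cbox a b" for l
              by (cases "l = 0") (use l0[of l] in auto)
            then show ?thesis unfolding lat_set_def scale by auto
          qed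
          then show ?case unfolding H_def lat_sum_def using scale[of 0] by (auto simp: indicator_def)
        qed
        then show "(\<lambda>m. H m ((1 / real (Suc m)) *\<^sub>R x)) \<longlonglongrightarrow> indicator (cbox a b) x" by (rule tendsto_eventually)
      qed
    qed measurable
    ultimately show ?thesis by (simp add: LIMSEQ_const_iff)
  qed
  have box: "(LINT x|lborel. indicator (box a b) x *\<^sub>R v x) = 0" for a b :: "real^'n"
  proof -
    have "cbox a b - box a b \<in> null_sets lebesgue"
      using negligible_frontier_interval by (simp add: negligible_iff_null_sets)
    then have "cbox a b - box a b \<in> null_sets lborel" by (subst (asm) null_sets_completion_iff) auto
    from AE_not_in[OF this] have "AE x in lborel. indicator (box a b) x *\<^sub>R v x = v x * indicator (cbox a b) x"
    proof (rule AE_mp, intro AE_I2 impI)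
      fix x assume "x \<notin> cbox a b - box a b"
      then show "indicator (box a b) x *\<^sub>R v x = v x * indicator (cbox a b) x"
        using box_subset_cbox[of a b] by (cases "x \<in> box a b") (auto simp: indicator_def)
    qed
    then have "(LINT x|lborel. indicator (box a b) x *\<^sub>R v x) = (LINT x|lborel. v x * indicator (cbox a b) x)"
      by (intro integral_cong_AE) auto
    then show ?thesis by (simp add: cbox)
  qed
  have i: "integrable lborel (\<lambda>x. indicator (box a b) x *\<^sub>R v x)" for a b
    by (intro integrable_mult_indicator v) simp
  have "AE x in lborel. Re (v x) = 0"
  proof (rule AE_zero_if_box_integrals_zero)
    show "(LINT x|lborel. indicator (box a b) x * Re (v x)) = 0" for a b
      using integral_Re[OF i[of a b]] box[of a b] by simp
  qed (use v in auto)
  moreover have "AE x in lborel. Im (v x) = 0"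
  proof (rule AE_zero_if_box_integrals_zero)
    show "(LINT x|lborel. indicator (box a b) x * Im (v x)) = 0" for a b
      using integral_Im[OF i[of a b]] box[of a b] by simp
  qed (use v in auto)
  ultimately show ?thesis by eventually_elim (simp add: complex_eq_iff)
qed

subsection \<open>Modulated Gaussians\<close>

text \<open>Modulated Gaussians serve as test functions. The remaining clauses close the class under
  partial derivatives, so that rapid decay proved for the class covers all iterated
  derivatives.\<close>

inductive modulated_gaussian :: "real^'n \<Rightarrow> (real^'n \<Rightarrow> complex) \<Rightarrow> bool" for y where
  base: "modulated_gaussian y (\<lambda>x. of_real (exp (- (x \<bullet> x))) * wave y x)"
| coordinate: "modulated_gaussian y f \<Longrightarrow> modulated_gaussian y (\<lambda>x. of_real (x $ i) * f x)"
| add: "modulated_gaussian y f \<Longrightarrow> modulated_gaussian y g \<Longrightarrow> modulated_gaussian y (\<lambda>x. f x + g x)"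
| scale: "modulated_gaussian y f \<Longrightarrow> modulated_gaussian y (\<lambda>x. c * f x)"

lemma modulated_gaussian_derivative:
  assumes "modulated_gaussian y f"
  shows "\<exists>f'. (\<forall>x. (f has_derivative f' x) (at x)) \<and> (\<forall>i. modulated_gaussian y (\<lambda>x. f' x (axis i 1)))"
  using assms
proof induction
  case base
  let ?f = "\<lambda>x. of_real (exp (- (x \<bullet> x))) * wave y x"
  let ?f' = "\<lambda>x h. (of_real (- (2 * (x \<bullet> h))) + \<i> * of_real (2 * pi * (y \<bullet> h))) * ?f x"
  have f: "?f = (\<lambda>x. exp (of_real (- (x \<bullet> x)) + \<i> * of_real (2 * pi * (y \<bullet> x))))"
    by (simp only: wave_def cis_conv_exp exp_add exp_of_real)
  have "(?f has_derivative ?f' x) (at x)" for x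
  proof -
    have "((\<lambda>x. of_real (- (x \<bullet> x)) + \<i> * of_real (2 * pi * (y \<bullet> x)) :: complex) has_derivative
        (\<lambda>h. of_real (- (2 * (x \<bullet> h))) + \<i> * of_real (2 * pi * (y \<bullet> h)))) (at x)"
      by (auto intro!: derivative_eq_intros simp: inner_commute)
    from has_derivative_compose[OF this DERIV_exp[unfolded has_field_derivative_def]]
    have "(?f has_derivative (\<lambda>h. exp (of_real (- (x \<bullet> x)) + \<i> * of_real (2 * pi * (y \<bullet> x))) * (of_real (- (2 * (x \<bullet> h))) + \<i> * of_real (2 * pi * (y \<bullet> h))))) (at x)"
      unfolding f .
    then show ?thesis unfolding fun_cong[OF f, of x, symmetric] by (simp only: mult.commute)
  qed
  moreover have "modulated_gaussian y (\<lambda>x. ?f' x (axis i 1))" for i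
  proof -
    have "(\<lambda>x. ?f' x (axis i 1)) = (\<lambda>x. (- 2) * (of_real (x $ i) * ?f x) + (\<i> * of_real (2 * pi * y $ i)) * ?f x)"
      by (simp add: inner_axis algebra_simps)
    then show ?thesis
      by (simp only:) (intro modulated_gaussian.intros)
  qed
  ultimately show ?case by (intro exI[of _ ?f']) blast
next
  case (coordinate f i)
  then obtain f' where f': "\<And>x. (f has_derivative f' x) (at x)" "\<And>i. modulated_gaussian y (\<lambda>x. f' x (axis i 1))" by blast
  let ?f' = "\<lambda>x h. of_real (h $ i) * f x + of_real (x $ i) * f' x h"
  have "((\<lambda>x. of_real (x $ i) * f x) has_derivative ?f' x) (at x)" for x
  proof -
    have "((\<lambda>x. complex_of_real (x $ i)) has_derivative (\<lambda>h. of_real (h $ i))) (at x)"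
      by (intro has_derivative_of_real bounded_linear.has_derivative[OF bounded_linear_vec_nth] has_derivative_ident)
    from has_derivative_mult[OF this f'(1)[of x]] show ?thesis by (simp add: add.commute)
  qed
  moreover have "modulated_gaussian y (\<lambda>x. ?f' x (axis j 1))" for j
  proof -
    have "(\<lambda>x. ?f' x (axis j 1)) = (\<lambda>x. of_bool (i = j) * f x + of_real (x $ i) * f' x (axis j 1))"
      by (auto simp: axis_def)
    then show ?thesis
      by (simp only:) (intro modulated_gaussian.intros coordinate.hyps f')
  qed
  ultimately show ?case by (intro exI[of _ ?f']) blast
next
  case (add f g)
  then obtain f' g' where f': "\<And>x. (f has_derivative f' x) (at x)" "\<And>i. modulated_gaussian y (\<lambda>x. f' x (axis i 1))"
    and g': "\<And>x. (g has_derivative g' x) (at x)" "\<And>i. modulated_gaussian y (\<lambda>x. g' x (axis i 1))" by metis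
  show ?case
    by (intro exI[of _ "\<lambda>x h. f' x h + g' x h"] conjI allI has_derivative_add f' g' modulated_gaussian.intros)
next
  case (scale f c)
  then obtain f' where f': "\<And>x. (f has_derivative f' x) (at x)" "\<And>i. modulated_gaussian y (\<lambda>x. f' x (axis i 1))" by blast
  show ?case
    by (intro exI[of _ "\<lambda>x h. c * f' x h"] conjI allI has_derivative_mult_right f' modulated_gaussian.intros)
qed

text \<open>Raising y \<le> exp y at y = (1+t)/n to the n-th power trades the polynomial for n^n
  exp(1+t), and 1 + t - t^2 \<le> 2.\<close>

lemma power_times_gaussian_le:
  fixes t :: real
  assumes "t \<ge> 0"
  shows "(1 + t) ^ n * exp (- (t * t)) \<le> real n ^ n * exp 2"
proof -
  have "(1 + t) ^ n \<le> real n ^ n * exp (1 + t)"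
  proof (cases "n = 0")
    case False
    have "(1 + t) / real n \<le> exp ((1 + t) / real n)"
      using exp_ge_add_one_self[of "(1 + t) / real n"] by linarith
    then have "((1 + t) / real n) ^ n \<le> exp ((1 + t) / real n) ^ n"
      using assms by (intro power_mono) auto
    also have "\<dots> = exp (1 + t)" using False by (simp flip: exp_of_nat_mult)
    finally show ?thesis using False by (simp add: power_divide divide_le_eq mult.commute)
  qed (use assms in simp)
  then have "(1 + t) ^ n * exp (- (t * t)) \<le> real n ^ n * exp (1 + t) * exp (- (t * t))"
    by (rule mult_right_mono) simp
  also have "\<dots> = real n ^ n * exp (1 + t - t * t)" by (simp add: exp_diff exp_minus divide_inverse)
  also have "\<dots> \<le> real n ^ n * exp 2"
  proof (intro mult_left_mono)
    have "0 \<le> (t - 1/2) * (t - 1/2)" by simp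
    then have "1 + t - t * t \<le> 2" by (simp add: algebra_simps)
    then show "exp (1 + t - t * t) \<le> exp 2" by simp
  qed simp
  finally show ?thesis .
qed

lemma modulated_gaussian_decay:
  assumes "modulated_gaussian y f"
  shows "\<exists>B. \<forall>x. (1 + norm x) ^ n * norm (f x) \<le> B"
  using assms
proof (induction arbitrary: n)
  case base
  then show ?case
    using power_times_gaussian_le[of "norm _" n]
    by (intro exI[of _ "real n ^ n * exp 2"]) (auto simp: norm_mult power2_norm_eq_inner[symmetric] power2_eq_square)
next
  case (coordinate f i)
  from coordinate.IH[of "Suc n"] obtain B where B: "\<And>x. (1 + norm x) ^ Suc n * norm (f x) \<le> B" by blast
  have "(1 + norm x) ^ n * norm (of_real (x $ i) * f x) \<le> B" for x
  proof -
    have "\<bar>x $ i\<bar> \<le> 1 + norm x" using component_le_norm_cart[of x i] by linarith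
    then have "(1 + norm x) ^ n * (\<bar>x $ i\<bar> * norm (f x)) \<le> (1 + norm x) ^ n * ((1 + norm x) * norm (f x))"
      by (intro mult_left_mono mult_right_mono) auto
    then show ?thesis using B[of x] by (simp add: norm_mult mult_ac)
  qed
  then show ?case by blast
next
  case (add f g)
  from add.IH(1)[of n] add.IH(2)[of n] obtain B B' where
    B: "\<And>x. (1 + norm x) ^ n * norm (f x) \<le> B" "\<And>x. (1 + norm x) ^ n * norm (g x) \<le> B'" by blast
  have "(1 + norm x) ^ n * norm (f x + g x) \<le> B + B'" for x
  proof -
    have "(1 + norm x) ^ n * norm (f x + g x) \<le> (1 + norm x) ^ n * (norm (f x) + norm (g x))"
      by (intro mult_left_mono norm_triangle_ineq) auto
    then show ?thesis using B[of x] by (simp add: distrib_left)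
  qed
  then show ?case by blast
next
  case (scale f c)
  from scale.IH[of n] obtain B where B: "\<And>x. (1 + norm x) ^ n * norm (f x) \<le> B" by blast
  have "(1 + norm x) ^ n * norm (c * f x) \<le> norm c * B" for x
    using mult_left_mono[OF B[of x], of "norm c"] by (simp add: norm_mult mult_ac)
  then show ?case by blast
qed

lemma modulated_gaussian_schwartz:
  assumes "modulated_gaussian y f"
  shows "f \<in> schwartz"
proof -
  have it: "modulated_gaussian y (iter_partial is f)" for "is"
  proof (induction "is")
    case (Cons i "is")
    obtain f' where f': "\<And>x. (iter_partial is f has_derivative f' x) (at x)" "\<And>i. modulated_gaussian y (\<lambda>x. f' x (axis i 1))"
      using modulated_gaussian_derivative[OF Cons] by blast
    have "frechet_derivative (iter_partial is f) (at x) = f' x" for x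
      using frechet_derivative_at[OF f'(1)] by simp
    then show ?case using f'(2)[of i] by simp
  qed (simp add: assms)
  show ?thesis
    unfolding schwartz_def
  proof (intro CollectI allI conjI)
    fix "is" x
    show "iter_partial is f differentiable (at x)"
      using modulated_gaussian_derivative[OF it] unfolding differentiable_def by blast
    fix n
    obtain B where "\<And>x. (1 + norm x) ^ n * norm (iter_partial is f x) \<le> B"
      using modulated_gaussian_decay[OF it] by blast
    then show "bounded (range (\<lambda>x. (1 + norm x) ^ n *\<^sub>R iter_partial is f x))"
      by (intro boundedI[of _ B]) auto
  qed
qed

subsection \<open>Linear changes of variables\<close>

text \<open>The library's change of variables needs a well-ordered index type.\<close>

lemma nn_integral_lborel_shear:
  fixes g :: "real^'n \<Rightarrow> ennreal"
  assumes [measurable]: "g \<in> borel_measurable borel" and mn: "m \<noteq> n"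
  shows "(\<integral>\<^sup>+x. g (x + (c * x $ n) *\<^sub>R axis m 1) \<partial>lborel) = (\<integral>\<^sup>+x. g x \<partial>lborel)"
proof -
  let ?e = "axis m 1 :: real^'n"
  \<comment> \<open>The integral of \<open>w\<close> along the direction \<open>?e\<close> is 1.
    Inserting it introduces a free shift t along that direction; translating first x and then t
    absorbs the shear and leaves an expression without \<open>c\<close>.\<close>
  define w :: "real^'n \<Rightarrow> ennreal" where "w x = indicator {0..<1} (x $ m)" for x
  have [measurable]: "w \<in> borel_measurable borel" unfolding w_def by measurable
  have w1: "(\<integral>\<^sup>+t. w (x + t *\<^sub>R ?e) \<partial>lborel) = 1" for x
  proof -
    have "w (x + t *\<^sub>R ?e) = indicator {- (x $ m)..<1 - x $ m} t" for t
      by (auto simp: w_def axis_def indicator_def)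
    then show ?thesis by simp
  qed
  have "(\<integral>\<^sup>+x. g (x + (c * x $ n) *\<^sub>R ?e) \<partial>lborel) = (\<integral>\<^sup>+x. (\<integral>\<^sup>+t. g (x - t *\<^sub>R ?e) * w x \<partial>lborel) \<partial>lborel)" for c
  proof -
    have "(\<integral>\<^sup>+x. g (x + (c * x $ n) *\<^sub>R ?e) \<partial>lborel) =
        (\<integral>\<^sup>+x. (\<integral>\<^sup>+t. g (x + (c * x $ n) *\<^sub>R ?e) * w (x + t *\<^sub>R ?e) \<partial>lborel) \<partial>lborel)"
      by (simp add: nn_integral_cmult w1)
    also have "\<dots> = (\<integral>\<^sup>+t. (\<integral>\<^sup>+x. g (x + (c * x $ n) *\<^sub>R ?e) * w (x + t *\<^sub>R ?e) \<partial>lborel) \<partial>lborel)"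
      by (rule lborel_pair.Fubini'[symmetric]) measurable
    also have "\<dots> = (\<integral>\<^sup>+t. (\<integral>\<^sup>+x. g (x + (c * x $ n - t) *\<^sub>R ?e) * w x \<partial>lborel) \<partial>lborel)"
    proof (rule nn_integral_cong)
      fix t :: real
      have "(\<integral>\<^sup>+x. g (x + (c * x $ n) *\<^sub>R ?e) * w (x + t *\<^sub>R ?e) \<partial>lborel)
          = (\<integral>\<^sup>+x. g ((- t *\<^sub>R ?e + x) + (c * (- t *\<^sub>R ?e + x) $ n) *\<^sub>R ?e) * w ((- t *\<^sub>R ?e + x) + t *\<^sub>R ?e) \<partial>lborel)"
        by (rule nn_integral_lborel_translate[symmetric]) measurable
      also have "\<dots> = (\<integral>\<^sup>+x. g (x + (c * x $ n - t) *\<^sub>R ?e) * w x \<partial>lborel)"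
        using mn by (simp add: axis_def algebra_simps)
      finally show "(\<integral>\<^sup>+x. g (x + (c * x $ n) *\<^sub>R ?e) * w (x + t *\<^sub>R ?e) \<partial>lborel)
          = (\<integral>\<^sup>+x. g (x + (c * x $ n - t) *\<^sub>R ?e) * w x \<partial>lborel)" .
    qed
    also have "\<dots> = (\<integral>\<^sup>+x. (\<integral>\<^sup>+t. g (x + (c * x $ n - t) *\<^sub>R ?e) * w x \<partial>lborel) \<partial>lborel)"
      by (rule lborel_pair.Fubini') measurable
    also have "\<dots> = (\<integral>\<^sup>+x. (\<integral>\<^sup>+t. g (x - t *\<^sub>R ?e) * w x \<partial>lborel) \<partial>lborel)"
    proof (rule nn_integral_cong)
      fix x :: "real^'n"
      have "(\<integral>\<^sup>+t. g (x + (c * x $ n - t) *\<^sub>R ?e) * w x \<partial>lborel) = (\<integral>\<^sup>+t. g (x + (c * x $ n - (c * x $ n + t)) *\<^sub>R ?e) * w x \<partial>lborel)"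
        by (rule nn_integral_lborel_translate[symmetric]) measurable
      then show "(\<integral>\<^sup>+t. g (x + (c * x $ n - t) *\<^sub>R ?e) * w x \<partial>lborel) = (\<integral>\<^sup>+t. g (x - t *\<^sub>R ?e) * w x \<partial>lborel)"
        by simp
    qed
    finally show ?thesis .
  qed
  from this[of c] this[of 0] show ?thesis by simp
qed

lemma prod_Basis_vec:
  fixes F :: "real^'n \<Rightarrow> 'a::comm_monoid_mult"
  shows "(\<Prod>b\<in>(Basis :: (real^'n) set). F b) = (\<Prod>i\<in>UNIV. F (axis i 1))"
proof -
  have "bij_betw (\<lambda>i. axis i 1) UNIV (Basis :: (real^'n) set)"
    by (auto simp: bij_betw_def inj_def axis_eq_axis Basis_vec_def)
  from prod.reindex_bij_betw[OF this, of F] show ?thesis by simp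
qed

lemma nn_integral_lborel_transpose_coordinates:
  fixes g :: "real^'n \<Rightarrow> ennreal"
  assumes [measurable]: "g \<in> borel_measurable borel"
  shows "(\<integral>\<^sup>+x. g (\<chi> i. x $ Transposition.transpose m n i) \<partial>lborel) = (\<integral>\<^sup>+x. g x \<partial>lborel)"
proof -
  let ?s = "Transposition.transpose m n" and ?f = "\<lambda>x::real^'n. \<chi> i. x $ Transposition.transpose m n i"
  have [measurable]: "?f \<in> borel_measurable borel"
    by (intro borel_measurable_continuous_onI continuous_on_vec_lambda continuous_intros)
  have "lborel = distr lborel borel ?f"
  proof (rule lborel_eqI)
    fix l u :: "real^'n"
    assume lu: "\<And>b. b \<in> Basis \<Longrightarrow> l \<bullet> b \<le> u \<bullet> b"
    have le: "l $ i \<le> u $ i" for i using lu[of "axis i 1"] by (auto simp: inner_axis)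
    have "?f -` box l u = box (?f l) (?f u)"
    proof (intro set_eqI iffI)
      fix x assume "x \<in> ?f -` box l u"
      then have "l $ i < x $ ?s i \<and> x $ ?s i < u $ i" for i by (auto simp: mem_box_cart)
      from this[of "?s _"] show "x \<in> box (?f l) (?f u)" by (auto simp: mem_box_cart)
    next
      fix x assume "x \<in> box (?f l) (?f u)"
      then have "l $ ?s i < x $ i \<and> x $ i < u $ ?s i" for i by (auto simp: mem_box_cart)
      from this[of "?s _"] show "x \<in> ?f -` box l u" by (auto simp: mem_box_cart)
    qed
    then have "emeasure (distr lborel borel ?f) (box l u) = emeasure lborel (box (?f l) (?f u))"
      by (subst emeasure_distr) auto
    also have "\<dots> = (\<Prod>i\<in>UNIV. (u - l) $ ?s i)"
    proof (subst emeasure_lborel_box)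
      show "?f l \<bullet> b \<le> ?f u \<bullet> b" if "b \<in> Basis" for b
        using that le by (auto simp: Basis_vec_def inner_axis)
    qed (simp add: prod_Basis_vec inner_axis)
    also have "(\<Prod>i\<in>UNIV. (u - l) $ ?s i) = (\<Prod>i\<in>UNIV. (u - l) $ i)"
      by (rule prod.reindex_bij_betw) simp
    also have "\<dots> = (\<Prod>b\<in>Basis. (u - l) \<bullet> b)"
      by (simp add: prod_Basis_vec inner_axis)
    finally show "emeasure (distr lborel borel ?f) (box l u) = (\<Prod>b\<in>Basis. (u - l) \<bullet> b)" .
  qed simp
  then have "(\<integral>\<^sup>+x. g x \<partial>lborel) = (\<integral>\<^sup>+x. g x \<partial>distr lborel borel ?f)" by simp
  also have "\<dots> = (\<integral>\<^sup>+x. g (?f x) \<partial>lborel)" by (simp add: nn_integral_distr)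
  finally show ?thesis ..
qed

lemma nn_integral_lborel_diagonal:
  fixes g :: "real^'n \<Rightarrow> ennreal"
  assumes [measurable]: "g \<in> borel_measurable borel" and c: "\<And>i. c i \<noteq> 0"
  shows "ennreal \<bar>\<Prod>i\<in>UNIV. c i\<bar> * (\<integral>\<^sup>+x. g (\<chi> i. c i * x $ i) \<partial>lborel) = (\<integral>\<^sup>+x. g x \<partial>lborel)"
proof -
  define C :: "real^'n \<Rightarrow> real" where "C b = (\<chi> i. c i) \<bullet> b" for b
  let ?T = "\<lambda>x::real^'n. 0 + (\<Sum>j\<in>Basis. (C j * (x \<bullet> j)) *\<^sub>R j)"
  have T: "?T x = (\<chi> i. c i * x $ i)" for x
  proof -
    have "bij_betw (\<lambda>i. axis i 1) UNIV (Basis :: (real^'n) set)"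
      by (auto simp: bij_betw_def inj_def axis_eq_axis Basis_vec_def)
    from sum.reindex_bij_betw[OF this, of "\<lambda>j. (C j * (x \<bullet> j)) *\<^sub>R j"]
    have "?T x = (\<Sum>j\<in>UNIV. (c j * x $ j) *\<^sub>R axis j 1)" by (simp add: C_def inner_axis)
    then show ?thesis by (simp add: vec_eq_iff axis_def if_distrib[of "\<lambda>t. _ * t"] cong: if_cong)
  qed
  have C0: "C b \<noteq> 0" if "b \<in> Basis" for b using that c by (auto simp: C_def Basis_vec_def inner_axis)
  have P: "(\<Prod>j\<in>Basis. \<bar>C j\<bar>) = \<bar>\<Prod>i\<in>UNIV. c i\<bar>"
    by (simp add: prod_Basis_vec inner_axis C_def abs_prod)
  have "(\<integral>\<^sup>+x. g x \<partial>lborel) = (\<integral>\<^sup>+x. g x \<partial>density (distr lborel borel ?T) (\<lambda>_. (\<Prod>j\<in>Basis. \<bar>C j\<bar>)))"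
    using lborel_affine_euclidean[of C 0] C0 by simp
  also have "\<dots> = (\<integral>\<^sup>+x. ennreal \<bar>\<Prod>i\<in>UNIV. c i\<bar> * g (?T x) \<partial>lborel)"
    unfolding P by (subst nn_integral_density) (auto simp: nn_integral_distr)
  also have "\<dots> = ennreal \<bar>\<Prod>i\<in>UNIV. c i\<bar> * (\<integral>\<^sup>+x. g (?T x) \<partial>lborel)"
    by (rule nn_integral_cmult) measurable
  finally show ?thesis unfolding T ..
qed

text \<open>Induction over elementary matrices. The claim is an implication from det A \<noteq> 0
  because the product step needs both factors regular, while the case of a zero row is then
  void.\<close>

lemma nn_integral_lborel_linear:
  fixes A :: "real^'n^'n" and g :: "real^'n \<Rightarrow> ennreal"
  assumes "det A \<noteq> 0" "g \<in> borel_measurable borel"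
  shows "(\<integral>\<^sup>+x. g x \<partial>lborel) = ennreal \<bar>det A\<bar> * (\<integral>\<^sup>+x. g (A *v x) \<partial>lborel)"
proof -
  have "det A \<noteq> 0 \<longrightarrow> (\<forall>g::real^'n \<Rightarrow> ennreal. g \<in> borel_measurable borel \<longrightarrow>
      (\<integral>\<^sup>+x. g x \<partial>lborel) = ennreal \<bar>det A\<bar> * (\<integral>\<^sup>+x. g (A *v x) \<partial>lborel))"
  proof (induction A rule: induct_matrix_elementary)
    case mult: (1 A B)
    show ?case
    proof (intro impI allI)
      fix g :: "real^'n \<Rightarrow> ennreal"
      assume d: "det (A ** B) \<noteq> 0" and [measurable]: "g \<in> borel_measurable borel"
      have [measurable]: "(\<lambda>x. g (A *v x)) \<in> borel_measurable borel"
        by (rule measurable_compose[of "\<lambda>x. A *v x" borel borel])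
           (auto intro!: borel_measurable_continuous_onI linear_continuous_on)
      have "(\<integral>\<^sup>+x. g x \<partial>lborel) = ennreal \<bar>det A\<bar> * (\<integral>\<^sup>+x. g (A *v x) \<partial>lborel)"
        using mult d by (simp add: det_mul)
      also have "(\<integral>\<^sup>+x. g (A *v x) \<partial>lborel) = ennreal \<bar>det B\<bar> * (\<integral>\<^sup>+x. g (A *v (B *v x)) \<partial>lborel)"
        using mult(2) d by (simp add: det_mul)
      finally show "(\<integral>\<^sup>+x. g x \<partial>lborel) = ennreal \<bar>det (A ** B)\<bar> * (\<integral>\<^sup>+x. g ((A ** B) *v x) \<partial>lborel)"
        by (simp add: det_mul abs_mult ennreal_mult matrix_vector_mul_assoc mult.assoc)
    qed
  next
    case zero_row: (2 A i)
    then show ?case by (simp add: det_zero_row)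
  next
    case diagonal: (3 A)
    have "A *v x = (\<chi> i. A $ i $ i * x $ i)" for x
    proof -
      have "(\<Sum>j\<in>UNIV. A $ i $ j * x $ j) = (\<Sum>j\<in>UNIV. if j = i then A $ i $ i * x $ i else 0)" for i
        using diagonal by (intro sum.cong) auto
      then show ?thesis by (simp add: matrix_vector_mult_def vec_eq_iff)
    qed
    moreover have "det A = (\<Prod>i\<in>UNIV. A $ i $ i)" using diagonal by (rule det_diagonal)
    ultimately show ?case
      using nn_integral_lborel_diagonal[of _ "\<lambda>i. A $ i $ i"] by simp
  next
    case swap1: (4 m n)
    let ?A = "\<chi> i j. mat 1 $ i $ Transposition.transpose m n j :: real^'n^'n"
    have "?A *v x = (\<chi> i. x $ Transposition.transpose m n i)" for x
    proof -
      have "(\<Sum>j\<in>UNIV. mat 1 $ i $ Transposition.transpose m n j * x $ j) = (\<Sum>j\<in>UNIV. if j = Transposition.transpose m n i then x $ j else 0)" for i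
        by (intro sum.cong) (auto simp: mat_def)
      then show ?thesis by (simp add: matrix_vector_mult_def vec_eq_iff)
    qed
    moreover have "\<bar>det ?A\<bar> = 1"
      using swap1 by (subst det_permute_columns) (auto simp: permutes_swap_id sign_swap_id)
    ultimately show ?case by (simp add: nn_integral_lborel_transpose_coordinates)
  next
    case idplus: (5 m n c)
    let ?A = "\<chi> i j. if i = m \<and> j = n then c else of_bool (i = j) :: real^'n^'n"
    have "?A *v x = x + (c * x $ n) *\<^sub>R axis m 1" for x
    proof -
      have "(\<Sum>j\<in>UNIV. ?A $ i $ j * x $ j) = (\<Sum>j\<in>UNIV. (if j = i then x $ j else 0) + (if j = n then (if i = m then c * x $ n else 0) else 0))" for i
        using idplus by (intro sum.cong) auto
      then show ?thesis by (simp add: matrix_vector_mult_def vec_eq_iff sum.distrib axis_def)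
    qed
    moreover have "det ?A = 1"
    proof -
      have "?A = (\<chi> k. if k = m then row m (mat 1) + c *s row n (mat 1) else row k (mat 1))"
        using idplus by (auto simp: vec_eq_iff row_def mat_def)
      then show ?thesis using det_row_operation[OF idplus, of "mat 1" c] by simp
    qed
    ultimately show ?case using idplus by (simp add: nn_integral_lborel_shear)
  qed
  then show ?thesis using assms by blast
qed

lemma matrix_vector_measurable [measurable]: "(\<lambda>x::real^'n. (A :: real^'n^'m) *v x) \<in> borel_measurable borel"
  by (intro borel_measurable_continuous_onI linear_continuous_on) auto

lemma distr_linear_lborel:
  fixes A :: "real^'n^'n"
  assumes "det A \<noteq> 0"
  shows "lborel = density (distr lborel borel ((*v) A)) (\<lambda>_. ennreal \<bar>det A\<bar>)"
proof (rule measure_eqI)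
  fix X :: "(real^'n) set"
  assume "X \<in> sets lborel"
  then have [measurable]: "X \<in> sets borel" by simp
  have "emeasure lborel X = (\<integral>\<^sup>+x. indicator X x \<partial>lborel)" by simp
  also have "\<dots> = ennreal \<bar>det A\<bar> * (\<integral>\<^sup>+x. indicator X (A *v x) \<partial>lborel)"
    by (rule nn_integral_lborel_linear[OF assms]) simp
  also have "(\<integral>\<^sup>+x. indicator X (A *v x) \<partial>lborel) = (\<integral>\<^sup>+x. indicator X x \<partial>distr lborel borel ((*v) A))"
    by (rule nn_integral_distr[symmetric]) measurable
  also have "ennreal \<bar>det A\<bar> * \<dots> = (\<integral>\<^sup>+x. ennreal \<bar>det A\<bar> * indicator X x \<partial>distr lborel borel ((*v) A))"
    by (rule nn_integral_cmult[symmetric]) measurable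
  finally show "emeasure lborel X = emeasure (density (distr lborel borel ((*v) A)) (\<lambda>_. ennreal \<bar>det A\<bar>)) X"
    by (simp add: emeasure_density)
qed simp

lemma integral_lborel_linear:
  fixes A :: "real^'n^'n" and g :: "real^'n \<Rightarrow> complex"
  assumes "det A \<noteq> 0" and [measurable]: "g \<in> borel_measurable borel"
  shows "(LINT x|lborel. g x) = \<bar>det A\<bar> *\<^sub>R (LINT x|lborel. g (A *v x))"
  by (subst distr_linear_lborel[OF assms(1)]) (simp add: integral_density integral_distr)

lemma AE_lborel_linear:
  fixes A :: "real^'n^'n"
  assumes "det A \<noteq> 0" "AE x in lborel. P x"
  shows "AE x in lborel. P (A *v x)"
proof -
  from AE_lborel_null_set[OF assms(2)] obtain N where N: "\<And>x. x \<notin> N \<Longrightarrow> P x" "N \<in> null_sets lborel"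
    by blast
  then have [measurable]: "N \<in> sets borel" by auto
  have "ennreal \<bar>det A\<bar> * (\<integral>\<^sup>+x. indicator N (A *v x) \<partial>lborel) = 0"
    using N(2) nn_integral_lborel_linear[OF assms(1), of "indicator N"] by (simp add: null_sets_def)
  then have "(\<integral>\<^sup>+x. indicator N (A *v x) \<partial>lborel) = 0" using assms(1) by (simp add: ennreal_eq_0_iff)
  then have "AE x in lborel. (indicator N (A *v x) :: ennreal) = 0"
    by (subst (asm) nn_integral_0_iff_AE) auto
  then show ?thesis by eventually_elim (use N(1) in \<open>auto simp: indicator_def split: if_splits\<close>)
qed

subsection \<open>Lebesgue measurable functions and their Borel representatives\<close>

text \<open>The definitions speak of Lebesgue measurable functions, while Fubini and the changes of
  variables are carried out for Borel functions. Real and imaginary parts are corrected on null sets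
  separately.\<close>

lemma lebesgue_borel_representative:
  fixes f :: "real^'n \<Rightarrow> complex"
  assumes "f \<in> borel_measurable lebesgue"
  obtains g where "g \<in> borel_measurable borel" "AE x in lborel. f x = g x"
proof -
  have "(\<lambda>x. Re (f x)) \<in> borel_measurable lebesgue" "(\<lambda>x. Im (f x)) \<in> borel_measurable lebesgue"
    using assms by measurable
  from completion_ex_borel_measurable_real[OF this(1)] completion_ex_borel_measurable_real[OF this(2)]
  obtain r i where [measurable]: "r \<in> borel_measurable lborel" "i \<in> borel_measurable lborel"
    and ri: "AE x in lborel. Re (f x) = r x" "AE x in lborel. Im (f x) = i x" by blast
  show thesis
  proof (rule that)
    show "(\<lambda>x. of_real (r x) + \<i> * of_real (i x)) \<in> borel_measurable borel" by measurable
    show "AE x in lborel. f x = of_real (r x) + \<i> * of_real (i x)"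
      using ri by eventually_elim (simp add: complex_eq_iff)
  qed
qed

lemma lebesgue_measurable_AE:
  fixes f g :: "real^'n \<Rightarrow> 'b::topological_space"
  assumes g: "g \<in> borel_measurable borel" and fg: "AE x in lborel. f x = g x"
  shows "f \<in> borel_measurable lebesgue"
proof (rule measurableI)
  fix X :: "'b set"
  assume X: "X \<in> sets borel"
  have gX: "g -` X \<in> sets lebesgue" using measurable_sets[OF g X] by simp
  have "AE x in lebesgue. x \<in> g -` X \<longleftrightarrow> x \<in> f -` X"
    unfolding AE_completion_iff using fg by eventually_elim simp
  then show "f -` X \<inter> space lebesgue \<in> sets lebesgue"
    using completion.in_sets_AE[OF _ gX] by simp
qed simp

lemma lebesgue_integral_AE:
  fixes f g :: "real^'n \<Rightarrow> 'b::{banach, second_countable_topology}"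
  assumes g: "g \<in> borel_measurable borel" and fg: "AE x in lborel. f x = g x"
  shows "(LINT x|lebesgue. f x) = (LINT x|lborel. g x)"
proof -
  have "(LINT x|lebesgue. f x) = (LINT x|lebesgue. g x)"
    using fg lebesgue_measurable_AE[OF g fg] g
    by (intro integral_cong_AE) (auto simp: AE_completion_iff measurable_completion)
  then show ?thesis using g by (simp add: integral_completion)
qed

lemma lebesgue_integrable_AE:
  fixes f g :: "real^'n \<Rightarrow> 'b::{banach, second_countable_topology}"
  assumes g: "g \<in> borel_measurable borel" and fg: "AE x in lborel. f x = g x"
  shows "integrable lebesgue f \<longleftrightarrow> integrable lborel g"
proof -
  have "integrable lebesgue f \<longleftrightarrow> integrable lebesgue g"
    using fg lebesgue_measurable_AE[OF g fg] g
    by (intro integrable_cong_AE) (auto simp: AE_completion_iff measurable_completion)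
  then show ?thesis using g by (simp add: integrable_completion)
qed

subsection \<open>Fourier inversion\<close>

lemma gaussian_integrable: "integrable lborel (\<lambda>x::real^'n. exp (- (x \<bullet> x)))"
proof -
  let ?n = "CARD('n) + 1"
  obtain B where B: "\<And>x::real^'n. (1 + norm x) ^ ?n * norm (of_real (exp (- (x \<bullet> x))) * wave 0 x) \<le> B"
    using modulated_gaussian_decay[OF modulated_gaussian.base[of 0], of ?n] by blast
  have w: "integrable lborel (\<lambda>x::real^'n. (1 + norm x) powr (- real ?n))"
    using nn_integral_polynomial_weight_finite[where 'n='n, of "real ?n"]
    by (auto simp: integrable_iff_bounded)
  show ?thesis
  proof (rule Bochner_Integration.integrable_bound)
    show "integrable lborel (\<lambda>x::real^'n. B * (1 + norm x) powr (- real ?n))" using w by simp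
    have le: "exp (- (x \<bullet> x)) \<le> B * (1 + norm x) powr (- real ?n)" for x :: "real^'n"
    proof -
      have "0 < 1 + norm x" by (simp add: add_pos_nonneg)
      then have "(1 + norm x) powr (- real ?n) = 1 / (1 + norm x) ^ ?n" "(1 + norm x) ^ ?n > 0"
        by (simp_all add: powr_minus powr_realpow divide_inverse del: of_nat_add of_nat_Suc)
      then show ?thesis using B[of x] by (simp add: pos_le_divide_eq mult.commute norm_mult)
    qed
    show "AE x::real^'n in lborel. norm (exp (- (x \<bullet> x))) \<le> norm (B * (1 + norm x) powr (- real ?n))"
      unfolding real_norm_def abs_of_pos[OF exp_gt_zero] by (rule AE_I2) (rule order_trans[OF le abs_ge_self])
  qed simp
qed

text \<open>\<open>F\<close> is tied to \<open>f\<close> only through the pairing with Schwartz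
  functions. Testing with the Gaussian times \<open>wave y\<close>, for every y, and applying Fubini
  shows that the Gaussian times the conjugate of f' - K has vanishing Fourier transform; the
  Gaussian factor makes this product integrable, so uniqueness applies.\<close>

lemma fourier_inversion:
  fixes f F f' F' :: "real^'n \<Rightarrow> complex"
  assumes p: "p \<ge> 1" and f: "f \<in> Lp_space p" and F: "has_fourier_function (distr_of f) F"
    and f'm [measurable]: "f' \<in> borel_measurable borel" and f': "AE x in lborel. f x = f' x"
    and F'm [measurable]: "F' \<in> borel_measurable borel" and F': "AE \<xi> in lborel. F \<xi> = F' \<xi>"
    and F'i: "integrable lborel F'"
  shows "AE x in lborel. f' x = (LINT \<xi>|lborel. F' \<xi> * wave x \<xi>)"
proof -
  define K where "K x = (LINT \<xi>|lborel. F' \<xi> * wave x \<xi>)" for x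
  have Km [measurable]: "K \<in> borel_measurable borel" unfolding K_def[abs_def] by (rule inverse_fourier_measurable) simp
  define B where "B = (LINT \<xi>|lborel. norm (F' \<xi>))"
  have KB: "norm (K x) \<le> B" for x
    unfolding K_def B_def
    by (rule order_trans[OF integral_norm_bound]) (simp add: norm_mult)
  have g: "integrable lborel (\<lambda>x::real^'n. exp (- (x \<bullet> x)))" by (rule gaussian_integrable)
  have fp: "integrable lborel (\<lambda>x. norm (f' x) powr p)"
  proof -
    have "AE x in lborel. norm (f x) powr p = norm (f' x) powr p" using f' by eventually_elim simp
    from lebesgue_integrable_AE[OF _ this] show ?thesis using f by (simp add: Lp_space_def)
  qed
  have gK: "integrable lborel (\<lambda>x. of_real (exp (- (x \<bullet> x))) * wave y x * cnj (K x))" for y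
  proof (rule Bochner_Integration.integrable_bound)
    show "integrable lborel (\<lambda>x::real^'n. exp (- (x \<bullet> x)) * B)" using g by simp
    show "AE x in lborel. norm (of_real (exp (- (x \<bullet> x))) * wave y x * cnj (K x)) \<le> norm (exp (- (x \<bullet> x)) * B)"
    proof (intro AE_I2)
      fix x
      have "norm (of_real (exp (- (x \<bullet> x))) * wave y x * cnj (K x)) = exp (- (x \<bullet> x)) * norm (K x)"
        by (simp add: norm_mult)
      also have "\<dots> \<le> exp (- (x \<bullet> x)) * B" by (intro mult_left_mono KB) simp
      finally show "norm (of_real (exp (- (x \<bullet> x))) * wave y x * cnj (K x)) \<le> norm (exp (- (x \<bullet> x)) * B)" by simp
    qed
  qed measurable
  have gf: "integrable lborel (\<lambda>x. of_real (exp (- (x \<bullet> x))) * wave y x * cnj (f' x))" for y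
  proof (rule Bochner_Integration.integrable_bound)
    show "integrable lborel (\<lambda>x::real^'n. exp (- (x \<bullet> x)) + norm (f' x) powr p)" using g fp by simp
    show "AE x in lborel. norm (of_real (exp (- (x \<bullet> x))) * wave y x * cnj (f' x)) \<le> norm (exp (- (x \<bullet> x)) + norm (f' x) powr p)"
    proof (intro AE_I2)
      fix x
      \<comment> \<open>This bounds the Gaussian times \<open>f'\<close> by a sum of two integrable
        functions, for any p \<ge> 1.\<close>
      have le: "norm (f' x) \<le> 1 + norm (f' x) powr p"
      proof (cases "norm (f' x) \<le> 1")
        case False
        then have "norm (f' x) powr 1 \<le> norm (f' x) powr p" using p by (intro powr_mono) auto
        then show ?thesis using False by simp
      qed (simp add: add_increasing2)
      have "norm (of_real (exp (- (x \<bullet> x))) * wave y x * cnj (f' x)) = exp (- (x \<bullet> x)) * norm (f' x)"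
        by (simp add: norm_mult)
      also have "\<dots> \<le> exp (- (x \<bullet> x)) * (1 + norm (f' x) powr p)" by (intro mult_left_mono le) simp
      also have "\<dots> \<le> exp (- (x \<bullet> x)) + 1 * norm (f' x) powr p"
        unfolding distrib_left by (intro add_mono mult_right_mono) auto
      finally show "norm (of_real (exp (- (x \<bullet> x))) * wave y x * cnj (f' x)) \<le> norm (exp (- (x \<bullet> x)) + norm (f' x) powr p)" by simp
    qed
  qed measurable
  define v where "v x = of_real (exp (- (x \<bullet> x))) * cnj (f' x - K x)" for x
  have v: "integrable lborel v"
  proof -
    have "v = (\<lambda>x. of_real (exp (- (x \<bullet> x))) * wave 0 x * cnj (f' x) - of_real (exp (- (x \<bullet> x))) * wave 0 x * cnj (K x))"
      by (auto simp: v_def right_diff_distrib)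
    then show ?thesis using gf[of 0] gK[of 0] by (simp only:) (rule Bochner_Integration.integrable_diff)
  qed
  have "AE x in lborel. v x = 0"
  proof (rule fourier_uniqueness[OF v])
    fix y :: "real^'n"
    let ?h = "\<lambda>x. of_real (exp (- (x \<bullet> x))) * wave y x"
    have "?h \<in> schwartz" by (rule modulated_gaussian_schwartz[OF modulated_gaussian.base])
    then have "distr_of f ?h = (LINT \<xi>|lebesgue. fourier ?h \<xi> * cnj (F \<xi>))"
      using F unfolding has_fourier_function_def by blast
    also have "distr_of f ?h = (LINT x|lborel. ?h x * cnj (f' x))"
    proof -
      have "AE x in lborel. ?h x * cnj (f x) = ?h x * cnj (f' x)" using f' by eventually_elim simp
      from lebesgue_integral_AE[OF _ this] show ?thesis by (simp add: distr_of_def)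
    qed
    also have "(LINT \<xi>|lebesgue. fourier ?h \<xi> * cnj (F \<xi>)) = (LINT \<xi>|lborel. (LINT x|lborel. ?h x * cnj (wave x \<xi>) * cnj (F' \<xi>)))"
    proof -
      have "fourier ?h \<xi> = (LINT x|lborel. ?h x * cnj (wave x \<xi>))" for \<xi>
        unfolding fourier_def
      proof (rule lebesgue_integral_AE)
        show "(\<lambda>x. ?h x * cnj (wave x \<xi>)) \<in> borel_measurable borel" by measurable
      qed (simp add: wave_def cis_cnj)
      then have "AE \<xi> in lborel. fourier ?h \<xi> * cnj (F \<xi>) = (LINT x|lborel. ?h x * cnj (wave x \<xi>) * cnj (F' \<xi>))"
        using F' by (auto elim!: eventually_mono)
      then show ?thesis by (intro lebesgue_integral_AE) measurable
    qed
    also have "\<dots> = (LINT x|lborel. (LINT \<xi>|lborel. ?h x * cnj (wave x \<xi>) * cnj (F' \<xi>)))"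
    proof -
      have "integrable (lborel \<Otimes>\<^sub>M lborel) (\<lambda>(x, \<xi>). ?h x * cnj (wave x \<xi>) * cnj (F' \<xi>))"
      proof (rule lborel_pair.Fubini_integrable)
        have "(LINT \<xi>|lborel. norm (?h x * cnj (wave x \<xi>) * cnj (F' \<xi>))) = exp (- (x \<bullet> x)) * B" for x
          by (simp add: norm_mult B_def)
        then show "integrable lborel (\<lambda>x. LINT \<xi>|lborel. norm (case (x, \<xi>) of (x, \<xi>) \<Rightarrow> ?h x * cnj (wave x \<xi>) * cnj (F' \<xi>)))"
          using g by simp
        show "AE x in lborel. integrable lborel (\<lambda>\<xi>. case (x, \<xi>) of (x, \<xi>) \<Rightarrow> ?h x * cnj (wave x \<xi>) * cnj (F' \<xi>))"
        proof (intro AE_I2)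
          fix x
          have "integrable lborel (\<lambda>\<xi>. ?h x * cnj (wave x \<xi>) * cnj (F' \<xi>))"
            by (rule Bochner_Integration.integrable_bound[OF F'i]) (auto simp: norm_mult mult_left_le_one_le)
          then show "integrable lborel (\<lambda>\<xi>. case (x, \<xi>) of (x, \<xi>) \<Rightarrow> ?h x * cnj (wave x \<xi>) * cnj (F' \<xi>))" by simp
        qed
      qed measurable
      from lborel_pair.Fubini_integral[OF this] show ?thesis by simp
    qed
    also have "\<dots> = (LINT x|lborel. ?h x * cnj (K x))"
    proof -
      have "(LINT \<xi>|lborel. ?h x * cnj (wave x \<xi>) * cnj (F' \<xi>)) = ?h x * cnj (K x)" for x
      proof -
        have "(LINT \<xi>|lborel. ?h x * cnj (wave x \<xi>) * cnj (F' \<xi>)) = (LINT \<xi>|lborel. ?h x * cnj (F' \<xi> * wave x \<xi>))"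
          by (simp add: mult_ac)
        also have "\<dots> = ?h x * cnj (K x)" unfolding K_def by (simp only: integral_mult_right_zero Bochner_Integration.integral_cnj)
        finally show ?thesis .
      qed
      then show ?thesis by simp
    qed
    finally have "(LINT x|lborel. ?h x * cnj (f' x)) = (LINT x|lborel. ?h x * cnj (K x))" .
    then have "0 = (LINT x|lborel. ?h x * cnj (f' x) - ?h x * cnj (K x))"
      using gf[of y] gK[of y] by simp
    then show "(LINT x|lborel. v x * wave y x) = 0"
      by (simp add: v_def algebra_simps)
  qed
  then show ?thesis unfolding K_def[symmetric] by eventually_elim (simp add: v_def)
qed

subsection \<open>Powers of dilation matrices\<close>

lemma matpow_0 [simp]: "matpow A 0 = mat 1"
  by (simp add: matpow_def)

lemma matpow_Suc: "matpow A (Suc j) = A ** matpow A j"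
  by (simp add: matpow_def)

lemma matpow_Suc2: "matpow A (Suc j) = matpow A j ** A"
  by (induction j) (simp_all add: matpow_Suc matrix_mul_assoc)

lemma det_matpow: "det (matpow A j) = det A ^ j"
  by (induction j) (simp_all add: matpow_Suc det_mul)

lemma transpose_matpow: "transpose (matpow A j) = matpow (transpose A) j"
proof (induction j)
  case 0
  then show ?case by (simp add: transpose_mat)
next
  case (Suc j)
  have "transpose (matpow A (Suc j)) = transpose (matpow A j) ** transpose A"
    by (simp add: matpow_Suc matrix_transpose_mul)
  then show ?case by (simp add: Suc matpow_Suc2)
qed

lemma matpow_inverse:
  fixes A B :: "real^'n^'n"
  assumes "A ** B = mat 1"
  shows "matpow A j ** matpow B j = mat 1"
proof (induction j)
  case (Suc j)
  have "matpow A (Suc j) ** matpow B (Suc j) = matpow A j ** (A ** B) ** matpow B j"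
    by (simp add: matpow_Suc2[of A] matpow_Suc[of B] matrix_mul_assoc)
  then show ?case using Suc assms by simp
qed simp

text \<open>A real kernel vector, viewed as a complex one, would be an eigenvector with eigenvalue
  0, which is not larger than 1 in modulus.\<close>

lemma dilation_matrix_det:
  fixes M :: "real^'n^'n"
  assumes "dilation_matrix M"
  shows "det M \<noteq> 0"
proof
  assume "det M = 0"
  then have "\<not> invertible M" by (simp add: invertible_det_nz)
  then obtain v where v: "v \<noteq> 0" "M *v v = 0"
    unfolding invertible_left_inverse matrix_left_invertible_ker by blast
  let ?w = "(\<chi> i. complex_of_real (v $ i))"
  have "?w \<noteq> 0" using v(1) by (auto simp: vec_eq_iff)
  moreover have "map_matrix complex_of_real M *v ?w = 0 *s ?w"
  proof -
    have "(\<Sum>j\<in>UNIV. complex_of_real (M $ i $ j) * complex_of_real (v $ j)) = 0" for i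
    proof -
      have "(\<Sum>j\<in>UNIV. M $ i $ j * v $ j) = 0" using v(2) by (simp add: matrix_vector_mult_def vec_eq_iff)
      then have "complex_of_real (\<Sum>j\<in>UNIV. M $ i $ j * v $ j) = 0" by simp
      then show ?thesis by simp
    qed
    then show ?thesis by (simp add: matrix_vector_mult_def map_matrix_def vec_eq_iff)
  qed
  ultimately have "norm (0::complex) > 1" using assms unfolding dilation_matrix_def by blast
  then show False by simp
qed

text \<open>The amplitude of the rescaled spectrum contributes |det A|^q and the Jacobian |det
  A|^(-1), whence the exponent q - 1.\<close>

lemma nn_integral_scale:
  fixes A B :: "real^'n^'n" and h :: "real^'n \<Rightarrow> real"
  assumes d: "det A \<noteq> 0" and AB: "A ** B = mat 1"
    and [measurable]: "h \<in> borel_measurable borel" "g \<in> borel_measurable borel"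
    and h: "\<And>x. h x \<ge> 0" and g: "\<And>x. g x \<ge> 0" and q: "q \<ge> 0"
  shows "(\<integral>\<^sup>+x. ennreal ((h x * (\<bar>det A\<bar> * g (A *v x))) powr q) \<partial>lborel)
    = ennreal (\<bar>det A\<bar> powr (q - 1)) * (\<integral>\<^sup>+x. ennreal ((h (B *v x) * g x) powr q) \<partial>lborel)"
proof -
  have BA: "B *v (A *v x) = x" for x
    using AB matrix_left_right_inverse[of A B] by (simp add: matrix_vector_mul_assoc)
  let ?d = "\<bar>det A\<bar>"
  have d0: "?d > 0" using d by simp
  have "(\<integral>\<^sup>+x. ennreal ((h (B *v x) * g x) powr q) \<partial>lborel) = ennreal ?d * (\<integral>\<^sup>+x. ennreal ((h x * g (A *v x)) powr q) \<partial>lborel)"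
    using nn_integral_lborel_linear[OF d, of "\<lambda>x. ennreal ((h (B *v x) * g x) powr q)"] by (simp add: BA)
  then have "ennreal (?d powr (q - 1)) * (\<integral>\<^sup>+x. ennreal ((h (B *v x) * g x) powr q) \<partial>lborel)
     = ennreal (?d powr (q - 1) * ?d) * (\<integral>\<^sup>+x. ennreal ((h x * g (A *v x)) powr q) \<partial>lborel)"
    by (simp add: ennreal_mult mult.assoc)
  also have "?d powr (q - 1) * ?d = ?d powr q" using d0 by (simp add: powr_diff)
  also have "ennreal (?d powr q) * (\<integral>\<^sup>+x. ennreal ((h x * g (A *v x)) powr q) \<partial>lborel)
     = (\<integral>\<^sup>+x. ennreal (?d powr q) * ennreal ((h x * g (A *v x)) powr q) \<partial>lborel)"
    by (rule nn_integral_cmult[symmetric]) measurable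
  also have "\<dots> = (\<integral>\<^sup>+x. ennreal ((h x * (?d * g (A *v x))) powr q) \<partial>lborel)"
    using d0 h g by (simp add: powr_mult ennreal_mult[symmetric] mult_ac)
  finally show ?thesis ..
qed

subsection \<open>Unconditional sums in Lebesgue spaces\<close>

lemma Lp_space_iff:
  "f \<in> Lp_space p \<longleftrightarrow> f \<in> borel_measurable lebesgue \<and> (\<integral>\<^sup>+x. ennreal (norm (f x) powr p) \<partial>lborel) < \<infinity>"
  unfolding Lp_space_def by (auto simp: integrable_iff_bounded nn_integral_completion)

lemma Lp_norm_eq:
  assumes "f \<in> borel_measurable lebesgue"
  shows "Lp_norm p f = enn2real (\<integral>\<^sup>+x. ennreal (norm (f x) powr p) \<partial>lborel) powr (1 / p)"
  unfolding Lp_norm_def using assms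
  by (subst integral_eq_nn_integral) (auto simp: nn_integral_completion)

lemma nn_integral_powr_add_le:
  fixes f g :: "real^'n \<Rightarrow> complex"
  assumes p: "p \<ge> 1" and [measurable]: "f \<in> borel_measurable lebesgue" "g \<in> borel_measurable lebesgue"
  shows "(\<integral>\<^sup>+x. ennreal (norm (f x + g x) powr p) \<partial>lborel) \<le>
    ennreal (2 powr p) * ((\<integral>\<^sup>+x. ennreal (norm (f x) powr p) \<partial>lborel) + (\<integral>\<^sup>+x. ennreal (norm (g x) powr p) \<partial>lborel))"
proof -
  have "(\<integral>\<^sup>+x. ennreal (norm (f x + g x) powr p) \<partial>lebesgue) \<le>
     (\<integral>\<^sup>+x. ennreal (2 powr p) * (ennreal (norm (f x) powr p) + ennreal (norm (g x) powr p)) \<partial>lebesgue)"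
  proof (rule nn_integral_mono)
    fix x
    have "norm (f x + g x) powr p \<le> (norm (f x) + norm (g x)) powr p"
      using p by (intro powr_mono2 norm_triangle_ineq) auto
    also have "\<dots> \<le> 2 powr p * (norm (f x) powr p + norm (g x) powr p)"
      by (rule powr_add_le[OF p]) auto
    finally show "ennreal (norm (f x + g x) powr p) \<le> ennreal (2 powr p) * (ennreal (norm (f x) powr p) + ennreal (norm (g x) powr p))"
      by (simp add: ennreal_mult[symmetric] ennreal_plus[symmetric] del: ennreal_plus)
  qed
  also have "\<dots> = ennreal (2 powr p) * ((\<integral>\<^sup>+x. ennreal (norm (f x) powr p) \<partial>lebesgue) + (\<integral>\<^sup>+x. ennreal (norm (g x) powr p) \<partial>lebesgue))"
    by (subst nn_integral_cmult, measurable, subst nn_integral_add) auto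
  finally show ?thesis by (simp add: nn_integral_completion)
qed

lemma Lp_space_add:
  assumes "p \<ge> 1" "f \<in> Lp_space p" "g \<in> Lp_space p"
  shows "(\<lambda>x. f x + g x) \<in> Lp_space p"
proof -
  have fg: "f \<in> borel_measurable lebesgue" "g \<in> borel_measurable lebesgue"
      "(\<integral>\<^sup>+x. ennreal (norm (f x) powr p) \<partial>lborel) < \<infinity>" "(\<integral>\<^sup>+x. ennreal (norm (g x) powr p) \<partial>lborel) < \<infinity>"
    using assms(2,3) by (auto simp: Lp_space_iff)
  have "(\<integral>\<^sup>+x. ennreal (norm (f x + g x) powr p) \<partial>lborel) < \<infinity>"
    by (rule le_less_trans[OF nn_integral_powr_add_le[OF assms(1) fg(1,2)]])
       (use fg(3,4) in \<open>simp add: ennreal_mult_less_top\<close>)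
  then show ?thesis using fg(1,2) by (simp add: Lp_space_iff)
qed

lemma Lp_space_minus: "f \<in> Lp_space p \<Longrightarrow> (\<lambda>x. - f x) \<in> Lp_space p"
  by (auto simp: Lp_space_iff)

lemma Lp_space_diff:
  assumes "p \<ge> 1" "f \<in> Lp_space p" "g \<in> Lp_space p"
  shows "(\<lambda>x. f x - g x) \<in> Lp_space p"
  using Lp_space_add[OF assms(1,2) Lp_space_minus[OF assms(3)]] by simp

lemma Lp_space_sum:
  assumes p: "p \<ge> 1" and u: "\<And>k. u k \<in> Lp_space p"
  shows "(\<lambda>x. \<Sum>k\<in>A. u k x) \<in> Lp_space p"
proof (induction A rule: infinite_finite_induct)
  case (insert k A)
  then show ?case using Lp_space_add[OF p u[of k] insert.IH] by simp
qed (auto simp: Lp_space_iff)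

lemma has_Lp_sumI:
  fixes S :: "real^'n \<Rightarrow> complex"
  assumes p: "p \<ge> 1" and u: "\<And>k. u k \<in> Lp_space p" and Sm: "S \<in> borel_measurable lebesgue"
    and lim: "((\<lambda>A. \<integral>\<^sup>+x. ennreal (norm (S x - (\<Sum>k\<in>A. u k x)) powr p) \<partial>lborel) \<longlongrightarrow> 0) (finite_subsets_at_top UNIV)"
  shows "has_Lp_sum p u S"
proof -
  let ?I = "\<lambda>A. \<integral>\<^sup>+x. ennreal (norm (S x - (\<Sum>k\<in>A. u k x)) powr p) \<partial>lborel"
  have sm: "(\<lambda>x. \<Sum>k\<in>A. u k x) \<in> Lp_space p" for A by (rule Lp_space_sum[OF p u])
  then have sm': "(\<lambda>x. \<Sum>k\<in>A. u k x) \<in> borel_measurable lebesgue" for A by (simp add: Lp_space_iff)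
  \<comment> \<open>A single finite set with error below 1 already places \<open>S\<close> in L_p,
    as a partial sum plus a small remainder.\<close>
  have "eventually (\<lambda>A. ?I A < 1) (finite_subsets_at_top UNIV)"
    using lim by (rule order_tendstoD) simp
  then obtain A where A: "?I A < 1"
    using eventually_happens'[OF finite_subsets_at_top_neq_bot] by blast
  then have "(\<lambda>x. S x - (\<Sum>k\<in>A. u k x)) \<in> Lp_space p"
    using Sm sm'[of A] by (simp add: Lp_space_iff less_trans[OF A])
  from Lp_space_add[OF p this sm[of A]] have S: "S \<in> Lp_space p" by simp
  have "((\<lambda>A. enn2real (?I A)) \<longlongrightarrow> 0) (finite_subsets_at_top UNIV)"
    using tendsto_enn2real[of ?I 0] lim by simp
  then have "((\<lambda>A. enn2real (?I A) powr (1 / p)) \<longlongrightarrow> 0 powr (1 / p)) (finite_subsets_at_top UNIV)"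
    using p by (intro tendsto_powr') auto
  then have "((\<lambda>A. Lp_norm p (\<lambda>x. S x - (\<Sum>k\<in>A. u k x))) \<longlongrightarrow> 0) (finite_subsets_at_top UNIV)"
    using Sm sm' by (simp add: Lp_norm_eq)
  then show ?thesis using S u by (simp add: has_Lp_sum_def)
qed

text \<open>\<open>Lp_infsum\<close> is an arbitrary choice of sum, so it must be identified almost
  everywhere with the one constructed. The crude triangle inequality with factor 2^p is enough,
  because the errors are made arbitrarily small.\<close>

lemma has_Lp_sum_unique:
  fixes S S' :: "real^'n \<Rightarrow> complex"
  assumes p: "p \<ge> 1" and S: "has_Lp_sum p u S" "has_Lp_sum p u S'"
  shows "AE x in lborel. S x = S' x"
proof -
  let ?s = "\<lambda>A x. \<Sum>k\<in>A. u k x" and ?I = "\<lambda>f. \<integral>\<^sup>+x. ennreal (norm (f x :: complex) powr p) \<partial>(lborel :: (real^'n) measure)"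
  have s: "?s A \<in> Lp_space p" for A using S by (intro Lp_space_sum[OF p]) (simp add: has_Lp_sum_def)
  have D: "(\<lambda>x. S x - ?s A x) \<in> Lp_space p" "(\<lambda>x. ?s A x - S' x) \<in> Lp_space p" "(\<lambda>x. S' x - ?s A x) \<in> Lp_space p" for A
    using S by (intro Lp_space_diff[OF p _ s] Lp_space_diff[OF p s]; simp add: has_Lp_sum_def)+
  have m: "(\<lambda>x. S x - S' x) \<in> borel_measurable lebesgue"
    using S by (auto simp: has_Lp_sum_def Lp_space_iff)
  have small: "?I (\<lambda>x. S x - S' x) \<le> ennreal (2 powr p * (e + e))" if e: "e > 0" for e
  proof -
    have "e powr (1 / p) > 0" using e by simp
    have "eventually (\<lambda>A. Lp_norm p (\<lambda>x. S x - ?s A x) < e powr (1 / p) \<and> Lp_norm p (\<lambda>x. S' x - ?s A x) < e powr (1 / p)) (finite_subsets_at_top UNIV)"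
      using S e unfolding has_Lp_sum_def by (intro eventually_conj order_tendstoD[where y = 0]) auto
    then obtain A where A: "Lp_norm p (\<lambda>x. S x - ?s A x) < e powr (1 / p)" "Lp_norm p (\<lambda>x. S' x - ?s A x) < e powr (1 / p)"
      using eventually_happens'[OF finite_subsets_at_top_neq_bot] by blast
    have le: "?I g \<le> ennreal e" if "Lp_norm p g < e powr (1 / p)" "g \<in> Lp_space p" for g
    proof -
      have g: "g \<in> borel_measurable lebesgue" "?I g < \<infinity>" using that(2) by (auto simp: Lp_space_iff)
      have "enn2real (?I g) powr (1 / p) < e powr (1 / p)" using that(1) Lp_norm_eq[OF g(1)] by simp
      then have "enn2real (?I g) < e" using powr_mono2[of "1 / p" e "enn2real (?I g)"] p e by (cases "enn2real (?I g) < e") auto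
      then show ?thesis using g(2) ennreal_leI[of "enn2real (?I g)" e] by simp
    qed
    have "?I (\<lambda>x. S x - S' x) = ?I (\<lambda>x. (S x - ?s A x) + (?s A x - S' x))" by simp
    also have "\<dots> \<le> ennreal (2 powr p) * (?I (\<lambda>x. S x - ?s A x) + ?I (\<lambda>x. ?s A x - S' x))"
      using D by (intro nn_integral_powr_add_le[OF p]) (auto simp: Lp_space_iff)
    also have "\<dots> \<le> ennreal (2 powr p) * (ennreal e + ennreal e)"
      using le[OF A(1) D(1)] le[OF A(2) D(3)] by (intro mult_left_mono add_mono) (auto simp: norm_minus_commute)
    also have "\<dots> = ennreal (2 powr p * (e + e))" unfolding ennreal_plus[OF less_imp_le[OF e] less_imp_le[OF e], symmetric]
      by (rule ennreal_mult[symmetric]) (use e in auto)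
    finally show ?thesis .
  qed
  have "?I (\<lambda>x. S x - S' x) \<le> 0"
  proof (rule ennreal_le_epsilon)
    fix e :: real assume e: "e > 0"
    show "?I (\<lambda>x. S x - S' x) \<le> 0 + ennreal e"
      using small[of "e / (2 * 2 powr p)"] e by (simp add: field_simps)
  qed
  then have "(\<integral>\<^sup>+x. ennreal (norm (S x - S' x) powr p) \<partial>lebesgue) = 0"
    by (simp add: nn_integral_completion)
  then have "AE x in lebesgue. ennreal (norm (S x - S' x) powr p) = 0"
    using m by (subst (asm) nn_integral_0_iff_AE) auto
  then show ?thesis unfolding AE_completion_iff by eventually_elim (auto simp: ennreal_eq_0_iff)
qed

subsection \<open>Rescaling of the approximation\<close>

text \<open>The first inequality only preserves finiteness, so its constant is lost. The second has
  the homogeneous weight and yields the factor with the operator norm of \<open>B\<close> in the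
  theorem.\<close>

lemma weight_scale_le:
  fixes B :: "real^'n^'n"
  assumes "\<gamma> \<ge> 0" "q \<ge> 0" "t \<ge> 0"
  shows "((1 + norm (B *v x)) powr \<gamma> * t) powr q \<le> (1 + onorm ((*v) B)) powr (\<gamma> * q) * ((1 + norm x) powr \<gamma> * t) powr q"
    and "(norm (B *v x) powr \<gamma> * t) powr q \<le> onorm ((*v) B) powr (\<gamma> * q) * (norm x powr \<gamma> * t) powr q"
proof -
  have on: "norm (B *v x) \<le> onorm ((*v) B) * norm x" "onorm ((*v) B) \<ge> 0"
    by (auto intro: onorm onorm_pos_le matrix_vector_mul_bounded_linear)
  have "(1 + onorm ((*v) B)) * (1 + norm x) = 1 + onorm ((*v) B) + norm x + onorm ((*v) B) * norm x"
    by (simp add: algebra_simps)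
  with on norm_ge_zero[of x] have "1 + norm (B *v x) \<le> (1 + onorm ((*v) B)) * (1 + norm x)" by linarith
  from powr_mono2[OF assms(1) _ this] have "(1 + norm (B *v x)) powr \<gamma> * t \<le> ((1 + onorm ((*v) B)) * (1 + norm x)) powr \<gamma> * t"
    using assms(3) by (intro mult_right_mono) auto
  then have "((1 + norm (B *v x)) powr \<gamma> * t) powr q \<le> (((1 + onorm ((*v) B)) * (1 + norm x)) powr \<gamma> * t) powr q"
    using assms by (intro powr_mono2) auto
  also have "\<dots> = (1 + onorm ((*v) B)) powr (\<gamma> * q) * ((1 + norm x) powr \<gamma> * t) powr q"
    using on assms by (simp add: powr_mult powr_powr mult.assoc)
  finally show "((1 + norm (B *v x)) powr \<gamma> * t) powr q \<le> (1 + onorm ((*v) B)) powr (\<gamma> * q) * ((1 + norm x) powr \<gamma> * t) powr q" .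
  have "norm (B *v x) powr \<gamma> * t \<le> (onorm ((*v) B) * norm x) powr \<gamma> * t"
    using assms on by (intro mult_right_mono powr_mono2) auto
  then have "(norm (B *v x) powr \<gamma> * t) powr q \<le> ((onorm ((*v) B) * norm x) powr \<gamma> * t) powr q"
    using assms by (intro powr_mono2) auto
  also have "\<dots> = onorm ((*v) B) powr (\<gamma> * q) * (norm x powr \<gamma> * t) powr q"
    using on assms by (simp add: powr_mult powr_powr mult.assoc)
  finally show "(norm (B *v x) powr \<gamma> * t) powr q \<le> onorm ((*v) B) powr (\<gamma> * q) * (norm x powr \<gamma> * t) powr q" .
qed

text \<open>Inside a ball the weight is bounded and F lies in L_q; outside, the decay of order s
  beats the weight \<gamma>, and the margin (s - \<gamma>) q > d makes the remaining power
  integrable. The radius is at least 1 so that |\<xi>| and 1 + |\<xi>| are comparable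
  outside.\<close>

lemma decay_weight_finite:
  fixes F :: "real^'n \<Rightarrow> complex"
  assumes q: "q \<ge> 1" and \<gamma>: "\<gamma> \<ge> 0" and s: "(s - \<gamma>) * q > real CARD('n)"
    and [measurable]: "F \<in> borel_measurable borel"
    and Fq: "(\<integral>\<^sup>+\<xi>. ennreal (norm (F \<xi>) powr q) \<partial>lborel) < \<infinity>"
    and decay: "AE \<xi> in lborel. norm \<xi> \<ge> R \<longrightarrow> norm (F \<xi>) \<le> K * norm \<xi> powr (- s)"
  shows "(\<integral>\<^sup>+\<xi>. ennreal (((1 + norm \<xi>) powr \<gamma> * norm (F \<xi>)) powr q) \<partial>lborel) < \<infinity>"
proof -
  define R1 where "R1 = max R 1"
  define c1 where "c1 = (1 + R1) powr (\<gamma> * q)"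
  define c2 where "c2 = (\<bar>K\<bar> * 2 powr s) powr q"
  have "(s - \<gamma>) * q > 0" using s by (rule le_less_trans[rotated]) simp
  then have s\<gamma>: "s > \<gamma>" using q by (simp add: zero_less_mult_iff)
  have "(\<integral>\<^sup>+\<xi>. ennreal (((1 + norm \<xi>) powr \<gamma> * norm (F \<xi>)) powr q) \<partial>lborel) \<le>
     (\<integral>\<^sup>+\<xi>. ennreal c1 * ennreal (norm (F \<xi>) powr q) + ennreal c2 * ennreal ((1 + norm \<xi>) powr (- ((s - \<gamma>) * q))) \<partial>lborel)"
  proof (rule nn_integral_mono_AE)
    show "AE \<xi> in lborel. ennreal (((1 + norm \<xi>) powr \<gamma> * norm (F \<xi>)) powr q) \<le>
      ennreal c1 * ennreal (norm (F \<xi>) powr q) + ennreal c2 * ennreal ((1 + norm \<xi>) powr (- ((s - \<gamma>) * q)))"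
      using decay
    proof eventually_elim
      case (elim \<xi>)
      let ?w = "1 + norm \<xi>"
      have w: "?w > 0" by (simp add: add_pos_nonneg)
      have "(?w powr \<gamma> * norm (F \<xi>)) powr q \<le> c1 * norm (F \<xi>) powr q + c2 * ?w powr (- ((s - \<gamma>) * q))"
      proof (cases "norm \<xi> \<ge> R1")
        case True
        then have \<xi>: "norm \<xi> \<ge> R" "norm \<xi> \<ge> 1" by (auto simp: R1_def)
        have half: "?w / 2 \<le> norm \<xi>" using \<xi> by simp
        have F: "norm (F \<xi>) \<le> \<bar>K\<bar> * norm \<xi> powr (- s)"
          using elim \<xi>(1) by (meson abs_ge_self mult_right_mono order_trans powr_ge_zero)
        have "norm \<xi> powr (- s) \<le> (?w / 2) powr (- s)"
          using half w s\<gamma> \<gamma> by (intro powr_mono2') auto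
        also have "(?w / 2) powr (- s) = 2 powr s * ?w powr (- s)"
          using w powr_divide[of ?w 2 "- s"] powr_minus_divide[of 2 s] by (simp add: less_imp_le)
        finally have "\<bar>K\<bar> * norm \<xi> powr (- s) \<le> \<bar>K\<bar> * (2 powr s * ?w powr (- s))" by (rule mult_left_mono) simp
        with F have "norm (F \<xi>) \<le> (\<bar>K\<bar> * 2 powr s) * ?w powr (- s)" by (simp add: mult.assoc)
        then have "(?w powr \<gamma> * norm (F \<xi>)) powr q \<le> (?w powr \<gamma> * ((\<bar>K\<bar> * 2 powr s) * ?w powr (- s))) powr q"
          using q by (intro powr_mono2 mult_left_mono) auto
        also have "\<dots> = c2 * (?w powr \<gamma> * ?w powr (- s)) powr q"
          by (simp add: c2_def powr_mult mult_ac)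
        also have "?w powr \<gamma> * ?w powr (- s) = ?w powr (- (s - \<gamma>))" by (simp flip: powr_add)
        also have "(?w powr (- (s - \<gamma>))) powr q = ?w powr (- ((s - \<gamma>) * q))" by (simp only: powr_powr mult_minus_left)
        finally show ?thesis by (rule order_trans) (simp add: c1_def)
      next
        case False
        then have "?w powr \<gamma> \<le> (1 + R1) powr \<gamma>" using \<gamma> by (intro powr_mono2) auto
        then have "(?w powr \<gamma> * norm (F \<xi>)) powr q \<le> ((1 + R1) powr \<gamma> * norm (F \<xi>)) powr q"
          using q by (intro powr_mono2[OF _ _ mult_right_mono]) auto
        also have "\<dots> = c1 * norm (F \<xi>) powr q" by (simp add: c1_def powr_mult powr_powr)
        finally show ?thesis by (rule order_trans) (simp add: c2_def)
      qed
      then show ?case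
        by (simp add: c1_def c2_def ennreal_mult[symmetric] ennreal_plus[symmetric] del: ennreal_plus)
    qed
  qed
  also have "\<dots> = ennreal c1 * (\<integral>\<^sup>+\<xi>. ennreal (norm (F \<xi>) powr q) \<partial>lborel) + ennreal c2 * (\<integral>\<^sup>+\<xi>. ennreal ((1 + norm \<xi>) powr (- ((s - \<gamma>) * q))) \<partial>(lborel :: (real^'n) measure))"
    by (subst nn_integral_add) (auto simp: nn_integral_cmult)
  also have "\<dots> < \<infinity>"
    using Fq nn_integral_polynomial_weight_finite[OF s] by (simp add: ennreal_mult_less_top)
  finally show ?thesis .
qed

text \<open>The core estimate is applied to \<open>FA\<close> and pulled back along x -> A x. The
  tail bound brings |det A|^(q-1) and, after the power q/p, the Jacobian brings |det A|^(-q/p).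
  These cancel, so the constant stays free of \<open>A\<close>.\<close>

lemma dilated_approximation:
  fixes A B :: "real^'n^'n" and F G \<phi> :: "real^'n \<Rightarrow> complex" and p q \<gamma> \<delta> C r :: real
  defines "FA \<equiv> \<lambda>\<eta>. of_real \<bar>det A\<bar> * F (transpose A *v \<eta>)"
  assumes core: "\<And>F I0. F \<in> borel_measurable borel \<Longrightarrow> I0 \<ge> 0 \<Longrightarrow>
      (\<integral>\<^sup>+\<xi>. ennreal (((1 + norm \<xi>) powr \<gamma> * norm (F \<xi>)) powr q) \<partial>lborel) \<le> ennreal I0 \<Longrightarrow>
      integrable lborel F \<and> (\<exists>S\<in>borel_measurable borel.
        ((\<lambda>A. \<integral>\<^sup>+x. ennreal (norm (S x - (\<Sum>k\<in>A. (LINT \<xi>|lborel. F \<xi> * cnj (wave (lattice_point k) \<xi> * G \<xi>)) * \<phi> (x + lattice_point k))) powr p) \<partial>lborel)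
          \<longlongrightarrow> 0) (finite_subsets_at_top UNIV) \<and>
        (\<forall>J\<ge>0. (\<integral>\<^sup>+\<xi>. ennreal ((norm \<xi> powr \<gamma> * norm (F \<xi>)) powr q) * indicator {\<xi>. \<delta> \<le> norm \<xi>} \<xi> \<partial>lborel) \<le> ennreal J \<longrightarrow>
          (\<integral>\<^sup>+x. ennreal (norm ((LINT \<xi>|lborel. F \<xi> * wave x \<xi>) - S x) powr p) \<partial>lborel) \<le> ennreal (C * J powr (p - 1))))"
    and pq: "p \<ge> 2" "1 / p + 1 / q = 1" and \<gamma>: "\<gamma> \<ge> 0" and C: "C \<ge> 0"
    and [measurable]: "\<phi> \<in> borel_measurable borel"
    and d: "det A \<noteq> 0" and AB: "transpose A ** B = mat 1"
    and Fm [measurable]: "F \<in> borel_measurable borel"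
    and W: "(\<integral>\<^sup>+\<xi>. ennreal (((1 + norm \<xi>) powr \<gamma> * norm (F \<xi>)) powr q) \<partial>lborel) < \<infinity>"
    and r: "r \<ge> 0" "(\<integral>\<^sup>+\<xi>. ennreal ((norm \<xi> powr \<gamma> * norm (F \<xi>)) powr q) * indicator {\<xi>. \<delta> \<le> norm (B *v \<xi>)} \<xi> \<partial>lborel) \<le> ennreal r"
  shows "\<exists>S\<in>borel_measurable borel.
      ((\<lambda>X. \<integral>\<^sup>+x. ennreal (norm (S x - (\<Sum>k\<in>X. (LINT \<xi>|lborel. FA \<xi> * cnj (wave (lattice_point k) \<xi> * G \<xi>)) * \<phi> (A *v x + lattice_point k))) powr p) \<partial>lborel)
          \<longlongrightarrow> 0) (finite_subsets_at_top UNIV) \<and>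
      enn2real (\<integral>\<^sup>+x. ennreal (norm ((LINT \<xi>|lborel. F \<xi> * wave x \<xi>) - S x) powr p) \<partial>lborel) powr (q / p)
        \<le> C powr (q / p) * (onorm ((*v) B) powr (\<gamma> * q) * r)"
proof -
  let ?d = "\<bar>det A\<bar>" and ?o = "onorm ((*v) B) powr (\<gamma> * q)"
  have p: "p > 1" "p > 0" using pq by auto
  have q: "q > 1" "q / p = q - 1" "(p - 1) * (q / p) = 1" "q > 0"
  proof -
    have "q \<noteq> 0" using pq by (cases "q = 0") auto
    then have eq: "q = p / (p - 1)" using pq by (simp add: field_simps)
    show "q > 1" "q > 0" unfolding eq using pq by (simp_all add: less_divide_eq)
    show "(p - 1) * (q / p) = 1" unfolding eq using p by simp
    then show "q / p = q - 1" using p by (simp add: field_simps)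
  qed
  have d0: "?d > 0" using d by simp
  have dT: "det (transpose A) \<noteq> 0" "\<bar>det (transpose A)\<bar> = ?d" using d by (simp_all add: det_transpose)
  have [measurable]: "FA \<in> borel_measurable borel" unfolding FA_def by measurable
  have nFA: "norm (FA \<eta>) = ?d * norm (F (transpose A *v \<eta>))" for \<eta> by (simp add: FA_def norm_mult)
  have scale: "(\<integral>\<^sup>+\<xi>. ennreal ((h \<xi> * norm (FA \<xi>)) powr q) \<partial>lborel) = ennreal (?d powr (q - 1)) * (\<integral>\<^sup>+\<xi>. ennreal ((h (B *v \<xi>) * norm (F \<xi>)) powr q) \<partial>lborel)"
    if "h \<in> borel_measurable borel" "\<And>x. h x \<ge> 0" for h :: "real^'n \<Rightarrow> real"
    using nn_integral_scale[OF dT(1) AB that(1) _ that(2), of "\<lambda>x. norm (F x)" q] q(1)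
    unfolding nFA dT(2) by simp
  define I0 where "I0 = enn2real (\<integral>\<^sup>+\<xi>. ennreal (((1 + norm \<xi>) powr \<gamma> * norm (FA \<xi>)) powr q) \<partial>lborel)"
  have "(\<integral>\<^sup>+\<xi>. ennreal (((1 + norm (B *v \<xi>)) powr \<gamma> * norm (F \<xi>)) powr q) \<partial>lborel)
    \<le> (\<integral>\<^sup>+\<xi>. ennreal ((1 + onorm ((*v) B)) powr (\<gamma> * q)) * ennreal (((1 + norm \<xi>) powr \<gamma> * norm (F \<xi>)) powr q) \<partial>lborel)"
    using weight_scale_le(1)[OF \<gamma>, of q "norm (F _)" B] q(1)
    by (intro nn_integral_mono) (simp add: ennreal_mult[symmetric])
  also have "\<dots> < \<infinity>" using W by (simp add: nn_integral_cmult ennreal_mult_less_top)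
  finally have "(\<integral>\<^sup>+\<xi>. ennreal (((1 + norm \<xi>) powr \<gamma> * norm (FA \<xi>)) powr q) \<partial>lborel) < \<infinity>"
    by (subst scale) (auto simp: ennreal_mult_less_top)
  then have "(\<integral>\<^sup>+\<xi>. ennreal (((1 + norm \<xi>) powr \<gamma> * norm (FA \<xi>)) powr q) \<partial>lborel) \<le> ennreal I0"
    unfolding I0_def by (subst ennreal_enn2real) auto
  from core[OF _ _ this] obtain S where Sm [measurable]: "S \<in> borel_measurable borel"
    and lim: "((\<lambda>X. \<integral>\<^sup>+x. ennreal (norm (S x - (\<Sum>k\<in>X. (LINT \<xi>|lborel. FA \<xi> * cnj (wave (lattice_point k) \<xi> * G \<xi>)) * \<phi> (x + lattice_point k))) powr p) \<partial>lborel)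
          \<longlongrightarrow> 0) (finite_subsets_at_top UNIV)"
    and bound: "\<And>J. J \<ge> 0 \<Longrightarrow> (\<integral>\<^sup>+\<xi>. ennreal ((norm \<xi> powr \<gamma> * norm (FA \<xi>)) powr q) * indicator {\<xi>. \<delta> \<le> norm \<xi>} \<xi> \<partial>lborel) \<le> ennreal J \<Longrightarrow>
          (\<integral>\<^sup>+x. ennreal (norm ((LINT \<xi>|lborel. FA \<xi> * wave x \<xi>) - S x) powr p) \<partial>lborel) \<le> ennreal (C * J powr (p - 1))"
    by (auto simp: I0_def)
  have sub: "(\<integral>\<^sup>+x. g (A *v x) \<partial>lborel) = ennreal (1 / ?d) * (\<integral>\<^sup>+x. g x \<partial>lborel)"
    if "g \<in> borel_measurable borel" for g :: "real^'n \<Rightarrow> ennreal"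
  proof -
    have "ennreal (1 / ?d) * (\<integral>\<^sup>+x. g x \<partial>lborel) = ennreal (1 / ?d * ?d) * (\<integral>\<^sup>+x. g (A *v x) \<partial>lborel)"
      using nn_integral_lborel_linear[OF d that] d0 by (simp add: ennreal_mult mult.assoc del: times_divide_eq_left)
    then show ?thesis using d0 by simp
  qed
  \<comment> \<open>The rescaled spectrum is normalised so that its inverse transform at A x equals
    that of \<open>F\<close> at x.\<close>
  have inv: "(LINT \<xi>|lborel. FA \<xi> * wave (A *v x) \<xi>) = (LINT \<xi>|lborel. F \<xi> * wave x \<xi>)" for x
  proof -
    have w: "wave (A *v x) \<xi> = wave x (transpose A *v \<xi>)" for \<xi>
    proof -
      have "(A *v x) \<bullet> \<xi> = x \<bullet> (transpose A *v \<xi>)"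
        unfolding transpose_matrix_vector inner_commute[of _ \<xi>] inner_commute[of x "\<xi> v* A"]
        by (rule dot_lmul_matrix[symmetric])
      then show ?thesis by (simp only: wave_def)
    qed
    have "(LINT \<xi>|lborel. F \<xi> * wave x \<xi>) = ?d *\<^sub>R (LINT \<xi>|lborel. F (transpose A *v \<xi>) * wave x (transpose A *v \<xi>))"
      using integral_lborel_linear[OF dT(1), of "\<lambda>\<xi>. F \<xi> * wave x \<xi>"] by (simp add: dT(2))
    also have "\<dots> = (LINT \<xi>|lborel. FA \<xi> * wave (A *v x) \<xi>)"
      unfolding w FA_def by (simp add: mult.assoc scaleR_conv_of_real)
    finally show ?thesis ..
  qed
  \<comment> \<open>The tail of \<open>FA\<close> outside the ball of radius \<delta> becomes, after
    substitution, the tail of \<open>F\<close> where |B \<xi>| \<ge> \<delta>, times |det A|^(q-1)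
    and the factor from the operator norm of \<open>B\<close>.\<close>
  define J where "J = ?d powr (q - 1) * (?o * r)"
  have J: "J \<ge> 0" using r(1) by (simp add: J_def)
  have "(\<integral>\<^sup>+\<xi>. ennreal ((norm \<xi> powr \<gamma> * norm (FA \<xi>)) powr q) * indicator {\<xi>. \<delta> \<le> norm \<xi>} \<xi> \<partial>lborel) \<le> ennreal J"
  proof -
    \<comment> \<open>Putting the cut into the weight lets the same scaling identity treat it; under
      the power q the value 0 stays 0.\<close>
    let ?h = "\<lambda>\<xi>::real^'n. norm \<xi> powr \<gamma> * indicat_real {\<xi>. \<delta> \<le> norm \<xi>} \<xi>"
    have "(\<integral>\<^sup>+\<xi>. ennreal ((norm \<xi> powr \<gamma> * norm (FA \<xi>)) powr q) * indicator {\<xi>. \<delta> \<le> norm \<xi>} \<xi> \<partial>lborel)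
      = (\<integral>\<^sup>+\<xi>. ennreal ((?h \<xi> * norm (FA \<xi>)) powr q) \<partial>lborel)"
      using q by (intro nn_integral_cong) (auto simp: indicator_def)
    also have "\<dots> = ennreal (?d powr (q - 1)) * (\<integral>\<^sup>+\<xi>. ennreal ((?h (B *v \<xi>) * norm (F \<xi>)) powr q) \<partial>lborel)"
      by (rule scale) auto
    also have "(\<integral>\<^sup>+\<xi>. ennreal ((?h (B *v \<xi>) * norm (F \<xi>)) powr q) \<partial>lborel)
      \<le> (\<integral>\<^sup>+\<xi>. ennreal ?o * (ennreal ((norm \<xi> powr \<gamma> * norm (F \<xi>)) powr q) * indicator {\<xi>. \<delta> \<le> norm (B *v \<xi>)} \<xi>) \<partial>lborel)"
      using weight_scale_le(2)[OF \<gamma>, of q "norm (F _)" B] q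
      by (intro nn_integral_mono) (auto simp: indicator_def ennreal_mult[symmetric])
    also have "\<dots> = ennreal ?o * (\<integral>\<^sup>+\<xi>. ennreal ((norm \<xi> powr \<gamma> * norm (F \<xi>)) powr q) * indicator {\<xi>. \<delta> \<le> norm (B *v \<xi>)} \<xi> \<partial>lborel)"
      by (rule nn_integral_cmult) measurable
    also have "\<dots> \<le> ennreal ?o * ennreal r" by (intro mult_left_mono r) simp
    finally show ?thesis using r(1) by (simp add: J_def ennreal_mult mult_left_mono)
  qed
  note bound = bound[OF J this]
  have "(\<integral>\<^sup>+x. ennreal (norm ((LINT \<xi>|lborel. F \<xi> * wave x \<xi>) - S (A *v x)) powr p) \<partial>lborel)
     = ennreal (1 / ?d) * (\<integral>\<^sup>+x. ennreal (norm ((LINT \<xi>|lborel. FA \<xi> * wave x \<xi>) - S x) powr p) \<partial>lborel)"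
    using sub[of "\<lambda>x. ennreal (norm ((LINT \<xi>|lborel. FA \<xi> * wave x \<xi>) - S x) powr p)"] inverse_fourier_measurable[of FA]
    unfolding inv by simp
  also have "\<dots> \<le> ennreal (1 / ?d) * ennreal (C * J powr (p - 1))" by (intro mult_left_mono bound) simp
  also have "\<dots> = ennreal (1 / ?d * (C * J powr (p - 1)))" using C by (subst ennreal_mult) auto
  finally have le: "enn2real (\<integral>\<^sup>+x. ennreal (norm ((LINT \<xi>|lborel. F \<xi> * wave x \<xi>) - S (A *v x)) powr p) \<partial>lborel)
      \<le> 1 / ?d * (C * J powr (p - 1))"
    using C by (intro enn2real_leI) auto
  have "enn2real (\<integral>\<^sup>+x. ennreal (norm ((LINT \<xi>|lborel. F \<xi> * wave x \<xi>) - S (A *v x)) powr p) \<partial>lborel) powr (q / p)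
      \<le> (1 / ?d * (C * J powr (p - 1))) powr (q / p)"
    using le p q by (intro powr_mono2) auto
  also have "\<dots> = ?d powr (- (q / p)) * (C powr (q / p) * J powr ((p - 1) * (q / p)))"
  proof -
    have "1 / ?d = ?d powr (- 1)" using d0 by (simp add: powr_minus divide_inverse)
    moreover have "(?d powr (- 1) * (C * J powr (p - 1))) powr (q / p) = ?d powr (- 1 * (q / p)) * (C powr (q / p) * J powr ((p - 1) * (q / p)))"
      using C unfolding powr_powr[symmetric] by (simp only: powr_mult)
    ultimately show ?thesis by simp
  qed
  also have "J powr ((p - 1) * (q / p)) = J" unfolding q(3) using J by simp
  also have "?d powr (- (q / p)) * (C powr (q / p) * J) = (?d powr (- (q / p)) * ?d powr (q - 1)) * (C powr (q / p) * (?o * r))"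
    unfolding J_def by (simp only: mult_ac)
  also have "?d powr (- (q / p)) * ?d powr (q - 1) = 1"
    unfolding q(2) using d0 by (simp flip: powr_add)
  finally have est: "enn2real (\<integral>\<^sup>+x. ennreal (norm ((LINT \<xi>|lborel. F \<xi> * wave x \<xi>) - S (A *v x)) powr p) \<partial>lborel) powr (q / p)
      \<le> C powr (q / p) * (?o * r)" by simp
  have "((\<lambda>X. ennreal (1 / ?d) * (\<integral>\<^sup>+x. ennreal (norm (S x - (\<Sum>k\<in>X. (LINT \<xi>|lborel. FA \<xi> * cnj (wave (lattice_point k) \<xi> * G \<xi>)) * \<phi> (x + lattice_point k))) powr p) \<partial>lborel))
          \<longlongrightarrow> ennreal (1 / ?d) * 0) (finite_subsets_at_top UNIV)"
    by (intro tendsto_mult_ennreal tendsto_const lim) auto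
  then have "((\<lambda>X. \<integral>\<^sup>+x. ennreal (norm (S (A *v x) - (\<Sum>k\<in>X. (LINT \<xi>|lborel. FA \<xi> * cnj (wave (lattice_point k) \<xi> * G \<xi>)) * \<phi> (A *v x + lattice_point k))) powr p) \<partial>lborel)
          \<longlongrightarrow> 0) (finite_subsets_at_top UNIV)"
    by (subst sub) auto
  with est show ?thesis by (intro bexI[of _ "\<lambda>x. S (A *v x)"]) auto
qed

section \<open>From a general matrix to the powers of the dilation matrix\<close>

lemma matrix_mult_matrix_inv:
  fixes A :: "real^'n^'n"
  assumes "det A \<noteq> 0"
  shows "A ** matrix_inv A = mat 1"
proof -
  have "\<exists>B. A ** B = mat 1 \<and> B ** A = mat 1" using assms by (simp add: invertible_det_nz[symmetric] invertible_def)
  from someI_ex[OF this] show ?thesis by (simp add: matrix_inv_def)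
qed

text \<open>The substitution \<xi> = A^T \<eta> turns the coefficient into an integral against
  integer waves. The normalisations |det M|^(-j/2) of the distribution and |det M|^(j/2) of the
  function cancel, and the Jacobian is the factor |det A| of the rescaled spectrum.\<close>

lemma scaling_term_eq:
  fixes M A B :: "real^'n^'n" and F F' G G' :: "real^'n \<Rightarrow> complex" and j :: nat
  defines "A \<equiv> matpow M j" and "B \<equiv> adj_inv_pow M j"
  assumes d: "det M \<noteq> 0"
    and Fm [measurable]: "F' \<in> borel_measurable borel" and F: "AE \<xi> in lborel. F \<xi> = F' \<xi>"
    and Gm [measurable]: "G' \<in> borel_measurable borel" and G: "AE \<xi> in lborel. G \<xi> = G' \<xi>"
  shows "scaling_term M \<phi> G F j k = (\<lambda>x.
    (LINT \<xi>|lborel. (of_real \<bar>det A\<bar> * F' (transpose A *v \<xi>)) * cnj (wave (lattice_point k) \<xi> * G' \<xi>)) * \<phi> (A *v x + lattice_point k))"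
    and "transpose A ** B = mat 1" and "det A \<noteq> 0"
proof -
  have Minv: "M ** matrix_inv M = mat 1" "transpose M ** matrix_inv (transpose M) = mat 1"
    using d by (simp_all add: matrix_mult_matrix_inv det_transpose)
  show AB: "transpose A ** B = mat 1"
    unfolding A_def B_def adj_inv_pow_def transpose_matpow by (rule matpow_inverse[OF Minv(2)])
  show dA: "det A \<noteq> 0" using d by (simp add: A_def det_matpow)
  have BA: "B *v (transpose A *v x) = x" for x
    using AB matrix_left_right_inverse[of "transpose A" B] by (simp add: matrix_vector_mul_assoc del: transpose_matrix_vector)
  have dB: "det B \<noteq> 0"
    using AB det_mul[of "transpose A" B] by (auto simp: det_I)
  let ?a = "\<bar>det M\<bar> powr (- real j / 2)" and ?h = "matpow (matrix_inv M) j *v lattice_point k"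
  have G2: "AE \<xi> in lborel. G (B *v \<xi>) = G' (B *v \<xi>)" by (rule AE_lborel_linear[OF dB G])
  let ?f = "\<lambda>\<xi>. F' \<xi> * cnj (of_real ?a * wave ?h \<xi> * G' (B *v \<xi>))"
  have fT: "?f (transpose A *v \<xi>) = of_real ?a * (F' (transpose A *v \<xi>) * cnj (wave (lattice_point k) \<xi> * G' \<xi>))" for \<xi>
  proof -
    have "?h \<bullet> (transpose A *v \<xi>) = (A *v ?h) \<bullet> \<xi>"
      using dot_lmul_matrix[of \<xi> A ?h] by (simp add: inner_commute)
    also have "A *v ?h = lattice_point k"
      unfolding A_def matrix_vector_mul_assoc matpow_inverse[OF Minv(1)] by simp
    finally have "wave ?h (transpose A *v \<xi>) = wave (lattice_point k) \<xi>" by (simp only: wave_def)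
    then show ?thesis by (simp add: BA mult_ac del: transpose_matrix_vector)
  qed
  have "(LINT \<xi>|lebesgue. F \<xi> * cnj (dilate_hat M G j k \<xi>)) = (LINT \<xi>|lborel. ?f \<xi>)"
  proof (rule lebesgue_integral_AE)
    show "AE \<xi> in lborel. F \<xi> * cnj (dilate_hat M G j k \<xi>) = ?f \<xi>"
      using F G2 by eventually_elim (simp add: dilate_hat_def B_def wave_def)
  qed measurable
  also have "\<dots> = \<bar>det (transpose A)\<bar> *\<^sub>R (LINT \<xi>|lborel. ?f (transpose A *v \<xi>))"
    by (rule integral_lborel_linear) (use dA in \<open>simp_all add: det_transpose\<close>)
  finally have coef: "(LINT \<xi>|lebesgue. F \<xi> * cnj (dilate_hat M G j k \<xi>)) =
      of_real ?a * (LINT \<xi>|lborel. (of_real \<bar>det A\<bar> * F' (transpose A *v \<xi>)) * cnj (wave (lattice_point k) \<xi> * G' \<xi>))"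
    unfolding fT unfolding det_transpose scaleR_conv_of_real mult.assoc integral_mult_right_zero by (simp only: mult_ac)
  have "\<bar>det M\<bar> powr (real j / 2) * ?a = 1" using d by (simp flip: powr_add)
  then have "of_real (\<bar>det M\<bar> powr (real j / 2)) * of_real ?a = (1::complex)" by (simp flip: of_real_mult)
  then have cancel: "of_real ?a * c * (of_real (\<bar>det M\<bar> powr (real j / 2)) * y) = c * y" for c y :: complex
    by (metis (no_types) mult.assoc mult.commute mult.left_commute mult_1)
  show "scaling_term M \<phi> G F j k = (\<lambda>x.
    (LINT \<xi>|lborel. (of_real \<bar>det A\<bar> * F' (transpose A *v \<xi>)) * cnj (wave (lattice_point k) \<xi> * G' \<xi>)) * \<phi> (A *v x + lattice_point k))"
    unfolding scaling_term_def coef dilate_def cancel A_def[symmetric] ..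
qed

text \<open>The two regimes are merged into one weight that is at least 1 everywhere. Absolute
  values appear because the given constants carry no sign condition.\<close>

lemma polynomial_growth:
  fixes G :: "real^'n \<Rightarrow> complex"
  assumes "AE \<xi> in lborel. \<xi> \<notin> torus \<longrightarrow> norm (G \<xi>) \<le> K1 * norm \<xi> ^ N"
    and "AE \<xi> in lborel. \<xi> \<in> torus \<longrightarrow> norm (G \<xi>) \<le> K2"
  shows "AE \<xi> in lborel. norm (G \<xi>) \<le> (\<bar>K1\<bar> + \<bar>K2\<bar>) * (1 + norm \<xi>) powr real N"
  using assms
proof eventually_elim
  case (elim \<xi>)
  have w: "(1 + norm \<xi>) powr real N = (1 + norm \<xi>) ^ N" by (rule powr_realpow) (simp add: add_pos_nonneg)
  have 1: "1 \<le> (1 + norm \<xi>) ^ N" by (rule one_le_power) simp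
  have "norm (G \<xi>) \<le> \<bar>K1\<bar> * (1 + norm \<xi>) ^ N + \<bar>K2\<bar> * (1 + norm \<xi>) ^ N"
  proof (cases "\<xi> \<in> torus")
    case True
    then have "norm (G \<xi>) \<le> \<bar>K2\<bar> * 1" using elim(2) by simp
    also have "\<dots> \<le> \<bar>K2\<bar> * (1 + norm \<xi>) ^ N" by (rule mult_left_mono[OF 1]) simp
    finally show ?thesis by (rule order_trans) simp
  next
    case False
    then have "norm (G \<xi>) \<le> K1 * norm \<xi> ^ N" using elim(1) by simp
    also have "\<dots> \<le> \<bar>K1\<bar> * (1 + norm \<xi>) ^ N" by (intro mult_mono power_mono) auto
    finally show ?thesis by (rule order_trans) simp
  qed
  then show ?case by (simp add: w distrib_right)
qed

theorem theorem11:
  fixes M :: "real^'n^'n" and p q \<epsilon> \<gamma> \<delta> :: real and N :: nat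
    and T :: "(real^'n \<Rightarrow> complex) \<Rightarrow> complex" and G \<phi> \<theta> :: "real^'n \<Rightarrow> complex"
  assumes "dilation_matrix M"
    and "2 \<le> p" and "1 / p + 1 / q = 1" and "\<epsilon> > 0"
    and "real N + real CARD('n) / p < \<gamma>" and "\<gamma> < real N + real CARD('n) / p + \<epsilon>"
    and "tempered_distribution T" and "has_fourier_function T G"
    and "\<exists>K. AE \<xi> in lebesgue. \<xi> \<notin> torus \<longrightarrow> norm (G \<xi>) \<le> K * norm \<xi> ^ N"
    and "\<exists>K. AE \<xi> in lebesgue. \<xi> \<in> torus \<longrightarrow> norm (G \<xi>) \<le> K"
    and "class_B \<phi> \<theta>"
    and "strictly_compatible \<delta> G \<theta>"
  shows "\<exists>C. \<forall>f F.
     f \<in> Lp_space p \<and> has_fourier_function (distr_of f) F \<and> F \<in> Lp_space q \<and>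
     (\<exists>K R. AE \<xi> in lebesgue. norm \<xi> \<ge> R \<longrightarrow>
        norm (F \<xi>) \<le> K * norm \<xi> powr (- real N - real CARD('n) - \<epsilon>)) \<longrightarrow>
     (\<forall>j. Lp_summable p (scaling_term M \<phi> G F j) \<and>
        Lp_norm p (\<lambda>x. f x - scaling_op p M \<phi> G F j x) powr q
          \<le> C * onorm ((*v) (adj_inv_pow M j)) powr (\<gamma> * q) *
            (LINT \<xi>:{\<xi>. norm (adj_inv_pow M j *v \<xi>) \<ge> \<delta>}|lebesgue.
               norm \<xi> powr (q * \<gamma>) * norm (F \<xi>) powr q))"
proof -
  note pq = assms(2,3)
  have p: "p \<ge> 1" "p > 0" using pq by auto
  have q: "q > 1" "1 / q = 1 - 1 / p"
  proof -
    have "q \<noteq> 0" using pq by (cases "q = 0") auto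
    then have eq: "q = p / (p - 1)" using pq by (simp add: field_simps)
    show "q > 1" unfolding eq using pq by (simp add: less_divide_eq)
    show "1 / q = 1 - 1 / p" using pq by simp
  qed
  let ?d = "real CARD('n)"
  have \<gamma>p: "(\<gamma> - real N) * p > ?d" using assms(5) p by (simp add: field_simps)
  have \<gamma>0: "\<gamma> \<ge> 0" using assms(5) p by (smt (verit) divide_nonneg_pos of_nat_0_le_iff)
  define s where "s = real N + ?d + \<epsilon>"
  \<comment> \<open>The upper bound on \<gamma> enters here: s - \<gamma> > d (1 - 1/p) =
    d/q.\<close>
  have s: "(s - \<gamma>) * q > ?d"
  proof -
    have "s - \<gamma> > ?d * (1 - 1 / p)" using assms(6) by (simp add: s_def algebra_simps)
    then show ?thesis unfolding q(2)[symmetric] using q(1) by (simp add: field_simps)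
  qed
  have dM: "det M \<noteq> 0" by (rule dilation_matrix_det[OF assms(1)])
  have Gm: "G \<in> borel_measurable lebesgue" using assms(8) by (simp add: has_fourier_function_def)
  obtain G' where G'm: "G' \<in> borel_measurable borel" and G': "AE \<xi> in lborel. G \<xi> = G' \<xi>"
    by (rule lebesgue_borel_representative[OF Gm])
  obtain K1 K2 where "AE \<xi> in lborel. \<xi> \<notin> torus \<longrightarrow> norm (G \<xi>) \<le> K1 * norm \<xi> ^ N" "AE \<xi> in lborel. \<xi> \<in> torus \<longrightarrow> norm (G \<xi>) \<le> K2"
    using assms(9,10) unfolding AE_completion_iff by blast
  from polynomial_growth[OF this] G' have GK: "AE \<xi> in lborel. norm (G' \<xi>) \<le> (\<bar>K1\<bar> + \<bar>K2\<bar>) * (1 + norm \<xi>) powr real N"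
    by eventually_elim simp
  obtain a b where ab: "\<And>i. a $ i < b $ i" and \<theta>0: "\<And>\<xi>. \<xi> \<notin> cbox a b \<Longrightarrow> \<theta> \<xi> = 0"
    and Ck: "Ck_on CARD('n) (cbox a b) \<theta>" and \<phi>1: "\<And>x. \<phi> x = (LINT \<xi>|lebesgue. \<theta> \<xi> * cis (2 * pi * (x \<bullet> \<xi>)))"
    using assms(11) unfolding class_B_def by blast
  have [measurable]: "\<theta> \<in> borel_measurable borel" by (rule spectrum_measurable[OF Ck_on_imp_continuous_on[OF Ck] \<theta>0])
  have \<phi>: "\<phi> x = (LINT \<xi>|lborel. \<theta> \<xi> * wave x \<xi>)" for x
    unfolding \<phi>1 by (rule lebesgue_integral_AE) (measurable, simp add: wave_def)
  have \<phi>m [measurable]: "\<phi> \<in> borel_measurable borel"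
    using inverse_fourier_measurable[of \<theta>] by (simp add: \<phi>[abs_def])
  have \<delta>: "\<delta> > 0" and compat1: "AE \<xi> in lborel. norm \<xi> < \<delta> \<longrightarrow> cnj (\<theta> \<xi>) * G \<xi> = 1"
    and compat2: "\<And>l. l \<noteq> 0 \<Longrightarrow> AE \<xi> in lborel. norm (lattice_point l - \<xi>) < \<delta> \<longrightarrow> \<theta> \<xi> = 0"
    using assms(12) unfolding strictly_compatible_def AE_completion_iff by blast+
  have compat1: "AE \<xi> in lborel. norm \<xi> < \<delta> \<longrightarrow> cnj (\<theta> \<xi>) * G' \<xi> = 1"
    using compat1 G' by eventually_elim simp
  obtain C where C: "C \<ge> 0" and core: "\<forall>F I0. F \<in> borel_measurable borel \<longrightarrow> I0 \<ge> 0 \<longrightarrow>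
      (\<integral>\<^sup>+\<xi>. ennreal (((1 + norm \<xi>) powr \<gamma> * norm (F \<xi>)) powr q) \<partial>lborel) \<le> ennreal I0 \<longrightarrow>
      integrable lborel F \<and> (\<exists>S\<in>borel_measurable borel.
        ((\<lambda>A. \<integral>\<^sup>+x. ennreal (norm (S x - (\<Sum>k\<in>A. (LINT \<xi>|lborel. F \<xi> * cnj (wave (lattice_point k) \<xi> * G' \<xi>)) * \<phi> (x + lattice_point k))) powr p) \<partial>lborel)
          \<longlongrightarrow> 0) (finite_subsets_at_top UNIV) \<and>
        (\<forall>J\<ge>0. (\<integral>\<^sup>+\<xi>. ennreal ((norm \<xi> powr \<gamma> * norm (F \<xi>)) powr q) * indicator {\<xi>. \<delta> \<le> norm \<xi>} \<xi> \<partial>lborel) \<le> ennreal J \<longrightarrow>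
          (\<integral>\<^sup>+x. ennreal (norm ((LINT \<xi>|lborel. F \<xi> * wave x \<xi>) - S x) powr p) \<partial>lborel) \<le> ennreal (C * J powr (p - 1))))"
    using core_approximation[OF pq \<gamma>p ab Ck \<theta>0 \<phi> G'm _ GK \<delta> compat1 compat2] by auto
  obtain Ck' where "conv_bounded p Ck' (\<lambda>x. LINT \<xi>|lborel. \<theta> \<xi> * wave x \<xi>)"
    by (rule class_B_kernel_bound[OF pq(1) ab Ck \<theta>0])
  then have cb: "conv_bounded p Ck' \<phi>" by (simp add: \<phi>[abs_def])
  show ?thesis
  \<comment> \<open>The core estimate bounds p-th powers and the theorem a q-th power, hence the
    exponent q/p on \<open>C\<close>, which was fixed before \<open>f\<close>, \<open>F\<close> and
    \<open>j\<close>.\<close>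
  proof (intro exI[of _ "C powr (q / p)"] allI impI, elim conjE exE)
    fix f F :: "real^'n \<Rightarrow> complex" and K R j
    assume f: "f \<in> Lp_space p" and fF: "has_fourier_function (distr_of f) F" and Fq: "F \<in> Lp_space q"
      and decay: "AE \<xi> in lebesgue. R \<le> norm \<xi> \<longrightarrow> norm (F \<xi>) \<le> K * norm \<xi> powr (- real N - ?d - \<epsilon>)"
    define A where "A = matpow M j"
    define B where "B = adj_inv_pow M j"
    obtain f' where f'm [measurable]: "f' \<in> borel_measurable borel" and f': "AE x in lborel. f x = f' x"
      using f lebesgue_borel_representative by (auto simp: Lp_space_def)
    obtain F' where F'm [measurable]: "F' \<in> borel_measurable borel" and F': "AE \<xi> in lborel. F \<xi> = F' \<xi>"
      using Fq lebesgue_borel_representative by (auto simp: Lp_space_def)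
    note st = scaling_term_eq[OF dM F'm F' G'm G', where j=j, folded A_def B_def]
    have W: "(\<integral>\<^sup>+\<xi>. ennreal (((1 + norm \<xi>) powr \<gamma> * norm (F' \<xi>)) powr q) \<partial>lborel) < \<infinity>"
    proof (rule decay_weight_finite[OF _ \<gamma>0 s F'm])
      have "(\<integral>\<^sup>+\<xi>. ennreal (norm (F' \<xi>) powr q) \<partial>lborel) = (\<integral>\<^sup>+\<xi>. ennreal (norm (F \<xi>) powr q) \<partial>lborel)"
        using F' by (intro nn_integral_cong_AE) (auto elim: eventually_mono)
      then show "(\<integral>\<^sup>+\<xi>. ennreal (norm (F' \<xi>) powr q) \<partial>lborel) < \<infinity>" using Fq by (simp add: Lp_space_iff)
      show "AE \<xi> in lborel. R \<le> norm \<xi> \<longrightarrow> norm (F' \<xi>) \<le> K * norm \<xi> powr (- s)"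
        using decay[unfolded AE_completion_iff] F' by eventually_elim (simp add: s_def)
    qed (use q in simp)
    define r where "r = (LINT \<xi>:{\<xi>. norm (B *v \<xi>) \<ge> \<delta>}|lebesgue. norm \<xi> powr (q * \<gamma>) * norm (F \<xi>) powr q)"
    let ?g = "\<lambda>\<xi>::real^'n. indicat_real {\<xi>. norm (B *v \<xi>) \<ge> \<delta>} \<xi> * (norm \<xi> powr (q * \<gamma>) * norm (F' \<xi>) powr q)"
    have g: "?g \<xi> = (norm \<xi> powr \<gamma> * norm (F' \<xi>)) powr q * indicat_real {\<xi>. norm (B *v \<xi>) \<ge> \<delta>} \<xi>" for \<xi> :: "real^'n"
      by (simp add: powr_mult powr_powr mult_ac)
    have gi: "integrable lborel ?g"
    proof (rule integrableI_bounded)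
      have "(\<integral>\<^sup>+\<xi>. ennreal (norm (?g \<xi>)) \<partial>lborel) \<le> (\<integral>\<^sup>+\<xi>. ennreal (((1 + norm \<xi>) powr \<gamma> * norm (F' \<xi>)) powr q) \<partial>lborel)"
      proof (rule nn_integral_mono)
        fix \<xi> :: "real^'n"
        have "norm \<xi> powr \<gamma> \<le> (1 + norm \<xi>) powr \<gamma>" using \<gamma>0 by (intro powr_mono2) auto
        then have "(norm \<xi> powr \<gamma> * norm (F' \<xi>)) powr q \<le> ((1 + norm \<xi>) powr \<gamma> * norm (F' \<xi>)) powr q"
          using q by (intro powr_mono2[OF _ _ mult_right_mono]) auto
        then show "ennreal (norm (?g \<xi>)) \<le> ennreal (((1 + norm \<xi>) powr \<gamma> * norm (F' \<xi>)) powr q)"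
          unfolding g by (intro ennreal_leI) (auto simp: indicator_def)
      qed
      then show "(\<integral>\<^sup>+\<xi>. ennreal (norm (?g \<xi>)) \<partial>lborel) < \<infinity>" using W by (rule le_less_trans)
    qed measurable
    have r: "r = (LINT \<xi>|lborel. ?g \<xi>)"
      unfolding r_def set_lebesgue_integral_def
    proof (rule lebesgue_integral_AE)
      show "AE \<xi> in lborel. indicat_real {\<xi>. norm (B *v \<xi>) \<ge> \<delta>} \<xi> *\<^sub>R (norm \<xi> powr (q * \<gamma>) * norm (F \<xi>) powr q) = ?g \<xi>"
        using F' by eventually_elim simp
    qed measurable
    have r0: "r \<ge> 0" unfolding r by (rule Bochner_Integration.integral_nonneg) simp
    have rI: "(\<integral>\<^sup>+\<xi>. ennreal ((norm \<xi> powr \<gamma> * norm (F' \<xi>)) powr q) * indicator {\<xi>. \<delta> \<le> norm (B *v \<xi>)} \<xi> \<partial>lborel) \<le> ennreal r"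
    proof -
      have "(\<integral>\<^sup>+\<xi>. ennreal ((norm \<xi> powr \<gamma> * norm (F' \<xi>)) powr q) * indicator {\<xi>. \<delta> \<le> norm (B *v \<xi>)} \<xi> \<partial>lborel) = (\<integral>\<^sup>+\<xi>. ennreal (?g \<xi>) \<partial>lborel)"
        unfolding g by (rule nn_integral_cong) (auto simp: indicator_def)
      also have "\<dots> = ennreal r" unfolding r by (rule nn_integral_eq_integral[OF gi]) auto
      finally show ?thesis by simp
    qed
    define I0 where "I0 = enn2real (\<integral>\<^sup>+\<xi>. ennreal (((1 + norm \<xi>) powr \<gamma> * norm (F' \<xi>)) powr q) \<partial>lborel)"
    have "(\<integral>\<^sup>+\<xi>. ennreal (((1 + norm \<xi>) powr \<gamma> * norm (F' \<xi>)) powr q) \<partial>lborel) \<le> ennreal I0"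
      using W unfolding I0_def by (subst ennreal_enn2real) auto
    \<comment> \<open>Integrability comes out of the core estimate as a by-product of its weighted
      bound; Fourier inversion depends on it.\<close>
    then have F'i: "integrable lborel F'"
      by (rule core[rule_format, OF F'm _, THEN conjunct1, rotated]) (simp add: I0_def)
    have inv: "AE x in lborel. f' x = (LINT \<xi>|lborel. F' \<xi> * wave x \<xi>)"
      by (rule fourier_inversion[OF p(1) f fF f'm f' F'm F' F'i])
    have "\<exists>S\<in>borel_measurable borel.
        ((\<lambda>X. \<integral>\<^sup>+x. ennreal (norm (S x - (\<Sum>k\<in>X. scaling_term M \<phi> G F j k x)) powr p) \<partial>lborel) \<longlongrightarrow> 0) (finite_subsets_at_top UNIV) \<and>
        enn2real (\<integral>\<^sup>+x. ennreal (norm ((LINT \<xi>|lborel. F' \<xi> * wave x \<xi>) - S x) powr p) \<partial>lborel) powr (q / p)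
        \<le> C powr (q / p) * (onorm ((*v) B) powr (\<gamma> * q) * r)"
      unfolding st(1)
      by (rule dilated_approximation[OF core[rule_format] pq \<gamma>0 C \<phi>m st(3,2) F'm W r0 rI])
    then obtain S where Sm [measurable]: "S \<in> borel_measurable borel"
      and S2: "((\<lambda>X. \<integral>\<^sup>+x. ennreal (norm (S x - (\<Sum>k\<in>X. scaling_term M \<phi> G F j k x)) powr p) \<partial>lborel) \<longlongrightarrow> 0) (finite_subsets_at_top UNIV) \<and>
        enn2real (\<integral>\<^sup>+x. ennreal (norm ((LINT \<xi>|lborel. F' \<xi> * wave x \<xi>) - S x) powr p) \<partial>lborel) powr (q / p)
        \<le> C powr (q / p) * (onorm ((*v) B) powr (\<gamma> * q) * r)"
      by (rule bexE)
    note lim = conjunct1[OF S2] and est = conjunct2[OF S2]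
    \<comment> \<open>Membership of each single term is the l_p to L_p bound for a one-point index
      set, followed by the linear change of variables.\<close>
    have u: "scaling_term M \<phi> G F j k \<in> Lp_space p" for k
    proof -
      let ?c = "LINT \<xi>|lborel. (of_real \<bar>det A\<bar> * F' (transpose A *v \<xi>)) * cnj (wave (lattice_point k) \<xi> * G' \<xi>)"
      have "(\<integral>\<^sup>+y. ennreal (norm (?c * \<phi> (y + lattice_point k)) powr p) \<partial>lborel) < \<infinity>"
        using conv_bounded_Lp[OF cb \<phi>m p(1), of "{k}" "\<lambda>_. ?c"] by (simp add: le_less_trans)
      then have "ennreal \<bar>det A\<bar> * (\<integral>\<^sup>+x. ennreal (norm (?c * \<phi> (A *v x + lattice_point k)) powr p) \<partial>lborel) < \<infinity>"
        by (subst (asm) nn_integral_lborel_linear[OF st(3)]) auto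
      then have "(\<integral>\<^sup>+x. ennreal (norm (?c * \<phi> (A *v x + lattice_point k)) powr p) \<partial>lborel) < \<infinity>"
        using st(3) by (auto simp: ennreal_mult_less_top)
      moreover have "(\<lambda>x. ?c * \<phi> (A *v x + lattice_point k)) \<in> borel_measurable lebesgue"
        by (intro measurable_completion) simp
      ultimately show ?thesis unfolding st(1) Lp_space_iff by blast
    qed
    have S: "has_Lp_sum p (scaling_term M \<phi> G F j) S"
      by (rule has_Lp_sumI[OF p(1) u _ lim]) (simp add: measurable_completion)
    \<comment> \<open>Since some sum exists, the chosen representative is a sum too; uniqueness then
      transfers the estimate from \<open>S\<close> to it.\<close>
    then have "has_Lp_sum p (scaling_term M \<phi> G F j) (scaling_op p M \<phi> G F j)"
      unfolding scaling_op_def Lp_infsum_def by (rule someI[of "has_Lp_sum p (scaling_term M \<phi> G F j)"])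
    from has_Lp_sum_unique[OF p(1) this S] f' inv
    have eq: "AE x in lborel. f x - scaling_op p M \<phi> G F j x = (LINT \<xi>|lborel. F' \<xi> * wave x \<xi>) - S x"
      by eventually_elim simp
    have m: "(\<lambda>x. (LINT \<xi>|lborel. F' \<xi> * wave x \<xi>) - S x) \<in> borel_measurable borel"
      using inverse_fourier_measurable[OF F'm] by measurable
    have "Lp_norm p (\<lambda>x. f x - scaling_op p M \<phi> G F j x) =
        enn2real (\<integral>\<^sup>+x. ennreal (norm (f x - scaling_op p M \<phi> G F j x) powr p) \<partial>lborel) powr (1 / p)"
      by (rule Lp_norm_eq[OF lebesgue_measurable_AE[OF m eq]])
    also have "(\<integral>\<^sup>+x. ennreal (norm (f x - scaling_op p M \<phi> G F j x) powr p) \<partial>lborel) =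
        (\<integral>\<^sup>+x. ennreal (norm ((LINT \<xi>|lborel. F' \<xi> * wave x \<xi>) - S x) powr p) \<partial>lborel)"
      using eq by (intro nn_integral_cong_AE) (auto elim: eventually_mono)
    finally have "Lp_norm p (\<lambda>x. f x - scaling_op p M \<phi> G F j x) powr q =
        enn2real (\<integral>\<^sup>+x. ennreal (norm ((LINT \<xi>|lborel. F' \<xi> * wave x \<xi>) - S x) powr p) \<partial>lborel) powr (q / p)"
      by (simp add: powr_powr)
    with est have "Lp_norm p (\<lambda>x. f x - scaling_op p M \<phi> G F j x) powr q \<le> C powr (q / p) * onorm ((*v) B) powr (\<gamma> * q) * r"
      by (simp add: mult.assoc)
    moreover have "Lp_summable p (scaling_term M \<phi> G F j)" using S by (auto simp: Lp_summable_def)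
    ultimately show "Lp_summable p (scaling_term M \<phi> G F j) \<and>
        Lp_norm p (\<lambda>x. f x - scaling_op p M \<phi> G F j x) powr q
          \<le> C powr (q / p) * onorm ((*v) (adj_inv_pow M j)) powr (\<gamma> * q) *
            (LINT \<xi>:{\<xi>. norm (adj_inv_pow M j *v \<xi>) \<ge> \<delta>}|lebesgue.
               norm \<xi> powr (q * \<gamma>) * norm (F \<xi>) powr q)"
      unfolding r_def B_def by blast
  qed
qed

end
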